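(* Let $\mathcal{F}_5$ be the family of all cyclically $5$-edge-connected snarks and let $\mathcal{F}_4$ be the family of all cyclically $4$-edge-connected snarks having a planarizing perfect pseudo-matching (graphs in both families being considered up to isomorphism). For each $G\in\mathcal{F}_5$, with a given perfect pseudo-matching $M_G$ of $G$, let a drawing of $G$ in the plane with $M_G$-avoiding intersections be given, and let $G^*$ be the cubic graph constructed from this drawing by replacing every crossing by a copy of the Blanuša block $B_0$ (as described in the context). Define a mapping $f:\mathcal{F}_5\to\mathcal{F}_4$ by setting $f(G)=G^*$. Then $f$ is injective.
   Context: A cubic graph is cyclically $k$-edge-connected if it is connected and has no edge cut with fewer than $k$ edges whose removal leaves at least two components containing cycles. A snark is a cyclically $4$-edge-connected cubic graph that is not $3$-edge-colorable (no girth requirement). A perfect pseudo-matching $M$ in a graph $G$ is a collection of vertex-disjoint subgraphs of $G$, each isomorphic to $K_2$ or $K_{1,3}$, whose vertex sets together cover $V(G)$; $E(M)$ denotes the set of edges of its members. $G/M$ is the (multi)graph obtained by contracting each member of $M$ to a single vertex (the edges of $E(M)$ disappear; all other edges are kept, possibly becoming loops or parallel edges). $M$ is planarizing if $G/M$ is planar. A drawing of $G$ in the plane with $M$-avoiding intersections is a drawing in which the crossings involve only edges of $E(G)\setminus E(M)$ and no three edges of $G$ cross each other in the same point of the plane. (Every simple cubic graph with a given perfect pseudo-matching $M$ has such a drawing.) The Blanuša block $B_0$ has vertices $u_0,\dots,u_7$, edges $u_0u_1,u_1u_2,u_3u_4,u_5u_6,u_6u_7,u_0u_3,u_3u_5,u_1u_6,u_2u_4,u_4u_7$,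 and four half-edges: $a$ at $u_0$, $b$ at $u_5$, $b'$ at $u_2$, $a'$ at $u_7$. Replacing a crossing: if edges $xx'''$ and $x'x''$ cross, delete both edges, add a (new, disjoint) copy of $B_0$ drawn near the crossing point, and connect $x$ with $a$, $x'''$ with $a'$, $x'$ with $b$ and $x''$ with $b'$ (i.e. add edges from $x,x''',x',x''$ to the vertices carrying the respective half-edges), the new edges following the four pieces of the old edges. The graph $G^*$ is obtained by doing this repeatedly for all crossings of the drawing; an edge with several crossings thus passes through several copies of $B_0$ in the order of its crossings, the half-edges $a,a'$ being used for one of the two crossing edges and $b,b'$ for the other.
   Formalization: The given drawings are required to have no crossing between two edges sharing a vertex; if such edges cross right next to their common vertex x, then x and its block are separated by a 3-edge cut and G* is not in F_4. *)

theory Defs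
  imports "HOL-Analysis.Analysis" "HOL-Library.Uprod"
begin

section \<open>Finite multigraphs\<close>

text \<open>Loops (\<open>ends G e = Upair v v\<close>) and parallel edges are allowed.\<close>

record ('v, 'e) mgraph =
  verts :: "'v set"
  edges :: "'e set"
  ends :: "'e \<Rightarrow> 'v uprod"

definition wf_graph :: "('v, 'e) mgraph \<Rightarrow> bool" where
  "wf_graph G \<longleftrightarrow> finite (verts G) \<and> finite (edges G) \<and>
     (\<forall>e\<in>edges G. set_uprod (ends G e) \<subseteq> verts G)"

definition graph_iso :: "('v, 'e) mgraph \<Rightarrow> ('w, 'f) mgraph \<Rightarrow> bool" where
  "graph_iso G H \<longleftrightarrow> (\<exists>\<phi> \<psi>. bij_betw \<phi> (verts G) (verts H) \<and> bij_betw \<psi> (edges G) (edges H) \<and>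
     (\<forall>e\<in>edges G. ends H (\<psi> e) = map_uprod \<phi> (ends G e)))"

text \<open>Every finite graph is isomorphic to one whose vertices and edges are natural numbers, so
  the isomorphism class of a graph is represented by its members of that type.\<close>

definition iso_class :: "('v, 'e) mgraph \<Rightarrow> (nat, nat) mgraph set" where
  "iso_class G = {H. graph_iso G H}"

definition subgraph :: "('v, 'e) mgraph \<Rightarrow> ('v, 'e) mgraph \<Rightarrow> bool" where
  "subgraph H G \<longleftrightarrow> wf_graph H \<and> verts H \<subseteq> verts G \<and> edges H \<subseteq> edges G \<and>
     (\<forall>e\<in>edges H. ends H e = ends G e)"

text \<open>A loop contributes 2 to the degree.\<close>

definition degree :: "('v, 'e) mgraph \<Rightarrow> 'v \<Rightarrow> nat" where
  "degree G v = card {e \<in> edges G. v \<in> set_uprod (ends G e)} + card {e \<in> edges G. ends G e = Upair v v}"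

definition cubic :: "('v, 'e) mgraph \<Rightarrow> bool" where
  "cubic G \<longleftrightarrow> wf_graph G \<and> (\<forall>v\<in>verts G. degree G v = 3)"

definition three_edge_colorable :: "('v, 'e) mgraph \<Rightarrow> bool" where
  "three_edge_colorable G \<longleftrightarrow> (\<forall>e\<in>edges G. \<forall>v. ends G e \<noteq> Upair v v) \<and>
     (\<exists>c :: 'e \<Rightarrow> nat. c ` edges G \<subseteq> {1, 2, 3} \<and>
        (\<forall>e\<in>edges G. \<forall>e'\<in>edges G.
           e \<noteq> e' \<and> set_uprod (ends G e) \<inter> set_uprod (ends G e') \<noteq> {} \<longrightarrow> c e \<noteq> c e'))"


section \<open>Cyclic edge-connectivity and snarks\<close>

definition adj :: "('v, 'e) mgraph \<Rightarrow> ('v \<times> 'v) set" where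
  "adj G = {(u, v). \<exists>e\<in>edges G. ends G e = Upair u v}"

definition components :: "('v, 'e) mgraph \<Rightarrow> 'v set set" where
  "components G = {(adj G)\<^sup>* `` {v} | v. v \<in> verts G}"

definition connected_graph :: "('v, 'e) mgraph \<Rightarrow> bool" where
  "connected_graph G \<longleftrightarrow> verts G \<noteq> {} \<and> (\<forall>u\<in>verts G. \<forall>v\<in>verts G. (u, v) \<in> (adj G)\<^sup>*)"

text \<open>Loops are cycles of length 1, pairs of parallel edges are cycles of length 2.\<close>

definition is_cycle :: "('v, 'e) mgraph \<Rightarrow> 'v list \<Rightarrow> 'e list \<Rightarrow> bool" where
  "is_cycle G vs es \<longleftrightarrow> vs \<noteq> [] \<and> length es = length vs \<and> distinct vs \<and> distinct es \<and>
     set vs \<subseteq> verts G \<and> set es \<subseteq> edges G \<and>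
     (\<forall>i<length vs. ends G (es ! i) = Upair (vs ! i) (vs ! (Suc i mod length vs)))"

definition contains_cycle :: "('v, 'e) mgraph \<Rightarrow> 'v set \<Rightarrow> bool" where
  "contains_cycle G C \<longleftrightarrow> (\<exists>vs es. is_cycle G vs es \<and> set vs \<subseteq> C)"

definition delete_edges :: "('v, 'e) mgraph \<Rightarrow> 'e set \<Rightarrow> ('v, 'e) mgraph" where
  "delete_edges G F = G\<lparr>edges := edges G - F\<rparr>"

definition cyclically_edge_connected :: "nat \<Rightarrow> ('v, 'e) mgraph \<Rightarrow> bool" where
  "cyclically_edge_connected k G \<longleftrightarrow> connected_graph G \<and>
     \<not> (\<exists>F. F \<subseteq> edges G \<and> card F < k \<and>
          (\<exists>C\<in>components (delete_edges G F). \<exists>C'\<in>components (delete_edges G F).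
             C \<noteq> C' \<and> contains_cycle (delete_edges G F) C \<and> contains_cycle (delete_edges G F) C'))"

definition snark :: "('v, 'e) mgraph \<Rightarrow> bool" where
  "snark G \<longleftrightarrow> cubic G \<and> cyclically_edge_connected 4 G \<and> \<not> three_edge_colorable G"


section \<open>Perfect pseudo-matchings and contraction\<close>

text \<open>The star \<open>K\<^sub>1\<^sub>,\<^sub>n\<close>; in particular \<open>K\<^sub>2\<close> is \<open>K1 1\<close>.\<close>

definition K1 :: "nat \<Rightarrow> (nat, nat) mgraph" where
  "K1 n = \<lparr>verts = {0..n}, edges = {1..n}, ends = (\<lambda>i. Upair 0 i)\<rparr>"

definition perfect_pseudo_matching :: "('v, 'e) mgraph \<Rightarrow> ('v, 'e) mgraph set \<Rightarrow> bool" where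
  "perfect_pseudo_matching G M \<longleftrightarrow>
     (\<forall>H\<in>M. subgraph H G \<and> (graph_iso (K1 1) H \<or> graph_iso (K1 3) H)) \<and>
     (\<forall>H\<in>M. \<forall>H'\<in>M. H \<noteq> H' \<longrightarrow> verts H \<inter> verts H' = {}) \<and>
     \<Union> (verts ` M) = verts G"

definition matching_edges :: "('v, 'e) mgraph set \<Rightarrow> 'e set" where
  "matching_edges M = \<Union> (edges ` M)"

text \<open>The vertices of \<open>G/M\<close> are the vertex sets of the members of \<open>M\<close>.\<close>

definition contract :: "('v, 'e) mgraph \<Rightarrow> ('v, 'e) mgraph set \<Rightarrow> ('v set, 'e) mgraph" where
  "contract G M = \<lparr>verts = verts ` M, edges = edges G - matching_edges M,
     ends = (\<lambda>e. map_uprod (\<lambda>v. THE W. W \<in> verts ` M \<and> v \<in> W) (ends G e))\<rparr>"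


section \<open>Drawings in the plane\<close>

record ('v, 'e) drawing =
  point :: "'v \<Rightarrow> complex"
  curve :: "'e \<Rightarrow> real \<Rightarrow> complex"

definition curve_interior :: "('v, 'e) drawing \<Rightarrow> 'e \<Rightarrow> complex set" where
  "curve_interior D e = curve D e ` {0<..<1}"

text \<open>Two curves cross at a point if, up to a homeomorphism of a neighbourhood, they look there
  like the two coordinate axes (so tangential contact is not a crossing).\<close>

definition cross_at :: "(real \<Rightarrow> complex) \<Rightarrow> (real \<Rightarrow> complex) \<Rightarrow> complex \<Rightarrow> bool" where
  "cross_at g h p \<longleftrightarrow> (\<exists>U \<phi> \<psi>. open U \<and> p \<in> U \<and> homeomorphism U (ball 0 1) \<phi> \<psi> \<and> \<phi> p = 0 \<and>
     \<phi> ` (U \<inter> path_image g) = {z \<in> ball 0 1. Im z = 0} \<and>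
     \<phi> ` (U \<inter> path_image h) = {z \<in> ball 0 1. Re z = 0})"

text \<open>Usual conventions: an edge does not cross itself, edges do not pass through vertices, two
  edges have finitely many common interior points, each of them a proper crossing, and adjacent
  edges do not cross. The last condition is needed for the block replacement below: the four ends
  of the two edges of a crossing have to be distinct. Nonadjacent edges may cross several times.\<close>

definition is_drawing :: "('v, 'e) mgraph \<Rightarrow> ('v, 'e) drawing \<Rightarrow> bool" where
  "is_drawing G D \<longleftrightarrow>
     inj_on (point D) (verts G) \<and>
     (\<forall>e\<in>edges G. simple_path (curve D e) \<and>
        map_uprod (point D) (ends G e) = Upair (pathstart (curve D e)) (pathfinish (curve D e)) \<and>
        curve_interior D e \<inter> point D ` verts G = {}) \<and>
     (\<forall>e\<in>edges G. \<forall>e'\<in>edges G. e \<noteq> e' \<longrightarrow>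
        finite (curve_interior D e \<inter> curve_interior D e') \<and>
        (\<forall>p \<in> curve_interior D e \<inter> curve_interior D e'. cross_at (curve D e) (curve D e') p) \<and>
        (set_uprod (ends G e) \<inter> set_uprod (ends G e') \<noteq> {} \<longrightarrow>
           curve_interior D e \<inter> curve_interior D e' = {}))"

definition crossings :: "('v, 'e) mgraph \<Rightarrow> ('v, 'e) drawing \<Rightarrow> complex set" where
  "crossings G D = {p. \<exists>e\<in>edges G. \<exists>e'\<in>edges G. e \<noteq> e' \<and>
     p \<in> curve_interior D e \<inter> curve_interior D e'}"

definition planar :: "('v, 'e) mgraph \<Rightarrow> bool" where
  "planar G \<longleftrightarrow> (\<exists>D. is_drawing G D \<and> crossings G D = {})"

definition planarizing :: "('v, 'e) mgraph \<Rightarrow> ('v, 'e) mgraph set \<Rightarrow> bool" where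
  "planarizing G M \<longleftrightarrow> planar (contract G M)"

definition avoiding_drawing ::
  "('v, 'e) mgraph \<Rightarrow> ('v, 'e) mgraph set \<Rightarrow> ('v, 'e) drawing \<Rightarrow> bool" where
  "avoiding_drawing G M D \<longleftrightarrow> is_drawing G D \<and>
     (\<forall>e\<in>matching_edges M. curve_interior D e \<inter> crossings G D = {}) \<and>
     (\<forall>e\<in>edges G. \<forall>e'\<in>edges G. \<forall>e''\<in>edges G. e \<noteq> e' \<and> e \<noteq> e'' \<and> e' \<noteq> e'' \<longrightarrow>
        curve_interior D e \<inter> curve_interior D e' \<inter> curve_interior D e'' = {})"


section \<open>Replacing crossings by Blanusa blocks\<close>

text \<open>The vertex \<open>u\<^sub>i\<close> of the block \<open>B\<^sub>0\<close> is the number \<open>i\<close>.\<close>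

definition block_edges :: "(nat \<times> nat) set" where
  "block_edges = {(0, 1), (1, 2), (3, 4), (5, 6), (6, 7), (0, 3), (3, 5), (1, 6), (2, 4), (4, 7)}"

datatype half_edge = half_a | half_a' | half_b | half_b'

fun carrier_vertex :: "half_edge \<Rightarrow> nat" where
  "carrier_vertex half_a = 0"
| "carrier_vertex half_b = 5"
| "carrier_vertex half_b' = 2"
| "carrier_vertex half_a' = 7"

text \<open>Each edge is traversed along its curve; it enters the block of a crossing by its incoming
  piece and leaves it by its outgoing piece.\<close>

datatype side = Incoming | Outgoing

text \<open>\<open>att p e s\<close> is the half-edge of the block at the crossing \<open>p\<close> to which the piece of \<open>e\<close> on
  side \<open>s\<close> is attached. Which of the two edges uses \<open>a, a'\<close>, and in which direction the edges pass
  through the block, is left open.\<close>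

definition valid_attachment ::
  "('v, 'e) mgraph \<Rightarrow> ('v, 'e) drawing \<Rightarrow> (complex \<Rightarrow> 'e \<Rightarrow> side \<Rightarrow> half_edge) \<Rightarrow> bool" where
  "valid_attachment G D att \<longleftrightarrow>
     (\<forall>e\<in>edges G. \<forall>e'\<in>edges G. \<forall>p. e \<noteq> e' \<and> p \<in> curve_interior D e \<inter> curve_interior D e' \<longrightarrow>
        range (att p e) = {half_a, half_a'} \<and> range (att p e') = {half_b, half_b'} \<or>
        range (att p e) = {half_b, half_b'} \<and> range (att p e') = {half_a, half_a'})"

definition crossing_params :: "('v, 'e) mgraph \<Rightarrow> ('v, 'e) drawing \<Rightarrow> 'e \<Rightarrow> real set" where
  "crossing_params G D e = {t \<in> {0<..<1}. curve D e t \<in> crossings G D}"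

text \<open>\<open>Block p i\<close> is the vertex \<open>u\<^sub>i\<close> of the block at the crossing \<open>p\<close>. \<open>Piece e t\<close> is the piece of
  \<open>e\<close> that starts at parameter \<open>t\<close> (the tail of \<open>e\<close> if \<open>t = 0\<close>, a crossing otherwise) and extends
  to the next crossing on \<open>e\<close>, or to the head of \<open>e\<close>.\<close>

datatype 'v star_vertex = Old 'v | Block complex nat
datatype 'e star_edge = Piece 'e real | Block_Edge complex "nat \<times> nat"

context
  fixes G :: "('v, 'e) mgraph" and D :: "('v, 'e) drawing"
    and att :: "complex \<Rightarrow> 'e \<Rightarrow> side \<Rightarrow> half_edge"
begin

definition old_vertex :: "complex \<Rightarrow> 'v star_vertex" where
  "old_vertex z = Old (the_inv_into (verts G) (point D) z)"

definition block_vertex :: "'e \<Rightarrow> real \<Rightarrow> side \<Rightarrow> 'v star_vertex" where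
  "block_vertex e t s = Block (curve D e t) (carrier_vertex (att (curve D e t) e s))"

definition piece_start :: "'e \<Rightarrow> real \<Rightarrow> 'v star_vertex" where
  "piece_start e t =
     (if t = 0 then old_vertex (pathstart (curve D e)) else block_vertex e t Outgoing)"

definition piece_end :: "'e \<Rightarrow> real \<Rightarrow> 'v star_vertex" where
  "piece_end e t = (let S = {s \<in> crossing_params G D e. t < s} in
     if S = {} then old_vertex (pathfinish (curve D e)) else block_vertex e (Min S) Incoming)"

fun star_ends :: "'e star_edge \<Rightarrow> 'v star_vertex uprod" where
  "star_ends (Piece e t) = Upair (piece_start e t) (piece_end e t)"
| "star_ends (Block_Edge p (i, j)) = Upair (Block p i) (Block p j)"

definition star_graph :: "('v star_vertex, 'e star_edge) mgraph" where
  "star_graph =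
     \<lparr>verts = Old ` verts G \<union> {Block p i | p i. p \<in> crossings G D \<and> i \<in> {0..7}},
      edges = {Piece e t | e t. e \<in> edges G \<and> t \<in> insert 0 (crossing_params G D e)} \<union>
              {Block_Edge p b | p b. p \<in> crossings G D \<and> b \<in> block_edges},
      ends = star_ends\<rparr>"

end


section \<open>The two families, up to isomorphism\<close>

definition F5 :: "(nat, nat) mgraph set set" where
  "F5 = {iso_class G | G :: (nat, nat) mgraph. snark G \<and> cyclically_edge_connected 5 G}"

definition F4 :: "(nat, nat) mgraph set set" where
  "F4 = {iso_class G | G :: (nat, nat) mgraph. snark G \<and> cyclically_edge_connected 4 G \<and>
           (\<exists>M. perfect_pseudo_matching G M \<and> planarizing G M)}"

end

(* A block has four outgoing edges, and every set of 3 to 7 of its vertices has at least five. Hence a cut of G* with at most 3 edges can be pushed off the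
blocks by sub- and posimodularity, and becomes a cut of G. In a 3-edge-colouring of a block the
half-edges a, a' have the same colour, and so have b, b'; a colouring of G* therefore colours G.

Planarity of the contracted graph: contract the star with centre 1 and leaves 0, 2, 6 and the edges
35, 47 of every block. The first stays at the crossing, the other two move a little along the curves
that use b and a', and the three edges that do not run along the crossing curves fit into three of the four
quadrants of the crossing. The uncrossed matching edges of G are then collapsed one after the other:
the complement of an arc in the Riemann sphere is conformally a disc, and collapsing the boundary of
the disc to a point gives a map of the plane that is constant on the arc and injective elsewhere.

Injectivity: two copies of the block in a cyclically 4-edge-connected cubic graph on more than 10
vertices are equal or disjoint. If an isomorphism of G* and H* maps blocks to blocks, then the edges of
G and H are recovered from the chains of linked pieces, since mates in a block are the carriers of
half-edges without a common neighbour. Otherwise one of the graphs, say H, contains a copy of the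
block; cyclic 5-edge-connectivity leaves only the Petersen graph for H, and counting vertices shows
that G contains the block as well, so that both graphs are the Petersen graph. *)

theory Submission
  imports Defs "HOL-Complex_Analysis.Riemann_Mapping"
begin

section \<open>Edge cuts in finite multigraphs\<close>

text \<open>Cyclic connectivity speaks of cycles in components after a deletion of edges, which does
  not fit uncrossing arguments. It is therefore traded for \<open>small_cuts_trivial\<close>, a
  condition on the sizes of vertex sets and their boundaries: in a cubic graph a set with w vertices
  and m inner edges sends out 3 w - 2 m edges, and m < w means at least w + 2. Cycles appear only in
  the translation at both ends. The topological obstacle is that edges are arbitrary curves and that
  a crossing is known only up to a local homeomorphism. Blocks are therefore never drawn in full;
  only a quotient is, in which every block has already shrunk. The combinatorial part forgets the
  drawing and keeps, for every edge, the sequence of half-edges that it passes through. Injectivity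
  compares two such structures along an isomorphism of the new graphs. The Petersen graph is
  exceptional because it is the block with two adjacent vertices added: deleting the ends of any of
  its edges leaves a block, so it contains many overlapping blocks. This is why disjointness of
  blocks is claimed only above ten vertices.\<close>

definition boundary :: "('v, 'e) mgraph \<Rightarrow> 'v set \<Rightarrow> 'e set" where
  "boundary G W = {e \<in> edges G. set_uprod (ends G e) \<inter> W \<noteq> {} \<and> \<not> set_uprod (ends G e) \<subseteq> W}"

definition inner_edges :: "('v, 'e) mgraph \<Rightarrow> 'v set \<Rightarrow> 'e set" where
  "inner_edges G W = {e \<in> edges G. set_uprod (ends G e) \<subseteq> W}"

definition cut_size :: "('v, 'e) mgraph \<Rightarrow> 'v set \<Rightarrow> nat" where
  "cut_size G W = card (boundary G W)"

text \<open>By the handshake identity, \<open>card W + 2 \<le> cut_size G W\<close> says in a cubic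
  graph that a nonempty \<open>W\<close> has fewer inner edges than vertices, as a forest has. So
  every cut with fewer than \<open>k\<close> edges must have a side that is as sparse as a
  forest.\<close>

definition small_cuts_trivial :: "nat \<Rightarrow> ('v, 'e) mgraph \<Rightarrow> bool" where
  "small_cuts_trivial k G \<longleftrightarrow> (\<forall>W \<subseteq> verts G. W \<noteq> {} \<and> W \<noteq> verts G \<and> cut_size G W < k \<longrightarrow>
     card W + 2 \<le> cut_size G W \<or> card (verts G - W) + 2 \<le> cut_size G W)"

lemma wf_graphD:
  assumes "wf_graph G"
  shows "finite (verts G)" "finite (edges G)" "\<And>e. e \<in> edges G \<Longrightarrow> set_uprod (ends G e) \<subseteq> verts G"
  using assms by (auto simp: wf_graph_def)

lemma wf_graph_ends:
  assumes "wf_graph G" "e \<in> edges G"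
  obtains a b where "ends G e = Upair a b" "a \<in> verts G" "b \<in> verts G"
  using wf_graphD(3)[OF assms] by (cases "ends G e") auto

lemma cubicD:
  assumes "cubic G"
  shows "wf_graph G" "finite (verts G)" "finite (edges G)" "\<And>v. v \<in> verts G \<Longrightarrow> degree G v = 3"
  using assms by (auto simp: cubic_def wf_graph_def)

lemma cut_size_sum:
  assumes "finite (edges G)"
  shows "cut_size G W = (\<Sum>e\<in>edges G. of_bool (e \<in> boundary G W))"
proof -
  have "edges G \<inter> boundary G W = boundary G W" by (auto simp: boundary_def)
  then show ?thesis using assms by (simp add: cut_size_def)
qed

lemma boundary_compl:
  assumes "wf_graph G" "W \<subseteq> verts G"
  shows "boundary G (verts G - W) = boundary G W"
proof -
  have "e \<in> boundary G (verts G - W) \<longleftrightarrow> e \<in> boundary G W" if "e \<in> edges G" for e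
  proof -
    obtain a b where "ends G e = Upair a b" "a \<in> verts G" "b \<in> verts G"
      by (rule wf_graph_ends[OF assms(1) \<open>e \<in> edges G\<close>])
    then show ?thesis using assms(2) that by (auto simp: boundary_def)
  qed
  then show ?thesis by (auto simp: boundary_def)
qed

lemma cut_size_compl: "wf_graph G \<Longrightarrow> W \<subseteq> verts G \<Longrightarrow> cut_size G (verts G - W) = cut_size G W"
  by (simp add: cut_size_def boundary_compl)

lemma submodular:
  assumes "wf_graph G"
  shows "cut_size G (A \<inter> B) + cut_size G (A \<union> B) \<le> cut_size G A + cut_size G B"
proof -
  have "of_bool (e \<in> boundary G (A \<inter> B)) + of_bool (e \<in> boundary G (A \<union> B))
     \<le> (of_bool (e \<in> boundary G A) + of_bool (e \<in> boundary G B) :: nat)" if "e \<in> edges G" for e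
  proof -
    obtain a b where "ends G e = Upair a b" by (cases "ends G e")
    then show ?thesis using that
      by (cases "a \<in> A"; cases "b \<in> A"; cases "a \<in> B"; cases "b \<in> B"; simp add: boundary_def)
  qed
  then show ?thesis
    unfolding cut_size_sum[OF wf_graphD(2)[OF assms]] sum.distrib[symmetric] by (intro sum_mono)
qed

lemma posimodular:
  assumes "wf_graph G"
  shows "cut_size G (A - B) + cut_size G (B - A) \<le> cut_size G A + cut_size G B"
proof -
  have "of_bool (e \<in> boundary G (A - B)) + of_bool (e \<in> boundary G (B - A))
     \<le> (of_bool (e \<in> boundary G A) + of_bool (e \<in> boundary G B) :: nat)" if "e \<in> edges G" for e
  proof -
    obtain a b where "ends G e = Upair a b" by (cases "ends G e")
    then show ?thesis using that
      by (cases "a \<in> A"; cases "b \<in> A"; cases "a \<in> B"; cases "b \<in> B"; simp add: boundary_def)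
  qed
  then show ?thesis
    unfolding cut_size_sum[OF wf_graphD(2)[OF assms]] sum.distrib[symmetric] by (intro sum_mono)
qed

lemma degree_sum:
  assumes "wf_graph G"
  shows "degree G v = (\<Sum>e\<in>edges G. of_bool (v \<in> set_uprod (ends G e)) + of_bool (ends G e = Upair v v))"
proof -
  have "{e \<in> edges G. P e} = edges G \<inter> {e. P e}" for P by auto
  then show ?thesis unfolding degree_def using wf_graphD[OF assms] by (simp add: sum.distrib)
qed

text \<open>Both sides count the edge ends that lie in \<open>W\<close>. A loop has two ends at its
  vertex and is an inner edge, so it is counted twice on either side.\<close>

lemma handshake:
  assumes "wf_graph G" "finite W"
  shows "(\<Sum>v\<in>W. degree G v) = 2 * card (inner_edges G W) + cut_size G W"
proof -
  have fin: "finite (edges G)" using wf_graphD[OF assms(1)] by simp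
  have *: "(\<Sum>v\<in>W. of_bool (v \<in> set_uprod (ends G e)) + of_bool (ends G e = Upair v v)) =
     (2 * of_bool (e \<in> inner_edges G W) + of_bool (e \<in> boundary G W) :: nat)" if "e \<in> edges G" for e
  proof (cases "ends G e")
    case (Upair a b)
    have "of_bool (v \<in> set_uprod (ends G e)) + of_bool (ends G e = Upair v v)
      = (of_bool (v = a) + of_bool (v = b) :: nat)" for v
      by (auto simp: Upair)
    then have "(\<Sum>v\<in>W. of_bool (v \<in> set_uprod (ends G e)) + of_bool (ends G e = Upair v v))
      = of_bool (a \<in> W) + (of_bool (b \<in> W) :: nat)"
      using assms(2) by (simp add: sum.distrib of_bool_def)
    then show ?thesis using that by (auto simp: Upair inner_edges_def boundary_def)
  qed
  have "(\<Sum>v\<in>W. degree G v) =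
     (\<Sum>e\<in>edges G. \<Sum>v\<in>W. of_bool (v \<in> set_uprod (ends G e)) + of_bool (ends G e = Upair v v))"
    by (subst sum.swap) (simp add: degree_sum[OF assms(1)])
  also have "\<dots> = (\<Sum>e\<in>edges G. 2 * of_bool (e \<in> inner_edges G W) + of_bool (e \<in> boundary G W))"
    using * by (intro sum.cong) auto
  also have "\<dots> = 2 * card (inner_edges G W) + cut_size G W"
  proof -
    have "edges G \<inter> inner_edges G W = inner_edges G W" by (auto simp: inner_edges_def)
    then show ?thesis using fin by (simp add: sum.distrib cut_size_sum flip: sum_distrib_left)
  qed
  finally show ?thesis .
qed

lemma cubic_handshake:
  assumes "cubic G" "W \<subseteq> verts G"
  shows "3 * card W = 2 * card (inner_edges G W) + cut_size G W"
proof -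
  have "(\<Sum>v\<in>W. degree G v) = (\<Sum>v\<in>W. 3)"
    using assms cubicD(4)[OF assms(1)] by (intro sum.cong) auto
  then show ?thesis
    using handshake[OF cubicD(1)[OF assms(1)] finite_subset[OF assms(2) cubicD(2)[OF assms(1)]]] by simp
qed

lemma cut_size_empty [simp]: "cut_size G {} = 0"
  by (simp add: cut_size_def boundary_def)

lemma cut_size_verts: "wf_graph G \<Longrightarrow> cut_size G (verts G) = 0"
  using cut_size_compl[of G "{}"] by simp

text \<open>A loop at \<open>v\<close> leaves only one edge in the boundary of \<open>{v}\<close>,
  by 3 = 2 m + d with m positive. Such a cut is never trivial, since a side with w vertices would
  need w + 2 \<le> 1.\<close>

lemma small_cuts_loopless:
  assumes "cubic G" "small_cuts_trivial k G" "2 \<le> k" "e \<in> edges G"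
  shows "ends G e \<noteq> Upair v v"
proof
  assume e: "ends G e = Upair v v"
  have v: "v \<in> verts G" using wf_graphD(3)[OF cubicD(1)[OF assms(1)] assms(4)] e by simp
  have "inner_edges G {v} \<noteq> {}" using e assms(4) by (auto simp: inner_edges_def)
  moreover have "finite (inner_edges G {v})" using cubicD(3)[OF assms(1)] by (auto simp: inner_edges_def)
  ultimately have "card (inner_edges G {v}) > 0" by (simp add: card_gt_0_iff)
  with cubic_handshake[OF assms(1), of "{v}"] v have d: "cut_size G {v} = 1" by simp presburger
  then have "{v} \<noteq> verts G" using cut_size_verts[OF cubicD(1)[OF assms(1)]] by auto
  with assms(2,3) v d show False
    unfolding small_cuts_trivial_def by (auto dest!: spec[of _ "{v}"])
qed

lemma adj_sym: "(u, v) \<in> adj G \<Longrightarrow> (v, u) \<in> adj G"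
proof -
  have "Upair u v = Upair v u" by simp
  then show "(u, v) \<in> adj G \<Longrightarrow> (v, u) \<in> adj G" unfolding adj_def by simp
qed

lemma adj_rtrancl_sym: "(u, v) \<in> (adj G)\<^sup>* \<Longrightarrow> (v, u) \<in> (adj G)\<^sup>*"
  by (meson adj_sym symI sym_rtrancl symD)

lemma adj_rtrancl_verts:
  assumes "(u, v) \<in> (adj G)\<^sup>*" "wf_graph G" "u \<in> verts G"
  shows "v \<in> verts G"
  using assms
proof (induction rule: rtrancl_induct)
  case (step y z)
  then obtain e where "e \<in> edges G" "ends G e = Upair y z" by (auto simp: adj_def)
  then show ?case using wf_graphD(3)[OF step.prems(1)] by fastforce
qed

lemma delete_edges_simps [simp]:
  "verts (delete_edges G F) = verts G" "edges (delete_edges G F) = edges G - F"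
  "ends (delete_edges G F) = ends G"
  by (auto simp: delete_edges_def)

lemma wf_delete_edges: "wf_graph G \<Longrightarrow> wf_graph (delete_edges G F)"
  by (auto simp: wf_graph_def)

lemma component_boundary:
  assumes "C \<in> components (delete_edges G F)"
  shows "boundary G C \<subseteq> F"
proof
  fix e assume e: "e \<in> boundary G C"
  obtain r where C: "C = (adj (delete_edges G F))\<^sup>* `` {r}" using assms by (auto simp: components_def)
  show "e \<in> F"
  proof (rule ccontr)
    assume "e \<notin> F"
    obtain a b where ab: "ends G e = Upair a b" by (cases "ends G e")
    have ad: "(a, b) \<in> adj (delete_edges G F)"
      using e ab \<open>e \<notin> F\<close> by (auto simp: adj_def boundary_def intro!: bexI[of _ e])
    with ad have "a \<in> C \<longleftrightarrow> b \<in> C" using adj_sym[OF ad] unfolding C by (auto intro: rtrancl_into_rtrancl)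
    then show False using e ab by (auto simp: boundary_def)
  qed
qed

lemma reachable_avoiding_boundary:
  assumes "(u, v) \<in> (adj (delete_edges G F))\<^sup>*" "boundary G W \<subseteq> F" "u \<in> W"
  shows "v \<in> W"
  using assms
proof (induction rule: rtrancl_induct)
  case (step y z)
  then obtain e where "e \<in> edges G" "e \<notin> F" "ends G e = Upair y z" "y \<in> W" by (auto simp: adj_def)
  then show ?case using step.prems by (auto simp: boundary_def)
qed

lemma is_cycle_delete_edges:
  assumes "is_cycle G vs es" "set es \<inter> F = {}"
  shows "is_cycle (delete_edges G F) vs es"
  using assms by (auto simp: is_cycle_def)

lemma is_cycle_edges_inner:
  assumes "is_cycle G vs es" "set vs \<subseteq> W"
  shows "set es \<subseteq> inner_edges G W"
proof
  fix e assume "e \<in> set es"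
  then obtain i where i: "i < length vs" "e = es ! i" using assms(1)
    by (metis in_set_conv_nth is_cycle_def)
  have "Suc i mod length vs < length vs" using i by (intro mod_less_divisor) auto
  then show "e \<in> inner_edges G W" using i assms \<open>e \<in> set es\<close>
    by (auto simp: inner_edges_def is_cycle_def)
qed

lemma cycle_connected:
  assumes "is_cycle G vs es" "i < length vs"
  shows "(vs ! 0, vs ! i) \<in> (adj G)\<^sup>*"
  using assms(2)
proof (induction i)
  case (Suc i)
  have "ends G (es ! i) = Upair (vs ! i) (vs ! Suc i)" "es ! i \<in> edges G"
    using assms(1) Suc.prems by (auto simp: is_cycle_def)
  then have "(vs ! i, vs ! Suc i) \<in> adj G" by (auto simp: adj_def)
  then show ?case using Suc by (auto intro: rtrancl_into_rtrancl)
qed auto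

text \<open>The edges of a cycle inside \<open>W\<close> are inner edges, so the cycle survives the
  removal of the boundary, and what can be reached from it stays inside \<open>W\<close>.\<close>

lemma cycle_in_component:
  assumes "wf_graph G" "is_cycle G vs es" "set vs \<subseteq> W" "W \<subseteq> verts G"
  shows "\<exists>C\<in>components (delete_edges G (boundary G W)). C \<subseteq> W \<and> C \<noteq> {} \<and>
     contains_cycle (delete_edges G (boundary G W)) C"
proof -
  let ?H = "delete_edges G (boundary G W)"
  have "set es \<inter> boundary G W = {}"
    using is_cycle_edges_inner[OF assms(2,3)] by (auto simp: inner_edges_def boundary_def)
  then have cyc: "is_cycle ?H vs es" by (rule is_cycle_delete_edges[OF assms(2)])
  have ne: "vs \<noteq> []" using assms(2) by (auto simp: is_cycle_def)
  then have r: "vs ! 0 \<in> W" using assms(3) by auto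
  define C where "C = (adj ?H)\<^sup>* `` {vs ! 0}"
  have "C \<subseteq> W" using reachable_avoiding_boundary[of "vs!0" _ G "boundary G W" W] r by (auto simp: C_def)
  moreover have "set vs \<subseteq> C" using cycle_connected[OF cyc] by (auto simp: C_def in_set_conv_nth)
  moreover have "C \<in> components ?H" using r assms(4) by (auto simp: C_def components_def)
  ultimately show ?thesis using cyc ne by (auto simp: contains_cycle_def intro!: bexI[of _ C])
qed

text \<open>Passes from components after an edge deletion to vertex sets: the deleted edges are the
  boundary of \<open>W\<close>, and the components of the two cycles lie on different sides of
  it.\<close>

lemma cyclic_cut_large:
  assumes "wf_graph G" "cyclically_edge_connected k G" "W \<subseteq> verts G"
    and "contains_cycle G W" "contains_cycle G (verts G - W)"
  shows "k \<le> cut_size G W"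
proof (rule ccontr)
  assume small: "\<not> k \<le> cut_size G W"
  let ?F = "boundary G W"
  obtain C where C: "C\<in>components (delete_edges G ?F)" "C \<subseteq> W" "C \<noteq> {}" "contains_cycle (delete_edges G ?F) C"
    using cycle_in_component[OF assms(1) _ _ assms(3)] assms(4) unfolding contains_cycle_def by metis
  obtain C' where C': "C'\<in>components (delete_edges G ?F)" "C' \<subseteq> verts G - W" "contains_cycle (delete_edges G ?F) C'"
    using cycle_in_component[OF assms(1), where W = "verts G - W"] assms(3,5) boundary_compl[OF assms(1,3)]
    unfolding contains_cycle_def by (metis Diff_subset)
  have "C \<noteq> C'" using C C' by auto
  moreover have "?F \<subseteq> edges G" by (auto simp: boundary_def)
  ultimately show False using assms(2) C C' small unfolding cyclically_edge_connected_def cut_size_def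
    by (meson not_le)
qed

subsection \<open>Dense vertex sets contain cycles\<close>

definition inner_trail :: "('v, 'e) mgraph \<Rightarrow> 'v set \<Rightarrow> 'v list \<Rightarrow> 'e list \<Rightarrow> bool" where
  "inner_trail G W vs es \<longleftrightarrow> vs \<noteq> [] \<and> length vs = Suc (length es) \<and> distinct vs \<and> set vs \<subseteq> W \<and>
     set es \<subseteq> inner_edges G W \<and> (\<forall>i<length es. ends G (es ! i) = Upair (vs ! i) (vs ! Suc i))"

lemma inner_trail_distinct:
  assumes "inner_trail G W vs es"
  shows "distinct es"
proof -
  have "es ! i \<noteq> es ! j" if "i < j" "j < length es" for i j
  proof
    assume eq: "es ! i = es ! j"
    have "Upair (vs ! i) (vs ! Suc i) = Upair (vs ! j) (vs ! Suc j)"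
      using assms that eq unfolding inner_trail_def by (metis order.strict_trans)
    then have "vs ! i = vs ! j \<or> vs ! i = vs ! Suc j" by auto
    moreover have "i < length vs" "j < length vs" "Suc j < length vs" "distinct vs"
      using assms that by (auto simp: inner_trail_def)
    ultimately show False using that by (auto simp: nth_eq_iff_index_eq)
  qed
  then show ?thesis by (metis distinct_conv_nth linorder_neqE_nat)
qed

text \<open>The last vertex of a longest path inside \<open>W\<close> has an inner edge besides the
  last edge of the path. By maximality its other end is on the path, which closes a cycle. Parallel
  edges are allowed, so the cycle may have length two.\<close>

lemma min_degree_two_cycle:
  assumes "finite W" "W \<noteq> {}" "W \<subseteq> verts G"
    and two: "\<And>v. v \<in> W \<Longrightarrow> \<exists>e\<in>inner_edges G W. \<exists>e'\<in>inner_edges G W. e \<noteq> e' \<and> v \<in> set_uprod (ends G e) \<and> v \<in> set_uprod (ends G e')"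
    and noloop: "\<And>e v. e \<in> inner_edges G W \<Longrightarrow> ends G e \<noteq> Upair v v"
  shows "contains_cycle G W"
proof -
  let ?P = "\<lambda>n. \<exists>vs es. inner_trail G W vs es \<and> length vs = n"
  obtain w where "w \<in> W" using assms(2) by auto
  then have "inner_trail G W [w] []" by (simp add: inner_trail_def)
  then have ex: "?P 1" by (metis One_nat_def length_Cons list.size(3))
  have bnd: "n \<le> card W" if "?P n" for n
    using that assms(1) unfolding inner_trail_def by (metis card_mono distinct_card)
  obtain vs es where tr: "inner_trail G W vs es"
    and mx: "\<And>vs' es'. inner_trail G W vs' es' \<Longrightarrow> length vs' \<le> length vs"
  proof -
    have g: "?P (Greatest ?P)" by (rule GreatestI_nat[where P = ?P, OF ex bnd])
    then obtain vs es where vs: "inner_trail G W vs es" "length vs = Greatest ?P" by blast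
    have "length vs' \<le> length vs" if "inner_trail G W vs' es'" for vs' es'
      unfolding vs(2) by (rule Greatest_le_nat[where P = ?P and b = "card W"]) (use that bnd in auto)
    then show ?thesis using that vs(1) by blast
  qed
  define m where "m = length es"
  have lv: "length vs = Suc m" "distinct vs" "set vs \<subseteq> W" "set es \<subseteq> inner_edges G W"
    and en: "\<And>i. i < m \<Longrightarrow> ends G (es ! i) = Upair (vs ! i) (vs ! Suc i)"
    using tr by (auto simp: inner_trail_def m_def)
  define v where "v = vs ! m"
  have vW: "v \<in> W" using lv by (auto simp: v_def)
  \<comment> \<open>A path with a single vertex has no last edge to avoid, hence the premise on
    \<open>m\<close>.\<close>
  obtain e where e: "e \<in> inner_edges G W" "v \<in> set_uprod (ends G e)" "m > 0 \<Longrightarrow> e \<noteq> es ! (m - 1)"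
    using two[OF vW] by metis
  obtain u where u: "ends G e = Upair v u" using e(2) by (cases "ends G e") auto
  have uv: "u \<noteq> v" using noloop[OF e(1)] u by auto
  have uW: "u \<in> W" using e u by (auto simp: inner_edges_def)
  have "u \<in> set vs"
  proof (rule ccontr)
    assume "u \<notin> set vs"
    then have "inner_trail G W (vs @ [u]) (es @ [e])"
      using lv en e(1) u uW by (auto simp: inner_trail_def m_def v_def nth_append less_Suc_eq)
    then show False using mx by fastforce
  qed
  then obtain j where j: "j \<le> m" "u = vs ! j" using lv(1) by (metis in_set_conv_nth less_Suc_eq_le)
  have jm: "j < m" using j uv by (metis le_neq_implies_less v_def)
  have enot: "e \<notin> set es"
  proof
    assume "e \<in> set es"
    then obtain i where i: "i < m" "e = es ! i" by (auto simp: in_set_conv_nth m_def)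
    then have "Upair v u = Upair (vs ! i) (vs ! Suc i)" using en u by metis
    then have "vs ! m = vs ! i \<or> vs ! m = vs ! Suc i" by (auto simp: v_def)
    then have "m = i \<or> m = Suc i" using lv i by (auto simp: nth_eq_iff_index_eq)
    then show False using i e(3) jm by auto
  qed
  let ?vs = "drop j vs" and ?es = "drop j es @ [e]"
  have "is_cycle G ?vs ?es"
    unfolding is_cycle_def
  proof (intro conjI allI impI)
    show "distinct ?es" using inner_trail_distinct[OF tr] enot by (auto dest: in_set_dropD)
    show "set ?vs \<subseteq> verts G" using lv assms(3) by (auto dest: in_set_dropD)
    show "set ?es \<subseteq> edges G" using lv e(1) by (auto simp: inner_edges_def dest!: in_set_dropD)
    fix i assume i: "i < length ?vs"
    show "ends G (?es ! i) = Upair (?vs ! i) (?vs ! (Suc i mod length ?vs))"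
    proof (cases "j + i < m")
      case True
      then have "i < length es - j" by (simp add: m_def)
      then show ?thesis using True en[of "j + i"] lv jm i by (simp add: nth_append m_def)
    next
      case False
      then have "j + i = m" using i lv by simp
      then have *: "Suc i = length ?vs" and l: "length (drop j es) = i" using lv jm by (auto simp: m_def)
      have "Suc i mod length ?vs = 0" unfolding * by (rule mod_self)
      then show ?thesis using l u j lv jm \<open>j + i = m\<close>
        by (simp add: nth_append v_def)
    qed
  qed (use lv jm in \<open>auto simp: m_def\<close>)
  moreover have "set ?vs \<subseteq> W" using lv by (auto dest: in_set_dropD)
  ultimately show ?thesis by (auto simp: contains_cycle_def)
qed

lemma loop_cycle:
  assumes "e \<in> inner_edges G W" "W \<subseteq> verts G" "ends G e = Upair v v"
  shows "contains_cycle G W"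
proof -
  have "is_cycle G [v] [e]" "v \<in> W" using assms by (auto simp: is_cycle_def inner_edges_def)
  then show ?thesis unfolding contains_cycle_def by (intro exI[of _ "[v]"] exI[of _ "[e]"]) auto
qed

text \<open>Deleting a vertex with at most one inner edge loses one vertex and at most one edge, so
  the hypothesis survives. The deletions must stop before \<open>W\<close> is exhausted, at a loop
  or at a set in which every vertex has two inner edges.\<close>

lemma dense_contains_cycle:
  assumes "finite (edges G)" "finite W" "W \<noteq> {}" "W \<subseteq> verts G" "card W \<le> card (inner_edges G W)"
  shows "contains_cycle G W"
  using assms(2-5)
proof (induction "card W" arbitrary: W rule: less_induct)
  case (less W)
  show ?case
  proof (cases "\<exists>e\<in>inner_edges G W. \<exists>v. ends G e = Upair v v")
    case True
    then show ?thesis using loop_cycle less.prems by metis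
  next
    case noloop: False
    have fin: "finite (inner_edges G W)" using assms(1) by (auto simp: inner_edges_def)
    show ?thesis
    proof (cases "\<forall>v\<in>W. \<exists>e\<in>inner_edges G W. \<exists>e'\<in>inner_edges G W. e \<noteq> e' \<and> v \<in> set_uprod (ends G e) \<and> v \<in> set_uprod (ends G e')")
      case True
      show ?thesis by (rule min_degree_two_cycle) (use less.prems True noloop in auto)
    next
      case False
      then obtain v where v: "v \<in> W" and one: "\<And>e e'. e \<in> inner_edges G W \<Longrightarrow> e' \<in> inner_edges G W \<Longrightarrow>
        v \<in> set_uprod (ends G e) \<Longrightarrow> v \<in> set_uprod (ends G e') \<Longrightarrow> e = e'" by blast
      let ?W = "W - {v}"
      let ?S = "{e \<in> inner_edges G W. v \<in> set_uprod (ends G e)}"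
      have "inner_edges G W = inner_edges G ?W \<union> ?S" by (auto simp: inner_edges_def)
      then have "card (inner_edges G W) \<le> card (inner_edges G ?W) + card ?S" by (metis card_Un_le)
      moreover have "card ?S \<le> Suc 0" using fin one by (subst card_le_Suc0_iff_eq) auto
      ultimately have c: "card (inner_edges G W) \<le> card (inner_edges G ?W) + 1" by simp
      have cW: "card W = Suc (card ?W)" using v less.prems(1) by (metis card_Suc_Diff1)
      \<comment> \<open>An inner edge of a one-element set is a loop, and loops have been dealt
        with.\<close>
      have "?W \<noteq> {}"
      proof
        assume "?W = {}"
        then have W: "W = {v}" using v by auto
        then have "inner_edges G W \<noteq> {}" using less.prems(4) by auto
        then obtain e where "e \<in> inner_edges G W" by auto
        then have "ends G e = Upair v v" by (cases "ends G e") (auto simp: inner_edges_def W)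
        then show False using noloop \<open>e \<in> inner_edges G W\<close> by auto
      qed
      then have "contains_cycle G ?W" using less.hyps[of ?W] less.prems c cW by auto
      then show ?thesis unfolding contains_cycle_def by blast
    qed
  qed
qed

text \<open>With w vertices, m inner edges and d \<le> w + 1 outgoing ones, 2 m = 3 w - d \<ge> 2 w
  - 1 and hence m \<ge> w.\<close>

lemma cubic_small_cut_cycle:
  assumes "cubic G" "W \<subseteq> verts G" "W \<noteq> {}" "cut_size G W \<le> card W + 1"
  shows "contains_cycle G W"
proof -
  have "card W \<le> card (inner_edges G W)" using cubic_handshake[OF assms(1,2)] assms(4) by linarith
  then show ?thesis
    by (intro dense_contains_cycle assms cubicD(3)[OF assms(1)] finite_subset[OF assms(2) cubicD(2)[OF assms(1)]])
qed

text \<open>If both inequalities fail, both sides of the cut are dense enough to contain a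
  cycle.\<close>

lemma cyclic_imp_small_cuts_trivial:
  assumes "cubic G" "cyclically_edge_connected k G"
  shows "small_cuts_trivial k G"
  unfolding small_cuts_trivial_def
proof (intro allI impI)
  fix W assume W: "W \<subseteq> verts G" and h: "W \<noteq> {} \<and> W \<noteq> verts G \<and> cut_size G W < k"
  show "card W + 2 \<le> cut_size G W \<or> card (verts G - W) + 2 \<le> cut_size G W"
  proof (rule ccontr)
    assume "\<not> ?thesis"
    then have "contains_cycle G W" "contains_cycle G (verts G - W)"
      using cubic_small_cut_cycle[OF assms(1) W] cubic_small_cut_cycle[OF assms(1), of "verts G - W"]
        cut_size_compl[OF cubicD(1)[OF assms(1)] W] h W by auto
    then show False using cyclic_cut_large[OF cubicD(1)[OF assms(1)] assms(2) W] h by simp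
  qed
qed

lemma component_subset: "wf_graph G \<Longrightarrow> C \<in> components (delete_edges G F) \<Longrightarrow> C \<subseteq> verts G"
  using adj_rtrancl_verts[OF _ wf_delete_edges] by (fastforce simp: components_def)

lemma component_disjoint:
  assumes "C \<in> components G" "C' \<in> components G" "C \<noteq> C'"
  shows "C \<inter> C' = {}"
proof (rule ccontr)
  assume "C \<inter> C' \<noteq> {}"
  then obtain x where x: "x \<in> C" "x \<in> C'" by blast
  have eq: "D = (adj G)\<^sup>* `` {x}" if "D \<in> components G" "x \<in> D" for D
  proof -
    obtain r where D: "D = (adj G)\<^sup>* `` {r}" using \<open>D \<in> components G\<close> by (auto simp: components_def)
    then have rx: "(r, x) \<in> (adj G)\<^sup>*" using that by auto
    show ?thesis unfolding D using rx adj_rtrancl_sym[OF rx] by (blast intro: rtrancl_trans)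
  qed
  show False using eq[OF assms(1) x(1)] eq[OF assms(2) x(2)] assms(3) by simp
qed

lemma single_vertex_cycle_cut:
  assumes "cubic G" "v \<in> verts G" "contains_cycle G {v}"
  shows "cut_size G {v} < 3"
proof -
  obtain vs es where c: "is_cycle G vs es" "set vs \<subseteq> {v}" using assms(3) by (auto simp: contains_cycle_def)
  have "set es \<subseteq> inner_edges G {v}" by (rule is_cycle_edges_inner[OF c])
  moreover have "es \<noteq> []" using c by (auto simp: is_cycle_def)
  ultimately have "inner_edges G {v} \<noteq> {}" by auto
  moreover have "finite (inner_edges G {v})" using cubicD(3)[OF assms(1)] by (auto simp: inner_edges_def)
  ultimately have "card (inner_edges G {v}) > 0" by (simp add: card_gt_0_iff)
  then show ?thesis using cubic_handshake[OF assms(1), of "{v}"] assms(2) by simp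
qed

text \<open>For \<open>k = 4\<close> the inequality w + 2 \<le> 3 leaves only a single vertex with
  three outgoing edges. It carries no loop and so no cycle, while a component of a disconnected
  graph would have an empty boundary.\<close>

lemma small_cuts_trivial_imp_cyclic:
  assumes "cubic G" "small_cuts_trivial 4 G" "verts G \<noteq> {}"
  shows "cyclically_edge_connected 4 G"
  unfolding cyclically_edge_connected_def
proof
  note wf = cubicD(1)[OF assms(1)]
  have triv: "card W = 1 \<and> cut_size G W = 3 \<or> card (verts G - W) = 1 \<and> cut_size G W = 3"
    if "W \<subseteq> verts G" "W \<noteq> {}" "W \<noteq> verts G" "cut_size G W < 4" for W
  proof -
    have "finite (verts G)" using cubicD(2)[OF assms(1)] .
    then have "card W > 0" "card (verts G - W) > 0" using that
      by (auto simp: card_gt_0_iff finite_subset)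
    moreover have "card W + 2 \<le> cut_size G W \<or> card (verts G - W) + 2 \<le> cut_size G W"
      using assms(2) that unfolding small_cuts_trivial_def by blast
    ultimately show ?thesis using that(4) by linarith
  qed
  show "connected_graph G"
    unfolding connected_graph_def
  proof (intro conjI ballI)
    fix u v assume uv: "u \<in> verts G" "v \<in> verts G"
    let ?C = "(adj G)\<^sup>* `` {u}"
    have C: "?C \<in> components (delete_edges G {})" using uv by (auto simp: components_def delete_edges_def)
    have "boundary G ?C = {}" using component_boundary[OF C] by auto
    then have "cut_size G ?C = 0" by (simp add: cut_size_def)
    moreover have "?C \<subseteq> verts G" by (rule component_subset[OF wf C])
    moreover have "?C \<noteq> {}" by auto
    ultimately have "?C = verts G" using triv[of ?C] by linarith
    then show "(u, v) \<in> (adj G)\<^sup>*" using uv by auto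
  qed (rule assms(3))
  show "\<not> (\<exists>F. F \<subseteq> edges G \<and> card F < 4 \<and>
          (\<exists>C\<in>components (delete_edges G F). \<exists>C'\<in>components (delete_edges G F).
             C \<noteq> C' \<and> contains_cycle (delete_edges G F) C \<and> contains_cycle (delete_edges G F) C'))"
  proof (intro notI, elim exE conjE bexE)
    fix F C C' assume F: "F \<subseteq> edges G" "card F < 4" and C: "C \<in> components (delete_edges G F)"
      "C' \<in> components (delete_edges G F)" "C \<noteq> C'" and cyc: "contains_cycle (delete_edges G F) C"
      "contains_cycle (delete_edges G F) C'"
    have "is_cycle G vs es" if "is_cycle (delete_edges G F) vs es" for vs es
      using that by (auto simp: is_cycle_def)
    then have cyc': "contains_cycle G C" "contains_cycle G C'"
      using cyc unfolding contains_cycle_def by blast+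
    have sub: "C \<subseteq> verts G" "C' \<subseteq> verts G" using component_subset[OF wf] C by auto
    have ne: "C \<noteq> {}" "C' \<noteq> {}" using C by (auto simp: components_def)
    have disj: "C \<inter> C' = {}" by (rule component_disjoint[OF C])
    have "cut_size G C \<le> card F" unfolding cut_size_def
      using component_boundary[OF C(1)] F cubicD(3)[OF assms(1)] by (meson card_mono finite_subset)
    moreover have "C \<noteq> verts G" using sub ne disj by blast
    ultimately consider "card C = 1" "cut_size G C = 3" | "card (verts G - C) = 1" "cut_size G C = 3"
      using triv[of C] sub(1) ne(1) F(2) by linarith
    then show False
    proof cases
      case 1
      then obtain v where "C = {v}" by (auto simp: card_1_singleton_iff)
      then show ?thesis using single_vertex_cycle_cut[OF assms(1), of v] 1 sub cyc' by auto
    next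
      case 2
      then obtain v where v: "verts G - C = {v}" by (auto simp: card_1_singleton_iff)
      have "C' \<subseteq> verts G - C" using sub(2) disj by blast
      then have "C' = {v}" using v ne(2) by (metis subset_singletonD)
      moreover have "cut_size G {v} = 3" using cut_size_compl[OF wf sub(1)] v 2(2) by simp
      ultimately show ?thesis using single_vertex_cycle_cut[OF assms(1), of v] sub(2) cyc'(2) by simp
    qed
  qed
qed

section \<open>Isomorphism invariance\<close>

lemma map_uprod_cong_on: "(\<And>v. v \<in> set_uprod x \<Longrightarrow> f v = g v) \<Longrightarrow> map_uprod f x = map_uprod g x"
  by (cases x) auto

lemma map_uprod_comp: "map_uprod f (map_uprod g x) = map_uprod (f \<circ> g) x"
  by (cases x) auto

lemma set_map_uprod: "set_uprod (map_uprod f x) = f ` set_uprod x"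
  by (cases x) auto

lemma Collect_image_eq:
  assumes "\<And>x. x \<in> A \<Longrightarrow> Q (f x) \<longleftrightarrow> P x"
  shows "{y \<in> f ` A. Q y} = f ` {x \<in> A. P x}"
  using assms by auto

locale graph_isomorphism =
  fixes G :: "('v, 'e) mgraph" and H :: "('w, 'f) mgraph" and \<phi> :: "'v \<Rightarrow> 'w" and \<psi> :: "'e \<Rightarrow> 'f"
  assumes wf: "wf_graph G"
    and bij_verts: "bij_betw \<phi> (verts G) (verts H)"
    and bij_edges: "bij_betw \<psi> (edges G) (edges H)"
    and ends_map: "\<And>e. e \<in> edges G \<Longrightarrow> ends H (\<psi> e) = map_uprod \<phi> (ends G e)"
begin

lemma wf_image: "wf_graph H"
proof -
  have "finite (verts H)" "finite (edges H)"
    using bij_betw_finite[OF bij_verts] bij_betw_finite[OF bij_edges] wf by (auto simp: wf_graph_def)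
  moreover have "set_uprod (ends H f) \<subseteq> verts H" if "f \<in> edges H" for f
  proof -
    obtain e where e: "e \<in> edges G" "f = \<psi> e" using \<open>f \<in> edges H\<close> bij_betw_imp_surj_on[OF bij_edges] by blast
    then have "set_uprod (ends H f) = \<phi> ` set_uprod (ends G e)" by (simp add: ends_map set_map_uprod)
    then show ?thesis using wf_graphD(3)[OF wf e(1)] bij_verts by (auto simp: bij_betw_def)
  qed
  ultimately show ?thesis by (auto simp: wf_graph_def)
qed

lemma inj_verts: "inj_on \<phi> (verts G)" and inj_edges: "inj_on \<psi> (edges G)"
  using bij_verts bij_edges by (auto simp: bij_betw_def)

lemma verts_image: "verts H = \<phi> ` verts G" and edges_image: "edges H = \<psi> ` edges G"
  using bij_verts bij_edges by (auto simp: bij_betw_def)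

lemma inverse: "graph_isomorphism H G (inv_into (verts G) \<phi>) (inv_into (edges G) \<psi>)"
proof
  show "wf_graph H" by (rule wf_image)
  show "bij_betw (inv_into (verts G) \<phi>) (verts H) (verts G)"
    "bij_betw (inv_into (edges G) \<psi>) (edges H) (edges G)"
    by (rule bij_betw_inv_into bij_verts bij_edges)+
  fix f assume "f \<in> edges H"
  then obtain e where e: "e \<in> edges G" "f = \<psi> e" by (auto simp: edges_image)
  have "map_uprod (inv_into (verts G) \<phi>) (ends H f) = map_uprod (inv_into (verts G) \<phi> \<circ> \<phi>) (ends G e)"
    using e by (simp add: ends_map map_uprod_comp)
  also have "\<dots> = map_uprod id (ends G e)"
    using wf_graphD(3)[OF wf e(1)] inj_verts by (intro map_uprod_cong_on) auto
  also have "\<dots> = ends G e" by (cases "ends G e") auto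
  finally show "ends G (inv_into (edges G) \<psi> f) = map_uprod (inv_into (verts G) \<phi>) (ends H f)"
    using e inj_edges by simp
qed

lemma ends_image: "e \<in> edges G \<Longrightarrow> set_uprod (ends H (\<psi> e)) = \<phi> ` set_uprod (ends G e)"
  by (simp add: ends_map set_map_uprod)

lemma ends_subset_iff:
  assumes "e \<in> edges G" "W \<subseteq> verts G"
  shows "set_uprod (ends H (\<psi> e)) \<subseteq> \<phi> ` W \<longleftrightarrow> set_uprod (ends G e) \<subseteq> W"
  unfolding ends_image[OF assms(1)]
  using inj_on_image_subset_iff[OF inj_verts wf_graphD(3)[OF wf assms(1)] assms(2)] .

lemma ends_inter_iff:
  assumes "e \<in> edges G" "W \<subseteq> verts G"
  shows "set_uprod (ends H (\<psi> e)) \<inter> \<phi> ` W = {} \<longleftrightarrow> set_uprod (ends G e) \<inter> W = {}"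
  unfolding ends_image[OF assms(1)] inj_on_image_Int[OF inj_verts wf_graphD(3)[OF wf assms(1)] assms(2), symmetric]
  by (rule image_is_empty)

lemma boundary_image: "W \<subseteq> verts G \<Longrightarrow> boundary H (\<phi> ` W) = \<psi> ` boundary G W"
  unfolding boundary_def edges_image by (rule Collect_image_eq) (simp add: ends_subset_iff ends_inter_iff)

lemma inner_edges_image: "W \<subseteq> verts G \<Longrightarrow> inner_edges H (\<phi> ` W) = \<psi> ` inner_edges G W"
  unfolding inner_edges_def edges_image by (rule Collect_image_eq) (simp add: ends_subset_iff)

lemma cut_size_image:
  assumes "W \<subseteq> verts G" shows "cut_size H (\<phi> ` W) = cut_size G W"
proof -
  have "inj_on \<psi> (boundary G W)" using inj_edges by (rule inj_on_subset) (auto simp: boundary_def)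
  then show ?thesis by (simp add: cut_size_def boundary_image[OF assms] card_image)
qed

lemma card_verts: "card (verts H) = card (verts G)"
  using bij_betw_same_card[OF bij_verts] by simp

lemma degree_image:
  assumes "v \<in> verts G"
  shows "degree H (\<phi> v) = degree G v"
proof -
  have 1: "{f \<in> edges H. \<phi> v \<in> set_uprod (ends H f)} = \<psi> ` {e \<in> edges G. v \<in> set_uprod (ends G e)}"
    unfolding edges_image by (rule Collect_image_eq) (use ends_inter_iff[of _ "{v}"] assms in auto)
  have 2: "{f \<in> edges H. ends H f = Upair (\<phi> v) (\<phi> v)} = \<psi> ` {e \<in> edges G. ends G e = Upair v v}"
  proof -
    have "ends H (\<psi> e) = Upair (\<phi> v) (\<phi> v) \<longleftrightarrow> ends G e = Upair v v" if "e \<in> edges G" for e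
    proof -
      obtain a b where "ends G e = Upair a b" "a \<in> verts G" "b \<in> verts G"
        by (rule wf_graph_ends[OF wf \<open>e \<in> edges G\<close>])
      then show ?thesis using that assms inj_verts by (simp add: ends_map inj_on_eq_iff)
    qed
    then show ?thesis unfolding edges_image by (rule Collect_image_eq)
  qed
  have "inj_on \<psi> {e \<in> edges G. P e}" for P using inj_edges by (rule inj_on_subset) auto
  then show ?thesis unfolding degree_def 1 2 by (simp add: card_image)
qed

lemma cubic_image: "cubic G \<Longrightarrow> cubic H"
  using wf_image degree_image by (auto simp: cubic_def verts_image)

lemma small_cuts_trivial_image:
  assumes "small_cuts_trivial k G"
  shows "small_cuts_trivial k H"
  unfolding small_cuts_trivial_def
proof (intro allI impI)
  fix U assume U: "U \<subseteq> verts H" and h: "U \<noteq> {} \<and> U \<noteq> verts H \<and> cut_size H U < k"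
  obtain W where W: "W \<subseteq> verts G" "U = \<phi> ` W" using U by (auto simp: verts_image subset_image_iff)
  have c: "card (\<phi> ` X) = card X" if "X \<subseteq> verts G" for X
    using card_image[OF inj_on_subset[OF inj_verts that]] .
  have "verts H - U = \<phi> ` (verts G - W)"
    using W inj_on_image_set_diff[OF inj_verts, of "verts G" W] by (simp add: verts_image)
  then have "card (verts H - U) = card (verts G - W)" using c by auto
  moreover have "W \<noteq> {}" "W \<noteq> verts G" using h W by (auto simp: verts_image)
  ultimately show "card U + 2 \<le> cut_size H U \<or> card (verts H - U) + 2 \<le> cut_size H U"
    using assms W h c[of W] unfolding small_cuts_trivial_def by (auto simp: cut_size_image)
qed

lemma colorable_preimage:
  assumes "three_edge_colorable H"
  shows "three_edge_colorable G"
proof -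
  note col = assms[unfolded three_edge_colorable_def]
  then obtain c :: "'f \<Rightarrow> nat" where c: "c ` edges H \<subseteq> {1, 2, 3}"
    and proper: "\<forall>e\<in>edges H. \<forall>e'\<in>edges H.
           e \<noteq> e' \<and> set_uprod (ends H e) \<inter> set_uprod (ends H e') \<noteq> {} \<longrightarrow> c e \<noteq> c e'"
    by (elim conjE exE)
  have nl: "\<And>f v. f \<in> edges H \<Longrightarrow> ends H f \<noteq> Upair v v" using conjunct1[OF col] by simp
  have "ends G e \<noteq> Upair v v" if "e \<in> edges G" for e v
  proof
    assume "ends G e = Upair v v"
    then have "ends H (\<psi> e) = Upair (\<phi> v) (\<phi> v)" using that by (simp add: ends_map)
    then show False using nl that by (auto simp: edges_image)
  qed
  moreover have "(c \<circ> \<psi>) ` edges G \<subseteq> {1,2,3}" using c by (auto simp: edges_image)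
  moreover have "(c \<circ> \<psi>) e \<noteq> (c \<circ> \<psi>) e'" if "e \<in> edges G" "e' \<in> edges G" "e \<noteq> e'"
    "set_uprod (ends G e) \<inter> set_uprod (ends G e') \<noteq> {}" for e e'
  proof -
    have "\<psi> e \<noteq> \<psi> e'" using that inj_edges by (auto simp: inj_on_eq_iff)
    moreover have "set_uprod (ends H (\<psi> e)) \<inter> set_uprod (ends H (\<psi> e')) \<noteq> {}"
      using that by (auto simp: ends_image)
    ultimately show ?thesis using proper that(1,2) by (simp add: edges_image)
  qed
  ultimately show ?thesis unfolding three_edge_colorable_def
    by (intro conjI exI[of _ "c \<circ> \<psi>"] ballI allI impI) auto
qed

end

lemma graph_iso_iff:
  assumes "wf_graph G"
  shows "graph_iso G H \<longleftrightarrow> (\<exists>\<phi> \<psi>. graph_isomorphism G H \<phi> \<psi>)"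
  using assms by (auto simp: graph_iso_def graph_isomorphism_def)

lemma graph_iso_sym: "wf_graph G \<Longrightarrow> graph_iso G H \<Longrightarrow> graph_iso H G"
  by (metis graph_isomorphism.inverse graph_isomorphism.wf_image graph_iso_iff)

lemma graph_iso_trans:
  assumes "graph_iso G H" "graph_iso H K"
  shows "graph_iso G K"
proof -
  obtain \<phi> \<psi> where 1: "bij_betw \<phi> (verts G) (verts H)" "bij_betw \<psi> (edges G) (edges H)"
    "\<forall>e\<in>edges G. ends H (\<psi> e) = map_uprod \<phi> (ends G e)" using assms(1) by (auto simp: graph_iso_def)
  obtain \<phi>' \<psi>' where 2: "bij_betw \<phi>' (verts H) (verts K)" "bij_betw \<psi>' (edges H) (edges K)"
    "\<forall>e\<in>edges H. ends K (\<psi>' e) = map_uprod \<phi>' (ends H e)" using assms(2) by (auto simp: graph_iso_def)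
  have "ends K ((\<psi>' \<circ> \<psi>) e) = map_uprod (\<phi>' \<circ> \<phi>) (ends G e)" if "e \<in> edges G" for e
  proof -
    have "\<psi> e \<in> edges H" using that 1(2) by (auto simp: bij_betw_def)
    then show ?thesis using that 1(3) 2(3) by (simp add: map_uprod_comp)
  qed
  then show ?thesis unfolding graph_iso_def
    using bij_betw_trans[OF 1(1) 2(1)] bij_betw_trans[OF 1(2) 2(2)] by blast
qed

lemma iso_class_eq:
  assumes "wf_graph G" "graph_iso G H"
  shows "iso_class G = iso_class H"
proof -
  have "graph_iso G K \<longleftrightarrow> graph_iso H K" for K :: "(nat, nat) mgraph"
    using graph_iso_trans[OF assms(2), of K] graph_iso_trans[OF graph_iso_sym[OF assms], of K] by iprover
  then show ?thesis by (simp add: iso_class_def)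
qed

lemma nat_representative:
  fixes G :: "('v, 'e) mgraph"
  assumes "wf_graph G"
  obtains H :: "(nat, nat) mgraph" where "graph_iso G H"
proof -
  obtain \<phi> :: "'v \<Rightarrow> nat" where p: "inj_on \<phi> (verts G)"
    using wf_graphD(1)[OF assms] finite_imp_inj_to_nat_seg by metis
  obtain \<psi> :: "'e \<Rightarrow> nat" where q: "inj_on \<psi> (edges G)"
    using wf_graphD(2)[OF assms] finite_imp_inj_to_nat_seg by metis
  define H where "H = \<lparr>verts = \<phi> ` verts G, edges = \<psi> ` edges G,
    ends = (\<lambda>f. map_uprod \<phi> (ends G (inv_into (edges G) \<psi> f)))\<rparr>"
  have "graph_iso G H" unfolding graph_iso_def H_def using p q
    by (intro exI[of _ \<phi>] exI[of _ \<psi>]) (auto simp: bij_betw_def)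
  then show ?thesis using that by blast
qed

text \<open>A class contains only graphs on natural numbers, so graphs of other types are compared
  through a common representative.\<close>

lemma iso_class_eq_imp_iso:
  assumes "wf_graph G" "wf_graph H" "iso_class G = iso_class H"
  shows "graph_iso G H"
proof -
  obtain K :: "(nat, nat) mgraph" where K: "graph_iso G K" using nat_representative[OF assms(1)] .
  then have "graph_iso H K" using assms(3) by (auto simp: iso_class_def)
  then show ?thesis using graph_iso_trans[OF K graph_iso_sym[OF assms(2)]] by iprover
qed

section \<open>The Blanusa block\<close>

definition block_edges_in :: "nat set \<Rightarrow> (nat \<times> nat) set" where
  "block_edges_in T = {(i, j) \<in> block_edges. i \<in> T \<and> j \<in> T}"

lemma finite_block_edges: "finite block_edges"
  by (simp add: block_edges_def)

text \<open>Counting by membership bits reduces the bounds on subsets of the block to a check of 256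
  cases.\<close>

lemma card_subset_8:
  assumes "T \<subseteq> {0..7::nat}"
  shows "card T = of_bool (0 \<in> T) + of_bool (1 \<in> T) + of_bool (2 \<in> T) + of_bool (3 \<in> T) +
    of_bool (4 \<in> T) + of_bool (5 \<in> T) + of_bool (6 \<in> T) + of_bool (7 \<in> T)"
proof -
  have "T = {0,1,2,3,4,5,6,7} \<inter> T" using assms by (auto simp: numeral_eq_Suc atLeastAtMost_iff le_Suc_eq)
  then have "card T = (\<Sum>i\<in>{0,1,2,3,4,5,6,7}. of_bool (i \<in> T))" by simp
  then show ?thesis by simp
qed

lemma card_block_edges_in:
  "card (block_edges_in T) = of_bool (0 \<in> T \<and> 1 \<in> T) + of_bool (1 \<in> T \<and> 2 \<in> T) +
    of_bool (3 \<in> T \<and> 4 \<in> T) + of_bool (5 \<in> T \<and> 6 \<in> T) + of_bool (6 \<in> T \<and> 7 \<in> T) +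
    of_bool (0 \<in> T \<and> 3 \<in> T) + of_bool (3 \<in> T \<and> 5 \<in> T) + of_bool (1 \<in> T \<and> 6 \<in> T) +
    of_bool (2 \<in> T \<and> 4 \<in> T) + of_bool (4 \<in> T \<and> 7 \<in> T)"
proof -
  have "block_edges_in T = block_edges \<inter> {b. fst b \<in> T \<and> snd b \<in> T}" by (auto simp: block_edges_in_def)
  then have "card (block_edges_in T) = (\<Sum>b\<in>block_edges. of_bool (fst b \<in> T \<and> snd b \<in> T))"
    using finite_block_edges by simp
  then show ?thesis by (simp add: block_edges_def del: sum_of_bool_eq)
qed

text \<open>In a cubic graph, \<open>3 * card T - 2 * card (block_edges_in T)\<close> is the size of
  the cut around a copy of \<open>T\<close>, so these are lower bounds 3, 4, 5, 6, 6 for cuts. The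
  cut has the parity of \<open>card T\<close>, which lifts 5 to 6 for four and for six
  vertices.\<close>

lemma block_edges_in_bound:
  assumes "T \<subseteq> {0..7}"
  shows "2 * card (block_edges_in T) + 3 \<le> 3 * card T \<or> card T = 0"
    and "card T = 2 \<Longrightarrow> 2 * card (block_edges_in T) + 4 \<le> 3 * card T"
    and "3 \<le> card T \<Longrightarrow> card T \<le> 7 \<Longrightarrow> 2 * card (block_edges_in T) + 5 \<le> 3 * card T"
    and "card T = 4 \<Longrightarrow> 2 * card (block_edges_in T) + 6 \<le> 3 * card T"
    and "card T = 6 \<Longrightarrow> 2 * card (block_edges_in T) + 6 \<le> 3 * card T"
  unfolding card_subset_8[OF assms] card_block_edges_in
  by (cases "0 \<in> T"; cases "1 \<in> T"; cases "2 \<in> T"; cases "3 \<in> T"; cases "4 \<in> T"; cases "5 \<in> T";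
      cases "6 \<in> T"; cases "7 \<in> T"; simp)+

text \<open>The copy is induced, because \<open>\<epsilon>\<close> reaches all inner edges of
  \<open>W\<close>. In a cubic graph exactly 24 - 20 = 4 edges then leave \<open>W\<close>. Contrast
  \<open>realizes\<close> below.\<close>

definition block_copy :: "('v, 'e) mgraph \<Rightarrow> 'v set \<Rightarrow> (nat \<Rightarrow> 'v) \<Rightarrow> (nat \<times> nat \<Rightarrow> 'e) \<Rightarrow> bool" where
  "block_copy G W \<beta> \<epsilon> \<longleftrightarrow> W \<subseteq> verts G \<and> bij_betw \<beta> {0..7} W \<and> bij_betw \<epsilon> block_edges (inner_edges G W) \<and>
     (\<forall>i j. (i, j) \<in> block_edges \<longrightarrow> ends G (\<epsilon> (i, j)) = Upair (\<beta> i) (\<beta> j))"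

definition is_block :: "('v, 'e) mgraph \<Rightarrow> 'v set \<Rightarrow> bool" where
  "is_block G W \<longleftrightarrow> (\<exists>\<beta> \<epsilon>. block_copy G W \<beta> \<epsilon>)"

lemma block_edges_range: "(i, j) \<in> block_edges \<Longrightarrow> i \<in> {0..7} \<and> j \<in> {0..7} \<and> i \<noteq> j"
  by (auto simp: block_edges_def)

lemma block_copy_inner_edges:
  assumes "block_copy G W \<beta> \<epsilon>" "T \<subseteq> {0..7}"
  shows "card (inner_edges G (\<beta> ` T)) = card (block_edges_in T)"
proof -
  have W: "bij_betw \<beta> {0..7} W" "bij_betw \<epsilon> block_edges (inner_edges G W)"
    and en: "\<And>i j. (i, j) \<in> block_edges \<Longrightarrow> ends G (\<epsilon> (i, j)) = Upair (\<beta> i) (\<beta> j)"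
    using assms(1) by (auto simp: block_copy_def)
  have inj: "inj_on \<beta> {0..7}" using W by (auto simp: bij_betw_def)
  have mem: "\<beta> i \<in> \<beta> ` T \<longleftrightarrow> i \<in> T" if "i \<in> {0..7}" for i
    using inj_on_image_mem_iff[OF inj that assms(2)] .
  have "inner_edges G (\<beta> ` T) = {f \<in> inner_edges G W. set_uprod (ends G f) \<subseteq> \<beta> ` T}"
  proof -
    have "\<beta> ` T \<subseteq> W" using W(1) assms(2) by (auto simp: bij_betw_def)
    then show ?thesis by (auto simp: inner_edges_def)
  qed
  also have "\<dots> = {f \<in> \<epsilon> ` block_edges. set_uprod (ends G f) \<subseteq> \<beta> ` T}"
    using W(2) by (auto simp: bij_betw_def)
  also have "\<dots> = \<epsilon> ` {b \<in> block_edges. fst b \<in> T \<and> snd b \<in> T}"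
  proof (rule Collect_image_eq)
    fix b assume b: "b \<in> block_edges"
    obtain i j where ij: "b = (i, j)" by (cases b)
    then show "set_uprod (ends G (\<epsilon> b)) \<subseteq> \<beta> ` T \<longleftrightarrow> fst b \<in> T \<and> snd b \<in> T"
      using b en[of i j] mem[of i] mem[of j] block_edges_range[of i j] by simp
  qed
  also have "{b \<in> block_edges. fst b \<in> T \<and> snd b \<in> T} = block_edges_in T"
    by (auto simp: block_edges_in_def)
  finally show ?thesis
    using W(2) card_image[OF inj_on_subset, of \<epsilon> block_edges "block_edges_in T"]
    by (auto simp: bij_betw_def block_edges_in_def)
qed

lemma block_copy_cut_size:
  assumes "cubic G" "block_copy G W \<beta> \<epsilon>" "T \<subseteq> {0..7}"
  shows "3 * card T = 2 * card (block_edges_in T) + cut_size G (\<beta> ` T)"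
proof -
  have W: "bij_betw \<beta> {0..7} W" "W \<subseteq> verts G" using assms(2) by (auto simp: block_copy_def)
  have "card (\<beta> ` T) = card T"
    using card_image[OF inj_on_subset[OF bij_betw_imp_inj_on[OF W(1)] assms(3)]] .
  moreover have "\<beta> ` T \<subseteq> verts G" using W assms(3) by (auto simp: bij_betw_def)
  ultimately show ?thesis
    using cubic_handshake[OF assms(1), of "\<beta> ` T"] block_copy_inner_edges[OF assms(2,3)] by simp
qed

lemma block_subset_cut_size:
  assumes "cubic G" "is_block G W" "U \<subseteq> W" "U \<noteq> {}"
  shows "3 \<le> cut_size G U"
    and "card U = 2 \<Longrightarrow> 4 \<le> cut_size G U"
    and "3 \<le> card U \<Longrightarrow> card U \<le> 7 \<Longrightarrow> 5 \<le> cut_size G U"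
    and "card U = 4 \<Longrightarrow> 6 \<le> cut_size G U"
    and "card U = 6 \<Longrightarrow> 6 \<le> cut_size G U"
    and "card U = 8 \<Longrightarrow> cut_size G U = 4"
    and "card U \<le> 8"
proof -
  obtain \<beta> \<epsilon> where c: "block_copy G W \<beta> \<epsilon>" using assms(2) by (auto simp: is_block_def)
  have W: "bij_betw \<beta> {0..7} W" using c by (auto simp: block_copy_def)
  define T where "T = {i \<in> {0..7}. \<beta> i \<in> U}"
  have T: "T \<subseteq> {0..7}" "\<beta> ` T = U" using W assms(3) by (auto simp: T_def bij_betw_def)
  have cT: "card T = card U"
    using T card_image[OF inj_on_subset[OF bij_betw_imp_inj_on[OF W] T(1)]] by simp
  have ne: "card T \<noteq> 0" using T assms(4) finite_subset[OF T(1)] by auto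
  note k = block_copy_cut_size[OF assms(1) c T(1), unfolded T(2) cT]
  note b = block_edges_in_bound[OF T(1), unfolded cT]
  show "3 \<le> cut_size G U" "card U = 2 \<Longrightarrow> 4 \<le> cut_size G U"
     "3 \<le> card U \<Longrightarrow> card U \<le> 7 \<Longrightarrow> 5 \<le> cut_size G U"
     "card U = 4 \<Longrightarrow> 6 \<le> cut_size G U" "card U = 6 \<Longrightarrow> 6 \<le> cut_size G U"
    using k b ne[unfolded cT] by linarith+
  show "card U \<le> 8" using card_mono[OF _ T(1)] cT by simp
  show "cut_size G U = 4" if "card U = 8"
  proof -
    have "T = {0..7}" using T(1) cT that by (intro card_subset_eq) auto
    then have "block_edges_in T = block_edges" using block_edges_range by (auto simp: block_edges_in_def)
    then have "card (block_edges_in T) = 10" by (simp add: block_edges_def)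
    then show ?thesis using k that by simp
  qed
qed

lemma is_block_card: "is_block G W \<Longrightarrow> card W = 8"
  using bij_betw_same_card by (fastforce simp: is_block_def block_copy_def)

lemma is_block_cut_size: "cubic G \<Longrightarrow> is_block G W \<Longrightarrow> cut_size G W = 4"
  using block_subset_cut_size(6)[of G W W] is_block_card[of G W] by fastforce

lemma is_block_subset: "is_block G W \<Longrightarrow> W \<subseteq> verts G"
  by (auto simp: is_block_def block_copy_def)

lemma is_block_finite: "is_block G W \<Longrightarrow> finite W"
  using is_block_card by (metis card.infinite zero_neq_numeral)

text \<open>If two blocks meet in at most five vertices then posimodularity is violated, otherwise
  submodularity.\<close>

lemma blocks_equal_or_disjoint:
  assumes "cubic G" "small_cuts_trivial 4 G" "10 < card (verts G)" "is_block G W" "is_block G W'"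
  shows "W = W' \<or> W \<inter> W' = {}"
proof (rule ccontr)
  assume "\<not> ?thesis"
  then have ne: "W \<noteq> W'" "W \<inter> W' \<noteq> {}" by auto
  note fin = is_block_finite[OF assms(4)] is_block_finite[OF assms(5)]
  note c8 = is_block_card[OF assms(4)] is_block_card[OF assms(5)]
  define t where "t = card (W \<inter> W')"
  have "W \<inter> W' \<noteq> W" using ne c8 fin by (metis Int_lower2 card_subset_eq)
  then have t8: "t < 8" unfolding t_def using c8(1) fin(1) by (metis Int_lower1 psubset_card_mono psubsetI)
  have t0: "t > 0" using ne fin by (simp add: t_def card_gt_0_iff)
  have d: "card (W - W') = 8 - t" "card (W' - W) = 8 - t"
    using c8 fin by (simp_all add: card_Diff_subset_Int t_def Int_commute)
  then have ned: "W - W' \<noteq> {}" "W' - W \<noteq> {}" using t8 by (metis card.empty zero_less_diff less_irrefl)+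
  note pos = posimodular[OF cubicD(1)[OF assms(1)], of W W', unfolded
      is_block_cut_size[OF assms(1,4)] is_block_cut_size[OF assms(1,5)]]
  note sub = submodular[OF cubicD(1)[OF assms(1)], of W W', unfolded
      is_block_cut_size[OF assms(1,4)] is_block_cut_size[OF assms(1,5)]]
  note b1 = block_subset_cut_size[OF assms(1,4) Diff_subset ned(1), unfolded d]
  note b2 = block_subset_cut_size[OF assms(1,5) Diff_subset ned(2), unfolded d]
  note b3 = block_subset_cut_size[OF assms(1,4) Int_lower1 ne(2), folded t_def]
  \<comment> \<open>For \<open>1 \<le> t \<le> 5\<close> both differences have 3 to 7 vertices, so
    their cuts sum to at least 10, against 4 + 4.\<close>
  have "\<not> t \<le> 5" using pos b1(3) b2(3) t0 by linarith
  then have t67: "t = 6 \<or> t = 7" using t8 by linarith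
  have u: "card (W \<union> W') + t = 16" using card_Un_Int[OF fin] c8 by (simp add: t_def)
  have usub: "W \<union> W' \<subseteq> verts G" using is_block_subset assms(4,5) by auto
  have fG: "finite (verts G)" using cubicD(2)[OF assms(1)] .
  have "card (verts G - (W \<union> W')) = card (verts G) - card (W \<union> W')"
    using usub finite_subset[OF usub fG] by (rule card_Diff_subset[rotated])
  then have cc: "card (verts G - (W \<union> W')) \<ge> 1" using u t67 assms(3) by linarith
  have un: "W \<union> W' \<noteq> {}" "W \<union> W' \<noteq> verts G" using ne cc by auto
  \<comment> \<open>The intersection has a cut of at least 6 for \<open>t = 6\<close> and at least 5
    for \<open>t = 7\<close>, which leaves 2 or 3 of the total of 8 for the union.\<close>
  have small: "cut_size G (W \<union> W') \<le> 3" using sub b3(3,5) t67 by linarith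
  then have "card (W \<union> W') + 2 \<le> cut_size G (W \<union> W') \<or>
      card (verts G - (W \<union> W')) + 2 \<le> cut_size G (W \<union> W')"
    using assms(2) usub un unfolding small_cuts_trivial_def by simp
  then have c3: "cut_size G (W \<union> W') = 3" "card (verts G - (W \<union> W')) = 1"
    using small cc u t67 by linarith+
  then have "t = 7" using sub b3(5) t67 by linarith
  \<comment> \<open>Nine vertices in the union and one outside it. The case does occur, in the
    Petersen graph.\<close>
  then have "card (verts G) = 10" using u c3(2)
    card_Un_disjoint[of "W \<union> W'" "verts G - (W \<union> W')"] usub fG by (simp add: Un_absorb1 fin)
  then show False using assms(3) by simp
qed

text \<open>The fact behind it is that the Petersen graph has no 3-edge-colouring. By parity the
  colours of the four half-edges form two equal pairs; if those of \<open>a\<close> and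
  \<open>a'\<close> differed, one could join a, a' in one new vertex, b, b' in another, and give the
  third colour to an edge between them. The proof is an exhaustive search.\<close>

lemma block_coloring:
  fixes a a' b b' c01 c12 c16 c03 c34 c35 c24 c47 c56 c67 :: nat
  assumes "c01 \<noteq> c12" "c01 \<noteq> c16" "c12 \<noteq> c16"
    "c03 \<noteq> c34" "c03 \<noteq> c35" "c34 \<noteq> c35"
    "c01 \<noteq> c03" "c01 \<noteq> a" "c03 \<noteq> a"
    "c12 \<noteq> c24" "c12 \<noteq> b'" "c24 \<noteq> b'"
    "c34 \<noteq> c24" "c34 \<noteq> c47" "c24 \<noteq> c47"
    "c56 \<noteq> c35" "c56 \<noteq> b" "c35 \<noteq> b"
    "c56 \<noteq> c67" "c56 \<noteq> c16" "c67 \<noteq> c16"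
    "c67 \<noteq> c47" "c67 \<noteq> a'" "c47 \<noteq> a'"
    "{a,a',b,b',c01,c12,c16,c03,c34,c35,c24,c47,c56,c67} \<subseteq> {1,2,3}"
  shows "a = a' \<and> b = b'"
  using assms by (smt (verit) insert_iff empty_iff subset_iff)

lemma block_edges_list: "(0, 1) \<in> block_edges" "(1, 2) \<in> block_edges" "(3, 4) \<in> block_edges" "(5, 6) \<in> block_edges"
  "(6, 7) \<in> block_edges" "(0, 3) \<in> block_edges" "(3, 5) \<in> block_edges" "(1, 6) \<in> block_edges"
  "(2, 4) \<in> block_edges" "(4, 7) \<in> block_edges"
  by (auto simp: block_edges_def)

lemma range_carrier: "range carrier_vertex = {0, 2, 5, 7}"
proof -
  have "h \<in> {half_a, half_a', half_b, half_b'}" for h by (cases h) auto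
  then have "UNIV = {half_a, half_a', half_b, half_b'}" by blast
  then have "range carrier_vertex = carrier_vertex ` {half_a, half_a', half_b, half_b'}" by simp
  then show ?thesis by auto
qed

lemma block_degree:
  assumes "i \<in> {0..7}"
  shows "card {b \<in> block_edges. i = fst b \<or> i = snd b} = (if i \<in> range carrier_vertex then 2 else 3)"
proof -
  have i: "i = 0 \<or> i = 1 \<or> i = 2 \<or> i = 3 \<or> i = 4 \<or> i = 5 \<or> i = 6 \<or> i = 7"
    using assms by (simp add: atLeastAtMost_iff) linarith
  have "card {b \<in> block_edges. i = fst b \<or> i = snd b} = (\<Sum>b\<in>block_edges. of_bool (i = fst b \<or> i = snd b))"
    using finite_block_edges by (simp only: sum_of_bool_eq Collect_conj_eq Collect_mem_eq of_nat_id)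
  also have "\<dots> = (if i \<in> range carrier_vertex then 2 else 3)"
    unfolding range_carrier using i
    by (elim disjE) (simp_all add: block_edges_def del: sum_of_bool_eq)
  finally show ?thesis .
qed

section \<open>Replacing crossings, combinatorially\<close>

fun mate :: "half_edge \<Rightarrow> half_edge" where
  "mate half_a = half_a'"
| "mate half_a' = half_a"
| "mate half_b = half_b'"
| "mate half_b' = half_b"

lemma mate_mate [simp]: "mate (mate h) = h"
  by (cases h) auto

lemma mate_neq: "mate h \<noteq> h"
  by (cases h) auto

lemma carrier_inject [simp]: "carrier_vertex h = carrier_vertex h' \<longleftrightarrow> h = h'"
  by (cases h; cases h') auto

lemma carrier_range: "carrier_vertex h \<in> {0..7}"
  by (cases h) auto

definition block_verts :: "complex \<Rightarrow> 'v star_vertex set" where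
  "block_verts p = Block p ` {0..7}"

lemma block_verts_iff [simp]:
  "Block p i \<in> block_verts q \<longleftrightarrow> p = q \<and> i \<in> {0..7}" "Old v \<notin> block_verts q"
  by (auto simp: block_verts_def)

text \<open>The edge \<open>e\<close> runs through the crossings number \<open>1, \<dots>, n e\<close>; the \<open>k\<close>-th of them is
  entered at \<open>L e k Incoming\<close> and left at \<open>L e k Outgoing\<close>. The pieces of \<open>e\<close> are numbered
  \<open>0, \<dots>, n e\<close>, and \<open>par\<close> gives their parameters.\<close>

locale replaced_crossings =
  fixes G :: "('v, 'e) mgraph" and X :: "('v star_vertex, 'e star_edge) mgraph"
    and tail head :: "'e \<Rightarrow> 'v" and n :: "'e \<Rightarrow> nat" and P :: "complex set"
    and L :: "'e \<Rightarrow> nat \<Rightarrow> side \<Rightarrow> complex \<times> half_edge" and par :: "'e \<Rightarrow> nat \<Rightarrow> real"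
  assumes cubic: "cubic G" and cuts: "small_cuts_trivial 4 G" and verts_ne: "verts G \<noteq> {}"
    and ends_G: "\<And>e. e \<in> edges G \<Longrightarrow> ends G e = Upair (tail e) (head e)"
    and finite_P: "finite P"
    and link_range: "\<And>e k s. e \<in> edges G \<Longrightarrow> 1 \<le> k \<Longrightarrow> k \<le> n e \<Longrightarrow> fst (L e k s) \<in> P"
    and link_surj: "\<And>p h. p \<in> P \<Longrightarrow> \<exists>e\<in>edges G. \<exists>k s. 1 \<le> k \<and> k \<le> n e \<and> L e k s = (p, h)"
    and link_inj: "\<And>e k s e' k' s'. e \<in> edges G \<Longrightarrow> 1 \<le> k \<Longrightarrow> k \<le> n e \<Longrightarrow> e' \<in> edges G \<Longrightarrow>
      1 \<le> k' \<Longrightarrow> k' \<le> n e' \<Longrightarrow> L e k s = L e' k' s' \<Longrightarrow> e = e' \<and> k = k' \<and> s = s'"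
    and link_once: "\<And>e k s k' s'. e \<in> edges G \<Longrightarrow> 1 \<le> k \<Longrightarrow> k \<le> n e \<Longrightarrow>
      1 \<le> k' \<Longrightarrow> k' \<le> n e \<Longrightarrow> fst (L e k s) = fst (L e k' s') \<Longrightarrow> k = k'"
    and link_mate: "\<And>e k. e \<in> edges G \<Longrightarrow> 1 \<le> k \<Longrightarrow> k \<le> n e \<Longrightarrow>
      L e k Outgoing = (fst (L e k Incoming), mate (snd (L e k Incoming)))"
    and link_nonadjacent: "\<And>e k s e' k' s'. e \<in> edges G \<Longrightarrow> 1 \<le> k \<Longrightarrow> k \<le> n e \<Longrightarrow> e' \<in> edges G \<Longrightarrow>
      1 \<le> k' \<Longrightarrow> k' \<le> n e' \<Longrightarrow> fst (L e k s) = fst (L e' k' s') \<Longrightarrow> e \<noteq> e' \<Longrightarrow>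
      set_uprod (ends G e) \<inter> set_uprod (ends G e') = {}"
    and par_inj: "\<And>e k k'. e \<in> edges G \<Longrightarrow> k \<le> n e \<Longrightarrow> k' \<le> n e \<Longrightarrow> par e k = par e k' \<Longrightarrow> k = k'"
    and verts_X: "verts X = Old ` verts G \<union> (\<Union>p\<in>P. block_verts p)"
    and edges_X: "edges X = {Piece e (par e k) | e k. e \<in> edges G \<and> k \<le> n e} \<union>
      {Block_Edge p b | p b. p \<in> P \<and> b \<in> block_edges}"
    and ends_piece: "\<And>e k. e \<in> edges G \<Longrightarrow> k \<le> n e \<Longrightarrow> ends X (Piece e (par e k)) = Upair
      (if k = 0 then Old (tail e) else Block (fst (L e k Outgoing)) (carrier_vertex (snd (L e k Outgoing))))
      (if k = n e then Old (head e) else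
        Block (fst (L e (Suc k) Incoming)) (carrier_vertex (snd (L e (Suc k) Incoming))))"
    and ends_block_edge: "\<And>p i j. p \<in> P \<Longrightarrow> (i, j) \<in> block_edges \<Longrightarrow>
      ends X (Block_Edge p (i, j)) = Upair (Block p i) (Block p j)"
begin

definition piece :: "'e \<Rightarrow> nat \<Rightarrow> 'e star_edge" where
  "piece e k = Piece e (par e k)"

definition link_vertex :: "'e \<Rightarrow> nat \<Rightarrow> side \<Rightarrow> 'v star_vertex" where
  "link_vertex e k s = Block (fst (L e k s)) (carrier_vertex (snd (L e k s)))"

definition piece_source :: "'e \<Rightarrow> nat \<Rightarrow> 'v star_vertex" where
  "piece_source e k = (if k = 0 then Old (tail e) else link_vertex e k Outgoing)"

definition piece_target :: "'e \<Rightarrow> nat \<Rightarrow> 'v star_vertex" where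
  "piece_target e k = (if k = n e then Old (head e) else link_vertex e (Suc k) Incoming)"

text \<open>Piece number \<open>k\<close> runs from crossing \<open>k\<close> to crossing
  \<open>Suc k\<close>, so the piece on the incoming side of crossing \<open>k\<close> has number
  \<open>k - 1\<close>.\<close>

definition attached :: "'e \<Rightarrow> nat \<Rightarrow> side \<Rightarrow> 'e star_edge" where
  "attached e k s = (case s of Outgoing \<Rightarrow> piece e k | Incoming \<Rightarrow> piece e (k - 1))"

lemma verts_X_iff [simp]:
  "Old v \<in> verts X \<longleftrightarrow> v \<in> verts G" "Block p i \<in> verts X \<longleftrightarrow> p \<in> P \<and> i \<in> {0..7}"
  by (auto simp: verts_X)

lemma wf_G: "wf_graph G" and finite_G: "finite (verts G)" "finite (edges G)"
  using cubicD[OF cubic] by auto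

lemma tail_head: "e \<in> edges G \<Longrightarrow> tail e \<in> verts G \<and> head e \<in> verts G \<and> tail e \<noteq> head e"
  using ends_G[of e] wf_graphD(3)[OF wf_G, of e] small_cuts_loopless[OF cubic cuts, of e "tail e"] by auto

lemma ends_piece': "e \<in> edges G \<Longrightarrow> k \<le> n e \<Longrightarrow> ends X (piece e k) = Upair (piece_source e k) (piece_target e k)"
  using ends_piece by (simp add: piece_def piece_source_def piece_target_def link_vertex_def)

lemma piece_in_edges: "e \<in> edges G \<Longrightarrow> k \<le> n e \<Longrightarrow> piece e k \<in> edges X"
  by (auto simp: edges_X piece_def)

lemma edges_X_cases:
  assumes "f \<in> edges X"
  obtains e k where "e \<in> edges G" "k \<le> n e" "f = piece e k"
  | p i j where "p \<in> P" "(i, j) \<in> block_edges" "f = Block_Edge p (i, j)"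
  using assms by (auto simp: edges_X piece_def)

lemma piece_eq_iff: "e \<in> edges G \<Longrightarrow> k \<le> n e \<Longrightarrow> k' \<le> n e \<Longrightarrow> piece e k = piece e' k' \<longleftrightarrow> e = e' \<and> k = k'"
  using par_inj[of e k k'] by (auto simp: piece_def)

lemma link_vertex_eq_iff:
  assumes "e \<in> edges G" "1 \<le> k" "k \<le> n e" "e' \<in> edges G" "1 \<le> k'" "k' \<le> n e'"
  shows "link_vertex e k s = link_vertex e' k' s' \<longleftrightarrow> e = e' \<and> k = k' \<and> s = s'"
  using link_inj[OF assms, of s s'] by (auto simp: link_vertex_def prod_eq_iff)

lemma link_fst: "e \<in> edges G \<Longrightarrow> 1 \<le> k \<Longrightarrow> k \<le> n e \<Longrightarrow> fst (L e k s) = fst (L e k s')"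
  using link_mate[of e k] by (cases s; cases s') auto

lemma link_other_side:
  assumes "e \<in> edges G" "1 \<le> k" "k \<le> n e" "L e k s = (p, h)"
  shows "L e k (if s = Incoming then Outgoing else Incoming) = (p, mate h)"
  using link_mate[OF assms(1-3)] assms(4) by (cases s) (auto simp: prod_eq_iff dest: arg_cong[where f = mate])

lemma finite_edges_X: "finite (edges X)"
proof -
  have "edges X = (\<lambda>(e, k). piece e k) ` (SIGMA e:edges G. {..n e}) \<union>
      (\<lambda>(p, b). Block_Edge p b) ` (P \<times> block_edges)"
    by (auto simp: edges_X piece_def)
  moreover have "finite (SIGMA e:edges G. {..n e})" "finite (P \<times> block_edges)"
    using finite_G(2) finite_P finite_block_edges by auto
  ultimately show ?thesis by simp
qed

lemma finite_verts_X: "finite (verts X)"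
  using finite_G(1) finite_P by (simp add: verts_X block_verts_def)

lemma link_vertex_in: "e \<in> edges G \<Longrightarrow> 1 \<le> k \<Longrightarrow> k \<le> n e \<Longrightarrow> link_vertex e k s \<in> verts X"
  using link_range[of e k s] carrier_range by (simp add: link_vertex_def)

lemma source_target_in: 
  assumes "e \<in> edges G" "k \<le> n e" 
  shows "piece_source e k \<in> verts X" "piece_target e k \<in> verts X"
  using assms tail_head[of e] link_vertex_in[of e] by (auto simp: piece_source_def piece_target_def)

lemma source_neq_target:
  assumes "e \<in> edges G" "k \<le> n e"
  shows "piece_source e k \<noteq> piece_target e k"
  using assms tail_head[OF assms(1)] link_vertex_eq_iff[of e k e "Suc k" Outgoing Incoming]
  by (auto simp: piece_source_def piece_target_def link_vertex_def)

lemma wf_X: "wf_graph X"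
  unfolding wf_graph_def
proof (intro conjI ballI finite_verts_X finite_edges_X)
  fix f assume "f \<in> edges X"
  then show "set_uprod (ends X f) \<subseteq> verts X"
  proof (cases rule: edges_X_cases)
    case (1 e k)
    then show ?thesis using source_target_in by (simp add: ends_piece')
  next
    case (2 p i j)
    then show ?thesis using block_edges_range[of i j] by (auto simp: ends_block_edge)
  qed
qed

lemma loopless_X:
  assumes "f \<in> edges X"
  shows "ends X f \<noteq> Upair x x"
  using assms
proof (cases rule: edges_X_cases)
  case (1 e k)
  then show ?thesis using source_neq_target[of e k] by (auto simp: ends_piece')
next
  case (2 p i j)
  then show ?thesis using block_edges_range[of i j] by (auto simp: ends_block_edge)
qed

lemma degree_X: "degree X x = card {f \<in> edges X. x \<in> set_uprod (ends X f)}"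
proof -
  have no: "{f \<in> edges X. ends X f = Upair x x} = {}" using loopless_X by auto
  show ?thesis unfolding degree_def no by simp
qed

lemma degree_G: "degree G v = card {e \<in> edges G. v \<in> {tail e, head e}}"
proof -
  have no: "{e \<in> edges G. ends G e = Upair v v} = {}" using small_cuts_loopless[OF cubic cuts] by auto
  have "{e \<in> edges G. v \<in> set_uprod (ends G e)} = {e \<in> edges G. v \<in> {tail e, head e}}"
    using ends_G by auto
  then show ?thesis unfolding degree_def no by simp
qed

text \<open>As \<open>G\<close> has no loops, an edge at \<open>v\<close> reaches \<open>v\<close>
  by exactly one of its ends, hence by its first or by its last piece.\<close>

definition end_piece :: "'v \<Rightarrow> 'e \<Rightarrow> 'e star_edge" where
  "end_piece v e = piece e (if tail e = v then 0 else n e)"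

lemma Old_incident_iff:
  assumes "e \<in> edges G" "k \<le> n e"
  shows "Old v \<in> set_uprod (ends X (piece e k)) \<longleftrightarrow> k = 0 \<and> tail e = v \<or> k = n e \<and> head e = v"
  using assms by (auto simp: ends_piece' piece_source_def piece_target_def link_vertex_def)

lemma edges_at_Old:
  "{f \<in> edges X. Old v \<in> set_uprod (ends X f)} = end_piece v ` {e \<in> edges G. v \<in> {tail e, head e}}"
proof (rule set_eqI, rule iffI)
  fix f assume "f \<in> {f \<in> edges X. Old v \<in> set_uprod (ends X f)}"
  then have f: "f \<in> edges X" "Old v \<in> set_uprod (ends X f)" by auto
  from f(1) show "f \<in> end_piece v ` {e \<in> edges G. v \<in> {tail e, head e}}"
  proof (cases rule: edges_X_cases)
    case (1 e k)
    then have "k = 0 \<and> tail e = v \<or> k = n e \<and> head e = v" using f Old_incident_iff[of e k v] by simp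
    then have "f = end_piece v e" "v \<in> {tail e, head e}" 
      using 1 tail_head[of e] by (auto simp: end_piece_def)
    then show ?thesis using 1 by auto
  next
    case (2 p i j)
    then show ?thesis using f by (simp add: ends_block_edge)
  qed
next
  fix f assume "f \<in> end_piece v ` {e \<in> edges G. v \<in> {tail e, head e}}"
  then obtain e where e: "e \<in> edges G" "v \<in> {tail e, head e}" "f = end_piece v e" by auto
  then show "f \<in> {f \<in> edges X. Old v \<in> set_uprod (ends X f)}"
    using piece_in_edges[of e] Old_incident_iff[of e _ v] by (auto simp: end_piece_def)
qed

lemma inj_end_piece: "inj_on (end_piece v) (edges G)"
  by (auto simp: inj_on_def end_piece_def piece_def)

lemma degree_Old: "v \<in> verts G \<Longrightarrow> degree X (Old v) = 3"
proof -
  assume "v \<in> verts G"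
  then have "card {e \<in> edges G. v \<in> {tail e, head e}} = 3" using cubicD(4)[OF cubic] degree_G by simp
  moreover have "inj_on (end_piece v) {e \<in> edges G. v \<in> {tail e, head e}}"
    using inj_end_piece by (rule inj_on_subset) auto
  ultimately show ?thesis unfolding degree_X edges_at_Old by (simp add: card_image)
qed

lemma pieces_at_link:
  assumes "e \<in> edges G" "1 \<le> k" "k \<le> n e"
    and "e' \<in> edges G" "k' \<le> n e'"
  shows "link_vertex e k s \<in> set_uprod (ends X (piece e' k')) \<longleftrightarrow> piece e' k' = attached e k s"
proof -
  have "link_vertex e k s = piece_source e' k' \<longleftrightarrow> k' \<noteq> 0 \<and> e = e' \<and> k = k' \<and> s = Outgoing"
    using link_vertex_eq_iff[OF assms(1-4), of k' s Outgoing] assms(5)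
    by (auto simp: piece_source_def link_vertex_def)
  moreover have "link_vertex e k s = piece_target e' k' \<longleftrightarrow> k' \<noteq> n e' \<and> e = e' \<and> k = Suc k' \<and> s = Incoming"
    using link_vertex_eq_iff[OF assms(1-4), of "Suc k'" s Incoming] assms(5)
    by (auto simp: piece_target_def link_vertex_def)
  moreover have "piece e' k' = attached e k s \<longleftrightarrow> e = e' \<and> (s = Outgoing \<and> k = k' \<or> s = Incoming \<and> k = Suc k')"
    using piece_eq_iff[OF assms(4,5), of k e] piece_eq_iff[OF assms(4,5), of "k - 1" e] assms(2,3,5)
    by (cases s) (auto simp: attached_def piece_def)
  ultimately show ?thesis using assms by (auto simp: ends_piece')
qed

lemma link_obtain:
  assumes "p \<in> P"
  obtains e k s where "e \<in> edges G" "1 \<le> k" "k \<le> n e" "L e k s = (p, h)"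
  using link_surj[OF assms] by blast

lemma Block_incident_piece:
  assumes "e \<in> edges G" "k \<le> n e" "Block p i \<in> set_uprod (ends X (piece e k))"
  shows "\<exists>k' s. 1 \<le> k' \<and> k' \<le> n e \<and> link_vertex e k' s = Block p i"
proof -
  have "Block p i = piece_source e k \<or> Block p i = piece_target e k"
    using assms by (simp add: ends_piece')
  then show ?thesis
  proof
    assume "Block p i = piece_source e k"
    then have "1 \<le> k" "link_vertex e k Outgoing = Block p i" by (auto simp: piece_source_def split: if_splits)
    then show ?thesis using assms(2) by blast
  next
    assume "Block p i = piece_target e k"
    then have "Suc k \<le> n e" "link_vertex e (Suc k) Incoming = Block p i"
      using assms(2) by (auto simp: piece_target_def split: if_splits)
    then show ?thesis by (intro exI[of _ "Suc k"] exI[of _ Incoming]) auto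
  qed
qed

lemma edges_at_Block:
  assumes "p \<in> P"
  shows "{f \<in> edges X. Block p i \<in> set_uprod (ends X f)} =
    Block_Edge p ` {b \<in> block_edges. i = fst b \<or> i = snd b} \<union>
    {attached e k s | e k s. e \<in> edges G \<and> 1 \<le> k \<and> k \<le> n e \<and> link_vertex e k s = Block p i}"
proof (rule set_eqI, rule iffI)
  fix f assume "f \<in> {f \<in> edges X. Block p i \<in> set_uprod (ends X f)}"
  then have f: "f \<in> edges X" "Block p i \<in> set_uprod (ends X f)" by auto
  from f(1) show "f \<in> Block_Edge p ` {b \<in> block_edges. i = fst b \<or> i = snd b} \<union>
    {attached e k s | e k s. e \<in> edges G \<and> 1 \<le> k \<and> k \<le> n e \<and> link_vertex e k s = Block p i}"
  proof (cases rule: edges_X_cases)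
    case (1 e k)
    then obtain k' s where k': "1 \<le> k'" "k' \<le> n e" "link_vertex e k' s = Block p i"
      using Block_incident_piece[of e k p i] f by auto
    then have "f = attached e k' s" using pieces_at_link[of e k' e k s] 1 f by auto
    then show ?thesis using k' 1 by blast
  next
    case (2 q a b)
    then show ?thesis using f by (auto simp: ends_block_edge image_iff)
  qed
next
  fix f assume "f \<in> Block_Edge p ` {b \<in> block_edges. i = fst b \<or> i = snd b} \<union>
    {attached e k s | e k s. e \<in> edges G \<and> 1 \<le> k \<and> k \<le> n e \<and> link_vertex e k s = Block p i}"
  then show "f \<in> {f \<in> edges X. Block p i \<in> set_uprod (ends X f)}"
  proof
    assume "f \<in> Block_Edge p ` {b \<in> block_edges. i = fst b \<or> i = snd b}"
    then obtain a b where "(a, b) \<in> block_edges" "i = a \<or> i = b" "f = Block_Edge p (a, b)" by auto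
    then show ?thesis using assms by (auto simp: ends_block_edge edges_X)
  next
    assume "f \<in> {attached e k s | e k s. e \<in> edges G \<and> 1 \<le> k \<and> k \<le> n e \<and> link_vertex e k s = Block p i}"
    then obtain e k s where e: "e \<in> edges G" "1 \<le> k" "k \<le> n e" "link_vertex e k s = Block p i" "f = attached e k s"
      by auto
    obtain k' where k': "k' \<le> n e" "attached e k s = piece e k'"
      using e by (cases s) (auto simp: attached_def intro: that[of k] that[of "k - 1"])
    show ?thesis using pieces_at_link[OF e(1-3) e(1) k'(1), of s] e k' piece_in_edges[of e k'] by simp
  qed
qed

text \<open>Links are injective, so every carrier of a half-edge receives exactly one piece. This
  supplies the third edge at the four block vertices of degree two.\<close>

lemma attached_at_half:
  assumes "e \<in> edges G" "1 \<le> k" "k \<le> n e" "L e k s = (p, h)"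
  shows "{attached e' k' s' | e' k' s'. e' \<in> edges G \<and> 1 \<le> k' \<and> k' \<le> n e' \<and>
      link_vertex e' k' s' = Block p (carrier_vertex h)} = {attached e k s}"
proof -
  have l: "link_vertex e k s = Block p (carrier_vertex h)" using assms(4) by (simp add: link_vertex_def)
  have "e' = e \<and> k' = k \<and> s' = s" if "e' \<in> edges G" "1 \<le> k'" "k' \<le> n e'"
    "link_vertex e' k' s' = Block p (carrier_vertex h)" for e' k' s'
    using link_vertex_eq_iff[OF that(1-3) assms(1-3), of s' s] that(4) l by simp
  then have "{attached e' k' s' | e' k' s'. e' \<in> edges G \<and> 1 \<le> k' \<and> k' \<le> n e' \<and>
      link_vertex e' k' s' = Block p (carrier_vertex h)} \<subseteq> {attached e k s}" by blast
  moreover have "attached e k s \<in> {attached e' k' s' | e' k' s'. e' \<in> edges G \<and> 1 \<le> k' \<and> k' \<le> n e' \<and>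
      link_vertex e' k' s' = Block p (carrier_vertex h)}" using l assms(1-3) by blast
  ultimately show ?thesis by (rule subset_antisym[OF _ insert_subsetI[OF _ empty_subsetI]])
qed

lemma no_attached:
  assumes "i \<notin> range carrier_vertex"
  shows "{attached e' k' s' | e' k' s'. e' \<in> edges G \<and> 1 \<le> k' \<and> k' \<le> n e' \<and> link_vertex e' k' s' = Block p i} = {}"
  using assms by (auto simp: link_vertex_def)

lemma degree_Block:
  assumes "p \<in> P" "i \<in> {0..7}"
  shows "degree X (Block p i) = 3"
proof -
  let ?B = "{b \<in> block_edges. i = fst b \<or> i = snd b}"
  have inj: "card (Block_Edge p ` ?B :: 'e star_edge set) = card ?B" by (intro card_image) (auto simp: inj_on_def)
  show ?thesis
  proof (cases "i \<in> range carrier_vertex")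
    case True
    then obtain h where h: "i = carrier_vertex h" by auto
    obtain e k s where e: "e \<in> edges G" "1 \<le> k" "k \<le> n e" "L e k s = (p, h)" 
      by (rule link_obtain[OF assms(1)])
    have "attached e k s \<notin> Block_Edge p ` ?B" by (cases s) (auto simp: attached_def piece_def)
    moreover have "finite (Block_Edge p ` ?B :: 'e star_edge set)" using finite_block_edges by auto
    ultimately show ?thesis unfolding degree_X edges_at_Block[OF assms(1)] h attached_at_half[OF e]
      using inj block_degree[OF assms(2)] True by (simp add: h)
  next
    case False
    then show ?thesis unfolding degree_X edges_at_Block[OF assms(1)] no_attached[OF False]
      using inj block_degree[OF assms(2)] by simp
  qed
qed

lemma cubic_X: "cubic X"
  unfolding cubic_def
proof (intro conjI wf_X ballI)
  fix x assume "x \<in> verts X"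
  then show "degree X x = 3" using degree_Old degree_Block by (auto simp: verts_X block_verts_def)
qed

end

section \<open>Edge cuts of the new graph\<close>

context replaced_crossings
begin

lemma block_verts_sub: "p \<in> P \<Longrightarrow> block_verts p \<subseteq> verts X"
  by (auto simp: verts_X)

text \<open>The ends of a piece belong to consecutive crossings of its edge, and an edge runs only
  once through a crossing. Hence the inserted blocks are induced.\<close>

lemma piece_not_in_block:
  assumes "e \<in> edges G" "k \<le> n e"
  shows "\<not> set_uprod (ends X (piece e k)) \<subseteq> block_verts p"
proof
  assume "set_uprod (ends X (piece e k)) \<subseteq> block_verts p"
  then have *: "piece_source e k \<in> block_verts p" "piece_target e k \<in> block_verts p"
    using assms by (auto simp: ends_piece')
  then have k: "k \<noteq> 0" "k \<noteq> n e" by (auto simp: piece_source_def piece_target_def split: if_splits)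
  then have "fst (L e k Outgoing) = p" "fst (L e (Suc k) Incoming) = p"
    using * by (auto simp: piece_source_def piece_target_def link_vertex_def)
  then show False using link_once[OF assms(1), of k "Suc k" Outgoing Incoming] assms(2) k by simp
qed

lemma inner_edges_block: "p \<in> P \<Longrightarrow> inner_edges X (block_verts p) = Block_Edge p ` block_edges"
proof (rule set_eqI, rule iffI)
  fix f :: "'e star_edge" assume p: "p \<in> P" and f: "f \<in> inner_edges X (block_verts p)"
  then have "f \<in> edges X" by (auto simp: inner_edges_def)
  then show "f \<in> Block_Edge p ` block_edges"
  proof (cases rule: edges_X_cases)
    case (1 e k)
    then show ?thesis using piece_not_in_block[of e k p] f by (auto simp: inner_edges_def)
  next
    case (2 q i j)
    then show ?thesis using f by (auto simp: inner_edges_def ends_block_edge)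
  qed
next
  fix f :: "'e star_edge" assume p: "p \<in> P" and f: "f \<in> Block_Edge p ` block_edges"
  then obtain i j where "f = Block_Edge p (i, j)" "(i, j) \<in> block_edges" by auto
  then show "f \<in> inner_edges X (block_verts p)"
    using p block_edges_range[of i j] by (auto simp: inner_edges_def edges_X ends_block_edge)
qed

lemma block_copy_X:
  assumes "p \<in> P"
  shows "block_copy X (block_verts p) (Block p) (Block_Edge p)"
  unfolding block_copy_def
proof (intro conjI allI impI)
  show "bij_betw (Block p) {0..7} (block_verts p :: 'v star_vertex set)"
    by (simp add: bij_betw_def inj_on_def block_verts_def)
  show "bij_betw (Block_Edge p) block_edges (inner_edges X (block_verts p))"
    unfolding inner_edges_block[OF assms] by (simp add: bij_betw_def inj_on_def)
qed (use assms in \<open>simp_all add: block_verts_sub ends_block_edge\<close>)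

lemma is_block_X: "p \<in> P \<Longrightarrow> is_block X (block_verts p)"
  using block_copy_X by (auto simp: is_block_def)

lemma block_disjoint: "p \<noteq> q \<Longrightarrow> block_verts p \<inter> block_verts q = {}"
  by (auto simp: block_verts_def)

text \<open>Whether the \<open>k\<close>-th vertex of the chain of \<open>e\<close> belongs to \<open>W\<close>, each block being regarded as
  a single vertex.\<close>

definition on_side :: "'v star_vertex set \<Rightarrow> 'e \<Rightarrow> nat \<Rightarrow> bool" where
  "on_side W e k = (if k = 0 then Old (tail e) \<in> W else if k = Suc (n e) then Old (head e) \<in> W
     else Block (fst (L e k Incoming)) 0 \<in> W)"

definition full :: "'v star_vertex set \<Rightarrow> bool" where
  "full W \<longleftrightarrow> (\<forall>p\<in>P. block_verts p \<subseteq> W \<or> block_verts p \<inter> W = {})"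

lemma full_iff:
  assumes "full W" "p \<in> P" "i \<in> {0..7}"
  shows "Block p i \<in> W \<longleftrightarrow> Block p 0 \<in> W"
proof -
  have "Block p i \<in> block_verts p" "Block p 0 \<in> block_verts p" using assms(3) by auto
  then show ?thesis using assms(1,2) unfolding full_def by blast
qed

lemma full_link:
  assumes "full W" "e \<in> edges G" "1 \<le> k" "k \<le> n e"
  shows "link_vertex e k s \<in> W \<longleftrightarrow> on_side W e k"
  using full_iff[OF assms(1) link_range[OF assms(2-4), of s] carrier_range] link_fst[OF assms(2-4), of s Incoming] assms
  by (auto simp: link_vertex_def on_side_def)

lemma boundary_piece:
  assumes "full W" "e \<in> edges G" "k \<le> n e"
  shows "piece e k \<in> boundary X W \<longleftrightarrow> on_side W e k \<noteq> on_side W e (Suc k)"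
proof -
  have "piece_source e k \<in> W \<longleftrightarrow> on_side W e k"
    using full_link[OF assms(1,2), of k Outgoing] assms(3) by (auto simp: piece_source_def on_side_def)
  moreover have "piece_target e k \<in> W \<longleftrightarrow> on_side W e (Suc k)"
    using full_link[OF assms(1,2), of "Suc k" Incoming] assms(3) by (auto simp: piece_target_def on_side_def)
  ultimately show ?thesis
    using assms piece_in_edges[of e k] by (auto simp: boundary_def ends_piece')
qed

lemma discrete_change:
  fixes q :: "nat \<Rightarrow> bool"
  assumes "i \<le> j" "q i \<noteq> q j"
  shows "\<exists>k. i \<le> k \<and> k < j \<and> q k \<noteq> q (Suc k)"
proof (rule ccontr)
  assume no: "\<not> ?thesis"
  have "i + m \<le> j \<Longrightarrow> q (i + m) = q i" for m
  proof (induction m)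
    case (Suc m)
    then show ?case using no by (auto dest!: spec[of _ "i + m"])
  qed auto
  from this[of "j - i"] show False using assms by simp
qed

definition crossed_pieces :: "'v star_vertex set \<Rightarrow> 'e \<Rightarrow> nat set" where
  "crossed_pieces W e = {k. k \<le> n e \<and> piece e k \<in> boundary X W}"

lemma finite_crossed_pieces: "finite (crossed_pieces W e)"
  by (rule finite_subset[of _ "{..n e}"]) (auto simp: crossed_pieces_def)

text \<open>Only the pieces are counted, edge by edge of \<open>G\<close>; block edges in the
  boundary are dropped, as a lower bound is all that is wanted.\<close>

lemma cut_size_X_ge:
  "(\<Sum>e\<in>edges G. card (crossed_pieces W e)) \<le> cut_size X W"
proof -
  let ?A = "SIGMA e:edges G. crossed_pieces W e"
  have "inj_on (\<lambda>(e, k). piece e k) ?A"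
    by (auto simp: inj_on_def crossed_pieces_def piece_def dest: par_inj)
  then have "card ?A = card ((\<lambda>(e, k). piece e k) ` ?A)" by (simp add: card_image)
  also have "\<dots> \<le> card (boundary X W)"
    by (rule card_mono) (auto simp: crossed_pieces_def finite_edges_X boundary_def)
  finally show ?thesis using finite_G(2) finite_crossed_pieces by (simp add: cut_size_def)
qed

definition old_part :: "'v star_vertex set \<Rightarrow> 'v set" where
  "old_part W = {v \<in> verts G. Old v \<in> W}"

lemma boundary_G_iff: "e \<in> edges G \<Longrightarrow> e \<in> boundary G A \<longleftrightarrow> (tail e \<in> A) \<noteq> (head e \<in> A)"
  by (auto simp: boundary_def ends_G)

lemma crossed_one:
  assumes "full W" "e \<in> boundary G (old_part W)"
  shows "1 \<le> card (crossed_pieces W e)"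
proof -
  have e: "e \<in> edges G" using assms(2) by (auto simp: boundary_def)
  have "on_side W e 0 \<noteq> on_side W e (Suc (n e))"
    using assms(2) ends_G[OF e] tail_head[OF e] by (auto simp: boundary_def on_side_def old_part_def)
  then obtain k where "k < Suc (n e)" "on_side W e k \<noteq> on_side W e (Suc k)"
    using discrete_change[of 0 "Suc (n e)" "on_side W e"] by blast
  then have "k \<in> crossed_pieces W e" using boundary_piece[OF assms(1) e] by (simp add: crossed_pieces_def)
  then show ?thesis using finite_crossed_pieces[of W e] by (metis One_nat_def Suc_leI card_gt_0_iff empty_iff)
qed

lemma crossed_two:
  assumes "full W" "e \<in> edges G" "Old (tail e) \<notin> W" "Old (head e) \<notin> W"
    and "1 \<le> k" "k \<le> n e" "Block (fst (L e k Incoming)) 0 \<in> W"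
  shows "2 \<le> card (crossed_pieces W e)"
proof -
  have q: "\<not> on_side W e 0" "on_side W e k" "\<not> on_side W e (Suc (n e))"
    using assms by (auto simp: on_side_def)
  obtain i where i: "i < k" "on_side W e i \<noteq> on_side W e (Suc i)"
    using discrete_change[of 0 k "on_side W e"] q by auto
  obtain j where j: "k \<le> j" "j < Suc (n e)" "on_side W e j \<noteq> on_side W e (Suc j)"
    using discrete_change[of k "Suc (n e)" "on_side W e"] q assms(6) by auto
  have "{i, j} \<subseteq> crossed_pieces W e" using i j assms(6) boundary_piece[OF assms(1,2)] by (simp add: crossed_pieces_def)
  then have "card {i, j} \<le> card (crossed_pieces W e)" by (intro card_mono finite_crossed_pieces)
  then show ?thesis using i j by simp
qed

text \<open>Disjointness of the ends is the point: a single old vertex is an end of at most one of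
  the two edges of a crossing.\<close>

lemma two_edges_at:
  assumes "p \<in> P"
  obtains e k e' k' where "e \<in> edges G" "1 \<le> k" "k \<le> n e" "fst (L e k Incoming) = p"
    "e' \<in> edges G" "1 \<le> k'" "k' \<le> n e'" "fst (L e' k' Incoming) = p" "e \<noteq> e'"
    "{tail e, head e} \<inter> {tail e', head e'} = {}"
proof -
  obtain e k s where 1: "e \<in> edges G" "1 \<le> k" "k \<le> n e" "L e k s = (p, half_a)"
    by (rule link_obtain[OF assms])
  obtain e' k' s' where 2: "e' \<in> edges G" "1 \<le> k'" "k' \<le> n e'" "L e' k' s' = (p, half_b)"
    by (rule link_obtain[OF assms])
  \<comment> \<open>A single passage through a block uses a half-edge and its mate, which cannot be
    \<open>half_a\<close> and \<open>half_b\<close>.\<close>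
  have "e \<noteq> e'"
  proof
    assume e: "e = e'"
    then have "k = k'" using link_once[of e k k' s s'] 1 2 by simp
    then show False using link_other_side[OF 1] 1 2 e by (cases s; cases s') auto
  qed
  moreover from this have "{tail e, head e} \<inter> {tail e', head e'} = {}"
    using link_nonadjacent[OF 1(1-3) 2(1-3), of s s'] 1 2 by (simp add: ends_G)
  moreover have "fst (L e k Incoming) = p" "fst (L e' k' Incoming) = p"
    using link_fst[OF 1(1-3), of s Incoming] link_fst[OF 2(1-3), of s' Incoming] 1(4) 2(4) by auto
  ultimately show ?thesis using that 1 2 by blast
qed

lemma cut_size_G: "cut_size G A = (\<Sum>e\<in>edges G. of_bool (e \<in> boundary G A))"
  by (rule cut_size_sum[OF finite_G(2)])

lemma full_cut_ge:
  assumes "full W"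
  shows "cut_size G (old_part W) \<le> cut_size X W"
proof -
  have "cut_size G (old_part W) \<le> (\<Sum>e\<in>edges G. card (crossed_pieces W e))"
    unfolding cut_size_G using crossed_one[OF assms] by (intro sum_mono) (auto simp: of_bool_def)
  then show ?thesis using cut_size_X_ge le_trans by blast
qed

text \<open>At least one of the two edges of a crossing is not incident with the only old vertex of \<open>W\<close>;
  it enters and leaves \<open>W\<close>.\<close>

lemma full_cut_with_block:
  assumes W: "W \<subseteq> verts X" "full W" "p \<in> P" "Block p 0 \<in> W" and old: "old_part W = {} \<or> (\<exists>v\<in>verts G. old_part W = {v})"
    and big: "verts G \<noteq> old_part W"
  shows "4 \<le> cut_size X W"
proof -
  obtain e k e' k' where e: "e \<in> edges G" "1 \<le> k" "k \<le> n e" "fst (L e k Incoming) = p"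
    and e': "e' \<in> edges G" "1 \<le> k'" "k' \<le> n e'" "fst (L e' k' Incoming) = p" and ne: "e \<noteq> e'"
    and disj: "{tail e, head e} \<inter> {tail e', head e'} = {}"
    by (rule two_edges_at[OF W(3)])
  have old_iff: "Old v \<in> W \<longleftrightarrow> v \<in> old_part W" for v using W(1) by (auto simp: old_part_def)
  have two: "2 \<le> card (crossed_pieces W e)" if "tail e \<notin> old_part W" "head e \<notin> old_part W"
    using crossed_two[OF W(2) e(1) _ _ e(2,3)] that e(4) W(4) old_iff by simp
  have two': "2 \<le> card (crossed_pieces W e')" if "tail e' \<notin> old_part W" "head e' \<notin> old_part W"
    using crossed_two[OF W(2) e'(1) _ _ e'(2,3)] that e'(4) W(4) old_iff by simp
  from old show ?thesis
  proof
    assume "old_part W = {}"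
    then have "4 \<le> (\<Sum>x\<in>{e, e'}. card (crossed_pieces W x))" using two two' ne by simp
    also have "\<dots> \<le> (\<Sum>x\<in>edges G. card (crossed_pieces W x))"
      using e(1) e'(1) finite_G(2) by (intro sum_mono2) auto
    finally show ?thesis using cut_size_X_ge le_trans by blast
  next
    assume "\<exists>v\<in>verts G. old_part W = {v}"
    then obtain v where v: "v \<in> verts G" "old_part W = {v}" by auto
    obtain x where x: "x \<in> edges G" "2 \<le> card (crossed_pieces W x)" "x \<notin> boundary G (old_part W)"
    proof (cases "v \<in> {tail e, head e}")
      case True
      then have "tail e' \<noteq> v" "head e' \<noteq> v" using disj by auto
      then show ?thesis using that[OF e'(1)] two' e'(1) v(2) by (simp add: boundary_G_iff)
    next
      case False
      then have "tail e \<noteq> v" "head e \<noteq> v" by auto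
      then show ?thesis using that[OF e(1)] two e(1) v(2) by (simp add: boundary_G_iff)
    qed
    have c3: "3 \<le> cut_size G (old_part W)"
    proof (rule ccontr)
      assume "\<not> ?thesis"
      then have "card (old_part W) + 2 \<le> cut_size G (old_part W) \<or>
          card (verts G - old_part W) + 2 \<le> cut_size G (old_part W)"
        using cuts[unfolded small_cuts_trivial_def, rule_format, of "old_part W"] v big by simp
      moreover have "verts G - old_part W \<noteq> {}" using big v(1) unfolding v(2) by (metis Diff_eq_empty_iff subset_singletonD empty_iff)
      then have "card (verts G - old_part W) > 0" using finite_G(1) by (simp add: card_gt_0_iff)
      moreover have "card (old_part W) = 1" using v by simp
      ultimately show False using \<open>\<not> 3 \<le> cut_size G (old_part W)\<close> by linarith
    qed
    \<comment> \<open>As \<open>x\<close> is not in the boundary of the old part, its two pieces add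
      to those of the boundary edges: at least 3 + 2 in all.\<close>
    have "cut_size G (old_part W) + 2 = (\<Sum>y\<in>edges G. of_bool (y \<in> boundary G (old_part W)) + (if y = x then 2 else 0))"
      using x(1) finite_G(2) by (simp add: cut_size_G sum.distrib del: sum_of_bool_eq)
    also have "\<dots> \<le> (\<Sum>y\<in>edges G. card (crossed_pieces W y))"
      using x crossed_one[OF W(2)] by (intro sum_mono) (auto simp: of_bool_def)
    finally show ?thesis using cut_size_X_ge[of W] c3 by linarith
  qed
qed

lemma old_part_compl: "W \<subseteq> verts X \<Longrightarrow> old_part (verts X - W) = verts G - old_part W"
  by (auto simp: old_part_def)

lemma full_compl: "full W \<Longrightarrow> full (verts X - W)"
  using block_verts_sub unfolding full_def by blast

lemma single_or_block:
  assumes "W \<subseteq> verts X" "full W" "old_part W = A" "\<And>p. p \<in> P \<Longrightarrow> Block p 0 \<notin> W"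
  shows "W = Old ` A"
proof (rule set_eqI)
  fix x show "x \<in> W \<longleftrightarrow> x \<in> Old ` A"
  proof (cases x)
    case (Old v)
    then show ?thesis using assms(1,3) by (auto simp: old_part_def)
  next
    case (Block p i)
    then show ?thesis using assms(1,4) full_iff[OF assms(2), of p i] by auto
  qed
qed

lemma full_cut_trivial_aux:
  assumes W: "W \<subseteq> verts X" "full W" "W \<noteq> {}" "W \<noteq> verts X"
    and old: "old_part W = {} \<or> (\<exists>v\<in>verts G. old_part W = {v})" and big: "verts G \<noteq> old_part W"
  shows "3 \<le> cut_size X W \<and> (cut_size X W = 3 \<longrightarrow> card W = 1)"
proof (cases "\<exists>p\<in>P. Block p 0 \<in> W")
  case True
  then show ?thesis using full_cut_with_block[OF W(1,2) _ _ old big] by fastforce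
next
  case False
  then have "W = Old ` old_part W" using single_or_block[OF W(1,2) refl] by blast
  moreover from this have "old_part W \<noteq> {}" using W(3) by blast
  then obtain v where "v \<in> verts G" "old_part W = {v}" using old by blast
  ultimately have v: "v \<in> verts G" "W = {Old v}" by simp_all
  then have "cut_size X W = 3"
  proof -
    have "inner_edges X W = {}"
    proof -
      have "False" if f: "f \<in> inner_edges X W" for f
      proof -
        obtain a b where "ends X f = Upair a b" by (cases "ends X f")
        then show False using f v loopless_X[of f a] by (auto simp: inner_edges_def)
      qed
      then show ?thesis by blast
    qed
    then show ?thesis using cubic_handshake[OF cubic_X W(1)] v by simp
  qed
  then show ?thesis using v by simp
qed

text \<open>If both sides have at least two old vertices, the cut that they induce in
  \<open>G\<close> is not trivial and has at least four edges. Otherwise one side has at most one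
  old vertex, and the preceding lemma applies to that side, since complements have the same
  cut.\<close>

lemma full_cut_trivial:
  assumes W: "W \<subseteq> verts X" "full W" "W \<noteq> {}" "W \<noteq> verts X"
  shows "3 \<le> cut_size X W \<and> (cut_size X W = 3 \<longrightarrow> card W = 1 \<or> card (verts X - W) = 1)"
proof (rule ccontr)
  assume not: "\<not> ?thesis"
  let ?V = "verts X - W"
  have compl: "cut_size X ?V = cut_size X W" by (rule cut_size_compl[OF wf_X W(1)])
  have V: "?V \<subseteq> verts X" "full ?V" "?V \<noteq> {}" "?V \<noteq> verts X" using W full_compl by auto
  have A: "old_part W = {} \<or> (\<exists>v\<in>verts G. old_part W = {v}) \<Longrightarrow> old_part W = verts G"
    using full_cut_trivial_aux[OF W] not by blast
  have sub: "old_part W \<subseteq> verts G" by (auto simp: old_part_def)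
  have B: "old_part W = {}" if h: "verts G - old_part W = {} \<or> (\<exists>v\<in>verts G. verts G - old_part W = {v})"
  proof (rule ccontr)
    assume "old_part W \<noteq> {}"
    then have "verts G \<noteq> verts G - old_part W" using sub by (metis Diff_disjoint Int_absorb1 Int_commute)
    then show False
      using full_cut_trivial_aux[OF V] not h unfolding compl old_part_compl[OF W(1)] by iprover
  qed
  show False
  proof (cases "old_part W = {} \<or> old_part W = verts G")
    case True
    then show False using A B verts_ne by auto
  next
    case False
    have le: "cut_size G (old_part W) \<le> 3" using full_cut_ge[OF W(2)] not by linarith
    then have "card (old_part W) + 2 \<le> cut_size G (old_part W) \<or>
          card (verts G - old_part W) + 2 \<le> cut_size G (old_part W)"
      using cuts[unfolded small_cuts_trivial_def, rule_format, of "old_part W"] False sub by simp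
    then have "card (old_part W) \<le> 1 \<or> card (verts G - old_part W) \<le> 1" using le by linarith
    moreover have "card (old_part W) > 0" "card (verts G - old_part W) > 0"
      using False sub finite_G(1) finite_subset[OF sub] by (auto simp: card_gt_0_iff)
    ultimately have "card (old_part W) = 1 \<or> card (verts G - old_part W) = 1" by linarith
    then show False using A B False sub by (auto simp: card_1_singleton_iff)
  qed
qed

text \<open>Induction on the number of blocks that \<open>W\<close> splits. A split block B has cut
  4, while the larger of its two parts has cut at least 5. So uncrossing \<open>W\<close> with B, to
  \<open>W - B\<close> or to \<open>W \<union> B\<close>, strictly lowers the cut of
  \<open>W\<close> and splits one block less. The smaller cut is at least 3 by induction, so the
  original one is at least 4.\<close>

lemma small_cuts_trivial_X_aux:
  assumes "W \<subseteq> verts X" "W \<noteq> {}" "W \<noteq> verts X"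
  shows "3 \<le> cut_size X W \<and> (cut_size X W = 3 \<longrightarrow> card W = 1 \<or> card (verts X - W) = 1)"
  using assms
proof (induction "card {p \<in> P. \<not> (block_verts p \<subseteq> W \<or> block_verts p \<inter> W = {})}" arbitrary: W rule: less_induct)
  case (less W)
  define partial where "partial W = {p \<in> P. \<not> (block_verts p \<subseteq> W \<or> block_verts p \<inter> W = {})}" for W :: "'v star_vertex set"
  note IH = less.hyps[folded partial_def]
  have fin: "finite (partial A)" for A using finite_P by (auto simp: partial_def)
  show ?case
  proof (cases "partial W = {}")
    case True
    then have "full W" by (auto simp: partial_def full_def)
    then show ?thesis using full_cut_trivial less.prems by blast
  next
    case False
    then obtain p where p: "p \<in> partial W" by blast
    then have pP: "p \<in> P" by (simp add: partial_def)
    let ?B = "block_verts p :: 'v star_vertex set"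
    have blk: "is_block X ?B" by (rule is_block_X[OF pP])
    have dB: "cut_size X ?B = 4" "card ?B = 8" "finite ?B"
      using is_block_cut_size[OF cubic_X blk] is_block_card[OF blk] is_block_finite[OF blk] by auto
    have ne: "?B \<inter> W \<noteq> {}" "?B - W \<noteq> {}" using p by (auto simp: partial_def)
    have split: "card (?B \<inter> W) + card (?B - W) = 8"
      using card_Int_Diff[OF dB(3), of W] dB(2) by simp
    have pos: "card (?B \<inter> W) > 0" "card (?B - W) > 0" using ne dB(3) by (auto simp: card_gt_0_iff)
    note b1 = block_subset_cut_size[OF cubic_X blk Int_lower1 ne(1)]
    note b2 = block_subset_cut_size[OF cubic_X blk Diff_subset ne(2)]
    have partial_less: "card (partial A) < card (partial W)"
      if other: "\<And>q. q \<noteq> p \<Longrightarrow> block_verts q \<inter> A = block_verts q \<inter> W"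
        and "block_verts p \<subseteq> A \<or> block_verts p \<inter> A = {}" for A
    proof (rule psubset_card_mono[OF fin])
      have "q \<in> partial W" "q \<noteq> p" if q: "q \<in> partial A" for q
      proof -
        show "q \<noteq> p" using q \<open>block_verts p \<subseteq> A \<or> block_verts p \<inter> A = {}\<close> by (auto simp: partial_def)
        then have "block_verts q \<inter> A = block_verts q \<inter> W" by (rule other)
        then show "q \<in> partial W" using q unfolding partial_def by blast
      qed
      then show "partial A \<subset> partial W" using p by blast
    qed
    show ?thesis
    proof (cases "card (?B \<inter> W) \<le> 4")
      case True
      \<comment> \<open>The part outside \<open>W\<close> has 4 to 7 vertices.\<close>
      then have "5 \<le> cut_size X (?B - W)" using b2(3) split pos by linarith
      then have lt: "cut_size X (W - ?B) < cut_size X W"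
        using posimodular[OF wf_X, of W ?B] dB(1) by linarith
      show ?thesis
      proof (cases "W - ?B = {}")
        case True
        \<comment> \<open>\<open>W\<close> lies inside the block and uncrossing would leave the
          empty set, so the bounds for subsets of a block are used directly.\<close>
        then have WB: "?B \<inter> W = W" by blast
        have "cut_size X W \<ge> 4" if "card W \<noteq> 1"
        proof -
          have "card W = 2 \<or> 3 \<le> card W \<and> card W \<le> 7" using that pos split unfolding WB by linarith
          then show ?thesis using b1(2,3) unfolding WB by linarith
        qed
        then show ?thesis using b1(1) unfolding WB by fastforce
      next
        case False
        have "block_verts q \<inter> (W - ?B) = block_verts q \<inter> W" if "q \<noteq> p" for q
          using block_disjoint[OF that] by blast
        then have "3 \<le> cut_size X (W - ?B)"
          using IH[of "W - ?B"] partial_less[of "W - ?B"] False less.prems by blast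
        then show ?thesis using lt by linarith
      qed
    next
      case False
      then have "5 \<le> cut_size X (?B \<inter> W)" using b1(3) split pos by linarith
      then have lt: "cut_size X (W \<union> ?B) < cut_size X W"
        using submodular[OF wf_X, of W ?B] dB(1) by (simp add: Int_commute)
      show ?thesis
      proof (cases "W \<union> ?B = verts X")
        case True
        \<comment> \<open>The mirror case: the complement of \<open>W\<close> lies inside the
          block.\<close>
        then have WB: "?B - W = verts X - W" using less.prems(1) by blast
        note compl = cut_size_compl[OF wf_X less.prems(1)]
        have "cut_size X W \<ge> 4" if "card (verts X - W) \<noteq> 1"
        proof -
          have "card (verts X - W) = 2 \<or> 3 \<le> card (verts X - W) \<and> card (verts X - W) \<le> 7"
            using that pos split unfolding WB by linarith
          then show ?thesis using b2(2,3) unfolding WB compl by linarith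
        qed
        then show ?thesis using b2(1) unfolding WB compl by fastforce
      next
        case neq: False
        have "block_verts q \<inter> (W \<union> ?B) = block_verts q \<inter> W" if "q \<noteq> p" for q
          using block_disjoint[OF that] by blast
        then have "3 \<le> cut_size X (W \<union> ?B)"
          using IH[of "W \<union> ?B"] partial_less[of "W \<union> ?B"] neq less.prems block_verts_sub[OF pP] by blast
        then show ?thesis using lt by linarith
      qed
    qed
  qed
qed

lemma small_cuts_trivial_X: "small_cuts_trivial 4 X"
  unfolding small_cuts_trivial_def
proof (intro allI impI)
  fix W assume "W \<subseteq> verts X" "W \<noteq> {} \<and> W \<noteq> verts X \<and> cut_size X W < 4"
  then have "cut_size X W = 3" "card W = 1 \<or> card (verts X - W) = 1"
    using small_cuts_trivial_X_aux[of W] by auto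
  then show "card W + 2 \<le> cut_size X W \<or> card (verts X - W) + 2 \<le> cut_size X W" by auto
qed

lemma verts_X_ne: "verts X \<noteq> {}"
  using verts_ne by (auto simp: verts_X)

end

section \<open>Edge colourings of the new graph\<close>

context replaced_crossings
begin

text \<open>For \<open>p \<in> P\<close> the choice exists by \<open>link_surj\<close> and is unique
  by \<open>link_inj\<close>.\<close>

definition half_piece :: "complex \<Rightarrow> half_edge \<Rightarrow> 'e star_edge" where
  "half_piece p h = (SOME f. \<exists>e k s. e \<in> edges G \<and> 1 \<le> k \<and> k \<le> n e \<and> L e k s = (p, h) \<and> f = attached e k s)"

lemma half_piece_eq:
  assumes "e \<in> edges G" "1 \<le> k" "k \<le> n e" "L e k s = (p, h)"
  shows "half_piece p h = attached e k s"
  unfolding half_piece_def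
proof (rule some_equality)
  show "\<exists>e' k' s'. e' \<in> edges G \<and> 1 \<le> k' \<and> k' \<le> n e' \<and> L e' k' s' = (p, h) \<and> attached e k s = attached e' k' s'"
    using assms by blast
  fix f assume "\<exists>e' k' s'. e' \<in> edges G \<and> 1 \<le> k' \<and> k' \<le> n e' \<and> L e' k' s' = (p, h) \<and> f = attached e' k' s'"
  then obtain e' k' s' where f: "e' \<in> edges G" "1 \<le> k'" "k' \<le> n e'" "L e' k' s' = (p, h)" "f = attached e' k' s'"
    by blast
  have "e' = e \<and> k' = k \<and> s' = s"
    by (rule link_inj[OF f(1-3) assms(1-3)]) (simp add: f(4) assms(4))
  then show "f = attached e k s" using f(5) by simp
qed

lemma half_piece_incident:
  assumes "p \<in> P"
  shows "half_piece p h \<in> edges X" "Block p (carrier_vertex h) \<in> set_uprod (ends X (half_piece p h))"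
    "half_piece p h \<noteq> Block_Edge q b"
proof -
  obtain e k s where e: "e \<in> edges G" "1 \<le> k" "k \<le> n e" "L e k s = (p, h)"
    by (rule link_obtain[OF assms])
  note eq = half_piece_eq[OF e]
  have "half_piece p h \<in> {f \<in> edges X. Block p (carrier_vertex h) \<in> set_uprod (ends X f)}"
    unfolding edges_at_Block[OF assms] attached_at_half[OF e] eq by simp
  then show "half_piece p h \<in> edges X" "Block p (carrier_vertex h) \<in> set_uprod (ends X (half_piece p h))"
    by auto
  show "half_piece p h \<noteq> Block_Edge q b" unfolding eq by (cases s) (auto simp: attached_def piece_def)
qed

lemma half_piece_mate:
  assumes "e \<in> edges G" "1 \<le> k" "k \<le> n e"
  obtains p h where "p \<in> P" "piece e (k - 1) = half_piece p h" "piece e k = half_piece p (mate h)"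
proof -
  obtain p h where ph: "L e k Incoming = (p, h)" by (cases "L e k Incoming")
  have "L e k Outgoing = (p, mate h)" using link_mate[OF assms] ph by simp
  then have "half_piece p h = piece e (k - 1)" "half_piece p (mate h) = piece e k"
    using half_piece_eq[OF assms ph] half_piece_eq[OF assms] by (simp_all add: attached_def)
  moreover have "p \<in> P" using link_range[OF assms, of Incoming] ph by simp
  ultimately show ?thesis by (intro that[of p h]) simp_all
qed

lemma not_colorable_X:
  assumes "\<not> three_edge_colorable G"
  shows "\<not> three_edge_colorable X"
proof
  assume "three_edge_colorable X"
  then obtain c :: "'e star_edge \<Rightarrow> nat" where c: "c ` edges X \<subseteq> {1, 2, 3}"
    and proper: "\<forall>e\<in>edges X. \<forall>e'\<in>edges X.
           e \<noteq> e' \<and> set_uprod (ends X e) \<inter> set_uprod (ends X e') \<noteq> {} \<longrightarrow> c e \<noteq> c e'"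
    unfolding three_edge_colorable_def by (elim conjE exE)
  have neq: "c f \<noteq> c f'" if "f \<in> edges X" "f' \<in> edges X" "f \<noteq> f'" "x \<in> set_uprod (ends X f)" "x \<in> set_uprod (ends X f')" for f f' x
  proof -
    have "set_uprod (ends X f) \<inter> set_uprod (ends X f') \<noteq> {}" using that(4,5) by blast
    then show ?thesis using proper that(1-3) by simp
  qed
  have mate: "c (half_piece p h) = c (half_piece p (mate h))" if p: "p \<in> P" for p h
  proof -
    define d where "d i j = c (Block_Edge p (i, j))" for i j
    define g where "g h = c (half_piece p h)" for h
    have range: "d i j \<in> {1, 2, 3}" if "(i, j) \<in> block_edges" for i j
    proof -
      have "Block_Edge p (i, j) \<in> edges X" using that p by (auto simp: edges_X)
      then show ?thesis using c unfolding d_def by blast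
    qed
    have grange: "g h \<in> {1, 2, 3}" for h
      using c half_piece_incident(1)[OF p, of h] unfolding g_def by blast
    have dd: "d i j \<noteq> d i' j'" if "(i, j) \<in> block_edges" "(i', j') \<in> block_edges" "(i, j) \<noteq> (i', j')"
      and meet: "{i, j} \<inter> {i', j'} \<noteq> {}" for i j i' j'
    proof -
      obtain x where "x \<in> {i, j}" "x \<in> {i', j'}" using meet by blast
      then show ?thesis unfolding d_def using that p
        by (intro neq[of _ _ "Block p x"]) (auto simp: edges_X ends_block_edge)
    qed
    have dg: "d i j \<noteq> g h" if "(i, j) \<in> block_edges" "carrier_vertex h \<in> {i, j}" for i j h
      unfolding d_def g_def
    proof (rule neq[of _ _ "Block p (carrier_vertex h)"])
      show "Block_Edge p (i, j) \<in> edges X" using that p by (auto simp: edges_X)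
      show "Block p (carrier_vertex h) \<in> set_uprod (ends X (Block_Edge p (i, j)))"
        using that p by (auto simp: ends_block_edge)
      show "Block_Edge p (i, j) \<noteq> half_piece p h" using half_piece_incident(3)[OF p] by metis
    qed (use half_piece_incident[OF p, of h] in auto)
    have be: "(0, 1) \<in> block_edges" "(1, 2) \<in> block_edges" "(3, 4) \<in> block_edges" "(5, 6) \<in> block_edges"
      "(6, 7) \<in> block_edges" "(0, 3) \<in> block_edges" "(3, 5) \<in> block_edges" "(1, 6) \<in> block_edges"
      "(2, 4) \<in> block_edges" "(4, 7) \<in> block_edges" by (auto simp: block_edges_def)
    have "g half_a = g half_a' \<and> g half_b = g half_b'"
    proof (rule block_coloring)
      show "{g half_a, g half_a', g half_b, g half_b', d 0 1, d 1 2, d 1 6, d 0 3, d 3 4, d 3 5, d 2 4, d 4 7,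
          d 5 6, d 6 7} \<subseteq> {1, 2, 3}"
        using range be grange by (intro insert_subsetI empty_subsetI) auto
    qed (simp_all add: dd dg be del: One_nat_def)
    then show ?thesis unfolding g_def by (cases h) auto
  qed
  \<comment> \<open>Consecutive pieces meet a block at mates, so the colour does not change along
    the chain of \<open>e\<close> and its first piece can stand for the edge.\<close>
  have const: "c (piece e k) = c (piece e 0)" if e: "e \<in> edges G" and "k \<le> n e" for e k
    using \<open>k \<le> n e\<close>
  proof (induction k)
    case (Suc k)
    obtain p h where p: "p \<in> P" "piece e (Suc k - 1) = half_piece p h" "piece e (Suc k) = half_piece p (mate h)"
      by (rule half_piece_mate[OF e _ Suc.prems]) simp
    then show ?case using mate[OF p(1), of h] Suc by simp
  qed simp
  have "three_edge_colorable G"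
    unfolding three_edge_colorable_def
  proof (intro conjI exI[of _ "\<lambda>e. c (piece e 0)"] ballI allI impI)
    fix e v assume "e \<in> edges G" then show "ends G e \<noteq> Upair v v" using small_cuts_loopless[OF cubic cuts] by simp
  next
    show "(\<lambda>e. c (piece e 0)) ` edges G \<subseteq> {1, 2, 3}" using c piece_in_edges by auto
  next
    fix e e' assume e: "e \<in> edges G" "e' \<in> edges G" and h: "e \<noteq> e' \<and> set_uprod (ends G e) \<inter> set_uprod (ends G e') \<noteq> {}"
    then obtain v where v: "v \<in> {tail e, head e}" "v \<in> {tail e', head e'}" by (auto simp: ends_G)
    have inc: "end_piece v x \<in> edges X \<and> Old v \<in> set_uprod (ends X (end_piece v x))"
      if "x \<in> edges G" "v \<in> {tail x, head x}" for x
    proof -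
      have "end_piece v x \<in> end_piece v ` {e \<in> edges G. v \<in> {tail e, head e}}" using that by blast
      then show ?thesis unfolding edges_at_Old[symmetric] by simp
    qed
    have "end_piece v e \<noteq> end_piece v e'" using inj_end_piece[of v] e h by (auto dest: inj_onD)
    then have "c (end_piece v e) \<noteq> c (end_piece v e')"
      using neq inc[OF e(1) v(1)] inc[OF e(2) v(2)] by blast
    moreover have "c (end_piece v x) = c (piece x 0)" if "x \<in> edges G" for x
      using const[OF that, of "n x"] by (simp add: end_piece_def)
    ultimately show "c (piece e 0) \<noteq> c (piece e' 0)" using e by simp
  qed
  then show False using assms by simp
qed

end

section \<open>Graphs of cyclic edge-connectivity five that contain the block\<close>

text \<open>An embedding that need not be induced, unlike \<open>block_copy\<close>. If the images
  exhaust vertices and edges, two such embeddings compose to an isomorphism.\<close>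

definition realizes :: "('v, 'e) mgraph \<Rightarrow> nat set \<Rightarrow> (nat \<times> nat) set \<Rightarrow> (nat \<Rightarrow> 'v) \<Rightarrow> (nat \<times> nat \<Rightarrow> 'e) \<Rightarrow> bool" where
  "realizes G I J \<beta> \<epsilon> \<longleftrightarrow> inj_on \<beta> I \<and> \<beta> ` I \<subseteq> verts G \<and> inj_on \<epsilon> J \<and> \<epsilon> ` J \<subseteq> edges G \<and>
     (\<forall>i j. (i, j) \<in> J \<longrightarrow> ends G (\<epsilon> (i, j)) = Upair (\<beta> i) (\<beta> j))"

text \<open>Vertex 8 receives the half-edges a and a', vertex 9 receives b and b'.\<close>

definition petersen_edges :: "(nat \<times> nat) set" where
  "petersen_edges = block_edges \<union> {(0, 8), (7, 8), (2, 9), (5, 9), (8, 9)}"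

lemma realizes_iso:
  assumes G: "realizes G I J \<beta> \<epsilon>" "\<beta> ` I = verts G" "\<epsilon> ` J = edges G"
    and H: "realizes H I J \<gamma> \<delta>" "\<gamma> ` I = verts H" "\<delta> ` J = edges H"
    and J: "\<And>i j. (i, j) \<in> J \<Longrightarrow> i \<in> I \<and> j \<in> I"
  shows "graph_iso G H"
proof -
  have inj: "inj_on \<beta> I" "inj_on \<gamma> I" "inj_on \<epsilon> J" "inj_on \<delta> J"
    and en: "\<And>i j. (i, j) \<in> J \<Longrightarrow> ends G (\<epsilon> (i, j)) = Upair (\<beta> i) (\<beta> j)"
    "\<And>i j. (i, j) \<in> J \<Longrightarrow> ends H (\<delta> (i, j)) = Upair (\<gamma> i) (\<gamma> j)"
    using G(1) H(1) by (auto simp: realizes_def)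
  have "bij_betw \<beta> I (verts G)" "bij_betw \<gamma> I (verts H)" "bij_betw \<epsilon> J (edges G)" "bij_betw \<delta> J (edges H)"
    using inj G(2,3) H(2,3) by (auto simp: bij_betw_def)
  then have "bij_betw (\<gamma> \<circ> inv_into I \<beta>) (verts G) (verts H)" "bij_betw (\<delta> \<circ> inv_into J \<epsilon>) (edges G) (edges H)"
    by (meson bij_betw_inv_into bij_betw_trans)+
  moreover have "ends H ((\<delta> \<circ> inv_into J \<epsilon>) e) = map_uprod (\<gamma> \<circ> inv_into I \<beta>) (ends G e)" if e: "e \<in> edges G" for e
  proof -
    obtain b where "b \<in> J" "e = \<epsilon> b" using e G(3) by blast
    moreover obtain i j where "b = (i, j)" by (cases b)
    ultimately have ij: "(i, j) \<in> J" "e = \<epsilon> (i, j)" by auto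
    then show ?thesis using inj en J[OF ij(1)] by simp
  qed
  ultimately show ?thesis unfolding graph_iso_def by blast
qed

text \<open>Eight vertices leave at least four outside any set of three or four, so that neither
  side of such a cut is trivial.\<close>

locale cyclic_five =
  fixes G :: "('v, 'e) mgraph"
  assumes cubic: "cubic G" and cuts: "small_cuts_trivial 5 G" and big: "8 \<le> card (verts G)"
begin

definition joined :: "'v \<Rightarrow> 'v \<Rightarrow> bool" where
  "joined u v \<longleftrightarrow> (\<exists>e\<in>edges G. ends G e = Upair u v)"

lemma joined_sym: "joined u v \<Longrightarrow> joined v u"
proof -
  have "Upair u v = Upair v u" by simp
  then show "joined u v \<Longrightarrow> joined v u" unfolding joined_def by simp
qed

lemma joined_neq: "joined u v \<Longrightarrow> u \<noteq> v"
  using small_cuts_loopless[OF cubic cuts] by (auto simp: joined_def)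

lemma joined_verts: "joined u v \<Longrightarrow> u \<in> verts G \<and> v \<in> verts G"
  using wf_graphD(3)[OF cubicD(1)[OF cubic]] by (fastforce simp: joined_def)

text \<open>As many inner edges as vertices would make the cut at most 4, hence below 5, while each
  side has at least as many vertices as the cut has edges. This excludes triangles and
  quadrangles.\<close>

lemma few_inner_edges:
  assumes "U \<subseteq> verts G" "card U = 3 \<or> card U = 4"
  shows "card (inner_edges G U) < card U"
proof (rule ccontr)
  assume "\<not> ?thesis"
  then have d: "cut_size G U \<le> card U" using cubic_handshake[OF cubic assms(1)] by linarith
  have fin: "finite (verts G)" using cubicD(2)[OF cubic] .
  have c: "card (verts G - U) = card (verts G) - card U"
    using card_Diff_subset[OF finite_subset[OF assms(1) fin] assms(1)] .
  have "U \<noteq> {}" "U \<noteq> verts G" using assms(2) big by auto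
  then have "card U + 2 \<le> cut_size G U \<or> card (verts G - U) + 2 \<le> cut_size G U"
    using cuts[unfolded small_cuts_trivial_def, rule_format, of U] d assms by auto
  then show False using d c big assms(2) by linarith
qed

lemma no_triangle:
  assumes "joined u v" "joined v w" "joined w u"
  shows False
proof -
  obtain e f g where e: "e \<in> edges G" "f \<in> edges G" "g \<in> edges G"
    "ends G e = Upair u v" "ends G f = Upair v w" "ends G g = Upair w u" using assms by (auto simp: joined_def)
  note ne = assms[THEN joined_neq]
  have "e \<noteq> f" "f \<noteq> g" "e \<noteq> g" using e ne by auto
  then have "card {e, f, g} = 3" by simp
  moreover have "{e, f, g} \<subseteq> inner_edges G {u, v, w}" using e by (auto simp: inner_edges_def)
  moreover have "finite (inner_edges G {u, v, w})" using cubicD(3)[OF cubic] by (auto simp: inner_edges_def)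
  ultimately have "3 \<le> card (inner_edges G {u, v, w})" by (metis card_mono)
  moreover have "card {u, v, w} = 3" using ne by auto
  moreover have "{u, v, w} \<subseteq> verts G" using assms joined_verts by blast
  ultimately show False using few_inner_edges[of "{u, v, w}"] by simp
qed

lemma no_quadrangle:
  assumes "joined u v" "joined v w" "joined w t" "joined t u" "u \<noteq> w" "v \<noteq> t"
  shows False
proof -
  obtain e f g h where e: "e \<in> edges G" "f \<in> edges G" "g \<in> edges G" "h \<in> edges G"
    "ends G e = Upair u v" "ends G f = Upair v w" "ends G g = Upair w t" "ends G h = Upair t u"
    using assms by (auto simp: joined_def)
  note ne = assms(1-4)[THEN joined_neq] assms(5,6)
  have "e \<noteq> f" "f \<noteq> g" "e \<noteq> g" "e \<noteq> h" "f \<noteq> h" "g \<noteq> h" using e ne by auto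
  then have "card {e, f, g, h} = 4" by simp
  moreover have "{e, f, g, h} \<subseteq> inner_edges G {u, v, w, t}" using e by (auto simp: inner_edges_def)
  moreover have "finite (inner_edges G {u, v, w, t})" using cubicD(3)[OF cubic] by (auto simp: inner_edges_def)
  ultimately have "4 \<le> card (inner_edges G {u, v, w, t})" by (metis card_mono)
  moreover have "card {u, v, w, t} = 4" using ne by auto
  moreover have "{u, v, w, t} \<subseteq> verts G" using assms joined_verts by blast
  ultimately show False using few_inner_edges[of "{u, v, w, t}"] by simp
qed

end

locale cyclic_five_with_block = cyclic_five +
  fixes \<beta> :: "nat \<Rightarrow> 'a" and \<epsilon> :: "nat \<times> nat \<Rightarrow> 'b"
  assumes block: "realizes G {0..7} block_edges \<beta> \<epsilon>"
begin

lemma beta_inj: "i \<in> {0..7} \<Longrightarrow> j \<in> {0..7} \<Longrightarrow> \<beta> i = \<beta> j \<longleftrightarrow> i = j"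
  using block by (auto simp: realizes_def inj_on_eq_iff)

lemma ends_block: "(i, j) \<in> block_edges \<Longrightarrow> ends G (\<epsilon> (i, j)) = Upair (\<beta> i) (\<beta> j)"
  using block by (auto simp: realizes_def)

lemma eps_edges: "b \<in> block_edges \<Longrightarrow> \<epsilon> b \<in> edges G"
  using block by (auto simp: realizes_def)

lemma joined_block: "(i, j) \<in> block_edges \<Longrightarrow> joined (\<beta> i) (\<beta> j) \<and> joined (\<beta> j) (\<beta> i)"
proof -
  assume ij: "(i, j) \<in> block_edges"
  then have "joined (\<beta> i) (\<beta> j)" using eps_edges[OF ij] ends_block[OF ij] unfolding joined_def by blast
  then show ?thesis using joined_sym by simp
qed

lemmas joined_blocks = block_edges_list[THEN joined_block]

lemma beta_verts: "i \<in> {0..7} \<Longrightarrow> \<beta> i \<in> verts G"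
  using block by (auto simp: realizes_def)

lemma edges_at:
  assumes "i \<in> {0..7}"
  shows "card {e \<in> edges G. \<beta> i \<in> set_uprod (ends G e)} = 3"
    "card {e \<in> \<epsilon> ` block_edges. \<beta> i \<in> set_uprod (ends G e)} = (if i \<in> range carrier_vertex then 2 else 3)"
    "{e \<in> \<epsilon> ` block_edges. \<beta> i \<in> set_uprod (ends G e)} \<subseteq> {e \<in> edges G. \<beta> i \<in> set_uprod (ends G e)}"
proof -
  have no: "{e \<in> edges G. ends G e = Upair (\<beta> i) (\<beta> i)} = {}" using small_cuts_loopless[OF cubic cuts] by auto
  show "card {e \<in> edges G. \<beta> i \<in> set_uprod (ends G e)} = 3"
    using cubicD(4)[OF cubic beta_verts[OF assms]] unfolding degree_def no by simp
  have "{e \<in> \<epsilon> ` block_edges. \<beta> i \<in> set_uprod (ends G e)} = \<epsilon> ` {b \<in> block_edges. i = fst b \<or> i = snd b}"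
  proof (rule Collect_image_eq)
    fix b assume b: "b \<in> block_edges"
    obtain j k where jk: "b = (j, k)" by (cases b)
    then show "\<beta> i \<in> set_uprod (ends G (\<epsilon> b)) \<longleftrightarrow> i = fst b \<or> i = snd b"
      using b ends_block[of j k] beta_inj[OF assms, of j] beta_inj[OF assms, of k] block_edges_range[of j k] by simp
  qed
  moreover have "inj_on \<epsilon> {b \<in> block_edges. i = fst b \<or> i = snd b}"
    using block by (auto simp: realizes_def intro: inj_on_subset)
  ultimately show "card {e \<in> \<epsilon> ` block_edges. \<beta> i \<in> set_uprod (ends G e)} = (if i \<in> range carrier_vertex then 2 else 3)"
    using block_degree[OF assms] by (simp add: card_image)
  show "{e \<in> \<epsilon> ` block_edges. \<beta> i \<in> set_uprod (ends G e)} \<subseteq> {e \<in> edges G. \<beta> i \<in> set_uprod (ends G e)}"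
    using eps_edges by auto
qed

lemma saturated:
  assumes "i \<in> {0..7}" "i \<notin> range carrier_vertex" "e \<in> edges G" "\<beta> i \<in> set_uprod (ends G e)"
  shows "e \<in> \<epsilon> ` block_edges"
proof -
  have "finite {e \<in> edges G. \<beta> i \<in> set_uprod (ends G e)}" using cubicD(3)[OF cubic] by simp
  then have "{e \<in> \<epsilon> ` block_edges. \<beta> i \<in> set_uprod (ends G e)} = {e \<in> edges G. \<beta> i \<in> set_uprod (ends G e)}"
    using edges_at[OF assms(1)] assms(2) by (intro card_subset_eq) auto
  then show ?thesis using assms(3,4) by blast
qed

text \<open>The third edge at a vertex that carries a half-edge leaves the block, since otherwise it
  would close a cycle of length at most four.\<close>

lemma outgoing_edge:
  obtains g y where "g \<in> edges G" "g \<notin> \<epsilon> ` block_edges" "ends G g = Upair (\<beta> (carrier_vertex h)) y"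
    "y \<notin> \<beta> ` {0..7}"
proof -
  let ?i = "carrier_vertex h"
  note i = carrier_range[of h]
  have "{e \<in> \<epsilon> ` block_edges. \<beta> ?i \<in> set_uprod (ends G e)} \<noteq> {e \<in> edges G. \<beta> ?i \<in> set_uprod (ends G e)}"
    using edges_at(1,2)[OF i] by (auto simp del: mem_Collect_eq)
  then obtain g where g: "g \<in> edges G" "g \<notin> \<epsilon> ` block_edges" "\<beta> ?i \<in> set_uprod (ends G g)"
    using edges_at(3)[OF i] by blast
  obtain y where y: "ends G g = Upair (\<beta> ?i) y"
    using g(3) by (cases "ends G g") auto
  have jy: "joined (\<beta> ?i) y" using g(1) y by (auto simp: joined_def)
  have "y \<notin> \<beta> ` {0..7}"
  proof
    assume "y \<in> \<beta> ` {0..7}"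
    then obtain j where j: "j \<in> {0..7}" "y = \<beta> j" by blast
    have "j \<in> range carrier_vertex"
    proof (rule ccontr)
      assume "j \<notin> range carrier_vertex"
      then have "g \<in> \<epsilon> ` block_edges" by (rule saturated[OF j(1) _ g(1)]) (simp add: y j)
      then show False using g(2) by simp
    qed
    then have j': "j = 0 \<or> j = 2 \<or> j = 5 \<or> j = 7" unfolding range_carrier by simp
    have i': "?i = 0 \<or> ?i = 2 \<or> ?i = 5 \<or> ?i = 7" by (cases h) auto
    have jij: "joined (\<beta> ?i) (\<beta> j)" using jy j by simp
    then have ne: "?i \<noteq> j" using joined_neq by auto
    note s = jij joined_sym[OF jij]
    \<comment> \<open>Any two carriers are joined inside the block by a path of length two or three,
      so an edge between them would close a triangle or a quadrangle. The six pairs are listed in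
      increasing order.\<close>
    have False if c: "c = (0::nat, 2::nat) \<or> c = (0, 5) \<or> c = (0, 7) \<or> c = (2, 5) \<or> c = (2, 7) \<or> c = (5, 7)"
      and jc: "joined (\<beta> (fst c)) (\<beta> (snd c))" for c
      using c
    proof (elim disjE)
      assume "c = (0, 2)"
      then show False using no_triangle[of "\<beta> 0" "\<beta> 2" "\<beta> 1"] jc joined_blocks by simp
    next
      assume "c = (0, 5)"
      then show False using no_triangle[of "\<beta> 0" "\<beta> 5" "\<beta> 3"] jc joined_blocks by simp
    next
      assume "c = (0, 7)"
      then show False using no_quadrangle[of "\<beta> 0" "\<beta> 7" "\<beta> 4" "\<beta> 3"] jc joined_blocks by (simp add: beta_inj)
    next
      assume "c = (2, 5)"
      then show False using no_quadrangle[of "\<beta> 2" "\<beta> 5" "\<beta> 3" "\<beta> 4"] jc joined_blocks by (simp add: beta_inj)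
    next
      assume "c = (2, 7)"
      then show False using no_triangle[of "\<beta> 2" "\<beta> 7" "\<beta> 4"] jc joined_blocks by simp
    next
      assume "c = (5, 7)"
      then show False using no_triangle[of "\<beta> 5" "\<beta> 7" "\<beta> 6"] jc joined_blocks by simp
    qed
    from this[of "(min ?i j, max ?i j)"] show False using s ne i' j' by auto
  qed
  then show ?thesis using that g(1,2) y by blast
qed

text \<open>Four edges leave the eight block vertices. Such a cut is below 5, so it must be trivial
  on the other side, which leaves two vertices joined by an edge. Excluded quadrangles decide how
  the four half-edges are distributed over these two.\<close>

lemma petersen:
  obtains \<gamma> \<delta> where "realizes G {0..9} petersen_edges \<gamma> \<delta>" "\<gamma> ` {0..9} = verts G" "\<delta> ` petersen_edges = edges G"
proof -
  let ?A = "\<beta> ` {0..7}"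
  have "\<forall>h. \<exists>g y. g \<in> edges G \<and> g \<notin> \<epsilon> ` block_edges \<and> ends G g = Upair (\<beta> (carrier_vertex h)) y \<and> y \<notin> ?A"
    using outgoing_edge by metis
  then obtain g y where g: "\<And>h. g h \<in> edges G" "\<And>h. g h \<notin> \<epsilon> ` block_edges"
    "\<And>h. ends G (g h) = Upair (\<beta> (carrier_vertex h)) (y h)" "\<And>h. y h \<notin> ?A" by metis
  have bA: "\<beta> (carrier_vertex h) \<in> ?A" for h using carrier_range by blast
  have yV: "y h \<in> verts G" for h using wf_graphD(3)[OF cubicD(1)[OF cubic] g(1)[of h]] g(3) by simp
  have ginj: "g h = g h' \<longleftrightarrow> h = h'" for h h'
  proof
    assume "g h = g h'"
    then have "Upair (\<beta> (carrier_vertex h)) (y h) = Upair (\<beta> (carrier_vertex h')) (y h')" using g(3) by metis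
    then have "\<beta> (carrier_vertex h) = \<beta> (carrier_vertex h')" using bA g(4) by (metis Upair_inject)
    then show "h = h'" using beta_inj carrier_range by simp
  qed simp
  have fin: "finite (verts G)" "finite (edges G)" using cubicD[OF cubic] by auto
  have AV: "?A \<subseteq> verts G" using beta_verts by blast
  have inj: "inj_on \<beta> {0..7}" "inj_on \<epsilon> block_edges" using block by (auto simp: realizes_def)
  have cA: "card ?A = 8" using card_image[OF inj(1)] by simp
  have "\<epsilon> ` block_edges \<subseteq> inner_edges G ?A"
    using eps_edges ends_block block_edges_range by (auto simp: inner_edges_def)
  then have "card (\<epsilon> ` block_edges) \<le> card (inner_edges G ?A)"
    using fin(2) by (intro card_mono) (auto simp: inner_edges_def)
  then have "10 \<le> card (inner_edges G ?A)" using card_image[OF inj(2)] by (simp add: block_edges_def)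
  \<comment> \<open>The embedding is not known to be induced, so the ten inner edges are only a
    lower bound; the four edges \<open>g h\<close> give equality.\<close>
  then have d4: "cut_size G ?A \<le> 4" using cubic_handshake[OF cubic AV] cA by linarith
  have "h \<in> {half_a, half_a', half_b, half_b'}" for h by (cases h) auto
  then have half4: "(UNIV :: half_edge set) = {half_a, half_a', half_b, half_b'}" by blast
  have "g ` UNIV \<subseteq> boundary G ?A" using g bA by (auto simp: boundary_def)
  then have "card (g ` UNIV) \<le> cut_size G ?A" using fin(2) unfolding cut_size_def
    by (intro card_mono) (auto simp: boundary_def)
  moreover have "card (g ` UNIV) = 4" unfolding half4 using ginj by simp
  ultimately have d: "cut_size G ?A = 4" using d4 by simp
  have Ane: "?A \<noteq> {}" "?A \<noteq> verts G" using yV g(4) by auto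
  have "card (verts G - ?A) + 2 \<le> 4"
    using cuts[unfolded small_cuts_trivial_def, rule_format, OF AV] Ane d cA by simp
  moreover have "3 * card (verts G - ?A) = 2 * card (inner_edges G (verts G - ?A)) + 4"
    using cubic_handshake[OF cubic, of "verts G - ?A"] cut_size_compl[OF cubicD(1)[OF cubic] AV] d by simp
  ultimately have c2: "card (verts G - ?A) = 2" "card (inner_edges G (verts G - ?A)) = 1" by presburger+
  obtain f where f: "inner_edges G (verts G - ?A) = {f}" using c2(2) by (auto simp: card_1_singleton_iff)
  obtain u v where uv: "ends G f = Upair u v" by (cases "ends G f")
  have fE: "f \<in> edges G" "u \<in> verts G - ?A" "v \<in> verts G - ?A" 
  proof -
    have "f \<in> inner_edges G (verts G - ?A)" using f by simp
    then have "f \<in> edges G" "set_uprod (ends G f) \<subseteq> verts G - ?A" by (simp_all add: inner_edges_def)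
    then show "f \<in> edges G" "u \<in> verts G - ?A" "v \<in> verts G - ?A" unfolding uv by simp_all
  qed
  have uv_ne: "u \<noteq> v" using small_cuts_loopless[OF cubic cuts _ fE(1), of u] uv by auto
  have VA: "verts G - ?A = {u, v}"
    using card_subset_eq[of "verts G - ?A" "{u, v}"] fin(1) fE uv_ne c2(1) by simp
  have yh: "y h = u \<or> y h = v" for h using yV[of h] g(4)[of h] VA by blast
  have jg: "joined (\<beta> (carrier_vertex h)) (y h)" "joined (y h) (\<beta> (carrier_vertex h))" for h
    using g(1,3)[of h] joined_sym[of "\<beta> (carrier_vertex h)" "y h"] by (auto simp: joined_def)
  have yA: "\<beta> i \<noteq> y h" if "i \<in> {0..7}" for i h using g(4)[of h] that by (metis imageI)
  \<comment> \<open>Carriers of half-edges that are not mates have a common neighbour in the block,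
    here 3, and a second one outside would close a quadrangle. With only two vertices outside, mates
    must share theirs.\<close>
  have n1: "y half_a \<noteq> y half_b"
    using no_quadrangle[of "\<beta> 0" "y half_a" "\<beta> 5" "\<beta> 3"] jg[of half_a] jg[of half_b] joined_blocks yA[of 3 half_a]
    by (auto simp: beta_inj)
  have n2: "y half_a \<noteq> y half_b'"
    using no_quadrangle[of "\<beta> 0" "y half_a" "\<beta> 2" "\<beta> 1"] jg[of half_a] jg[of half_b'] joined_blocks yA[of 1 half_a]
    by (auto simp: beta_inj)
  have n3: "y half_a' \<noteq> y half_b"
    using no_quadrangle[of "\<beta> 7" "y half_a'" "\<beta> 5" "\<beta> 6"] jg[of half_a'] jg[of half_b] joined_blocks yA[of 6 half_a']
    by (auto simp: beta_inj)
  define x8 where "x8 = y half_a"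
  define x9 where "x9 = y half_b"
  have y: "y half_a = x8" "y half_a' = x8" "y half_b = x9" "y half_b' = x9" "x8 \<noteq> x9"
    using yh[of half_a] yh[of half_a'] yh[of half_b] yh[of half_b'] n1 n2 n3 uv_ne unfolding x8_def x9_def by metis+
  have f89: "ends G f = Upair x8 x9" "{u, v} = {x8, x9}"
    using yh[of half_a] yh[of half_b] y uv by auto
  define \<gamma> where "\<gamma> i = (if i = 8 then x8 else if i = 9 then x9 else \<beta> i)" for i :: nat
  define \<delta> where "\<delta> b = (if b = (0, 8) then g half_a else if b = (7, 8) then g half_a' else
    if b = (2, 9) then g half_b' else if b = (5, 9) then g half_b else if b = (8, 9) then f else \<epsilon> b)" for b :: "nat \<times> nat"
  have I: "{0..9} = {0..7} \<union> {8, 9::nat}" by auto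
  have g7: "\<gamma> i = \<beta> i" if "i \<in> {0..7}" for i using that by (simp add: \<gamma>_def)
  have db: "\<delta> b = \<epsilon> b" if "b \<in> block_edges" for b
  proof -
    obtain i j where "b = (i, j)" by (cases b)
    then show ?thesis using that block_edges_range[of i j] by (auto simp: \<delta>_def)
  qed
  have \<gamma>im: "\<gamma> ` {0..9} = ?A \<union> {x8, x9}" unfolding I image_Un using g7 by (auto simp: \<gamma>_def)
  also have "\<dots> = verts G" using VA f89(2) AV by blast
  finally have \<gamma>V: "\<gamma> ` {0..9} = verts G" .
  have cV: "card (verts G) = 10" using c2(1) cA card_Diff_subset[OF _ AV] fin(1) AV finite_subset[OF AV]
    card_mono[OF fin(1) AV] by linarith
  then have \<gamma>inj: "inj_on \<gamma> {0..9}" using \<gamma>V by (intro eq_card_imp_inj_on) auto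
  have fnot: "f \<notin> \<epsilon> ` block_edges" "f \<notin> range g"
  proof -
    show "f \<notin> \<epsilon> ` block_edges"
    proof
      assume "f \<in> \<epsilon> ` block_edges"
      then obtain i j where "(i, j) \<in> block_edges" "f = \<epsilon> (i, j)" by auto
      then have "set_uprod (ends G f) \<subseteq> ?A" using ends_block block_edges_range by auto
      then show False using uv fE by auto
    qed
    show "f \<notin> range g"
    proof
      assume "f \<in> range g"
      then obtain h where "f = g h" by blast
      then have "\<beta> (carrier_vertex h) \<in> set_uprod (ends G f)" using g(3) by simp
      then show False using uv fE bA[of h] by auto
    qed
  qed
  have "\<delta> ` petersen_edges = \<delta> ` block_edges \<union> \<delta> ` {(0, 8), (7, 8), (2, 9), (5, 9), (8, 9)}"
    unfolding petersen_edges_def by (rule image_Un)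
  also have "\<delta> ` block_edges = \<epsilon> ` block_edges" using db by (intro image_cong) auto
  also have "\<delta> ` {(0, 8), (7, 8), (2, 9), (5, 9), (8, 9)} = {f} \<union> range g"
    unfolding half4 by (auto simp: \<delta>_def)
  finally have \<delta>im: "\<delta> ` petersen_edges = \<epsilon> ` block_edges \<union> ({f} \<union> range g)" .
  have c5: "card ({f} \<union> range g) = 5" 
  proof -
    have fg: "finite (range g)" unfolding half4 by simp
    have "card (insert f (range g)) = 5"
      using card_insert_disjoint[OF fg fnot(2)] \<open>card (g ` UNIV) = 4\<close> by linarith
    then show ?thesis by (simp only: insert_is_Un[symmetric])
  qed
  have "card (\<epsilon> ` block_edges \<union> ({f} \<union> range g)) = 10 + 5"
    using c5 card_image[OF inj(2)] fnot g(2) finite_block_edges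
    by (subst card_Un_disjoint) (auto simp: half4 block_edges_def)
  then have c15: "card (\<delta> ` petersen_edges) = 15" using \<delta>im by simp
  have "card (edges G) = 15"
  proof -
    have "inner_edges G (verts G) = edges G"
      using wf_graphD(3)[OF cubicD(1)[OF cubic]] by (auto simp: inner_edges_def)
    then show ?thesis using cubic_handshake[OF cubic subset_refl] cut_size_verts[OF cubicD(1)[OF cubic]] cV by simp
  qed
  moreover have "\<delta> ` petersen_edges \<subseteq> edges G" unfolding \<delta>im using eps_edges g(1) fE by auto
  ultimately have \<delta>E: "\<delta> ` petersen_edges = edges G" using c15 fin(2) by (intro card_subset_eq) auto
  \<comment> \<open>The image has as many elements as the index set, which gives
    injectivity.\<close>
  have "card petersen_edges = 15" by (simp add: petersen_edges_def block_edges_def)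
  moreover have "finite petersen_edges" by (simp add: petersen_edges_def block_edges_def)
  ultimately have \<delta>inj: "inj_on \<delta> petersen_edges" using c15 by (intro eq_card_imp_inj_on) auto
  have "ends G (\<delta> (i, j)) = Upair (\<gamma> i) (\<gamma> j)" if ij: "(i, j) \<in> petersen_edges" for i j
  proof (cases "(i, j) \<in> block_edges")
    case True
    then show ?thesis using db[OF True] ends_block[OF True] g7 block_edges_range[OF True] by simp
  next
    case False
    then have "(i, j) \<in> {(0, 8), (7, 8), (2, 9), (5, 9), (8, 9)}" using ij by (simp add: petersen_edges_def)
    then show ?thesis using g(3)[of half_a] g(3)[of half_a'] g(3)[of half_b] g(3)[of half_b'] y f89(1)
      by (auto simp: \<delta>_def \<gamma>_def)
  qed
  then have "realizes G {0..9} petersen_edges \<gamma> \<delta>"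
    using \<gamma>inj \<gamma>V \<delta>inj \<delta>E by (simp add: realizes_def)
  then show ?thesis using that \<gamma>V \<delta>E by blast
qed

end

lemma two_graphs_with_block_iso:
  assumes "cubic G" "small_cuts_trivial 5 G" "realizes G {0..7} block_edges \<beta> \<epsilon>"
    and "cubic H" "small_cuts_trivial 5 H" "realizes H {0..7} block_edges \<gamma> \<delta>"
  shows "graph_iso G H"
proof -
  have "8 \<le> card (verts K)" if "cubic K" "realizes K {0..7} block_edges \<beta> \<epsilon>" for K :: "('x, 'y) mgraph" and \<beta> \<epsilon>
  proof -
    have "card (\<beta> ` {0..7}) = 8" "\<beta> ` {0..7} \<subseteq> verts K" using that(2) by (auto simp: realizes_def card_image)
    then show ?thesis using card_mono[OF cubicD(2)[OF that(1)]] by metis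
  qed
  note b = this[OF assms(1,3)] this[OF assms(4,6)]
  interpret G: cyclic_five_with_block G \<beta> \<epsilon> using assms b by unfold_locales
  interpret H: cyclic_five_with_block H \<gamma> \<delta> using assms b by unfold_locales
  obtain a c where 1: "realizes G {0..9} petersen_edges a c" "a ` {0..9} = verts G" "c ` petersen_edges = edges G"
    by (rule G.petersen)
  obtain a' c' where 2: "realizes H {0..9} petersen_edges a' c'" "a' ` {0..9} = verts H" "c' ` petersen_edges = edges H"
    by (rule H.petersen)
  show ?thesis by (rule realizes_iso[OF 1 2]) (auto simp: petersen_edges_def block_edges_def)
qed

section \<open>Recovering a graph from its blocks\<close>

text \<open>For a block this recognizes boundary edges that sit at mates, in terms that every
  isomorphism preserves.\<close>

definition linked :: "('v, 'e) mgraph \<Rightarrow> 'v set \<Rightarrow> 'e \<Rightarrow> 'e \<Rightarrow> bool" where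
  "linked G B f f' \<longleftrightarrow> f \<in> boundary G B \<and> f' \<in> boundary G B \<and>
     (\<exists>x\<in>B. \<exists>y\<in>B. x \<noteq> y \<and> x \<in> set_uprod (ends G f) \<and> y \<in> set_uprod (ends G f') \<and>
       \<not> (\<exists>z\<in>B. \<exists>g\<in>inner_edges G B. \<exists>g'\<in>inner_edges G B.
         set_uprod (ends G g) = {x, z} \<and> set_uprod (ends G g') = {y, z}))"

definition block_adj :: "nat \<Rightarrow> nat \<Rightarrow> bool" where
  "block_adj i j \<longleftrightarrow> (i, j) \<in> block_edges \<or> (j, i) \<in> block_edges"

text \<open>The following description of mates is invariant under isomorphisms of blocks, so that the two
  pieces of an edge that meet in a block can be recognized.\<close>

lemma mates_no_common_neighbour: "\<not> (block_adj (carrier_vertex h) z \<and> block_adj (carrier_vertex (mate h)) z)"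
  by (cases h) (auto simp: block_adj_def block_edges_def)

lemma non_mates_common_neighbour:
  assumes "h \<noteq> h'" "h' \<noteq> mate h"
  shows "\<exists>z\<in>{0..7}. block_adj (carrier_vertex h) z \<and> block_adj (carrier_vertex h') z"
proof -
  have "\<exists>z\<in>{1, 3, 4, 6}. block_adj (carrier_vertex h) z \<and> block_adj (carrier_vertex h') z"
    using assms by (cases h; cases h') (simp_all add: block_adj_def block_edges_def)
  then show ?thesis by auto
qed

primrec base_edge :: "'e star_edge \<Rightarrow> 'e" where
  "base_edge (Piece e t) = e"
| "base_edge (Block_Edge p b) = undefined"

primrec old_of :: "'v star_vertex \<Rightarrow> 'v" where
  "old_of (Old v) = v"
| "old_of (Block p i) = undefined"

context graph_isomorphism
begin

lemma linked_image:
  assumes B: "B \<subseteq> verts G" and l: "linked G B f f'"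
  shows "linked H (\<phi> ` B) (\<psi> f) (\<psi> f')"
proof -
  obtain x y where f: "f \<in> boundary G B" "f' \<in> boundary G B" and xy: "x \<in> B" "y \<in> B" "x \<noteq> y"
    "x \<in> set_uprod (ends G f)" "y \<in> set_uprod (ends G f')"
    and no: "\<And>z g g'. z \<in> B \<Longrightarrow> g \<in> inner_edges G B \<Longrightarrow> g' \<in> inner_edges G B \<Longrightarrow>
      set_uprod (ends G g) = {x, z} \<Longrightarrow> set_uprod (ends G g') = {y, z} \<Longrightarrow> False"
    using l unfolding linked_def by blast
  have fE: "f \<in> edges G" "f' \<in> edges G" using f by (auto simp: boundary_def)
  have img: "set_uprod (ends H (\<psi> g)) = {\<phi> u, \<phi> v} \<longleftrightarrow> set_uprod (ends G g) = {u, v}"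
    if "g \<in> inner_edges G B" "u \<in> B" "v \<in> B" for g u v
  proof -
    have g: "g \<in> edges G" "set_uprod (ends G g) \<subseteq> B" using that(1) by (auto simp: inner_edges_def)
    have "inj_on \<phi> B" using inj_verts B by (rule inj_on_subset)
    then have "\<phi> ` set_uprod (ends G g) = \<phi> ` {u, v} \<longleftrightarrow> set_uprod (ends G g) = {u, v}"
      using that(2,3) g(2) by (intro inj_on_image_eq_iff) auto
    then show ?thesis by (simp add: ends_image[OF g(1)])
  qed
  show ?thesis unfolding linked_def
  proof (intro conjI)
    show "\<psi> f \<in> boundary H (\<phi> ` B)" "\<psi> f' \<in> boundary H (\<phi> ` B)"
      using f by (simp_all add: boundary_image[OF B])
    have "\<not> (\<exists>z\<in>\<phi> ` B. \<exists>g\<in>inner_edges H (\<phi> ` B). \<exists>g'\<in>inner_edges H (\<phi> ` B).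
         set_uprod (ends H g) = {\<phi> x, z} \<and> set_uprod (ends H g') = {\<phi> y, z})"
    proof (intro notI, elim bexE conjE)
      fix z g g' assume z: "z \<in> \<phi> ` B" "g \<in> inner_edges H (\<phi> ` B)" "g' \<in> inner_edges H (\<phi> ` B)"
        "set_uprod (ends H g) = {\<phi> x, z}" "set_uprod (ends H g') = {\<phi> y, z}"
      obtain w where w: "w \<in> B" "z = \<phi> w" using z(1) by blast
      obtain h h' where h: "h \<in> inner_edges G B" "g = \<psi> h" "h' \<in> inner_edges G B" "g' = \<psi> h'"
        using z(2,3) unfolding inner_edges_image[OF B] by blast
      show False using no[OF w(1) h(1,3)] img[OF h(1) xy(1) w(1)] img[OF h(3) xy(2) w(1)] z(4,5) w(2) h(2,4) by simp
    qed
    moreover have "\<phi> x \<noteq> \<phi> y" using inj_verts xy B by (meson inj_onD subsetD)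
    moreover have "\<phi> x \<in> set_uprod (ends H (\<psi> f))" "\<phi> y \<in> set_uprod (ends H (\<psi> f'))"
      using xy fE by (auto simp: ends_image)
    ultimately show "\<exists>x\<in>\<phi> ` B. \<exists>y\<in>\<phi> ` B. x \<noteq> y \<and> x \<in> set_uprod (ends H (\<psi> f)) \<and> y \<in> set_uprod (ends H (\<psi> f')) \<and>
       \<not> (\<exists>z\<in>\<phi> ` B. \<exists>g\<in>inner_edges H (\<phi> ` B). \<exists>g'\<in>inner_edges H (\<phi> ` B).
         set_uprod (ends H g) = {x, z} \<and> set_uprod (ends H g') = {y, z})"
      by (intro bexI[OF _ imageI[OF xy(1)]] bexI[OF _ imageI[OF xy(2)]] conjI)
  qed
qed

end

context replaced_crossings
begin

lemma base_edge_piece [simp]: "base_edge (piece e k) = e"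
  by (simp add: piece_def)

lemma base_edge_attached [simp]: "base_edge (attached e k s) = e"
  by (cases s) (simp_all add: attached_def)

lemma base_edge_half_piece_mate:
  assumes "p \<in> P" shows "base_edge (half_piece p (mate h)) = base_edge (half_piece p h)"
proof -
  obtain e k s where e: "e \<in> edges G" "1 \<le> k" "k \<le> n e" "L e k s = (p, h)"
    by (rule link_obtain[OF assms])
  show ?thesis using half_piece_eq[OF e] half_piece_eq[OF e(1-3) link_other_side[OF e]] by simp
qed

lemma boundary_block_end:
  assumes p: "p \<in> P" and f: "f \<in> boundary X (block_verts p)" and x: "x \<in> block_verts p" "x \<in> set_uprod (ends X f)"
  obtains h where "x = Block p (carrier_vertex h)" "f = half_piece p h"
proof -
  obtain i where i: "x = Block p i" using x(1) by (auto simp: block_verts_def)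
  have fE: "f \<in> edges X" "\<not> set_uprod (ends X f) \<subseteq> block_verts p" using f by (auto simp: boundary_def)
  then have ni: "f \<notin> Block_Edge p ` block_edges"
    unfolding inner_edges_block[OF p, symmetric] by (simp add: inner_edges_def)
  have "f \<in> {f \<in> edges X. Block p i \<in> set_uprod (ends X f)}" using fE(1) x(2) i by simp
  then have "f \<in> {attached e k s | e k s. e \<in> edges G \<and> 1 \<le> k \<and> k \<le> n e \<and> link_vertex e k s = Block p i}"
    unfolding edges_at_Block[OF p] using ni by blast
  then obtain e k s where e: "e \<in> edges G" "1 \<le> k" "k \<le> n e" "link_vertex e k s = Block p i" "f = attached e k s"
    by blast
  obtain h where h: "L e k s = (p, h)" using e(4) by (cases "L e k s") (auto simp: link_vertex_def)
  have "x = Block p (carrier_vertex h)" using e(4) h i by (simp add: link_vertex_def)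
  then show ?thesis using that half_piece_eq[OF e(1-3) h] e(5) by simp
qed

lemma half_piece_boundary:
  assumes "p \<in> P" shows "half_piece p h \<in> boundary X (block_verts p)"
proof -
  have "half_piece p h \<notin> inner_edges X (block_verts p)"
    unfolding inner_edges_block[OF assms] using half_piece_incident(3)[OF assms] by blast
  then have "\<not> set_uprod (ends X (half_piece p h)) \<subseteq> block_verts p"
    using half_piece_incident(1)[OF assms] by (simp add: inner_edges_def)
  moreover have "Block p (carrier_vertex h) \<in> block_verts p" using carrier_range[of h] by simp
  then have "set_uprod (ends X (half_piece p h)) \<inter> block_verts p \<noteq> {}"
    using half_piece_incident(2)[OF assms, of h] by blast
  ultimately show ?thesis using half_piece_incident(1)[OF assms] by (simp add: boundary_def)
qed

lemma inner_edge_between: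
  assumes "p \<in> P"
  shows "(\<exists>g\<in>inner_edges X (block_verts p). set_uprod (ends X g) = {Block p i, Block p j}) \<longleftrightarrow> block_adj i j"
proof
  assume "\<exists>g\<in>inner_edges X (block_verts p). set_uprod (ends X g) = {Block p i, Block p j}"
  then obtain a b where "(a, b) \<in> block_edges" "set_uprod (ends X (Block_Edge p (a, b))) = {Block p i, Block p j}"
    unfolding inner_edges_block[OF assms] by auto
  then show "block_adj i j" using assms by (auto simp: ends_block_edge block_adj_def doubleton_eq_iff)
next
  assume "block_adj i j"
  then obtain a b where ab: "(a, b) \<in> block_edges" "a = i \<and> b = j \<or> a = j \<and> b = i" by (auto simp: block_adj_def)
  then show "\<exists>g\<in>inner_edges X (block_verts p). set_uprod (ends X g) = {Block p i, Block p j}"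
    unfolding inner_edges_block[OF assms] using assms
    by (intro bexI[of _ "Block_Edge p (a, b)"]) (auto simp: ends_block_edge)
qed

lemma linked_mates:
  assumes "p \<in> P"
  shows "linked X (block_verts p) (half_piece p h) (half_piece p (mate h))"
proof -
  have "\<not> (\<exists>z\<in>block_verts p. \<exists>g\<in>inner_edges X (block_verts p). \<exists>g'\<in>inner_edges X (block_verts p).
         set_uprod (ends X g) = {Block p (carrier_vertex h), z} \<and>
         set_uprod (ends X g') = {Block p (carrier_vertex (mate h)), z})"
  proof (intro notI, elim bexE conjE)
    fix z g g' assume z: "z \<in> block_verts p" "g \<in> inner_edges X (block_verts p)" "g' \<in> inner_edges X (block_verts p)"
      "set_uprod (ends X g) = {Block p (carrier_vertex h), z}"
      "set_uprod (ends X g') = {Block p (carrier_vertex (mate h)), z}"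
    obtain j where "z = Block p j" using z(1) by (auto simp: block_verts_def)
    then have "block_adj (carrier_vertex h) j" "block_adj (carrier_vertex (mate h)) j"
      using inner_edge_between[OF assms] z(2-5) by blast+
    then show False using mates_no_common_neighbour by blast
  qed
  moreover have "Block p (carrier_vertex h) \<noteq> (Block p (carrier_vertex (mate h)) :: 'v star_vertex)"
    using mate_neq[of h] by simp
  moreover have "Block p (carrier_vertex h) \<in> (block_verts p :: 'v star_vertex set)" for h using carrier_range[of h] by simp
  ultimately show ?thesis unfolding linked_def using half_piece_boundary[OF assms] half_piece_incident(2)[OF assms] by blast
qed

text \<open>The two ends in the block are distinct carriers without a common neighbour, hence
  carriers of mates, and mates are used by the two sides of one edge.\<close>

lemma linked_same_edge:
  assumes p: "p \<in> P" and l: "linked X (block_verts p) f f'"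
  shows "base_edge f = base_edge f'"
proof -
  obtain x y where f: "f \<in> boundary X (block_verts p)" "f' \<in> boundary X (block_verts p)"
    and xy: "x \<in> block_verts p" "y \<in> block_verts p" "x \<noteq> y" "x \<in> set_uprod (ends X f)" "y \<in> set_uprod (ends X f')"
    and no: "\<not> (\<exists>z\<in>block_verts p. \<exists>g\<in>inner_edges X (block_verts p). \<exists>g'\<in>inner_edges X (block_verts p).
         set_uprod (ends X g) = {x, z} \<and> set_uprod (ends X g') = {y, z})"
    using l unfolding linked_def by blast
  obtain h where h: "x = Block p (carrier_vertex h)" "f = half_piece p h"
    by (rule boundary_block_end[OF p f(1) xy(1,4)])
  obtain h' where h': "y = Block p (carrier_vertex h')" "f' = half_piece p h'"
    by (rule boundary_block_end[OF p f(2) xy(2,5)])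
  have "h' = mate h"
  proof (rule ccontr)
    assume "h' \<noteq> mate h"
    moreover have "h \<noteq> h'" using xy(3) h h' by auto
    ultimately obtain z where z: "z \<in> {0..7}" "block_adj (carrier_vertex h) z" "block_adj (carrier_vertex h') z"
      using non_mates_common_neighbour by blast
    have "Block p z \<in> block_verts p" using z(1) by simp
    then show False using no z(2,3) unfolding h(1) h'(1) inner_edge_between[OF p, symmetric] by blast
  qed
  then show ?thesis using base_edge_half_piece_mate[OF p] h h' by simp
qed

lemma piece_iff:
  "f \<in> edges X \<and> (\<forall>p\<in>P. f \<notin> inner_edges X (block_verts p)) \<longleftrightarrow> (\<exists>e\<in>edges G. \<exists>k\<le>n e. f = piece e k)"
proof
  assume f: "f \<in> edges X \<and> (\<forall>p\<in>P. f \<notin> inner_edges X (block_verts p))"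
  then have "f \<in> edges X" by simp
  then show "\<exists>e\<in>edges G. \<exists>k\<le>n e. f = piece e k"
  proof (cases rule: edges_X_cases)
    case (2 p i j)
    then show ?thesis using f inner_edges_block[of p] by auto
  qed auto
next
  assume "\<exists>e\<in>edges G. \<exists>k\<le>n e. f = piece e k"
  then show "f \<in> edges X \<and> (\<forall>p\<in>P. f \<notin> inner_edges X (block_verts p))"
    using piece_in_edges inner_edges_block by (auto simp: piece_def)
qed

lemma old_iff: "x \<in> verts X \<and> (\<forall>p\<in>P. x \<notin> block_verts p) \<longleftrightarrow> (\<exists>v\<in>verts G. x = Old v)"
  by (cases x) auto

end

section \<open>Isomorphisms that map blocks onto blocks\<close>

locale replaced_pair = A: replaced_crossings G X tail head n P L par +
  B: replaced_crossings G' Y tail' head' n' P' L' par' + graph_isomorphism X Y \<phi> \<psi>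
  for G :: "('v, 'e) mgraph" and X :: "('v star_vertex, 'e star_edge) mgraph" and tail head n P L par
    and G' :: "('w, 'f) mgraph" and Y :: "('w star_vertex, 'f star_edge) mgraph" and tail' head' n' P' L' par'
    and \<phi> \<psi> +
  assumes blocks: "\<And>p. p \<in> P \<Longrightarrow> \<exists>q\<in>P'. \<phi> ` block_verts p = block_verts q"
    and blocks': "\<And>q. q \<in> P' \<Longrightarrow> \<exists>p\<in>P. \<phi> ` block_verts p = block_verts q"
begin

text \<open>The locale is symmetric, so whatever is shown about the maps of vertices and edges also
  holds for those of the inverse.\<close>

lemma inverse_pair: "replaced_pair G' Y tail' head' n' P' L' par' G X tail head n P L par
  (inv_into (verts X) \<phi>) (inv_into (edges X) \<psi>)"
proof -
  interpret I: graph_isomorphism Y X "inv_into (verts X) \<phi>" "inv_into (edges X) \<psi>" by (rule inverse)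
  have inv: "inv_into (verts X) \<phi> ` \<phi> ` block_verts p = block_verts p" if "p \<in> P" for p
    using inv_into_image_cancel[OF inj_verts A.block_verts_sub[OF that]] .
  show ?thesis
  proof
    show "\<exists>p\<in>P. inv_into (verts X) \<phi> ` block_verts q = block_verts p" if q: "q \<in> P'" for q
      using blocks'[OF q] inv by metis
    show "\<exists>q\<in>P'. inv_into (verts X) \<phi> ` block_verts q = block_verts p" if p: "p \<in> P" for p
      using blocks[OF p] inv[OF p] by metis
  qed
qed

lemma piece_image:
  assumes "e \<in> edges G" "k \<le> n e"
  obtains e' k' where "e' \<in> edges G'" "k' \<le> n' e'" "\<psi> (A.piece e k) = B.piece e' k'"
proof -
  let ?f = "A.piece e k"
  have f: "?f \<in> edges X" "\<And>p. p \<in> P \<Longrightarrow> ?f \<notin> inner_edges X (block_verts p)" using A.piece_iff[of ?f] assms by blast+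
  have "\<psi> ?f \<in> edges Y" using f(1) by (simp add: edges_image)
  moreover have "\<psi> ?f \<notin> inner_edges Y (block_verts q)" if q: "q \<in> P'" for q
  proof -
    obtain p where p: "p \<in> P" "\<phi> ` block_verts p = block_verts q" using blocks'[OF q] by blast
    have "inner_edges X (block_verts p) \<subseteq> edges X" by (auto simp: inner_edges_def)
    then show ?thesis using f(2)[OF p(1)] inj_on_image_mem_iff[OF inj_edges f(1)]
      unfolding p(2)[symmetric] inner_edges_image[OF A.block_verts_sub[OF p(1)]] by blast
  qed
  ultimately show ?thesis using B.piece_iff[of "\<psi> ?f"] that by blast
qed

definition edge_map :: "'e \<Rightarrow> 'f" where "edge_map e = base_edge (\<psi> (A.piece e 0))"

definition vert_map :: "'v \<Rightarrow> 'w" where "vert_map v = old_of (\<phi> (Old v))"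

text \<open>Consecutive pieces of \<open>e\<close> are linked through a block. The isomorphism
  preserves links, and linked edges of \<open>Y\<close> come from one edge of
  \<open>G'\<close>.\<close>

lemma edge_map_const:
  assumes e: "e \<in> edges G" and "k \<le> n e"
  shows "base_edge (\<psi> (A.piece e k)) = edge_map e"
  using \<open>k \<le> n e\<close>
proof (induction k)
  case (Suc k)
  obtain p h where p: "p \<in> P" "A.piece e (Suc k - 1) = A.half_piece p h" "A.piece e (Suc k) = A.half_piece p (mate h)"
    by (rule A.half_piece_mate[OF e _ Suc.prems]) simp
  obtain q where q: "q \<in> P'" "\<phi> ` block_verts p = block_verts q" using blocks[OF p(1)] by blast
  have "linked Y (block_verts q) (\<psi> (A.half_piece p h)) (\<psi> (A.half_piece p (mate h)))"
    using linked_image[OF A.block_verts_sub[OF p(1)] A.linked_mates[OF p(1)]] unfolding q(2) .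
  then show ?case using B.linked_same_edge[OF q(1)] p Suc by simp
qed (simp add: edge_map_def)

lemma edge_map_image:
  assumes "e \<in> edges G" "k \<le> n e"
  obtains k' where "k' \<le> n' (edge_map e)" "\<psi> (A.piece e k) = B.piece (edge_map e) k'" "edge_map e \<in> edges G'"
proof -
  obtain e' k' where e': "e' \<in> edges G'" "k' \<le> n' e'" "\<psi> (A.piece e k) = B.piece e' k'"
    by (rule piece_image[OF assms])
  then have "edge_map e = e'" using edge_map_const[OF assms] by simp
  then show ?thesis using that e' by simp
qed

lemma vert_map:
  assumes "v \<in> verts G"
  shows "vert_map v \<in> verts G'" "\<phi> (Old v) = Old (vert_map v)"
proof -
  have v: "Old v \<in> verts X" using assms by simp
  have "\<phi> (Old v) \<notin> block_verts q" if q: "q \<in> P'" for q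
  proof -
    obtain p where p: "p \<in> P" "\<phi> ` block_verts p = block_verts q" using blocks'[OF q] by blast
    show ?thesis using inj_on_image_mem_iff[OF inj_verts v A.block_verts_sub[OF p(1)]] p(2) by simp
  qed
  moreover have "\<phi> (Old v) \<in> verts Y" using v by (simp add: verts_image)
  ultimately obtain w where "w \<in> verts G'" "\<phi> (Old v) = Old w" using B.old_iff[of "\<phi> (Old v)"] by blast
  then show "vert_map v \<in> verts G'" "\<phi> (Old v) = Old (vert_map v)" by (simp_all add: vert_map_def)
qed

lemma vert_map_inj: "inj_on vert_map (verts G)"
proof (rule inj_onI)
  fix u v assume uv: "u \<in> verts G" "v \<in> verts G" "vert_map u = vert_map v"
  then have "\<phi> (Old u) = \<phi> (Old v)" using vert_map by simp
  then have "Old u = Old v" using inj_onD[OF inj_verts, of "Old u" "Old v"] uv by simp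
  then show "u = v" by simp
qed

lemma edge_map_inj: "inj_on edge_map (edges G)"
proof (rule inj_onI)
  interpret I: replaced_pair G' Y tail' head' n' P' L' par' G X tail head n P L par
    "inv_into (verts X) \<phi>" "inv_into (edges X) \<psi>" by (rule inverse_pair)
  \<comment> \<open>The piece of \<open>edge_map e\<close> that is the image of the first piece of
    \<open>e\<close> need not be a first piece, but by constancy along chains any piece may be used
    to go back.\<close>
  have inv: "I.edge_map (edge_map e) = e" if e: "e \<in> edges G" for e
  proof -
    obtain k where k: "k \<le> n' (edge_map e)" "\<psi> (A.piece e 0) = B.piece (edge_map e) k" "edge_map e \<in> edges G'"
      by (rule edge_map_image[OF e le0])
    have "inv_into (edges X) \<psi> (B.piece (edge_map e) k) = A.piece e 0"
      unfolding k(2)[symmetric] using A.piece_in_edges[OF e le0] by (rule inv_into_f_f[OF inj_edges])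
    then show ?thesis using I.edge_map_const[OF k(3,1)] by simp
  qed
  fix e e' assume "e \<in> edges G" "e' \<in> edges G" "edge_map e = edge_map e'"
  then show "e = e'" using inv by metis
qed

lemma edge_map_range: "e \<in> edges G \<Longrightarrow> edge_map e \<in> edges G'"
  using edge_map_image[of e 0] by blast

lemma ends_edge_map:
  assumes e: "e \<in> edges G"
  shows "ends G' (edge_map e) = map_uprod vert_map (ends G e)"
proof -
  have inc: "vert_map v \<in> {tail' (edge_map e), head' (edge_map e)}" if v: "v \<in> {tail e, head e}" for v
  proof -
    have vV: "v \<in> verts G" using A.tail_head[OF e] v by blast
    have ep: "A.end_piece v e \<in> edges X" "Old v \<in> set_uprod (ends X (A.end_piece v e))"
    proof -
      have "A.end_piece v e \<in> A.end_piece v ` {e \<in> edges G. v \<in> {tail e, head e}}" using e v by blast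
      then show "A.end_piece v e \<in> edges X" "Old v \<in> set_uprod (ends X (A.end_piece v e))"
        unfolding A.edges_at_Old[symmetric] by simp_all
    qed
    obtain k where k: "k \<le> n e" "A.end_piece v e = A.piece e k" 
      using that[of "if tail e = v then 0 else n e"] by (simp add: A.end_piece_def split: if_splits)
    obtain k' where k': "k' \<le> n' (edge_map e)" "\<psi> (A.piece e k) = B.piece (edge_map e) k'" "edge_map e \<in> edges G'"
      by (rule edge_map_image[OF e k(1)])
    have "\<phi> (Old v) \<in> set_uprod (ends Y (\<psi> (A.end_piece v e)))"
      using ep by (simp add: ends_image)
    then have "Old (vert_map v) \<in> set_uprod (ends Y (B.piece (edge_map e) k'))"
      unfolding k(2) k'(2) vert_map(2)[OF vV] .
    then show ?thesis using B.Old_incident_iff[OF k'(3,1)] by auto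
  qed
  have "vert_map (tail e) \<noteq> vert_map (head e)"
    using inj_onD[OF vert_map_inj, of "tail e" "head e"] A.tail_head[OF e] by blast
  then show ?thesis using inc[of "tail e"] inc[of "head e"]
    by (auto simp: A.ends_G[OF e] B.ends_G[OF edge_map_range[OF e]])
qed

text \<open>Injections in both directions between finite sets are bijections, so surjectivity comes
  from counting.\<close>

lemma recovered_iso: "graph_iso G G'"
proof -
  interpret I: replaced_pair G' Y tail' head' n' P' L' par' G X tail head n P L par
    "inv_into (verts X) \<phi>" "inv_into (edges X) \<psi>" by (rule inverse_pair)
  have V: "vert_map ` verts G \<subseteq> verts G'" "edge_map ` edges G \<subseteq> edges G'"
    using vert_map edge_map_range by blast+
  have V': "I.vert_map ` verts G' \<subseteq> verts G" "I.edge_map ` edges G' \<subseteq> edges G"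
    using I.vert_map I.edge_map_range by blast+
  have "card (verts G') \<le> card (verts G)" "card (edges G') \<le> card (edges G)"
    using card_inj_on_le[OF I.vert_map_inj V'(1) A.finite_G(1)] card_inj_on_le[OF I.edge_map_inj V'(2) A.finite_G(2)] .
  then have "vert_map ` verts G = verts G'" "edge_map ` edges G = edges G'"
    using card_seteq[OF B.finite_G(1) V(1)] card_seteq[OF B.finite_G(2) V(2)]
      card_image[OF vert_map_inj] card_image[OF edge_map_inj] by simp_all
  then have "bij_betw vert_map (verts G) (verts G')" "bij_betw edge_map (edges G) (edges G')"
    using vert_map_inj edge_map_inj by (simp_all add: bij_betw_def)
  then show ?thesis unfolding graph_iso_def using ends_edge_map by blast
qed

end

section \<open>Small graphs, and counting vertices\<close>

lemma few_edges_colorable: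
  assumes "cubic G" "small_cuts_trivial k G" "2 \<le> k" "card (verts G) \<le> 2"
  shows "three_edge_colorable G"
proof -
  have fin: "finite (edges G)" using cubicD(3)[OF assms(1)] .
  have "inner_edges G (verts G) = edges G"
    using wf_graphD(3)[OF cubicD(1)[OF assms(1)]] by (auto simp: inner_edges_def)
  then have "card (edges G) \<le> 3"
    using cubic_handshake[OF assms(1) subset_refl] cut_size_verts[OF cubicD(1)[OF assms(1)]] assms(4) by simp
  then have "card (edges G) \<le> card {1, 2, 3 :: nat}" by simp
  then obtain c where c: "c ` edges G \<subseteq> {1, 2, 3 :: nat}" "inj_on c (edges G)"
    using card_le_inj[OF fin, of "{1, 2, 3 :: nat}"] by auto
  show ?thesis unfolding three_edge_colorable_def
    using small_cuts_loopless[OF assms(1-3)] c by (intro conjI exI[of _ c]) (auto dest: inj_onD)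
qed

lemma card_verts_with_block:
  assumes "cubic G" "small_cuts_trivial 5 G" "realizes G {0..7} block_edges \<beta> \<epsilon>"
  shows "card (verts G) = 10"
proof -
  have "card (\<beta> ` {0..7}) = 8" "\<beta> ` {0..7} \<subseteq> verts G" using assms(3) by (auto simp: realizes_def card_image)
  then have "8 \<le> card (verts G)" using card_mono[OF cubicD(2)[OF assms(1)]] by metis
  then interpret cyclic_five_with_block G \<beta> \<epsilon> using assms by unfold_locales
  obtain a c where 1: "realizes G {0..9} petersen_edges a c" "a ` {0..9} = verts G" "c ` petersen_edges = edges G"
    by (rule petersen)
  then have "inj_on a {0..9}" by (simp add: realizes_def)
  then have "card (a ` {0..9}) = 10" by (simp add: card_image)
  then show ?thesis using 1(2) by simp
qed

context graph_isomorphism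
begin

lemma is_block_image:
  assumes "is_block G B"
  shows "is_block H (\<phi> ` B)"
proof -
  obtain \<beta> \<epsilon> where "block_copy G B \<beta> \<epsilon>" using assms by (auto simp: is_block_def)
  then have b: "B \<subseteq> verts G" "bij_betw \<beta> {0..7} B" "bij_betw \<epsilon> block_edges (inner_edges G B)"
    "\<And>i j. (i, j) \<in> block_edges \<Longrightarrow> ends G (\<epsilon> (i, j)) = Upair (\<beta> i) (\<beta> j)"
    by (auto simp: block_copy_def)
  have inner: "inner_edges G B \<subseteq> edges G" by (auto simp: inner_edges_def)
  have "bij_betw \<phi> B (\<phi> ` B)" "bij_betw \<psi> (inner_edges G B) (\<psi> ` inner_edges G B)"
    using inj_on_subset[OF inj_verts b(1)] inj_on_subset[OF inj_edges inner] by (simp_all add: bij_betw_def)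
  then have "bij_betw (\<phi> \<circ> \<beta>) {0..7} (\<phi> ` B)" "bij_betw (\<psi> \<circ> \<epsilon>) block_edges (inner_edges H (\<phi> ` B))"
    unfolding inner_edges_image[OF b(1)] using b(2,3) by (simp_all add: bij_betw_trans)
  moreover have "ends H ((\<psi> \<circ> \<epsilon>) (i, j)) = Upair ((\<phi> \<circ> \<beta>) i) ((\<phi> \<circ> \<beta>) j)" if "(i, j) \<in> block_edges" for i j
  proof -
    have "\<epsilon> (i, j) \<in> edges G" using b(3) that inner by (auto simp: bij_betw_def)
    then show ?thesis using b(4)[OF that] by (simp add: ends_map)
  qed
  moreover have "\<phi> ` B \<subseteq> verts H" using b(1) by (auto simp: verts_image)
  ultimately show ?thesis unfolding is_block_def block_copy_def by blast
qed

end

context replaced_crossings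
begin

lemma card_verts_X: "card (verts X) = card (verts G) + 8 * card P"
proof -
  have "card (\<Union>p\<in>P. block_verts p :: 'v star_vertex set) = (\<Sum>p\<in>P. card (block_verts p :: 'v star_vertex set))"
    using finite_P block_disjoint by (intro card_UN_disjoint) (auto simp: block_verts_def)
  moreover have "card (block_verts p :: 'v star_vertex set) = 8" for p
    by (simp add: block_verts_def card_image inj_on_def)
  moreover have "card (Old ` verts G) = card (verts G)" by (simp add: card_image inj_on_def)
  moreover have "Old ` verts G \<inter> (\<Union>p\<in>P. block_verts p) = {}" by auto
  ultimately show ?thesis unfolding verts_X using finite_G(1) finite_P
    by (subst card_Un_disjoint) (auto simp: block_verts_def)
qed

text \<open>Such a block has only old vertices, and a piece with two old ends is a whole uncrossed
  edge. So the block can be read as a part of \<open>G\<close>.\<close>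

lemma old_block:
  assumes "is_block X B" "\<And>p. p \<in> P \<Longrightarrow> B \<inter> block_verts p = {}"
  shows "\<exists>\<beta> \<epsilon>. realizes G {0..7} block_edges \<beta> \<epsilon>"
proof -
  obtain \<beta> \<epsilon> where "block_copy X B \<beta> \<epsilon>" using assms(1) by (auto simp: is_block_def)
  then have b: "B \<subseteq> verts X" "bij_betw \<beta> {0..7} B" "bij_betw \<epsilon> block_edges (inner_edges X B)"
    "\<And>i j. (i, j) \<in> block_edges \<Longrightarrow> ends X (\<epsilon> (i, j)) = Upair (\<beta> i) (\<beta> j)"
    by (auto simp: block_copy_def)
  have old: "\<exists>v\<in>verts G. x = Old v" if "x \<in> B" for x
    using old_iff[of x] that b(1) assms(2) by blast
  have ol: "Old (old_of (\<beta> i)) = \<beta> i \<and> old_of (\<beta> i) \<in> verts G" if "i \<in> {0..7}" for i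
  proof -
    have "\<beta> i \<in> B" using b(2) that by (auto simp: bij_betw_def)
    then show ?thesis using old[of "\<beta> i"] by auto
  qed
  have edge: "base_edge f \<in> edges G \<and> n (base_edge f) = 0 \<and> f = piece (base_edge f) 0" if f: "f \<in> inner_edges X B" for f
  proof -
    have fE: "f \<in> edges X" "set_uprod (ends X f) \<subseteq> B" using f by (auto simp: inner_edges_def)
    from fE(1) show ?thesis
    proof (cases rule: edges_X_cases)
      case (1 e k)
      then have "piece_source e k \<in> B" "piece_target e k \<in> B" using fE(2) by (auto simp: ends_piece')
      then have "\<exists>v. piece_source e k = Old v" "\<exists>v. piece_target e k = Old v" using old by blast+
      \<comment> \<open>A piece that starts at an old vertex is the first of its edge, and one that
        ends at an old vertex is the last.\<close>
      then have "k = 0" "k = n e" by (auto simp: piece_source_def piece_target_def link_vertex_def split: if_splits)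
      then show ?thesis using 1 by simp
    next
      case (2 p i j)
      then have "Block p i \<in> B" using fE(2) by (simp add: ends_block_edge)
      then show ?thesis using old by blast
    qed
  qed
  have eb: "\<epsilon> b \<in> inner_edges X B" if "b \<in> block_edges" for b using b(3) that by (auto simp: bij_betw_def)
  have "realizes G {0..7} block_edges (\<lambda>i. old_of (\<beta> i)) (\<lambda>b. base_edge (\<epsilon> b))"
    unfolding realizes_def
  proof (intro conjI allI impI)
    show "inj_on (\<lambda>i. old_of (\<beta> i)) {0..7}"
      using ol b(2) by (intro inj_onI) (metis bij_betw_inv_into_left)
    show "(\<lambda>i. old_of (\<beta> i)) ` {0..7} \<subseteq> verts G" using ol by blast
    show "inj_on (\<lambda>b. base_edge (\<epsilon> b)) block_edges"
      using edge eb b(3) by (intro inj_onI) (metis bij_betw_inv_into_left)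
    show "(\<lambda>b. base_edge (\<epsilon> b)) ` block_edges \<subseteq> edges G" using edge eb by blast
    fix i j assume ij: "(i, j) \<in> block_edges"
    define e where "e = base_edge (\<epsilon> (i, j))"
    have e: "e \<in> edges G" "n e = 0" "\<epsilon> (i, j) = piece e 0" using edge[OF eb[OF ij]] unfolding e_def by auto
    have "Upair (Old (tail e)) (Old (head e)) = Upair (\<beta> i) (\<beta> j)"
      using b(4)[OF ij] ends_piece'[OF e(1) le0] e(2,3) by (simp add: piece_source_def piece_target_def)
    moreover have "i \<in> {0..7}" "j \<in> {0..7}" using block_edges_range[OF ij] by auto
    moreover note ol[OF this(1)] ol[OF this(2)]
    ultimately have "map_uprod Old (Upair (tail e) (head e)) = map_uprod Old (Upair (old_of (\<beta> i)) (old_of (\<beta> j)))"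
      by simp
    then show "ends G (base_edge (\<epsilon> (i, j))) = Upair (old_of (\<beta> i)) (old_of (\<beta> j))"
      unfolding e_def[symmetric] ends_G[OF e(1)] by simp
  qed
  then show ?thesis by blast
qed

end

section \<open>Comparing two graphs whose replacements are isomorphic\<close>

locale isomorphic_replacements = A: replaced_crossings G X tail head n P L par +
  B: replaced_crossings G' Y tail' head' n' P' L' par' + graph_isomorphism X Y \<phi> \<psi>
  for G :: "('v, 'e) mgraph" and X :: "('v star_vertex, 'e star_edge) mgraph" and tail head n P L par
    and G' :: "('w, 'f) mgraph" and Y :: "('w star_vertex, 'f star_edge) mgraph" and tail' head' n' P' L' par'
    and \<phi> \<psi> +
  assumes five: "small_cuts_trivial 5 G" "small_cuts_trivial 5 G'"
    and not_colorable: "\<not> three_edge_colorable G" "\<not> three_edge_colorable G'"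
begin

lemma inverse_replacements: "isomorphic_replacements G' Y tail' head' n' P' L' par' G X tail head n P L par
  (inv_into (verts X) \<phi>) (inv_into (edges X) \<psi>)"
proof -
  interpret I: graph_isomorphism Y X "inv_into (verts X) \<phi>" "inv_into (edges X) \<psi>" by (rule inverse)
  show ?thesis using five not_colorable by unfold_locales
qed

text \<open>A single crossing then gives more than 2 + 8 vertices, which is the bound that
  \<open>blocks_equal_or_disjoint\<close> asks for.\<close>

lemma card_verts_G: "2 < card (verts G)"
  using few_edges_colorable[OF A.cubic five(1)] not_colorable(1) by fastforce

text \<open>A block of \<open>X\<close> that is not a block of \<open>Y\<close> avoids the blocks of \<open>Y\<close> and hence consists of
  vertices of \<open>G'\<close>.\<close>

lemma foreign_block:
  assumes p: "p \<in> P" and foreign: "\<not> (\<exists>q\<in>P'. \<phi> ` block_verts p = block_verts q)"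
  shows "\<exists>\<beta> \<epsilon>. realizes G' {0..7} block_edges \<beta> \<epsilon>"
proof (rule B.old_block)
  show blk: "is_block Y (\<phi> ` block_verts p)" by (rule is_block_image[OF A.is_block_X[OF p]])
  have "card P \<ge> 1" using p A.finite_P by (metis One_nat_def Suc_leI card_gt_0_iff empty_iff)
  then have big: "10 < card (verts Y)" using card_verts A.card_verts_X card_verts_G by linarith
  fix q assume q: "q \<in> P'"
  show "\<phi> ` block_verts p \<inter> block_verts q = {}"
    using blocks_equal_or_disjoint[OF B.cubic_X B.small_cuts_trivial_X big blk B.is_block_X[OF q]] foreign q by blast
qed

text \<open>The foreign block makes \<open>G'\<close> have ten vertices and \<open>P\<close> have
  more crossings than \<open>P'\<close>. Isomorphic replacements have equally many vertices, so
  \<open>G\<close> would have at least eight vertices fewer than \<open>G'\<close>, that is, at most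
  two.\<close>

lemma no_partial_agreement:
  assumes covered: "\<And>q. q \<in> P' \<Longrightarrow> \<exists>p\<in>P. \<phi> ` block_verts p = block_verts q"
    and p: "p \<in> P" and foreign: "\<not> (\<exists>q\<in>P'. \<phi> ` block_verts p = block_verts q)"
  shows False
proof -
  obtain \<beta> \<epsilon> where r: "realizes G' {0..7} block_edges \<beta> \<epsilon>" using foreign_block[OF p foreign] by blast
  have ten: "card (verts G') = 10" by (rule card_verts_with_block[OF B.cubic five(2) r])
  obtain g where g: "\<And>q. q \<in> P' \<Longrightarrow> g q \<in> P \<and> \<phi> ` block_verts (g q) = block_verts q" using covered by metis
  have "inj_on g P'"
  proof (rule inj_onI)
    fix q q' assume "q \<in> P'" "q' \<in> P'" "g q = g q'"
    then have "block_verts q = (block_verts q' :: 'w star_vertex set)" using g by metis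
    then have "Block q 0 \<in> (block_verts q' :: 'w star_vertex set)" by (metis block_verts_iff(1) atLeastAtMost_iff le0)
    then show "q = q'" by simp
  qed
  moreover have "g ` P' \<subseteq> P - {p}" using g foreign by blast
  ultimately have "card P' \<le> card (P - {p})" using A.finite_P by (intro card_inj_on_le) auto
  also have "\<dots> < card P" using A.finite_P p by (rule card_Diff1_less)
  finally have "card P' < card P" .
  moreover have "card (verts G) + 8 * card P = card (verts G') + 8 * card P'"
    using card_verts A.card_verts_X B.card_verts_X by simp
  ultimately show False using ten card_verts_G by linarith
qed

lemma original_iso: "graph_iso G G'"
proof -
  interpret I: isomorphic_replacements G' Y tail' head' n' P' L' par' G X tail head n P L par
    "inv_into (verts X) \<phi>" "inv_into (edges X) \<psi>" by (rule inverse_replacements)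
  \<comment> \<open>Lets the cases with exchanged roles be stated in terms of \<phi>.\<close>
  have flip: "inv_into (verts X) \<phi> ` block_verts q = block_verts p \<longleftrightarrow> \<phi> ` block_verts p = block_verts q"
    if "p \<in> P" "q \<in> P'" for p q
  proof
    assume "\<phi> ` block_verts p = block_verts q"
    then show "inv_into (verts X) \<phi> ` block_verts q = block_verts p"
      using inv_into_image_cancel[OF inj_verts A.block_verts_sub[OF that(1)]] by metis
  next
    assume "inv_into (verts X) \<phi> ` block_verts q = block_verts p"
    then show "\<phi> ` block_verts p = block_verts q"
      using image_inv_into_cancel[OF verts_image[symmetric] B.block_verts_sub[OF that(2)]] by metis
  qed
  consider (both) "\<forall>p\<in>P. \<exists>q\<in>P'. \<phi> ` block_verts p = block_verts q" "\<forall>q\<in>P'. \<exists>p\<in>P. \<phi> ` block_verts p = block_verts q"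
    | (left) p where "p \<in> P" "\<not> (\<exists>q\<in>P'. \<phi> ` block_verts p = block_verts q)" "\<forall>q\<in>P'. \<exists>p\<in>P. \<phi> ` block_verts p = block_verts q"
    | (right) q where "q \<in> P'" "\<not> (\<exists>p\<in>P. \<phi> ` block_verts p = block_verts q)" "\<forall>p\<in>P. \<exists>q\<in>P'. \<phi> ` block_verts p = block_verts q"
    | (none) p q where "p \<in> P" "\<not> (\<exists>q\<in>P'. \<phi> ` block_verts p = block_verts q)"
      "q \<in> P'" "\<not> (\<exists>p\<in>P. \<phi> ` block_verts p = block_verts q)"
    by blast
  then show ?thesis
  proof cases
    case both
    interpret replaced_pair G X tail head n P L par G' Y tail' head' n' P' L' par' \<phi> \<psi>
      by unfold_locales (rule both[rule_format], assumption)+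
    show ?thesis by (rule recovered_iso)
  next
    case left
    then show ?thesis using no_partial_agreement[OF _ left(1,2)] by simp
  next
    case right
    have "\<exists>q\<in>P'. inv_into (verts X) \<phi> ` block_verts q = block_verts p" if p: "p \<in> P" for p
    proof -
      obtain q where q: "q \<in> P'" "\<phi> ` block_verts p = block_verts q" using right(3) p by blast
      then show ?thesis using flip[OF p q(1)] by (intro bexI[OF _ q(1)]) simp
    qed
    moreover have "\<not> (\<exists>p\<in>P. inv_into (verts X) \<phi> ` block_verts q = block_verts p)"
      using right(2) flip[OF _ right(1)] by simp
    ultimately show ?thesis using I.no_partial_agreement[OF _ right(1)] by iprover
  next
    case none
    obtain \<beta> \<epsilon> where 1: "realizes G' {0..7} block_edges \<beta> \<epsilon>" using foreign_block[OF none(1,2)] by blast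
    have "\<not> (\<exists>p\<in>P. inv_into (verts X) \<phi> ` block_verts q = block_verts p)" using none(4) flip[OF _ none(3)] by simp
    then obtain \<gamma> \<delta> where 2: "realizes G {0..7} block_edges \<gamma> \<delta>" using I.foreign_block[OF none(3)] by blast
    show ?thesis by (rule two_graphs_with_block_iso[OF A.cubic five(1) 2 B.cubic five(2) 1])
  qed
qed

end

section \<open>Collapsing an arc in the plane\<close>

text \<open>The complement of an arc in the Riemann sphere, moved to the plane by an inversion centred at
  an end of the arc.\<close>

lemma inverted_arc_complement:
  fixes \<gamma> :: "real \<Rightarrow> complex"
  assumes "arc \<gamma>"
  defines "a \<equiv> pathstart \<gamma>" and "T \<equiv> path_image \<gamma>"
  defines "S \<equiv> insert 0 ((\<lambda>z. 1 / (z - a)) ` (- T))"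
  shows "open S" "simply_connected S" "S \<noteq> UNIV"
    and "\<And>z. z \<in> T \<Longrightarrow> z \<noteq> a \<Longrightarrow> 1 / (z - a) \<notin> S"
proof -
  have aT: "a \<in> T" unfolding a_def T_def by (rule pathstart_in_path_image)
  have cT: "compact T" using assms(1) by (simp add: T_def compact_arc_image)
  \<comment> \<open>The image of the arc without its start under the inversion. The start goes to
    infinity, and infinity goes to 0, which is therefore added to \<open>S\<close>.\<close>
  define C where "C = {w. w \<noteq> 0 \<and> a + 1 / w \<in> T}"
  have SC: "S = - C"
  proof (rule set_eqI)
    fix w show "w \<in> S \<longleftrightarrow> w \<in> - C"
    proof (cases "w = 0")
      case False
      have "w \<in> S \<longleftrightarrow> (\<exists>z. z \<notin> T \<and> w = 1 / (z - a))" using False by (auto simp: S_def)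
      also have "\<dots> \<longleftrightarrow> a + 1 / w \<notin> T"
      proof
        assume "a + 1 / w \<notin> T"
        moreover have "w = 1 / ((a + 1 / w) - a)" using False by simp
        ultimately show "\<exists>z. z \<notin> T \<and> w = 1 / (z - a)" by blast
      next
        assume "\<exists>z. z \<notin> T \<and> w = 1 / (z - a)"
        then obtain z where z: "z \<notin> T" "w = 1 / (z - a)" by blast
        then have "z \<noteq> a" using False by auto
        then have "a + 1 / w = z" using z by simp
        then show "a + 1 / w \<notin> T" using z by simp
      qed
      finally show ?thesis using False by (simp add: C_def)
    qed (simp add: S_def C_def)
  qed
  show notS: "1 / (z - a) \<notin> S" if "z \<in> T" "z \<noteq> a" for z
    unfolding SC C_def using that by simp
  obtain R where R: "R > 0" "\<And>z. z \<in> T \<Longrightarrow> norm (z - a) \<le> R"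
  proof -
    have "bounded ((\<lambda>z. z - a) ` T)"
      using cT by (intro compact_imp_bounded compact_continuous_image continuous_intros)
    then show ?thesis using that unfolding bounded_pos by auto
  qed
  \<comment> \<open>The arc is bounded, so its inverted image stays away from 0. Outside that ball
    the inverse map is continuous, which makes \<open>C\<close> closed.\<close>
  have Cbig: "1 / R \<le> norm w" if "w \<in> C" for w
  proof -
    have "norm (1 / w) \<le> R" "w \<noteq> 0" using R(2)[of "a + 1 / w"] that by (auto simp: C_def)
    then show ?thesis using R(1) by (simp add: norm_divide field_simps)
  qed
  have "closed ((- ball 0 (1 / R)) \<inter> (\<lambda>w. a + 1 / w) -` T)"
  proof (rule continuous_closed_preimage)
    show "continuous_on (- ball 0 (1 / R)) (\<lambda>w. a + 1 / w)"
      using R(1) by (intro continuous_intros) auto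
  qed (use compact_imp_closed[OF cT] in \<open>auto simp: closed_def\<close>)
  moreover have "(- ball 0 (1 / R)) \<inter> (\<lambda>w. a + 1 / w) -` T = C"
    using Cbig R(1) by (fastforce simp: C_def)
  ultimately show oS: "open S" unfolding SC by (simp add: open_Compl)
  have inf: "path_image \<gamma> \<noteq> {a}"
  proof
    assume "path_image \<gamma> = {a}"
    then have "pathstart \<gamma> = pathfinish \<gamma>" by (metis pathfinish_in_path_image pathstart_in_path_image singletonD)
    then show False using arc_distinct_ends[OF assms(1)] by simp
  qed
  then obtain z where "z \<in> T" "z \<noteq> a" using aT unfolding T_def by blast
  then show "S \<noteq> UNIV" using notS by blast
  \<comment> \<open>An arc does not separate the plane. Adding 0 keeps the image connected because 0
    is a limit of images of points far away.\<close>
  have conn: "connected S"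
  proof (rule connected_intermediate_closure)
    have "connected (- T)" unfolding T_def using connected_arc_complement[OF assms(1)] by simp
    then show "connected ((\<lambda>z. 1 / (z - a)) ` (- T))"
      using aT by (intro connected_continuous_image continuous_intros) auto
    show "(\<lambda>z. 1 / (z - a)) ` (- T) \<subseteq> S" by (auto simp: S_def)
    have "0 \<in> closure ((\<lambda>z. 1 / (z - a)) ` (- T))"
      unfolding closure_approachable
    proof (intro allI impI)
      fix e :: real assume e: "0 < e"
      define b where "b = min (e / 2) (1 / (2 * R))"
      have b: "0 < b" "b < e" "b < 1 / R" using e R(1) by (auto simp: b_def min_less_iff_disj field_simps)
      define w where "w = complex_of_real b"
      have nw: "norm w = b" "w \<noteq> 0" using b by (auto simp: w_def)
      then have "w \<notin> C" using Cbig[of w] b by auto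
      then have "w \<in> S" by (simp add: SC)
      then have "w \<in> (\<lambda>z. 1 / (z - a)) ` (- T)" using nw by (auto simp: S_def)
      then show "\<exists>y\<in>(\<lambda>z. 1 / (z - a)) ` (- T). dist y 0 < e" using nw b by (intro bexI[of _ w]) auto
    qed
    then show "S \<subseteq> closure ((\<lambda>z. 1 / (z - a)) ` (- T))"
      unfolding S_def by (intro insert_subsetI closure_subset)
  qed
  have arcC: "C = (\<lambda>t. 1 / (\<gamma> t - a)) ` {0<..1}"
  proof -
    have inj: "inj_on \<gamma> {0..1}" using assms(1) by (simp add: arc_def)
    have "\<gamma> t \<noteq> a" if "t \<in> {0<..1}" for t
      using inj_onD[OF inj, of t 0] that by (auto simp: a_def pathstart_def)
    then have "1 / (\<gamma> t - a) \<in> C" if "t \<in> {0<..1}" for t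
      using that by (auto simp: C_def T_def path_image_def)
    moreover have "w \<in> (\<lambda>t. 1 / (\<gamma> t - a)) ` {0<..1}" if "w \<in> C" for w
    proof -
      have w: "w \<noteq> 0" "a + 1 / w \<in> T" using that by (auto simp: C_def)
      then obtain t where t: "t \<in> {0..1}" "\<gamma> t = a + 1 / w" by (auto simp: T_def path_image_def)
      have "t \<noteq> 0" using t(2) w(1) by (auto simp: a_def pathstart_def)
      then show ?thesis using t w by (intro image_eqI[of _ _ t]) auto
    qed
    ultimately show ?thesis by blast
  qed
  have cont: "continuous_on {0..1} \<gamma>" using assms(1) by (simp add: arc_def path_def)
  have connC: "connected C"
  proof -
    have "\<gamma> t - a \<noteq> 0" if "t \<in> {0<..1}" for t
      using inj_onD[of \<gamma> "{0..1}" t 0] that assms(1) by (auto simp: a_def pathstart_def arc_def)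
    then show ?thesis unfolding arcC
      by (intro connected_continuous_image continuous_intros continuous_on_subset[OF cont]) auto
  qed
  \<comment> \<open>Close to its start the arc is inverted to points of arbitrarily large norm. So
    the complement of \<open>S\<close> is a single unbounded component, which is the criterion for
    simple connectedness.\<close>
  have unb: "\<not> bounded C"
  proof
    assume "bounded C"
    then obtain B where B: "B > 0" "\<And>w. w \<in> C \<Longrightarrow> norm w \<le> B" unfolding bounded_pos by auto
    have "(\<gamma> \<longlongrightarrow> \<gamma> 0) (at 0 within {0..1})"
      using cont by (auto simp: continuous_on_def)
    then have "\<forall>\<^sub>F t in at 0 within {0..1}. dist (\<gamma> t) (\<gamma> 0) < 1 / B"
      using B(1) by (intro tendstoD) auto
    then obtain d where d: "d > 0" "\<And>t. t \<in> {0..1} \<Longrightarrow> t \<noteq> 0 \<Longrightarrow> dist t 0 < d \<Longrightarrow> dist (\<gamma> t) (\<gamma> 0) < 1 / B"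
      unfolding eventually_at by auto
    define t where "t = min 1 (d / 2)"
    have t: "t \<in> {0<..1}" "dist t 0 < d" using d(1) by (auto simp: t_def)
    then have small: "norm (\<gamma> t - a) < 1 / B" using d(2)[of t] by (simp add: a_def pathstart_def dist_norm)
    have "1 / (\<gamma> t - a) \<in> C" using t arcC by blast
    then have "norm (1 / (\<gamma> t - a)) \<le> B" "\<gamma> t \<noteq> a" using B(2) by (auto simp: C_def)
    then show False using small B(1) by (simp add: norm_divide field_simps)
  qed
  have "C \<noteq> {}" using arcC by auto
  then have "Connected.components (- S) = {C}" unfolding SC using connC by (simp add: components_eq_sing_iff)
  then show "simply_connected S"
    using conn unb by (simp add: simply_connected_eq_unbounded_complement_components[OF oS])
qed

text \<open>A Riemann map followed by an automorphism of the disc, so that 0, which stands for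
  infinity, goes to the centre.\<close>

lemma pointed_disc_chart:
  fixes S :: "complex set"
  assumes "open S" "simply_connected S" "S \<noteq> UNIV" "0 \<in> S"
  obtains F G :: "complex \<Rightarrow> complex" where "continuous_on S F" "continuous_on (ball 0 1) G" "F 0 = 0"
    "\<And>z. z \<in> S \<Longrightarrow> F z \<in> ball 0 1 \<and> G (F z) = z" "\<And>w. w \<in> ball 0 1 \<Longrightarrow> G w \<in> S \<and> F (G w) = w"
proof -
  obtain f g where f: "f holomorphic_on S" "g holomorphic_on ball 0 1"
    "\<forall>z\<in>S. f z \<in> ball 0 1 \<and> g (f z) = z" "\<forall>w\<in>ball 0 1. g w \<in> S \<and> f (g w) = w"
    using Riemann_mapping_theorem[of S] assms by auto
  have "f 0 \<in> ball 0 1" using f(3) assms(4) by blast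
  then obtain h k where h: "h (f 0) = 0" "h holomorphic_on ball 0 1" "h ` ball 0 1 \<subseteq> ball 0 1"
                "k holomorphic_on ball 0 1" "k ` ball 0 1 \<subseteq> ball 0 1"
                "\<And>z. z \<in> ball 0 1 \<Longrightarrow> h (k z) = z" "\<And>z. z \<in> ball 0 1 \<Longrightarrow> k (h z) = z"
    by (rule ball_biholomorphism_exists) blast
  show ?thesis
  proof (rule that[of "h \<circ> f" "g \<circ> k"])
    show "continuous_on S (h \<circ> f)"
      using f(1,3) h(2) by (intro continuous_on_compose holomorphic_on_imp_continuous_on holomorphic_on_subset[OF h(2)]) auto
    show "continuous_on (ball 0 1) (g \<circ> k)"
      using f(2) h(4,5) by (intro continuous_on_compose holomorphic_on_imp_continuous_on holomorphic_on_subset[OF f(2)]) auto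
    show "(h \<circ> f) 0 = 0" using h(1) by simp
    show "(h \<circ> f) z \<in> ball 0 1 \<and> (g \<circ> k) ((h \<circ> f) z) = z" if "z \<in> S" for z
    proof -
      have "f z \<in> ball 0 1" "g (f z) = z" using f(3) that by blast+
      moreover from this have "h (f z) \<in> ball 0 1" using h(3) by blast
      ultimately show ?thesis using h(7) by simp
    qed
    show "(g \<circ> k) w \<in> S \<and> (h \<circ> f) ((g \<circ> k) w) = w" if "w \<in> ball 0 1" for w
    proof -
      have "k w \<in> ball 0 1" using h(5) that by blast
      then have "g (k w) \<in> S" "f (g (k w)) = k w" using f(4) by blast+
      then show ?thesis using h(6)[OF that] by simp
    qed
  qed
qed

text \<open>\<open>F \<circ> h\<close> maps the complement of the arc injectively into the disc
  without its centre, and approaching the arc means approaching the circle. The radial flip that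
  sends a point of norm r to norm 1 - r in the same direction shrinks the circle to 0, so that the
  value 0 on the arc fits continuously.\<close>

lemma arc_collapse:
  fixes \<gamma> :: "real \<Rightarrow> complex"
  assumes "arc \<gamma>"
  obtains q :: "complex \<Rightarrow> complex" where "continuous_on UNIV q" "\<And>z. z \<in> path_image \<gamma> \<Longrightarrow> q z = 0"
    "\<And>z. z \<notin> path_image \<gamma> \<Longrightarrow> q z \<noteq> 0" "inj_on q (- path_image \<gamma>)"
proof -
  define a where "a = pathstart \<gamma>"
  define T where "T = path_image \<gamma>"
  define h where "h z = 1 / (z - a)" for z
  define S where "S = insert 0 (h ` (- T))"
  have h_eq: "h = (\<lambda>z. 1 / (z - a))" by (simp add: fun_eq_iff h_def)
  note S = inverted_arc_complement[OF assms, folded a_def T_def, folded h_eq S_def]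
  have hT: "h z \<notin> S" if "z \<in> T" "z \<noteq> a" for z using inverted_arc_complement(4)[OF assms, folded a_def T_def, folded h_eq S_def] that
    by (simp add: h_def)
  obtain F G :: "complex \<Rightarrow> complex" where F: "continuous_on S F" "continuous_on (ball 0 1) G" "F 0 = 0"
    "\<And>z. z \<in> S \<Longrightarrow> F z \<in> ball 0 1 \<and> G (F z) = z" "\<And>w. w \<in> ball 0 1 \<Longrightarrow> G w \<in> S \<and> F (G w) = w"
    using pointed_disc_chart[OF S(1-3)] by (metis S_def insertI1)
  \<comment> \<open>The factor 1/r - 1 turns norm r into 1 - r.\<close>
  define q where "q z = (if z \<in> T then 0 else (1 / norm (F (h z)) - 1) *\<^sub>R F (h z))" for z
  have aT: "a \<in> T" unfolding a_def T_def by (rule pathstart_in_path_image)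
  have cT: "compact T" using assms by (simp add: T_def compact_arc_image)
  have hS: "h z \<in> S" if "z \<notin> T" for z using that by (simp add: S_def)
  have h0: "h z \<noteq> 0" if "z \<notin> T" for z using that aT by (auto simp: h_def)
  have F0: "F (h z) \<noteq> 0" "norm (F (h z)) < 1" if "z \<notin> T" for z
  proof -
    show "F (h z) \<noteq> 0"
    proof
      assume "F (h z) = 0"
      then have "G (F (h z)) = G (F 0)" using F(3) by simp
      then have "h z = 0" using F(4)[OF hS[OF that]] F(4)[of 0] by (simp add: S_def)
      then show False using h0[OF that] by simp
    qed
    show "norm (F (h z)) < 1" using F(4)[OF hS[OF that]] by simp
  qed
  have nq: "norm (q z) = 1 - norm (F (h z))" if "z \<notin> T" for z
    using F0[OF that] that by (simp add: q_def field_simps)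
  show ?thesis
  proof (rule that[of q])
    show "q z = 0" if "z \<in> path_image \<gamma>" for z using that by (simp add: q_def T_def)
    show "q z \<noteq> 0" if z: "z \<notin> path_image \<gamma>" for z
    proof -
      have "z \<notin> T" using z by (simp add: T_def)
      then have "norm (q z) > 0" using nq F0(2) by simp
      then show ?thesis by auto
    qed
    show "inj_on q (- path_image \<gamma>)"
    proof (rule inj_onI)
      fix x y assume "x \<in> - path_image \<gamma>" "y \<in> - path_image \<gamma>" and eq: "q x = q y"
      then have xy: "x \<notin> T" "y \<notin> T" by (auto simp: T_def)
      have n: "norm (F (h x)) = norm (F (h y))" using nq[OF xy(1)] nq[OF xy(2)] eq by simp
      have "1 / norm (F (h x)) - 1 \<noteq> 0" using F0[OF xy(1)] by (simp add: field_simps)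
      moreover have "(1 / norm (F (h x)) - 1) *\<^sub>R F (h x) = (1 / norm (F (h x)) - 1) *\<^sub>R F (h y)"
        using eq xy n by (simp add: q_def)
      ultimately have "F (h x) = F (h y)" by (rule scaleR_left_imp_eq)
      then have "G (F (h x)) = G (F (h y))" by simp
      then have "h x = h y" using F(4)[OF hS[OF xy(1)]] F(4)[OF hS[OF xy(2)]] by simp
      moreover have "x \<noteq> a" "y \<noteq> a" using xy aT by auto
      ultimately show "x = y" by (simp add: h_def)
    qed
    have oT: "open (- T)" using compact_imp_closed[OF cT] by (simp add: open_Compl)
    have "continuous_on (- T) h" unfolding h_def using aT by (intro continuous_intros) auto
    then have cFh: "continuous_on (- T) (\<lambda>z. F (h z))"
      using hS by (intro continuous_on_compose2[OF F(1)]) auto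
    have "continuous_on (- T) (\<lambda>z. (1 / norm (F (h z)) - 1) *\<^sub>R F (h z))"
      using F0 by (intro continuous_intros cFh) auto
    then have cq: "continuous_on (- T) q" by (rule continuous_on_eq) (simp add: q_def)
    have "isCont q z" for z
    proof (cases "z \<in> T")
      case False
      then show ?thesis using cq oT continuous_on_eq_continuous_at by blast
    next
      case True
      \<comment> \<open>Where \<open>q\<close> has norm at least \<open>e\<close>,
        \<open>F (h x)\<close> lies in a compact smaller disc and \<open>h x\<close> in its compact
        preimage \<open>K\<close> in \<open>S\<close>, which \<open>h\<close> never reaches from the
        arc.\<close>
      have "\<exists>d>0. \<forall>x. dist x z < d \<longrightarrow> dist (q x) (q z) < e" if e: "e > 0" for e
      proof -
        define K where "K = G ` cball 0 (1 - e)"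
        have sub: "cball 0 (1 - e) \<subseteq> ball (0::complex) 1" using e by (auto simp: dist_norm)
        have cK: "compact K" unfolding K_def
          by (rule compact_continuous_image[OF continuous_on_subset[OF F(2) sub]]) simp
        have KS: "K \<subseteq> S" unfolding K_def using F(5) sub by blast
        obtain B where B: "B > 0" "\<And>w. w \<in> K \<Longrightarrow> norm w \<le> B"
          using compact_imp_bounded[OF cK] unfolding bounded_pos by auto
        \<comment> \<open>The set of points with \<open>h x \<in> K\<close>. As \<open>K\<close> is
          bounded, these stay away from the pole \<open>a\<close> of \<open>h\<close>; removing a
          ball there makes \<open>h\<close> continuous and the set closed.\<close>
        define N where "N = (- ball a (1 / B)) \<inter> h -` K"
        have "continuous_on (- ball a (1 / B)) h" unfolding h_def
          using B(1) by (intro continuous_intros) auto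
        then have "closed N" unfolding N_def
          using compact_imp_closed[OF cK] by (intro continuous_closed_preimage) (auto simp: closed_def)
        moreover have "z \<in> - N"
        proof (cases "z = a")
          case True
          then show ?thesis using B(1) by (simp add: N_def)
        next
          case False
          then have "h z \<notin> K" using hT[OF \<open>z \<in> T\<close>] KS by blast
          then show ?thesis by (simp add: N_def)
        qed
        ultimately obtain d where d: "d > 0" "ball z d \<subseteq> - N" by (metis openE open_Compl)
        have "dist (q x) (q z) < e" if "dist x z < d" for x
        proof (cases "x \<in> T")
          case True
          then show ?thesis using \<open>z \<in> T\<close> e by (simp add: q_def)
        next
          case False
          have "x \<in> ball z d" using that by (simp add: dist_commute)
          then have xN: "x \<notin> N" using d(2) by blast
          have xa: "x \<noteq> a" using False aT by auto
          have "h x \<notin> K"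
          proof
            assume hK: "h x \<in> K"
            then have "norm (h x) \<le> B" using B(2) by blast
            then have "1 / B \<le> dist a x" using xa B(1) by (simp add: h_def norm_divide dist_norm norm_minus_commute field_simps)
            then have "x \<in> N" using hK by (simp add: N_def)
            then show False using xN by simp
          qed
          have "F (h x) \<notin> cball 0 (1 - e)"
          proof
            assume "F (h x) \<in> cball 0 (1 - e)"
            then have "G (F (h x)) \<in> K" by (simp add: K_def)
            then show False using \<open>h x \<notin> K\<close> F(4)[OF hS[OF False]] by simp
          qed
          then have "norm (q x) < e" using nq[OF False] by simp
          then show ?thesis using \<open>z \<in> T\<close> by (simp add: q_def[of z])
        qed
        then show ?thesis using d(1) by blast
      qed
      then show ?thesis unfolding continuous_at_eps_delta by (simp add: dist_commute)
    qed
    then show "continuous_on UNIV q" by (simp add: continuous_at_imp_continuous_on)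
  qed
qed

section \<open>Drawings with collapsed edges\<close>

text \<open>A plane drawing of the quotient by the edges in \<open>F\<close>: the vertices of a component of \<open>F\<close>
  share a point.\<close>

definition plane_quotient :: "('v, 'e) mgraph \<Rightarrow> 'e set \<Rightarrow> ('v \<Rightarrow> complex) \<Rightarrow> ('e \<Rightarrow> real \<Rightarrow> complex) \<Rightarrow> bool" where
  "plane_quotient X F pt cv \<longleftrightarrow>
     (\<forall>u\<in>verts X. \<forall>v\<in>verts X. pt u = pt v \<longleftrightarrow> (u, v) \<in> (adj (X\<lparr>edges := F\<rparr>))\<^sup>*) \<and>
     (\<forall>e\<in>edges X - F. simple_path (cv e) \<and>
        map_uprod pt (ends X e) = Upair (pathstart (cv e)) (pathfinish (cv e)) \<and>
        cv e ` {0<..<1} \<inter> pt ` verts X = {}) \<and>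
     (\<forall>e\<in>edges X - F. \<forall>e'\<in>edges X - F. e \<noteq> e' \<longrightarrow> cv e ` {0<..<1} \<inter> cv e' ` {0<..<1} = {})"

lemma adj_mono: "F \<subseteq> F' \<Longrightarrow> adj (X\<lparr>edges := F\<rparr>) \<subseteq> adj (X\<lparr>edges := F'\<rparr>)"
  by (auto simp: adj_def)

lemma path_image_interior:
  fixes c :: "real \<Rightarrow> complex"
  shows "path_image c = insert (pathstart c) (insert (pathfinish c) (c ` {0<..<1}))"
proof -
  have "{0..1} = insert 0 (insert 1 {0<..<1::real})" by auto
  then show ?thesis by (simp add: path_image_def pathstart_def pathfinish_def)
qed

lemma simple_path_eqD:
  assumes "simple_path c" "x \<in> {0<..<1}" "y \<in> {0..1}" "c x = c y"
  shows "x = y"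
  using assms by (fastforce simp: simple_path_def loop_free_def)

text \<open>Off \<open>T\<close> the map is injective, so only the two ends can be identified. The
  result may be closed even if \<open>c\<close> is not, which is how contraction creates
  loops.\<close>

lemma simple_path_collapse:
  fixes c :: "real \<Rightarrow> complex"
  assumes c: "simple_path c" and int: "c ` {0<..<1} \<inter> T = {}"
    and q: "continuous_on UNIV q" "\<And>z. z \<in> T \<Longrightarrow> q z = 0" "\<And>z. z \<notin> T \<Longrightarrow> q z \<noteq> 0" "inj_on q (- T)"
  shows "simple_path (q \<circ> c)"
proof -
  have "continuous_on {0..1} c" using c by (simp add: simple_path_def path_def)
  then have "path (q \<circ> c)" unfolding path_def
    by (rule continuous_on_compose) (rule continuous_on_subset[OF q(1)], simp)
  moreover have *: "x = y" if "x \<in> {0<..<1}" "y \<in> {0..1}" "q (c x) = q (c y)" for x y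
  proof -
    have "c x \<notin> T" using int that(1) by blast
    then have "c y \<notin> T" using q(2,3) that(3) by metis
    then have "c x = c y" using \<open>c x \<notin> T\<close> that(3) inj_onD[OF q(4)] by simp
    then show ?thesis using simple_path_eqD[OF c that(1,2)] by simp
  qed
  moreover have "loop_free (q \<circ> c)"
    unfolding loop_free_def
  proof (intro ballI impI)
    fix x y :: real assume xy: "x \<in> {0..1}" "y \<in> {0..1}" "(q \<circ> c) x = (q \<circ> c) y"
    consider "x \<in> {0<..<1}" | "y \<in> {0<..<1}" | "x \<in> {0, 1}" "y \<in> {0, 1}" using xy by fastforce
    then show "x = y \<or> x = 0 \<and> y = 1 \<or> x = 1 \<and> y = 0"
    proof cases
      case 1
      then show ?thesis using *[OF 1 xy(2)] xy(3) by simp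
    next
      case 2
      then show ?thesis using *[OF 2 xy(1)] xy(3) by simp
    qed auto
  qed
  ultimately show ?thesis by (simp add: simple_path_def)
qed

text \<open>If the ends of \<open>e0\<close> already share a point, its curve is simply erased.
  Otherwise its curve is an arc that meets the rest of the drawing only in its two end points, and
  \<open>arc_collapse\<close> identifies these without creating new coincidences.\<close>

lemma plane_quotient_insert:
  assumes wf: "wf_graph X" and D: "plane_quotient X F pt cv" and F: "F \<subseteq> edges X" and e0: "e0 \<in> edges X" "e0 \<notin> F"
  shows "\<exists>pt cv. plane_quotient X (insert e0 F) pt cv"
proof -
  let ?R = "adj (X\<lparr>edges := F\<rparr>)" and ?R' = "adj (X\<lparr>edges := insert e0 F\<rparr>)"
  have pt: "\<And>u v. u \<in> verts X \<Longrightarrow> v \<in> verts X \<Longrightarrow> pt u = pt v \<longleftrightarrow> (u, v) \<in> ?R\<^sup>*"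
    and sp: "\<And>e. e \<in> edges X \<Longrightarrow> e \<notin> F \<Longrightarrow> simple_path (cv e)"
    and en: "\<And>e. e \<in> edges X \<Longrightarrow> e \<notin> F \<Longrightarrow> map_uprod pt (ends X e) = Upair (pathstart (cv e)) (pathfinish (cv e))"
    and av: "\<And>e. e \<in> edges X \<Longrightarrow> e \<notin> F \<Longrightarrow> cv e ` {0<..<1} \<inter> pt ` verts X = {}"
    and dj: "\<And>e e'. e \<in> edges X \<Longrightarrow> e \<notin> F \<Longrightarrow> e' \<in> edges X \<Longrightarrow> e' \<notin> F \<Longrightarrow> e \<noteq> e' \<Longrightarrow>
      cv e ` {0<..<1} \<inter> cv e' ` {0<..<1} = {}"
    using D by (auto simp: plane_quotient_def)
  obtain a b where ab: "ends X e0 = Upair a b" "a \<in> verts X" "b \<in> verts X"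
    by (rule wf_graph_ends[OF wf e0(1)])
  have sub: "?R\<^sup>* \<subseteq> ?R'\<^sup>*" by (intro rtrancl_mono adj_mono) auto
  have abR: "(a, b) \<in> ?R'" using ab by (auto simp: adj_def)
  have wf': "wf_graph (X\<lparr>edges := insert e0 F\<rparr>)"
    using wf F e0 by (auto simp: wf_graph_def dest: finite_subset)
  have step: "(u, v) \<in> ?R \<or> {u, v} = {a, b}" if uv: "(u, v) \<in> ?R'" for u v
  proof -
    obtain e where e: "e \<in> insert e0 F" "ends X e = Upair u v" using uv by (auto simp: adj_def)
    show ?thesis
    proof (cases "e = e0")
      case True
      then show ?thesis using e(2) ab(1) by auto
    next
      case False
      then show ?thesis using e by (auto simp: adj_def)
    qed
  qed
  \<comment> \<open>A function that is constant on the old classes and agrees on the ends of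
    \<open>e0\<close> is constant on the new classes.\<close>
  have ind: "g u = g v" if g: "\<And>u v. u \<in> verts X \<Longrightarrow> v \<in> verts X \<Longrightarrow> (u, v) \<in> ?R\<^sup>* \<Longrightarrow> g u = g v" "g a = g b"
    and uv: "(u, v) \<in> ?R'\<^sup>*" and u: "u \<in> verts X" for g :: "'a \<Rightarrow> complex" and u v
    using uv
  proof (induction rule: rtrancl_induct)
    case (step y z)
    have y: "y \<in> verts X" using adj_rtrancl_verts[OF step(1) wf'] u by simp
    have z: "z \<in> verts X" using adj_rtrancl_verts[OF rtrancl_into_rtrancl[OF step(1,2)] wf'] u by simp
    have "g y = g z"
      using \<open>\<And>u v. (u, v) \<in> ?R' \<Longrightarrow> (u, v) \<in> ?R \<or> {u, v} = {a, b}\<close>[OF step(2)]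
    proof
      assume "(y, z) \<in> ?R"
      then show ?thesis using g(1)[OF y z] by auto
    next
      assume "{y, z} = {a, b}"
      then show ?thesis using g(2) by (auto simp: doubleton_eq_iff)
    qed
    then show ?case using step(3) by simp
  qed simp
  show ?thesis
  proof (cases "pt a = pt b")
    case True
    have "plane_quotient X (insert e0 F) pt cv"
      unfolding plane_quotient_def
    proof (intro conjI ballI impI)
      fix u v assume uv: "u \<in> verts X" "v \<in> verts X"
      show "pt u = pt v \<longleftrightarrow> (u, v) \<in> ?R'\<^sup>*"
        using ind[of pt u v] pt True uv sub by blast
    qed (use sp en av dj in auto)
    then show ?thesis by blast
  next
    case False
    have se: "Upair (pt a) (pt b) = Upair (pathstart (cv e0)) (pathfinish (cv e0))" using en[OF e0] ab by simp
    then have pair: "{pt a, pt b} = {pathstart (cv e0), pathfinish (cv e0)}" by auto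
    have "pathstart (cv e0) \<noteq> pathfinish (cv e0)" using False pair by (metis doubleton_eq_iff)
    then have arc: "arc (cv e0)" using sp[OF e0] by (simp add: arc_simple_path)
    define T where "T = path_image (cv e0)"
    have T: "T = {pt a, pt b} \<union> cv e0 ` {0<..<1}" unfolding T_def path_image_interior pair by auto
    have "\<exists>q :: complex \<Rightarrow> complex. continuous_on UNIV q \<and> (\<forall>z. q z = 0 \<longleftrightarrow> z \<in> T) \<and> inj_on q (- T)"
    proof (rule arc_collapse[OF arc, folded T_def])
      fix q :: "complex \<Rightarrow> complex" assume "continuous_on UNIV q" "\<And>z. z \<in> T \<Longrightarrow> q z = 0" "\<And>z. z \<notin> T \<Longrightarrow> q z \<noteq> 0" "inj_on q (- T)"
      then show ?thesis by (intro exI[of _ q] conjI allI iffI) auto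
    qed
    then obtain q :: "complex \<Rightarrow> complex" where q: "continuous_on UNIV q" "\<And>z. z \<in> T \<Longrightarrow> q z = 0" "\<And>z. z \<notin> T \<Longrightarrow> q z \<noteq> 0"
      "inj_on q (- T)" by (elim exE conjE) simp
    \<comment> \<open>The only identification made by \<open>q\<close> is that of the points of the
      arc.\<close>
    have qeq: "q x = q y \<longleftrightarrow> x = y \<or> x \<in> T \<and> y \<in> T" for x y
      using q(2,3) inj_onD[OF q(4), of x y] by (metis ComplI)
    have ptT: "pt u \<in> T \<longleftrightarrow> pt u = pt a \<or> pt u = pt b" if "u \<in> verts X" for u
      using av[OF e0] that unfolding T by blast
    have intT: "cv e ` {0<..<1} \<inter> T = {}" if "e \<in> edges X" "e \<notin> insert e0 F" for e
      using av[of e] dj[of e e0] that e0 ab unfolding T by blast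
    have "plane_quotient X (insert e0 F) (q \<circ> pt) (\<lambda>e. q \<circ> cv e)"
      unfolding plane_quotient_def
    proof (intro conjI ballI impI)
      fix u v assume uv: "u \<in> verts X" "v \<in> verts X"
      show "(q \<circ> pt) u = (q \<circ> pt) v \<longleftrightarrow> (u, v) \<in> ?R'\<^sup>*"
      proof
        assume uvR: "(u, v) \<in> ?R'\<^sup>*"
        have "q (pt u) = q (pt v)"
        proof (rule ind[OF _ _ uvR uv(1)])
          show "q (pt a) = q (pt b)" using qeq ptT[OF ab(2)] ptT[OF ab(3)] by simp
          show "q (pt x) = q (pt y)" if "x \<in> verts X" "y \<in> verts X" "(x, y) \<in> ?R\<^sup>*" for x y
            using pt[OF that(1,2)] that(3) by simp
        qed
        then show "(q \<circ> pt) u = (q \<circ> pt) v" by simp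
      next
        assume "(q \<circ> pt) u = (q \<circ> pt) v"
        then consider "pt u = pt v" | "pt u \<in> T" "pt v \<in> T" using qeq by auto
        then show "(u, v) \<in> ?R'\<^sup>*"
        proof cases
          case 1
          then show ?thesis using pt[OF uv] sub by blast
        next
          case 2
          have near: "(w, a) \<in> ?R'\<^sup>*" if w: "w \<in> verts X" "pt w \<in> T" for w
          proof -
            have "(w, a) \<in> ?R\<^sup>* \<or> (w, b) \<in> ?R\<^sup>*"
              using ptT[OF w(1)] w(2) pt[OF w(1) ab(2)] pt[OF w(1) ab(3)] by simp
            then show ?thesis
            proof
              assume "(w, b) \<in> ?R\<^sup>*"
              then have "(w, b) \<in> ?R'\<^sup>*" using sub by (rule subsetD[rotated])
              then show ?thesis using adj_sym[OF abR] by (rule rtrancl_into_rtrancl)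
            qed (rule subsetD[OF sub])
          qed
          show ?thesis using near[OF uv(1) 2(1)] adj_rtrancl_sym[OF near[OF uv(2) 2(2)]] by (rule rtrancl_trans)
        qed
      qed
    next
      fix e assume e: "e \<in> edges X - insert e0 F"
      show "simple_path (q \<circ> cv e)"
        using simple_path_collapse[OF sp intT q] e by simp
      have "map_uprod (q \<circ> pt) (ends X e) = map_uprod q (map_uprod pt (ends X e))" by (simp add: map_uprod_comp)
      then show "map_uprod (q \<circ> pt) (ends X e) = Upair (pathstart (q \<circ> cv e)) (pathfinish (q \<circ> cv e))"
        using en[of e] e by (simp add: pathstart_def pathfinish_def)
      show "(q \<circ> cv e) ` {0<..<1} \<inter> (q \<circ> pt) ` verts X = {}"
      proof -
        have "q (cv e x) \<noteq> q (pt u)" if "x \<in> {0<..<1}" "u \<in> verts X" for x u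
          using qeq intT[of e] av[of e] e that by blast
        then show ?thesis by auto
      qed
    next
      fix e e' assume e: "e \<in> edges X - insert e0 F" "e' \<in> edges X - insert e0 F" "e \<noteq> e'"
      have "q (cv e x) \<noteq> q (cv e' y)" if "x \<in> {0<..<1}" "y \<in> {0<..<1}" for x y
        using qeq intT[of e] dj[of e e'] e that by blast
      then show "(q \<circ> cv e) ` {0<..<1} \<inter> (q \<circ> cv e') ` {0<..<1} = {}" by auto
    qed
    then show ?thesis by blast
  qed
qed

lemma plane_quotient_extend:
  assumes "wf_graph X" "plane_quotient X F pt cv" "F \<subseteq> F'" "F' \<subseteq> edges X"
  shows "\<exists>pt cv. plane_quotient X F' pt cv"
proof -
  have "finite (F' - F)" using wf_graphD(2)[OF assms(1)] assms(4) by (meson finite_Diff finite_subset)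
  moreover have "A \<subseteq> edges X - F \<Longrightarrow> \<exists>pt cv. plane_quotient X (F \<union> A) pt cv" if "finite A" for A
    using that
  proof (induction A rule: finite_induct)
    case empty
    then show ?case using assms(2) by auto
  next
    case (insert e A)
    then obtain pt cv where "plane_quotient X (F \<union> A) pt cv" by auto
    then have "\<exists>pt cv. plane_quotient X (insert e (F \<union> A)) pt cv"
      using insert.prems insert.hyps(2) assms(3,4) by (intro plane_quotient_insert[OF assms(1)]) auto
    then show ?case by simp
  qed
  ultimately have "\<exists>pt cv. plane_quotient X (F \<union> (F' - F)) pt cv" using assms(4) by blast
  then show ?thesis using assms(3) by (simp add: Un_absorb1)
qed

lemma K1_connected:
  assumes "graph_iso (K1 m) H" "u \<in> verts H" "v \<in> verts H"
  shows "(u, v) \<in> (adj H)\<^sup>*"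
proof -
  obtain \<phi> \<psi> where iso: "bij_betw \<phi> (verts (K1 m)) (verts H)" "bij_betw \<psi> (edges (K1 m)) (edges H)"
    "\<forall>e\<in>edges (K1 m). ends H (\<psi> e) = map_uprod \<phi> (ends (K1 m) e)" using assms(1) by (auto simp: graph_iso_def)
  have c: "(\<phi> 0, x) \<in> (adj H)\<^sup>*" if x: "x \<in> verts H" for x
  proof -
    have "x \<in> \<phi> ` {0..m}" using iso(1) x by (simp add: bij_betw_def K1_def)
    then obtain i where i: "i \<le> m" "x = \<phi> i" by auto
    show ?thesis
    proof (cases "i = 0")
      case False
      then have "i \<in> edges (K1 m)" using i by (simp add: K1_def)
      then have "\<psi> i \<in> edges H" "ends H (\<psi> i) = Upair (\<phi> 0) (\<phi> i)"
        using iso(2,3) by (auto simp: bij_betw_def K1_def)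
      then have "(\<phi> 0, \<phi> i) \<in> adj H" by (auto simp: adj_def)
      then show ?thesis using i by blast
    qed (simp add: i)
  qed
  show ?thesis using adj_rtrancl_sym[OF c[OF assms(2)]] c[OF assms(3)] by (rule rtrancl_trans)
qed

text \<open>Members of \<open>M\<close> are connected and pairwise disjoint, so their vertex sets
  are exactly the classes of the relation generated by \<open>matching_edges M\<close>. The common
  point of a class therefore serves as the point of the contracted vertex.\<close>

lemma plane_quotient_imp_planarizing:
  assumes wf: "wf_graph X" and M: "perfect_pseudo_matching X M" and D: "plane_quotient X (matching_edges M) pt cv"
  shows "planarizing X M"
proof -
  let ?F = "matching_edges M"
  let ?R = "adj (X\<lparr>edges := ?F\<rparr>)"
  have pt: "\<And>u v. u \<in> verts X \<Longrightarrow> v \<in> verts X \<Longrightarrow> pt u = pt v \<longleftrightarrow> (u, v) \<in> ?R\<^sup>*"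
    and sp: "\<And>e. e \<in> edges X \<Longrightarrow> e \<notin> ?F \<Longrightarrow> simple_path (cv e)"
    and en: "\<And>e. e \<in> edges X \<Longrightarrow> e \<notin> ?F \<Longrightarrow> map_uprod pt (ends X e) = Upair (pathstart (cv e)) (pathfinish (cv e))"
    and av: "\<And>e. e \<in> edges X \<Longrightarrow> e \<notin> ?F \<Longrightarrow> cv e ` {0<..<1} \<inter> pt ` verts X = {}"
    and dj: "\<And>e e'. e \<in> edges X \<Longrightarrow> e \<notin> ?F \<Longrightarrow> e' \<in> edges X \<Longrightarrow> e' \<notin> ?F \<Longrightarrow> e \<noteq> e' \<Longrightarrow>
      cv e ` {0<..<1} \<inter> cv e' ` {0<..<1} = {}"
    using D by (auto simp: plane_quotient_def)
  have M1: "\<And>H. H \<in> M \<Longrightarrow> subgraph H X" "\<And>H. H \<in> M \<Longrightarrow> graph_iso (K1 1) H \<or> graph_iso (K1 3) H"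
    and M2: "\<And>H H'. H \<in> M \<Longrightarrow> H' \<in> M \<Longrightarrow> H \<noteq> H' \<Longrightarrow> verts H \<inter> verts H' = {}"
    and M3: "\<Union> (verts ` M) = verts X"
    using M unfolding perfect_pseudo_matching_def by blast+
  define cls where "cls v = (THE W. W \<in> verts ` M \<and> v \<in> W)" for v
  have cls: "cls v = verts H" if "H \<in> M" "v \<in> verts H" for v H
    unfolding cls_def
  proof (rule the_equality)
    show "verts H \<in> verts ` M \<and> v \<in> verts H" using that by blast
    fix W assume "W \<in> verts ` M \<and> v \<in> W"
    then obtain H' where "H' \<in> M" "W = verts H'" "v \<in> verts H'" by blast
    then show "W = verts H" using M2[of H H'] that by blast
  qed
  have same: "pt u = pt v" if H: "H \<in> M" "u \<in> verts H" "v \<in> verts H" for H u v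
  proof -
    have "(u, v) \<in> (adj H)\<^sup>*" using M1(2)[OF H(1)] K1_connected[OF _ H(2,3)] by auto
    moreover have "adj H \<subseteq> ?R"
      using M1(1)[OF H(1)] H(1) by (auto simp: adj_def subgraph_def matching_edges_def)
    ultimately have "(u, v) \<in> ?R\<^sup>*" using rtrancl_mono subsetD by metis
    moreover have "u \<in> verts X" "v \<in> verts X" using M1(1)[OF H(1)] H by (auto simp: subgraph_def)
    ultimately show ?thesis using pt by simp
  qed
  \<comment> \<open>Every matching edge lies in one member, and members that share a vertex are
    equal, so a walk along matching edges never leaves its member.\<close>
  have stay: "v \<in> verts H" if uv: "(u, v) \<in> ?R\<^sup>*" and H: "H \<in> M" and u: "u \<in> verts H" for u v H
    using uv
  proof (induction rule: rtrancl_induct)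
    case (step y z)
    then obtain e H' where e: "H' \<in> M" "e \<in> edges H'" "ends X e = Upair y z" by (auto simp: adj_def matching_edges_def)
    then have "ends H' e = Upair y z" "wf_graph H'" using M1(1)[OF e(1)] by (auto simp: subgraph_def)
    then have "y \<in> verts H'" "z \<in> verts H'" using wf_graphD(3)[of H' e] e(2) by auto
    then show ?case using M2[OF H e(1)] step(3) by blast
  qed (rule u)
  define rep where "rep W = pt (SOME v. v \<in> W)" for W
  have rep: "rep (verts H) = pt v" if "H \<in> M" "v \<in> verts H" for H v
  proof -
    have "(SOME v. v \<in> verts H) \<in> verts H" using that(2) by (rule someI)
    then show ?thesis unfolding rep_def using same[OF that(1) _ that(2)] by blast
  qed
  have repcls: "rep (cls v) = pt v" if v: "v \<in> verts X" for v
  proof -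
    obtain H where "H \<in> M" "v \<in> verts H" using v M3 by blast
    then show ?thesis using cls[of H v] rep[of H v] by simp
  qed
  have "verts H \<noteq> {}" if "graph_iso (K1 m) H" for m and H :: "('a, 'b) mgraph"
    using that by (auto simp: graph_iso_def bij_betw_def K1_def)
  then have ne: "verts H \<noteq> {}" if "H \<in> M" for H
    using M1(2)[OF that] by blast
  have repV: "rep ` verts ` M \<subseteq> pt ` verts X"
  proof
    fix z assume "z \<in> rep ` verts ` M"
    then obtain H where H: "H \<in> M" "z = rep (verts H)" by blast
    obtain v where "v \<in> verts H" using ne[OF H(1)] by blast
    moreover from this have "v \<in> verts X" using H(1) M3 by blast
    ultimately show "z \<in> pt ` verts X" using rep[OF H(1)] H(2) by simp
  qed
  let ?D = "\<lparr>point = rep, curve = cv\<rparr>"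
  have "is_drawing (contract X M) ?D"
    unfolding is_drawing_def
  proof (intro conjI ballI impI)
    show "inj_on (point ?D) (verts (contract X M))"
    proof (rule inj_onI)
      fix W W' assume "W \<in> verts (contract X M)" "W' \<in> verts (contract X M)" and eq: "point ?D W = point ?D W'"
      then obtain H H' where H: "H \<in> M" "W = verts H" "H' \<in> M" "W' = verts H'" by (auto simp: contract_def)
      obtain v v' where v: "v \<in> verts H" "v' \<in> verts H'" using ne H by blast
      then have "pt v = pt v'" using eq rep H by simp
      moreover have "v \<in> verts X" "v' \<in> verts X" using v H M3 by blast+
      ultimately have "(v, v') \<in> ?R\<^sup>*" using pt by simp
      then have "v' \<in> verts H" using stay H(1) v(1) by blast
      then show "W = W'" using M2[OF H(1,3)] v(2) H by blast
    qed
  next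
    fix e assume "e \<in> edges (contract X M)"
    then have e: "e \<in> edges X" "e \<notin> ?F" by (auto simp: contract_def)
    show "simple_path (curve ?D e)" using sp[OF e] by simp
    have "map_uprod (point ?D) (ends (contract X M) e) = map_uprod (rep \<circ> cls) (ends X e)"
      by (simp add: contract_def map_uprod_comp cls_def[abs_def])
    also have "\<dots> = map_uprod pt (ends X e)"
      using repcls wf_graphD(3)[OF wf e(1)] by (intro map_uprod_cong_on) auto
    finally show "map_uprod (point ?D) (ends (contract X M) e) = Upair (pathstart (curve ?D e)) (pathfinish (curve ?D e))"
      using en[OF e] by simp
    show "curve_interior ?D e \<inter> point ?D ` verts (contract X M) = {}"
      using av[OF e] repV by (simp add: curve_interior_def contract_def) blast
  next
    fix e e' assume "e \<in> edges (contract X M)" "e' \<in> edges (contract X M)" and ne: "e \<noteq> e'"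
    then have e: "e \<in> edges X" "e \<notin> ?F" "e' \<in> edges X" "e' \<notin> ?F" by (auto simp: contract_def)
    have none: "curve_interior ?D e \<inter> curve_interior ?D e' = {}"
      using dj[OF e ne] by (simp add: curve_interior_def)
    show "finite (curve_interior ?D e \<inter> curve_interior ?D e')" unfolding none by simp
    show "cross_at (curve ?D e) (curve ?D e') p" if "p \<in> curve_interior ?D e \<inter> curve_interior ?D e'" for p
      using that none by blast
    show "curve_interior ?D e \<inter> curve_interior ?D e' = {}" by (rule none)
  qed
  moreover have "crossings (contract X M) ?D = {}"
    using dj by (auto simp: crossings_def curve_interior_def contract_def)
  ultimately show ?thesis unfolding planarizing_def planar_def by blast
qed

section \<open>Local structure of a crossing\<close>

lemma arc_param_continuous:
  fixes g :: "real \<Rightarrow> complex"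
  assumes "arc g"
  obtains \<theta> where "continuous_on (path_image g) \<theta>" "\<And>x. x \<in> {0..1} \<Longrightarrow> \<theta> (g x) = x"
    "\<And>z. z \<in> path_image g \<Longrightarrow> \<theta> z \<in> {0..1} \<and> g (\<theta> z) = z"
proof -
  have c: "continuous_on {0..1} g" "inj_on g {0..1}" using assms by (auto simp: arc_def path_def)
  have "continuous_on (g ` {0..1}) (inv_into {0..1} g)"
    using c by (intro continuous_on_inv) auto
  moreover have "inv_into {0..1} g z \<in> {0..1} \<and> g (inv_into {0..1} g z) = z" if "z \<in> path_image g" for z
    using that c(2) by (auto simp: path_image_def)
  ultimately show ?thesis using that[of "inv_into {0..1} g"] c(2) by (simp add: path_image_def)
qed

text \<open>Walking along an axis of the chart in one of its two directions means walking along the curve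
  in the direction \<open>\<sigma>\<close>.\<close>

lemma axis_direction:
  fixes g :: "real \<Rightarrow> complex" and \<xi> :: "real \<Rightarrow> complex" and \<sigma> :: real
  assumes g: "arc g" and t: "t \<in> {0<..<1}" and \<sigma>: "\<sigma> = 1 \<or> \<sigma> = -1" and R: "R > 0"
    and \<xi>: "continuous_on {-R..R} \<xi>" "inj_on \<xi> {-R..R}" "\<And>u. u \<in> {-R..R} \<Longrightarrow> \<xi> u \<in> path_image g" "\<xi> 0 = g t"
    and far: "\<And>x. x \<in> {0..1} \<Longrightarrow> \<bar>x - t\<bar> \<ge> \<epsilon> \<Longrightarrow> g x \<notin> \<xi> ` {-R..R}"
  obtains \<delta> \<kappa> where "0 < \<delta>" "\<delta> < \<epsilon>" "\<kappa> = 1 \<or> \<kappa> = -1" "\<xi> (\<kappa> * R) = g (t + \<sigma> * \<delta>)" "t + \<sigma> * \<delta> \<in> {0..1}"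
proof -
  obtain \<theta> where \<theta>: "continuous_on (path_image g) \<theta>" "\<And>x. x \<in> {0..1} \<Longrightarrow> \<theta> (g x) = x"
    "\<And>z. z \<in> path_image g \<Longrightarrow> \<theta> z \<in> {0..1} \<and> g (\<theta> z) = z"
    using arc_param_continuous[OF g] by metis
  have "continuous_on {-R..R} (\<lambda>u. \<theta> (\<xi> u))"
    using \<xi>(3) by (intro continuous_on_compose2[OF \<theta>(1) \<xi>(1)]) auto
  moreover have "inj_on (\<lambda>u. \<theta> (\<xi> u)) {-R..R}"
  proof (rule inj_onI)
    fix u v assume uv: "u \<in> {-R..R}" "v \<in> {-R..R}" "\<theta> (\<xi> u) = \<theta> (\<xi> v)"
    have "\<xi> u = g (\<theta> (\<xi> u))" using \<theta>(3)[OF \<xi>(3)[OF uv(1)]] by (elim conjE) (rule sym)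
    also have "\<dots> = \<xi> v" unfolding uv(3) using \<theta>(3)[OF \<xi>(3)[OF uv(2)]] by (rule conjunct2)
    finally have "\<xi> u = \<xi> v" .
    then show "u = v" using inj_onD[OF \<xi>(2)] uv by blast
  qed
  \<comment> \<open>A continuous injective real function is monotone, so precisely one of the two
    ends of the axis segment lies in direction \<sigma>; its sign is \<kappa>.\<close>
  ultimately have mono: "\<theta> (\<xi> (-R)) < \<theta> (\<xi> 0) \<and> \<theta> (\<xi> 0) < \<theta> (\<xi> R) \<or> \<theta> (\<xi> R) < \<theta> (\<xi> 0) \<and> \<theta> (\<xi> 0) < \<theta> (\<xi> (-R))"
    using R by (intro continuous_inj_imp_mono) simp_all
  have t0: "\<theta> (\<xi> 0) = t" using \<xi>(4) \<theta>(2) t by simp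
  have "\<exists>\<kappa>. (\<kappa> = 1 \<or> \<kappa> = -1) \<and> 0 < \<sigma> * (\<theta> (\<xi> (\<kappa> * R)) - t)"
  proof (cases "0 < \<sigma> * (\<theta> (\<xi> R) - t)")
    case True
    then show ?thesis by (intro exI[of _ 1]) simp
  next
    case False
    then show ?thesis using mono t0 \<sigma> by (intro exI[of _ "-1"]) auto
  qed
  then obtain \<kappa> where \<kappa>: "\<kappa> = 1 \<or> \<kappa> = -1" "0 < \<sigma> * (\<theta> (\<xi> (\<kappa> * R)) - t)" by blast
  define \<delta> where "\<delta> = \<sigma> * (\<theta> (\<xi> (\<kappa> * R)) - t)"
  have kR: "\<kappa> * R \<in> {-R..R}" using \<kappa>(1) R by auto
  have eq: "t + \<sigma> * \<delta> = \<theta> (\<xi> (\<kappa> * R))" using \<sigma> by (auto simp: \<delta>_def)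
  have gk: "g (\<theta> (\<xi> (\<kappa> * R))) = \<xi> (\<kappa> * R)" "\<theta> (\<xi> (\<kappa> * R)) \<in> {0..1}" using \<theta>(3)[OF \<xi>(3)[OF kR]] by auto
  \<comment> \<open>Points of the curve with parameters at distance \<epsilon> or more from
    \<open>t\<close> are not on the axis segment, by \<open>far\<close>.\<close>
  have \<delta>\<epsilon>: "\<delta> < \<epsilon>"
  proof (rule ccontr)
    assume "\<not> \<delta> < \<epsilon>"
    then have "\<bar>\<theta> (\<xi> (\<kappa> * R)) - t\<bar> \<ge> \<epsilon>" using \<sigma> by (auto simp: \<delta>_def)
    then have "\<xi> (\<kappa> * R) \<notin> \<xi> ` {-R..R}" using far[OF gk(2)] gk(1) by simp
    then show False using kR by blast
  qed
  show ?thesis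
  proof (rule that[of \<delta> \<kappa>])
    show "0 < \<delta>" unfolding \<delta>_def by (rule \<kappa>(2))
    show "\<xi> (\<kappa> * R) = g (t + \<sigma> * \<delta>)" unfolding eq by (rule gk(1)[symmetric])
    show "t + \<sigma> * \<delta> \<in> {0..1}" unfolding eq by (rule gk(2))
  qed (rule \<delta>\<epsilon> \<kappa>(1))+
qed

text \<open>\<beta> is the segment between the points of the two half-axes given by the signs
  \<kappa> and \<mu>. The other two arcs join these points to the origin and are bent off their axes
  by the term x (1 - x), to the side away from \<beta>, so that all three interiors lie in different
  open quadrants. The coordinates add up to at most R + R/4 in absolute value, hence the ball of
  radius 2 R.\<close>

lemma quadrant_arcs:
  fixes \<kappa> \<mu> R :: real
  assumes \<kappa>: "\<kappa> = 1 \<or> \<kappa> = -1" and \<mu>: "\<mu> = 1 \<or> \<mu> = -1" and R: "R > 0"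
  defines "\<alpha> \<equiv> \<lambda>x. Complex (- \<kappa> * R * (x * (1 - x))) (\<mu> * R * x)"
    and "\<beta> \<equiv> \<lambda>x. Complex (\<kappa> * R * x) (\<mu> * R * (1 - x))"
    and "\<gamma> \<equiv> \<lambda>x. Complex (\<kappa> * R * (1 - x)) (- \<mu> * R * (x * (1 - x)))"
  shows "arc \<alpha>" "arc \<beta>" "arc \<gamma>"
    and "\<And>x. x \<in> {0..1} \<Longrightarrow> \<alpha> x \<in> ball 0 (2 * R) \<and> \<beta> x \<in> ball 0 (2 * R) \<and> \<gamma> x \<in> ball 0 (2 * R)"
    and "\<And>x. x \<in> {0<..<1} \<Longrightarrow> \<kappa> * Re (\<alpha> x) < 0 \<and> \<mu> * Im (\<alpha> x) > 0"
    and "\<And>x. x \<in> {0<..<1} \<Longrightarrow> \<kappa> * Re (\<beta> x) > 0 \<and> \<mu> * Im (\<beta> x) > 0"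
    and "\<And>x. x \<in> {0<..<1} \<Longrightarrow> \<kappa> * Re (\<gamma> x) > 0 \<and> \<mu> * Im (\<gamma> x) < 0"
proof -
  have nz: "\<kappa> * R \<noteq> 0" "\<mu> * R \<noteq> 0" using \<kappa> \<mu> R by auto
  show "arc \<alpha>" "arc \<beta>" "arc \<gamma>"
    unfolding arc_def path_def \<alpha>_def \<beta>_def \<gamma>_def inj_on_def Complex_eq
    using nz by (auto intro!: continuous_intros simp: complex_eq_iff)
  have sq: "x * (1 - x) \<le> 1 / 4" "0 \<le> x * (1 - x)" if "x \<in> {0..1}" for x :: real
  proof -
    have "0 \<le> (x - 1 / 2)\<^sup>2" by simp
    then show "x * (1 - x) \<le> 1 / 4" by (simp add: power2_eq_square algebra_simps)
    show "0 \<le> x * (1 - x)" using that by simp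
  qed
  have nb: "Complex a b \<in> ball 0 (2 * R)" if "\<bar>a\<bar> + \<bar>b\<bar> < 2 * R" for a b
    using cmod_le[of "Complex a b"] that by simp
  show "\<alpha> x \<in> ball 0 (2 * R) \<and> \<beta> x \<in> ball 0 (2 * R) \<and> \<gamma> x \<in> ball 0 (2 * R)" if x: "x \<in> {0..1}" for x
  proof (intro conjI)
    define v where "v = R * (x * (1 - x))"
    define w where "w = R * x"
    have "v \<le> R * (1 / 4)" unfolding v_def using sq(1)[OF x] R by (intro mult_left_mono) simp_all
    moreover have "0 \<le> v" unfolding v_def
      by (rule mult_nonneg_nonneg[OF less_imp_le[OF R] sq(2)[OF x]])
    ultimately have v: "0 \<le> v" "v \<le> R / 4" by simp_all
    have w: "0 \<le> w" "w \<le> R" using x R by (simp_all add: w_def mult_left_le)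
    have \<kappa>s: "\<bar>\<kappa> * y\<bar> = \<bar>y\<bar>" and \<mu>s: "\<bar>\<mu> * y\<bar> = \<bar>y\<bar>" for y using \<kappa> \<mu> by auto
    have eq: "- \<kappa> * R * (x * (1 - x)) = \<kappa> * (- v)" "\<mu> * R * x = \<mu> * w" "\<kappa> * R * x = \<kappa> * w"
      "\<mu> * R * (1 - x) = \<mu> * (R - w)" "\<kappa> * R * (1 - x) = \<kappa> * (R - w)" "- \<mu> * R * (x * (1 - x)) = \<mu> * (- v)"
      by (simp_all add: v_def w_def algebra_simps)
    have ab: "\<bar>\<kappa> * (- v)\<bar> = v" "\<bar>\<mu> * w\<bar> = w" "\<bar>\<kappa> * w\<bar> = w" "\<bar>\<mu> * (R - w)\<bar> = R - w"
      "\<bar>\<kappa> * (R - w)\<bar> = R - w" "\<bar>\<mu> * (- v)\<bar> = v"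
      unfolding \<kappa>s \<mu>s using v w by simp_all
    show "\<alpha> x \<in> ball 0 (2 * R)" unfolding \<alpha>_def eq by (rule nb) (use ab v w R in linarith)
    show "\<beta> x \<in> ball 0 (2 * R)" unfolding \<beta>_def eq by (rule nb) (use ab v w R in linarith)
    show "\<gamma> x \<in> ball 0 (2 * R)" unfolding \<gamma>_def eq by (rule nb) (use ab v w R in linarith)
  qed
  have sq': "0 < R * (x * (1 - x))" "0 < R * x" "0 < R * (1 - x)" if "x \<in> {0<..<1}" for x
    using that R by auto
  show "\<kappa> * Re (\<alpha> x) < 0 \<and> \<mu> * Im (\<alpha> x) > 0" if "x \<in> {0<..<1}" for x
    using sq'[OF that] \<kappa> \<mu> by (auto simp: \<alpha>_def)
  show "\<kappa> * Re (\<beta> x) > 0 \<and> \<mu> * Im (\<beta> x) > 0" if "x \<in> {0<..<1}" for x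
    using sq'[OF that] \<kappa> \<mu> by (auto simp: \<beta>_def)
  show "\<kappa> * Re (\<gamma> x) > 0 \<and> \<mu> * Im (\<gamma> x) < 0" if "x \<in> {0<..<1}" for x
    using sq'[OF that] \<kappa> \<mu> by (auto simp: \<gamma>_def)
qed

text \<open>The three extra arcs of a crossing lie in three different quadrants.\<close>

lemma crossing_arcs:
  fixes g h :: "real \<Rightarrow> complex" and \<sigma> \<tau> \<epsilon> :: real
  assumes cr: "cross_at g h p" and g: "arc g" "t \<in> {0<..<1}" "g t = p" and h: "arc h" "s \<in> {0<..<1}" "h s = p"
    and W: "open W" "p \<in> W" and \<epsilon>: "\<epsilon> > 0" and \<sigma>: "\<sigma> = 1 \<or> \<sigma> = -1" and \<tau>: "\<tau> = 1 \<or> \<tau> = -1"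
  shows "\<exists>\<delta> \<eta> \<alpha> \<beta> \<gamma>. 0 < \<delta> \<and> \<delta> < \<epsilon> \<and> 0 < \<eta> \<and> \<eta> < \<epsilon> \<and> arc \<alpha> \<and> arc \<beta> \<and> arc \<gamma> \<and>
     path_image \<alpha> \<subseteq> W \<and> path_image \<beta> \<subseteq> W \<and> path_image \<gamma> \<subseteq> W \<and>
     pathstart \<alpha> = p \<and> pathfinish \<alpha> = h (s + \<tau> * \<eta>) \<and>
     pathstart \<beta> = h (s + \<tau> * \<eta>) \<and> pathfinish \<beta> = g (t + \<sigma> * \<delta>) \<and>
     pathstart \<gamma> = g (t + \<sigma> * \<delta>) \<and> pathfinish \<gamma> = p \<and>
     (\<alpha> ` {0<..<1} \<union> \<beta> ` {0<..<1} \<union> \<gamma> ` {0<..<1}) \<inter> (path_image g \<union> path_image h) = {} \<and>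
     \<alpha> ` {0<..<1} \<inter> \<beta> ` {0<..<1} = {} \<and> \<beta> ` {0<..<1} \<inter> \<gamma> ` {0<..<1} = {} \<and> \<alpha> ` {0<..<1} \<inter> \<gamma> ` {0<..<1} = {}"
proof -
  obtain U \<phi> \<psi> where U: "open U" "p \<in> U" "homeomorphism U (ball 0 1) \<phi> \<psi>" "\<phi> p = (0::complex)"
     "\<phi> ` (U \<inter> path_image g) = {z \<in> ball 0 1. Im z = 0}" "\<phi> ` (U \<inter> path_image h) = {z \<in> ball 0 1. Re z = 0}"
    using cr unfolding cross_at_def by blast
  have \<psi>c: "continuous_on (ball 0 1) \<psi>" and \<psi>U: "\<And>z. z \<in> ball 0 1 \<Longrightarrow> \<psi> z \<in> U"
    and \<phi>\<psi>: "\<And>z. z \<in> ball 0 1 \<Longrightarrow> \<phi> (\<psi> z) = z" and \<psi>\<phi>: "\<And>z. z \<in> U \<Longrightarrow> \<psi> (\<phi> z) = z"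
    using U(3) by (auto simp: homeomorphism_def)
  have \<psi>inj: "x = y" if "\<psi> x = \<psi> y" "x \<in> ball 0 1" "y \<in> ball 0 1" for x y using \<phi>\<psi> that by metis
  have \<psi>0: "\<psi> 0 = p" using \<psi>\<phi>[OF U(2)] U(4) by simp
  have ong: "\<psi> z \<in> path_image g \<longleftrightarrow> Im z = 0" if z: "z \<in> ball 0 1" for z
  proof
    assume "\<psi> z \<in> path_image g"
    then have "\<phi> (\<psi> z) \<in> \<phi> ` (U \<inter> path_image g)" using \<psi>U[OF z] by blast
    then show "Im z = 0" unfolding U(5) \<phi>\<psi>[OF z] by simp
  next
    assume "Im z = 0"
    then have "z \<in> \<phi> ` (U \<inter> path_image g)" unfolding U(5) using z by simp
    then obtain w where "w \<in> U" "w \<in> path_image g" "z = \<phi> w" by blast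
    then show "\<psi> z \<in> path_image g" using \<psi>\<phi> by simp
  qed
  have onh: "\<psi> z \<in> path_image h \<longleftrightarrow> Re z = 0" if z: "z \<in> ball 0 1" for z
  proof
    assume "\<psi> z \<in> path_image h"
    then have "\<phi> (\<psi> z) \<in> \<phi> ` (U \<inter> path_image h)" using \<psi>U[OF z] by blast
    then show "Re z = 0" unfolding U(6) \<phi>\<psi>[OF z] by simp
  next
    assume "Re z = 0"
    then have "z \<in> \<phi> ` (U \<inter> path_image h)" unfolding U(6) using z by simp
    then obtain w where "w \<in> U" "w \<in> path_image h" "z = \<phi> w" by blast
    then show "\<psi> z \<in> path_image h" using \<psi>\<phi> by simp
  qed
  \<comment> \<open>Curves may return close to \<open>p\<close> after leaving it; the parts far from
    the crossing in parameter are compact and miss \<open>p\<close>, so a neighbourhood can avoid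
    them.\<close>
  have cl: "closed (c ` ({0..1} - {x. \<bar>x - r\<bar> < \<epsilon>}))" "p \<notin> c ` ({0..1} - {x. \<bar>x - r\<bar> < \<epsilon>})"
    if c: "arc c" "r \<in> {0<..<1}" "c r = p" for c :: "real \<Rightarrow> complex" and r
  proof -
    have "{x. \<bar>x - r\<bar> < \<epsilon>} = ball r \<epsilon>" by (auto simp: dist_real_def)
    then have comp: "compact ({0..1} - {x. \<bar>x - r\<bar> < \<epsilon>})"
      using compact_diff[OF compact_Icc open_ball, of 0 1 r \<epsilon>] by simp
    have "continuous_on {0..1} c" using c(1) by (simp add: arc_def path_def)
    then have "continuous_on ({0..1} - {x. \<bar>x - r\<bar> < \<epsilon>}) c" by (rule continuous_on_subset) blast
    then show "closed (c ` ({0..1} - {x. \<bar>x - r\<bar> < \<epsilon>}))"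
      by (rule compact_imp_closed[OF compact_continuous_image[OF _ comp]])
    show "p \<notin> c ` ({0..1} - {x. \<bar>x - r\<bar> < \<epsilon>})"
    proof
      assume "p \<in> c ` ({0..1} - {x. \<bar>x - r\<bar> < \<epsilon>})"
      then obtain x where "x \<in> {0..1} - {x. \<bar>x - r\<bar> < \<epsilon>}" "p = c x" by blast
      then have x: "x \<in> {0..1}" "\<not> \<bar>x - r\<bar> < \<epsilon>" "c x = c r" using c(3) by simp_all
      then have "x = r" using c(1,2) by (auto simp: arc_def inj_on_def)
      then show False using x(2) \<epsilon> by simp
    qed
  qed
  define N where "N = W - g ` ({0..1} - {x. \<bar>x - t\<bar> < \<epsilon>}) - h ` ({0..1} - {x. \<bar>x - s\<bar> < \<epsilon>})"
  have "open N" "p \<in> N" unfolding N_def using W cl[OF g] cl[OF h] by (auto intro!: open_Diff)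
  have "open (ball 0 1 \<inter> \<psi> -` N)"
    by (rule continuous_open_preimage[OF \<psi>c open_ball \<open>open N\<close>])
  moreover have "0 \<in> ball 0 1 \<inter> \<psi> -` N" using \<psi>0 \<open>p \<in> N\<close> by simp
  ultimately obtain r where r: "r > 0" "ball 0 r \<subseteq> ball 0 1 \<inter> \<psi> -` N" by (metis openE)
  \<comment> \<open>Half of the radius, because the arcs of \<open>quadrant_arcs\<close> need a ball
    of radius 2 R.\<close>
  define R where "R = r / 2"
  have R: "R > 0" "2 * R = r" using r(1) by (auto simp: R_def)
  have b1: "z \<in> ball 0 1" "\<psi> z \<in> N" if "z \<in> ball 0 r" for z using r(2) that by auto
  have \<psi>cr: "continuous_on (ball 0 r) \<psi>" using \<psi>c by (rule continuous_on_subset) (use b1 in blast)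
  have re: "complex_of_real u \<in> ball 0 r" "\<i> * complex_of_real u \<in> ball 0 r" if "u \<in> {-R..R}" for u
    using that r(1) by (auto simp: R_def norm_mult)
  have "\<exists>\<delta> \<kappa>. 0 < \<delta> \<and> \<delta> < \<epsilon> \<and> (\<kappa> = 1 \<or> \<kappa> = -1) \<and> \<psi> (of_real (\<kappa> * R)) = g (t + \<sigma> * \<delta>)"
  proof (rule axis_direction[OF g(1,2) \<sigma> R(1), of "\<lambda>u. \<psi> (of_real u)" \<epsilon>])
    show "continuous_on {-R..R} (\<lambda>u. \<psi> (complex_of_real u))"
      using re by (intro continuous_on_compose2[OF \<psi>cr] continuous_intros) blast
    show "inj_on (\<lambda>u. \<psi> (complex_of_real u)) {-R..R}"
      using \<psi>inj b1 re by (intro inj_onI) (metis of_real_eq_iff)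
    show "\<psi> (complex_of_real u) \<in> path_image g" if "u \<in> {-R..R}" for u
      using ong[OF b1(1)[OF re(1)[OF that]]] by simp
    show "\<psi> (complex_of_real 0) = g t" using \<psi>0 g(3) by simp
    fix x :: real assume x: "x \<in> {0..1}" "\<bar>x - t\<bar> \<ge> \<epsilon>"
    show "g x \<notin> (\<lambda>u. \<psi> (complex_of_real u)) ` {-R..R}"
    proof
      assume "g x \<in> (\<lambda>u. \<psi> (complex_of_real u)) ` {-R..R}"
      then obtain u where "u \<in> {-R..R}" "g x = \<psi> (complex_of_real u)" by blast
      then have "g x \<in> N" using b1(2)[OF re(1)] by simp
      then show False using x by (auto simp: N_def)
    qed
  qed blast
  then obtain \<delta> \<kappa> where \<delta>: "0 < \<delta>" "\<delta> < \<epsilon>" "\<kappa> = 1 \<or> \<kappa> = -1" "\<psi> (of_real (\<kappa> * R)) = g (t + \<sigma> * \<delta>)" by blast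
  have "\<exists>\<eta> \<nu>. 0 < \<eta> \<and> \<eta> < \<epsilon> \<and> (\<nu> = 1 \<or> \<nu> = -1) \<and> \<psi> (\<i> * of_real (\<nu> * R)) = h (s + \<tau> * \<eta>)"
  proof (rule axis_direction[OF h(1,2) \<tau> R(1), of "\<lambda>u. \<psi> (\<i> * of_real u)" \<epsilon>])
    show "continuous_on {-R..R} (\<lambda>u. \<psi> (\<i> * complex_of_real u))"
      using re by (intro continuous_on_compose2[OF \<psi>cr] continuous_intros) blast
    show "inj_on (\<lambda>u. \<psi> (\<i> * complex_of_real u)) {-R..R}"
    proof (rule inj_onI)
      fix u v assume uv: "u \<in> {-R..R}" "v \<in> {-R..R}" "\<psi> (\<i> * complex_of_real u) = \<psi> (\<i> * complex_of_real v)"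
      then have "\<i> * complex_of_real u = \<i> * complex_of_real v" using \<psi>inj b1(1)[OF re(2)] by blast
      then show "u = v" by simp
    qed
    show "\<psi> (\<i> * complex_of_real u) \<in> path_image h" if "u \<in> {-R..R}" for u
      using onh[OF b1(1)[OF re(2)[OF that]]] by simp
    show "\<psi> (\<i> * complex_of_real 0) = h s" using \<psi>0 h(3) by simp
    fix x :: real assume x: "x \<in> {0..1}" "\<bar>x - s\<bar> \<ge> \<epsilon>"
    show "h x \<notin> (\<lambda>u. \<psi> (\<i> * complex_of_real u)) ` {-R..R}"
    proof
      assume "h x \<in> (\<lambda>u. \<psi> (\<i> * complex_of_real u)) ` {-R..R}"
      then obtain u where "u \<in> {-R..R}" "h x = \<psi> (\<i> * complex_of_real u)" by blast
      then have "h x \<in> N" using b1(2)[OF re(2)] by simp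
      then show False using x by (auto simp: N_def)
    qed
  qed blast
  then obtain \<eta> \<nu> where \<eta>: "0 < \<eta>" "\<eta> < \<epsilon>" "\<nu> = 1 \<or> \<nu> = -1" "\<psi> (\<i> * of_real (\<nu> * R)) = h (s + \<tau> * \<eta>)" by blast
  \<comment> \<open>The displaced points sit at \<kappa> R on the real axis and at \<nu> R on the
    imaginary one, so the quadrants are taken relative to these two signs.\<close>
  define \<alpha> where "\<alpha> x = Complex (- \<kappa> * R * (x * (1 - x))) (\<nu> * R * x)" for x
  define \<beta> where "\<beta> x = Complex (\<kappa> * R * x) (\<nu> * R * (1 - x))" for x
  define \<gamma> where "\<gamma> x = Complex (\<kappa> * R * (1 - x)) (- \<nu> * R * (x * (1 - x)))" for x
  note Q = quadrant_arcs[OF \<delta>(3) \<eta>(3) R(1), folded \<alpha>_def \<beta>_def \<gamma>_def, unfolded R(2)]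
  have lift: "arc (\<psi> \<circ> c)" "path_image (\<psi> \<circ> c) \<subseteq> W" if c: "arc c" "\<And>x. x \<in> {0..1} \<Longrightarrow> c x \<in> ball 0 r" for c :: "real \<Rightarrow> complex"
  proof -
    have cc: "continuous_on {0..1} c" "inj_on c {0..1}" using c(1) by (auto simp: arc_def path_def)
    have "continuous_on {0..1} (\<psi> \<circ> c)"
      using cc(1) by (rule continuous_on_compose) (rule continuous_on_subset[OF \<psi>cr], use c(2) in auto)
    moreover have "inj_on (\<psi> \<circ> c) {0..1}"
    proof (rule inj_onI)
      fix x y :: real assume xy: "x \<in> {0..1}" "y \<in> {0..1}" "(\<psi> \<circ> c) x = (\<psi> \<circ> c) y"
      then have "c x = c y" using \<psi>inj[OF _ b1(1)[OF c(2)] b1(1)[OF c(2)]] by simp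
      then show "x = y" using cc(2) xy by (auto dest: inj_onD)
    qed
    ultimately show "arc (\<psi> \<circ> c)" by (simp add: arc_def path_def)
    show "path_image (\<psi> \<circ> c) \<subseteq> W" using b1(2)[OF c(2)] by (auto simp: path_image_def N_def)
  qed
  have in1: "\<alpha> x \<in> ball 0 1" "\<beta> x \<in> ball 0 1" "\<gamma> x \<in> ball 0 1" if "x \<in> {0<..<1}" for x
    using Q(4)[of x] b1(1) that by auto
  have "\<psi> (\<alpha> x) \<notin> path_image g \<union> path_image h" "\<psi> (\<beta> x) \<notin> path_image g \<union> path_image h"
    "\<psi> (\<gamma> x) \<notin> path_image g \<union> path_image h" if "x \<in> {0<..<1}" for x
    using ong[OF in1(1)[OF that]] onh[OF in1(1)[OF that]] ong[OF in1(2)[OF that]] onh[OF in1(2)[OF that]]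
      ong[OF in1(3)[OF that]] onh[OF in1(3)[OF that]] Q(5-7)[OF that] by auto
  then have off: "((\<psi> \<circ> \<alpha>) ` {0<..<1} \<union> (\<psi> \<circ> \<beta>) ` {0<..<1} \<union> (\<psi> \<circ> \<gamma>) ` {0<..<1}) \<inter> (path_image g \<union> path_image h) = {}"
    by auto
  have "\<psi> (\<alpha> x) \<noteq> \<psi> (\<beta> y)" "\<psi> (\<beta> x) \<noteq> \<psi> (\<gamma> y)" "\<psi> (\<alpha> x) \<noteq> \<psi> (\<gamma> y)" if x: "x \<in> {0<..<1}" and y: "y \<in> {0<..<1}" for x y
  proof -
    show "\<psi> (\<alpha> x) \<noteq> \<psi> (\<beta> y)" using \<psi>inj[OF _ in1(1)[OF x] in1(2)[OF y]] Q(5)[OF x] Q(6)[OF y] by fastforce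
    show "\<psi> (\<beta> x) \<noteq> \<psi> (\<gamma> y)" using \<psi>inj[OF _ in1(2)[OF x] in1(3)[OF y]] Q(6)[OF x] Q(7)[OF y] by fastforce
    show "\<psi> (\<alpha> x) \<noteq> \<psi> (\<gamma> y)" using \<psi>inj[OF _ in1(1)[OF x] in1(3)[OF y]] Q(5)[OF x] Q(7)[OF y] by fastforce
  qed
  then have dis: "(\<psi> \<circ> \<alpha>) ` {0<..<1} \<inter> (\<psi> \<circ> \<beta>) ` {0<..<1} = {}" "(\<psi> \<circ> \<beta>) ` {0<..<1} \<inter> (\<psi> \<circ> \<gamma>) ` {0<..<1} = {}"
    "(\<psi> \<circ> \<alpha>) ` {0<..<1} \<inter> (\<psi> \<circ> \<gamma>) ` {0<..<1} = {}" by fastforce+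
  have e0: "\<alpha> 0 = 0" "\<alpha> 1 = \<i> * of_real (\<nu> * R)" "\<beta> 0 = \<i> * of_real (\<nu> * R)" "\<beta> 1 = of_real (\<kappa> * R)"
    "\<gamma> 0 = of_real (\<kappa> * R)" "\<gamma> 1 = 0"
    by (simp_all add: \<alpha>_def \<beta>_def \<gamma>_def complex_eq_iff)
  have ends: "pathstart (\<psi> \<circ> \<alpha>) = p" "pathfinish (\<psi> \<circ> \<alpha>) = h (s + \<tau> * \<eta>)"
    "pathstart (\<psi> \<circ> \<beta>) = h (s + \<tau> * \<eta>)" "pathfinish (\<psi> \<circ> \<beta>) = g (t + \<sigma> * \<delta>)"
    "pathstart (\<psi> \<circ> \<gamma>) = g (t + \<sigma> * \<delta>)" "pathfinish (\<psi> \<circ> \<gamma>) = p"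
    by (simp_all only: pathstart_def pathfinish_def comp_apply e0 \<psi>0 \<delta>(4) \<eta>(4))
  have l\<alpha>: "arc (\<psi> \<circ> \<alpha>)" "path_image (\<psi> \<circ> \<alpha>) \<subseteq> W" by (rule lift[OF Q(1)]; use Q(4) in blast)+
  have l\<beta>: "arc (\<psi> \<circ> \<beta>)" "path_image (\<psi> \<circ> \<beta>) \<subseteq> W" by (rule lift[OF Q(2)]; use Q(4) in blast)+
  have l\<gamma>: "arc (\<psi> \<circ> \<gamma>)" "path_image (\<psi> \<circ> \<gamma>) \<subseteq> W" by (rule lift[OF Q(3)]; use Q(4) in blast)+
  show ?thesis
    by (rule exI[of _ \<delta>], rule exI[of _ \<eta>], rule exI[of _ "\<psi> \<circ> \<alpha>"], rule exI[of _ "\<psi> \<circ> \<beta>"], rule exI[of _ "\<psi> \<circ> \<gamma>"])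
      (intro conjI \<delta>(1,2) \<eta>(1,2) l\<alpha> l\<beta> l\<gamma> ends off dis)
qed

section \<open>The graph of a drawing with replaced crossings\<close>

locale drawn_graph =
  fixes G :: "('v, 'e) mgraph" and M :: "('v, 'e) mgraph set" and D :: "('v, 'e) drawing"
    and att :: "complex \<Rightarrow> 'e \<Rightarrow> side \<Rightarrow> half_edge"
  assumes cubic: "cubic G" and cuts: "small_cuts_trivial 4 G" and verts_ne: "verts G \<noteq> {}"
    and matching: "perfect_pseudo_matching G M" and drawing: "avoiding_drawing G M D"
    and attachment: "valid_attachment G D att"
begin

abbreviation "crs \<equiv> crossings G D"

definition tl_vert :: "'e \<Rightarrow> 'v" where "tl_vert e = the_inv_into (verts G) (point D) (pathstart (curve D e))"
definition hd_vert :: "'e \<Rightarrow> 'v" where "hd_vert e = the_inv_into (verts G) (point D) (pathfinish (curve D e))"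
definition cnum :: "'e \<Rightarrow> nat" where "cnum e = card (crossing_params G D e)"
text \<open>Index 0 stands for the start of the curve, so crossings are numbered from 1 and the
  sorted list is read at \<open>k - 1\<close>.\<close>

definition par :: "'e \<Rightarrow> nat \<Rightarrow> real" where
  "par e k = (if k = 0 then 0 else sorted_list_of_set (crossing_params G D e) ! (k - 1))"
definition link :: "'e \<Rightarrow> nat \<Rightarrow> side \<Rightarrow> complex \<times> half_edge" where
  "link e k s = (curve D e (par e k), att (curve D e (par e k)) e s)"

lemma wf: "wf_graph G" and fin: "finite (verts G)" "finite (edges G)"
  using cubicD[OF cubic] by auto

lemma drawing_facts:
  shows "inj_on (point D) (verts G)"
    and "\<And>e. e \<in> edges G \<Longrightarrow> simple_path (curve D e)"
    and "\<And>e. e \<in> edges G \<Longrightarrow> map_uprod (point D) (ends G e) = Upair (pathstart (curve D e)) (pathfinish (curve D e))"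
    and "\<And>e. e \<in> edges G \<Longrightarrow> curve_interior D e \<inter> point D ` verts G = {}"
    and "\<And>e e'. e \<in> edges G \<Longrightarrow> e' \<in> edges G \<Longrightarrow> e \<noteq> e' \<Longrightarrow> finite (curve_interior D e \<inter> curve_interior D e')"
    and "\<And>e e' p. e \<in> edges G \<Longrightarrow> e' \<in> edges G \<Longrightarrow> e \<noteq> e' \<Longrightarrow> p \<in> curve_interior D e \<Longrightarrow> p \<in> curve_interior D e' \<Longrightarrow>
      cross_at (curve D e) (curve D e') p"
    and "\<And>e e'. e \<in> edges G \<Longrightarrow> e' \<in> edges G \<Longrightarrow> e \<noteq> e' \<Longrightarrow> set_uprod (ends G e) \<inter> set_uprod (ends G e') \<noteq> {} \<Longrightarrow>
      curve_interior D e \<inter> curve_interior D e' = {}"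
    and "\<And>e e' e''. e \<in> edges G \<Longrightarrow> e' \<in> edges G \<Longrightarrow> e'' \<in> edges G \<Longrightarrow> e \<noteq> e' \<Longrightarrow> e \<noteq> e'' \<Longrightarrow> e' \<noteq> e'' \<Longrightarrow>
      curve_interior D e \<inter> curve_interior D e' \<inter> curve_interior D e'' = {}"
    and "\<And>e. e \<in> matching_edges M \<Longrightarrow> curve_interior D e \<inter> crs = {}"
  using drawing unfolding avoiding_drawing_def is_drawing_def by (simp_all del: Upair_inject)

lemma ends_tl_hd:
  assumes e: "e \<in> edges G"
  shows "ends G e = Upair (tl_vert e) (hd_vert e)" "tl_vert e \<in> verts G" "hd_vert e \<in> verts G"
    "point D (tl_vert e) = pathstart (curve D e)" "point D (hd_vert e) = pathfinish (curve D e)"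
proof -
  obtain a b where ab: "ends G e = Upair a b" "a \<in> verts G" "b \<in> verts G"
    by (rule wf_graph_ends[OF wf e])
  have "Upair (point D a) (point D b) = Upair (pathstart (curve D e)) (pathfinish (curve D e))"
    using drawing_facts(3)[OF e] ab(1) by (simp del: Upair_inject)
  then have cs: "point D a = pathstart (curve D e) \<and> point D b = pathfinish (curve D e) \<or>
     point D a = pathfinish (curve D e) \<and> point D b = pathstart (curve D e)" by simp
  note inv = the_inv_into_f_f[OF drawing_facts(1)]
  show "ends G e = Upair (tl_vert e) (hd_vert e)" "tl_vert e \<in> verts G" "hd_vert e \<in> verts G"
    "point D (tl_vert e) = pathstart (curve D e)" "point D (hd_vert e) = pathfinish (curve D e)"
    using cs inv[OF ab(2)] inv[OF ab(3)] ab unfolding tl_vert_def hd_vert_def by auto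
qed

lemma arc_curve:
  assumes e: "e \<in> edges G" shows "arc (curve D e)"
proof -
  have "tl_vert e \<noteq> hd_vert e" using small_cuts_loopless[OF cubic cuts _ e] ends_tl_hd(1)[OF e] by fastforce
  then have "pathstart (curve D e) \<noteq> pathfinish (curve D e)"
    using inj_onD[OF drawing_facts(1), of "tl_vert e" "hd_vert e"] ends_tl_hd[OF e] by auto
  then show ?thesis using drawing_facts(2)[OF e] by (simp add: arc_simple_path)
qed

lemma curve_inj: "e \<in> edges G \<Longrightarrow> x \<in> {0..1} \<Longrightarrow> y \<in> {0..1} \<Longrightarrow> curve D e x = curve D e y \<Longrightarrow> x = y"
  using arc_curve by (auto simp: arc_def inj_on_def)

lemma crs_iff: "p \<in> crs \<longleftrightarrow> (\<exists>e\<in>edges G. \<exists>e'\<in>edges G. e \<noteq> e' \<and> p \<in> curve_interior D e \<and> p \<in> curve_interior D e')"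
  unfolding crossings_def by blast

lemma other_edge:
  assumes e: "e \<in> edges G" "p \<in> curve_interior D e" "p \<in> crs"
  obtains e' where "e' \<in> edges G" "e' \<noteq> e" "p \<in> curve_interior D e'"
proof -
  obtain f f' where f: "f \<in> edges G" "f' \<in> edges G" "f \<noteq> f'" "p \<in> curve_interior D f" "p \<in> curve_interior D f'"
    using e(3) crs_iff by blast
  show ?thesis
  proof (cases "f = e")
    case True
    then show ?thesis using that[of f'] f by simp
  next
    case False
    then show ?thesis using that[of f] f by simp
  qed
qed

lemma finite_crs: "finite crs"
proof -
  have "crs \<subseteq> (\<Union>e\<in>edges G. \<Union>e'\<in>edges G - {e}. curve_interior D e \<inter> curve_interior D e')"
    by (auto simp: crossings_def)
  moreover have "finite (\<Union>e\<in>edges G. \<Union>e'\<in>edges G - {e}. curve_interior D e \<inter> curve_interior D e')"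
    using fin(2) drawing_facts(5) by (intro finite_UN_I) auto
  ultimately show ?thesis by (rule finite_subset)
qed

lemma params: "t \<in> crossing_params G D e \<longleftrightarrow> t \<in> {0<..<1} \<and> curve D e t \<in> crs"
  by (auto simp: crossing_params_def)

lemma finite_params:
  assumes e: "e \<in> edges G" shows "finite (crossing_params G D e)"
proof (rule finite_imageD)
  show "finite (curve D e ` crossing_params G D e)"
    by (rule finite_subset[OF _ finite_crs]) (auto simp: crossing_params_def)
  show "inj_on (curve D e) (crossing_params G D e)"
    using curve_inj[OF e] by (auto simp: inj_on_def crossing_params_def)
qed

lemma par_image:
  assumes e: "e \<in> edges G"
  shows "par e ` {1..cnum e} = crossing_params G D e"
proof -
  let ?l = "sorted_list_of_set (crossing_params G D e)"
  have l: "length ?l = cnum e" "set ?l = crossing_params G D e"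
    using finite_params[OF e] by (simp_all add: cnum_def)
  have "par e ` {1..cnum e} = (\<lambda>i. ?l ! i) ` {..<cnum e}"
  proof (rule set_eqI, rule iffI)
    fix x assume "x \<in> par e ` {1..cnum e}"
    then obtain k where "k \<in> {1..cnum e}" "x = ?l ! (k - 1)" by (auto simp: par_def)
    then show "x \<in> (\<lambda>i. ?l ! i) ` {..<cnum e}" by (intro image_eqI[of _ _ "k - 1"]) auto
  next
    fix x assume "x \<in> (\<lambda>i. ?l ! i) ` {..<cnum e}"
    then obtain i where "i < cnum e" "x = ?l ! i" by auto
    then show "x \<in> par e ` {1..cnum e}" by (intro image_eqI[of _ _ "Suc i"]) (auto simp: par_def)
  qed
  also have "\<dots> = set ?l" using l(1) by (auto simp: set_conv_nth)
  finally show ?thesis using l(2) by simp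
qed

lemma par_in: "e \<in> edges G \<Longrightarrow> 1 \<le> k \<Longrightarrow> k \<le> cnum e \<Longrightarrow> par e k \<in> crossing_params G D e"
  using par_image[of e] by force

lemma par_0 [simp]: "par e 0 = 0"
  by (simp add: par_def)

lemma par_less:
  assumes e: "e \<in> edges G" and jk: "j < k" "k \<le> cnum e"
  shows "par e j < par e k"
proof (cases "j = 0")
  case True
  then show ?thesis using par_in[OF e, of k] jk by (auto simp: params)
next
  case False
  let ?l = "sorted_list_of_set (crossing_params G D e)"
  have l: "length ?l = cnum e" using finite_params[OF e] by (simp add: cnum_def)
  have "?l ! (j - 1) < ?l ! (k - 1)"
    using strict_sorted_list_of_set[of "crossing_params G D e"] jk False l
    by (auto simp: sorted_wrt_iff_nth_less)
  then show ?thesis using False jk by (simp add: par_def)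
qed

lemma par_range: "e \<in> edges G \<Longrightarrow> 1 \<le> k \<Longrightarrow> k \<le> cnum e \<Longrightarrow> par e k \<in> {0<..<1} \<and> curve D e (par e k) \<in> crs"
  using par_in[of e k] by (auto simp: params)

lemma par_interior: "e \<in> edges G \<Longrightarrow> 1 \<le> k \<Longrightarrow> k \<le> cnum e \<Longrightarrow> curve D e (par e k) \<in> curve_interior D e"
  using par_range[of e k] by (auto simp: curve_interior_def)

lemma crossing_param_exists:
  assumes e: "e \<in> edges G" "p \<in> curve_interior D e" "p \<in> crs"
  obtains k where "1 \<le> k" "k \<le> cnum e" "curve D e (par e k) = p"
proof -
  obtain t where t: "t \<in> {0<..<1}" "p = curve D e t" using e(2) by (auto simp: curve_interior_def)
  then have "t \<in> crossing_params G D e" using e(3) by (simp add: params)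
  then obtain k where "k \<in> {1..cnum e}" "t = par e k" using par_image[OF e(1)] by blast
  then show ?thesis using that t by auto
qed

lemma par_inj: "e \<in> edges G \<Longrightarrow> k \<le> cnum e \<Longrightarrow> k' \<le> cnum e \<Longrightarrow> par e k = par e k' \<Longrightarrow> k = k'"
  using par_less[of e k k'] par_less[of e k' k] by (metis less_irrefl linorder_neqE_nat)

lemma att_cases:
  assumes "e \<in> edges G" "e' \<in> edges G" "e \<noteq> e'" "p \<in> curve_interior D e" "p \<in> curve_interior D e'"
  shows "range (att p e) = {half_a, half_a'} \<and> range (att p e') = {half_b, half_b'} \<or>
        range (att p e) = {half_b, half_b'} \<and> range (att p e') = {half_a, half_a'}"
  using attachment assms unfolding valid_attachment_def by blast

lemma range_side: "range f = {f Incoming, f Outgoing}"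
proof -
  have "s = Incoming \<or> s = Outgoing" for s by (cases s) auto
  then have "UNIV = {Incoming, Outgoing}" by blast
  then show ?thesis by (metis image_empty image_insert)
qed

lemma att_mate:
  assumes "e \<in> edges G" "p \<in> curve_interior D e" "p \<in> crs"
  shows "att p e Outgoing = mate (att p e Incoming)" "att p e Outgoing \<noteq> att p e Incoming"
proof -
  obtain e' where e': "e' \<in> edges G" "e' \<noteq> e" "p \<in> curve_interior D e'" by (rule other_edge[OF assms])
  have "range (att p e) = {half_a, half_a'} \<or> range (att p e) = {half_b, half_b'}"
    using att_cases[OF assms(1) e'(1) e'(2)[symmetric] assms(2) e'(3)] by blast
  then have "{att p e Incoming, att p e Outgoing} = {half_a, half_a'} \<or> {att p e Incoming, att p e Outgoing} = {half_b, half_b'}"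
    by (simp add: range_side)
  then show "att p e Outgoing = mate (att p e Incoming)" "att p e Outgoing \<noteq> att p e Incoming"
    by (auto simp: doubleton_eq_iff)
qed

lemma att_disjoint:
  assumes "e \<in> edges G" "e' \<in> edges G" "e \<noteq> e'" "p \<in> curve_interior D e" "p \<in> curve_interior D e'"
  shows "att p e s \<noteq> att p e' s'"
proof -
  have "range (att p e) \<inter> range (att p e') = {}" using att_cases[OF assms] by (elim disjE conjE) simp_all
  then show ?thesis using rangeI[of "att p e" s] rangeI[of "att p e'" s'] by (metis IntI empty_iff)
qed

text \<open>All results on cuts, colours and recognition of blocks become available for
  \<open>star_graph\<close>; only the plane drawing still refers to curves.\<close>

sublocale replaced_crossings G "star_graph G D att" tl_vert hd_vert cnum crs link par
proof
  show "cubic G" "small_cuts_trivial 4 G" "verts G \<noteq> {}" "finite crs"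
    by (rule cubic cuts verts_ne finite_crs)+
  show "ends G e = Upair (tl_vert e) (hd_vert e)" if "e \<in> edges G" for e by (rule ends_tl_hd[OF that])
  show "fst (link e k s) \<in> crs" if "e \<in> edges G" "1 \<le> k" "k \<le> cnum e" for e k s
    using par_range[OF that] by (simp add: link_def)
  show "\<exists>e\<in>edges G. \<exists>k s. 1 \<le> k \<and> k \<le> cnum e \<and> link e k s = (p, h)" if p: "p \<in> crs" for p h
  proof -
    obtain e e' where e: "e \<in> edges G" "e' \<in> edges G" "e \<noteq> e'" "p \<in> curve_interior D e" "p \<in> curve_interior D e'"
      using p crs_iff by blast
    have "h \<in> {half_a, half_a', half_b, half_b'}" by (cases h) auto
    then have "h \<in> range (att p e) \<or> h \<in> range (att p e')" using att_cases[OF e] by auto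
    then obtain f s where f: "f \<in> edges G" "p \<in> curve_interior D f" "att p f s = h" using e by blast
    obtain k where "1 \<le> k" "k \<le> cnum f" "curve D f (par f k) = p" by (rule crossing_param_exists[OF f(1,2) p])
    then show ?thesis using f by (intro bexI[of _ f] exI[of _ k] exI[of _ s]) (simp_all add: link_def)
  qed
  show "e = e' \<and> k = k' \<and> s = s'" if k: "e \<in> edges G" "1 \<le> k" "k \<le> cnum e" and k': "e' \<in> edges G" "1 \<le> k'" "k' \<le> cnum e'"
    and eq: "link e k s = link e' k' s'" for e k s e' k' s'
  proof -
    have p: "curve D e (par e k) = curve D e' (par e' k')" and h: "att (curve D e (par e k)) e s = att (curve D e (par e k)) e' s'"
      using eq by (auto simp: link_def)
    note i = par_interior[OF k] par_interior[OF k', folded p]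
    have ee: "e = e'" using att_disjoint[OF k(1) k'(1) _ i] h by blast
    have "par e k = par e k'" using curve_inj[OF k(1) _ _ p[folded ee]] par_range[OF k] par_range[OF k'] ee by auto
    then have kk: "k = k'" using par_inj[OF k(1,3)] k'(3) ee by simp
    have "att (curve D e (par e k)) e Outgoing \<noteq> att (curve D e (par e k)) e Incoming"
      using att_mate(2)[OF k(1) i(1)] par_range[OF k] by blast
    then have "s = s'" using h unfolding ee[symmetric] by (cases s; cases s') auto
    then show ?thesis using ee kk by simp
  qed
  show "k = k'" if k: "e \<in> edges G" "1 \<le> k" "k \<le> cnum e" "1 \<le> k'" "k' \<le> cnum e"
    and eq: "fst (link e k s) = fst (link e k' s')" for e k s k' s'
  proof -
    have "par e k = par e k'" using curve_inj[OF k(1)] par_range[OF k(1-3)] par_range[OF k(1,4,5)] eq by (auto simp: link_def)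
    then show ?thesis using par_inj[OF k(1,3,5)] by simp
  qed
  show "link e k Outgoing = (fst (link e k Incoming), mate (snd (link e k Incoming)))"
    if k: "e \<in> edges G" "1 \<le> k" "k \<le> cnum e" for e k
    using att_mate(1)[OF k(1) par_interior[OF k]] par_range[OF k] by (simp add: link_def)
  show "set_uprod (ends G e) \<inter> set_uprod (ends G e') = {}"
    if k: "e \<in> edges G" "1 \<le> k" "k \<le> cnum e" and k': "e' \<in> edges G" "1 \<le> k'" "k' \<le> cnum e'"
      and eq: "fst (link e k s) = fst (link e' k' s')" and ne: "e \<noteq> e'" for e k s e' k' s'
  proof -
    have "curve D e (par e k) = curve D e' (par e' k')" using eq by (simp add: link_def)
    then have "curve_interior D e \<inter> curve_interior D e' \<noteq> {}" using par_interior[OF k] par_interior[OF k'] by auto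
    then show ?thesis using drawing_facts(7)[OF k(1) k'(1) ne] by blast
  qed
  show "k = k'" if "e \<in> edges G" "k \<le> cnum e" "k' \<le> cnum e" "par e k = par e k'" for e k k'
    by (rule par_inj[OF that])
  show "verts (star_graph G D att) = Old ` verts G \<union> (\<Union>p\<in>crs. block_verts p)"
    by (auto simp: star_graph_def block_verts_def)
  have params0: "insert 0 (crossing_params G D e) = par e ` {0..cnum e}" if "e \<in> edges G" for e
  proof -
    have "{0..cnum e} = insert 0 {1..cnum e}" by auto
    then show ?thesis using par_image[OF that] by simp
  qed
  have "e \<in> edges G \<and> t \<in> insert 0 (crossing_params G D e) \<longleftrightarrow> e \<in> edges G \<and> (\<exists>k\<le>cnum e. t = par e k)" for e t
  proof (cases "e \<in> edges G")
    case True
    then show ?thesis unfolding params0[OF True] by auto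
  qed simp
  then have "{Piece e t | e t. e \<in> edges G \<and> t \<in> insert 0 (crossing_params G D e)} =
      {Piece e t | e t. e \<in> edges G \<and> (\<exists>k\<le>cnum e. t = par e k)}" by (simp only:)
  also have "\<dots> = {Piece e (par e k) | e k. e \<in> edges G \<and> k \<le> cnum e}" by blast
  finally show "edges (star_graph G D att) = {Piece e (par e k) | e k. e \<in> edges G \<and> k \<le> cnum e} \<union>
      {Block_Edge p b | p b. p \<in> crs \<and> b \<in> block_edges}"
    unfolding star_graph_def by simp
  show "ends (star_graph G D att) (Piece e (par e k)) = Upair
      (if k = 0 then Old (tl_vert e) else Block (fst (link e k Outgoing)) (carrier_vertex (snd (link e k Outgoing))))
      (if k = cnum e then Old (hd_vert e) else
        Block (fst (link e (Suc k) Incoming)) (carrier_vertex (snd (link e (Suc k) Incoming))))"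
    if e: "e \<in> edges G" and k: "k \<le> cnum e" for e k
  proof -
    have "par e k = 0 \<longleftrightarrow> k = 0" using par_inj[OF e k, of 0] by auto
    then have 1: "piece_start G D att e (par e k) = (if k = 0 then Old (tl_vert e)
        else Block (fst (link e k Outgoing)) (carrier_vertex (snd (link e k Outgoing))))"
      by (simp add: piece_start_def old_vertex_def block_vertex_def tl_vert_def link_def)
    \<comment> \<open>The crossings after number \<open>k\<close> are those with larger index, so
      the minimum in \<open>piece_end\<close> is the parameter of the next crossing.\<close>
    have S: "{s \<in> crossing_params G D e. par e k < s} = par e ` {Suc k..cnum e}"
    proof (rule set_eqI, rule iffI)
      fix s assume s: "s \<in> {s \<in> crossing_params G D e. par e k < s}"
      then obtain j where j: "j \<in> {1..cnum e}" "s = par e j" using par_image[OF e] by blast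
      have "k < j" using s j par_less[OF e, of j k] k by (cases rule: linorder_cases[of j k]) auto
      then show "s \<in> par e ` {Suc k..cnum e}" using j by auto
    next
      fix s assume "s \<in> par e ` {Suc k..cnum e}"
      then obtain j where "j \<in> {Suc k..cnum e}" "s = par e j" by blast
      then show "s \<in> {s \<in> crossing_params G D e. par e k < s}"
        using par_less[OF e, of k j] par_in[OF e, of j] by auto
    qed
    have 2: "piece_end G D att e (par e k) = (if k = cnum e then Old (hd_vert e) else
        Block (fst (link e (Suc k) Incoming)) (carrier_vertex (snd (link e (Suc k) Incoming))))"
    proof (cases "k = cnum e")
      case True
      then show ?thesis unfolding piece_end_def S by (simp add: old_vertex_def hd_vert_def)
    next
      case False
      have "Min (par e ` {Suc k..cnum e}) = par e (Suc k)"
      proof (rule Min_eqI)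
        show "par e (Suc k) \<in> par e ` {Suc k..cnum e}" using False k by auto
        fix y assume "y \<in> par e ` {Suc k..cnum e}"
        then obtain j where "j \<in> {Suc k..cnum e}" "y = par e j" by blast
        then show "par e (Suc k) \<le> y" using par_less[OF e, of "Suc k" j] by (cases "j = Suc k") auto
      qed simp
      then show ?thesis unfolding piece_end_def S using False k
        by (simp add: Let_def block_vertex_def link_def)
    qed
    show ?thesis using 1 2 by (simp add: star_graph_def)
  qed
  show "ends (star_graph G D att) (Block_Edge p (i, j)) = Upair (Block p i) (Block p j)" for p i j
    by (simp add: star_graph_def)
qed

end

section \<open>A plane drawing with three points for every block\<close>

text \<open>The block of a crossing is partitioned into the star with centre 1 and leaves 0, 2, 6 and the
  two edges 35 and 47.\<close>

definition block_matching :: "(nat \<times> nat) set" where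
  "block_matching = {(0, 1), (1, 2), (1, 6), (3, 5), (4, 7)}"

text \<open>The half-edges carried by 7 and 5, which lie outside the star of the block and are
  therefore drawn away from the crossing. Of two mates exactly one is shifted, so each of the
  crossing curves has one displaced point.\<close>

definition shifted :: "half_edge \<Rightarrow> bool" where
  "shifted h \<longleftrightarrow> h = half_a' \<or> h = half_b"

lemma shifted_mate: "shifted (mate h) \<longleftrightarrow> \<not> shifted h"
  by (cases h) (auto simp: shifted_def)

text \<open>The star of the block is drawn at the crossing \<open>p\<close> itself, the edges 35 and 47 at nearby
  points of the two crossing curves, on the sides of \<open>b\<close> and of \<open>a'\<close>.\<close>

locale plane_replacement = drawn_graph G M D att
  for G :: "('v, 'e) mgraph" and M D att +
  fixes ea eb :: "complex \<Rightarrow> 'e" and ka kb :: "complex \<Rightarrow> nat" and \<delta> \<eta> :: "complex \<Rightarrow> real"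
    and \<alpha> \<beta> \<gamma> :: "complex \<Rightarrow> real \<Rightarrow> complex" and \<epsilon> :: real
    and pr :: "'e \<Rightarrow> nat \<Rightarrow> real" and off :: "'e \<Rightarrow> nat \<Rightarrow> real" and spt :: "'e \<Rightarrow> nat \<Rightarrow> complex"
    and Ar :: "complex \<Rightarrow> complex set"
  defines "pr \<equiv> \<lambda>e k. if k = Suc (cnum e) then 1 else par e k"
    and "off \<equiv> \<lambda>e k. if 1 \<le> k \<and> k \<le> cnum e then
      (if shifted (att (curve D e (par e k)) e Outgoing) then 1 else -1) *
      (if e = ea (curve D e (par e k)) then \<delta> (curve D e (par e k)) else \<eta> (curve D e (par e k))) else 0"
    and "spt \<equiv> \<lambda>e k. curve D e (par e k + off e k)"
    and "Ar \<equiv> \<lambda>p. \<alpha> p ` {0<..<1} \<union> \<beta> p ` {0<..<1} \<union> \<gamma> p ` {0<..<1}"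
  assumes gap: "\<And>e j k. e \<in> edges G \<Longrightarrow> j < k \<Longrightarrow> k \<le> Suc (cnum e) \<Longrightarrow> pr e j + 2 * \<epsilon> < pr e k"
    and at_a: "\<And>p. p \<in> crs \<Longrightarrow> ea p \<in> edges G \<and> 1 \<le> ka p \<and> ka p \<le> cnum (ea p) \<and>
      curve D (ea p) (par (ea p) (ka p)) = p \<and> range (att p (ea p)) = {half_a, half_a'}"
    and at_b: "\<And>p. p \<in> crs \<Longrightarrow> eb p \<in> edges G \<and> 1 \<le> kb p \<and> kb p \<le> cnum (eb p) \<and>
      curve D (eb p) (par (eb p) (kb p)) = p \<and> range (att p (eb p)) = {half_b, half_b'}"
    and small: "\<And>p. p \<in> crs \<Longrightarrow> 0 < \<delta> p \<and> \<delta> p < \<epsilon> \<and> 0 < \<eta> p \<and> \<eta> p < \<epsilon>"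
    and arcs: "\<And>p. p \<in> crs \<Longrightarrow> arc (\<alpha> p) \<and> arc (\<beta> p) \<and> arc (\<gamma> p)"
    and arc_ends: "\<And>p. p \<in> crs \<Longrightarrow> pathstart (\<alpha> p) = p \<and> pathfinish (\<alpha> p) = spt (eb p) (kb p) \<and>
      pathstart (\<beta> p) = spt (eb p) (kb p) \<and> pathfinish (\<beta> p) = spt (ea p) (ka p) \<and>
      pathstart (\<gamma> p) = spt (ea p) (ka p) \<and> pathfinish (\<gamma> p) = p"
    and arcs_off_curves: "\<And>p e. p \<in> crs \<Longrightarrow> e \<in> edges G \<Longrightarrow> Ar p \<inter> path_image (curve D e) = {}"
    and arcs_off_points: "\<And>p. p \<in> crs \<Longrightarrow> Ar p \<inter> point D ` verts G = {}"
    and arcs_disjoint: "\<And>p. p \<in> crs \<Longrightarrow> \<alpha> p ` {0<..<1} \<inter> \<beta> p ` {0<..<1} = {} \<and>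
      \<beta> p ` {0<..<1} \<inter> \<gamma> p ` {0<..<1} = {} \<and> \<alpha> p ` {0<..<1} \<inter> \<gamma> p ` {0<..<1} = {}"
    and arcs_apart: "\<And>p q. p \<in> crs \<Longrightarrow> q \<in> crs \<Longrightarrow> p \<noteq> q \<Longrightarrow> Ar p \<inter> Ar q = {}"
begin

abbreviation "X \<equiv> star_graph G D att"

text \<open>No three edges have a common interior point, so a passage through \<open>p\<close> is
  one of the two recorded in \<open>at_a\<close> and \<open>at_b\<close>.\<close>

lemma at_crossing:
  assumes "e \<in> edges G" "1 \<le> k" "k \<le> cnum e" "curve D e (par e k) = p"
  shows "p \<in> crs" "e = ea p \<and> k = ka p \<or> e = eb p \<and> k = kb p" "ea p \<noteq> eb p"
proof -
  show p: "p \<in> crs" using par_range[OF assms(1-3)] assms(4) by simp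
  note a = at_a[OF p] and b = at_b[OF p]
  show ne: "ea p \<noteq> eb p" using a b by auto
  have k: "k = k'" if "e = e'" "1 \<le> k'" "k' \<le> cnum e'" "curve D e' (par e' k') = p" for e' k'
    using link_once[OF assms(1-3), of k' Incoming Incoming] that assms(4) by (simp add: link_def)
  have ints: "p \<in> curve_interior D e" "p \<in> curve_interior D (ea p)" "p \<in> curve_interior D (eb p)"
    using par_interior[OF assms(1-3)] par_interior[of "ea p" "ka p"] par_interior[of "eb p" "kb p"] assms(4) a b by auto
  have "e = ea p \<or> e = eb p"
    using drawing_facts(8)[of e "ea p" "eb p"] ints a b assms(1) ne by blast
  then show "e = ea p \<and> k = ka p \<or> e = eb p \<and> k = kb p" using k a b by blast
qed

lemma off_out: "\<not> (1 \<le> k \<and> k \<le> cnum e) \<Longrightarrow> off e k = 0"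
  by (auto simp: off_def)

lemma off_bounds:
  assumes k: "e \<in> edges G" "1 \<le> k" "k \<le> cnum e"
  shows "\<bar>off e k\<bar> < \<epsilon>" "off e k \<noteq> 0" "off e k > 0 \<longleftrightarrow> shifted (att (curve D e (par e k)) e Outgoing)"
proof -
  define r where "r = (if e = ea (curve D e (par e k)) then \<delta> (curve D e (par e k)) else \<eta> (curve D e (par e k)))"
  have r: "0 < r" "r < \<epsilon>" using small[OF at_crossing(1)[OF k refl]] by (auto simp: r_def)
  have o: "off e k = (if shifted (att (curve D e (par e k)) e Outgoing) then 1 else -1) * r"
    using k by (simp add: off_def r_def)
  show "\<bar>off e k\<bar> < \<epsilon>" "off e k \<noteq> 0" "off e k > 0 \<longleftrightarrow> shifted (att (curve D e (par e k)) e Outgoing)"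
    unfolding o using r by auto
qed

lemma off_le: "e \<in> edges G \<Longrightarrow> \<bar>off e k\<bar> < \<epsilon> \<or> off e k = 0"
  using off_bounds(1)[of e k] off_out[of k e] by blast

lemma pr_simps [simp]: "pr e 0 = 0" "pr e (Suc (cnum e)) = 1" "k \<le> cnum e \<Longrightarrow> pr e k = par e k"
  by (auto simp: pr_def)

lemma off_simps [simp]: "off e 0 = 0" "off e (Suc (cnum e)) = 0"
  by (auto simp: off_def)

lemma pr_less: 
  assumes e: "e \<in> edges G" and jk: "j < k" "k \<le> Suc (cnum e)"
  shows "pr e j < pr e k"
proof (cases "k = Suc (cnum e)")
  case True
  then show ?thesis using par_range[OF e, of j] jk by (cases "j = 0") auto
next
  case False
  then show ?thesis using par_less[OF e, of j k] jk by simp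
qed

text \<open>Crossing parameters differ by more than 2 \<epsilon> and each displacement is smaller
  than \<epsilon>, so displaced points keep their order along the curve.\<close>

lemma shift_less:
  assumes e: "e \<in> edges G" and jk: "j < k" "k \<le> Suc (cnum e)"
    and ab: "a = 0 \<or> a = off e j" "b = 0 \<or> b = off e k"
  shows "pr e j + a < pr e k + b"
proof -
  have "\<bar>a\<bar> < \<epsilon> \<or> a = 0" "\<bar>b\<bar> < \<epsilon> \<or> b = 0" using ab off_le[OF e, of j] off_le[OF e, of k] by auto
  then show ?thesis using gap[OF e jk] pr_less[OF e jk] by (elim disjE) linarith+
qed

text \<open>A positive displacement at a crossing shortens the piece after it, a negative one the
  piece before it. The stub thus cut off, between the crossing and the displaced point, carries the
  block edge 03 on the curve of b and 67 on the curve of a.\<close>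

definition lo :: "'e \<Rightarrow> nat \<Rightarrow> real" where "lo e k = pr e k + max 0 (off e k)"
definition hi :: "'e \<Rightarrow> nat \<Rightarrow> real" where "hi e k = pr e (Suc k) + min 0 (off e (Suc k))"
definition stub_lo :: "'e \<Rightarrow> nat \<Rightarrow> real" where "stub_lo e k = pr e k + min 0 (off e k)"
definition stub_hi :: "'e \<Rightarrow> nat \<Rightarrow> real" where "stub_hi e k = pr e k + max 0 (off e k)"

lemma mm: "max 0 (off e k) = 0 \<or> max 0 (off e k) = off e k" "min 0 (off e k) = 0 \<or> min 0 (off e k) = off e k"
  by (auto simp: max_def min_def)

text \<open>The parameters \<open>pr e j\<close> and \<open>pr e j + off e j\<close> are marks.
  Since a segment begins at a mark and has no mark inside, two segments of one edge with different
  lower ends cannot overlap.\<close>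

definition segment :: "'e \<Rightarrow> real \<Rightarrow> real \<Rightarrow> bool" where
  "segment e l h \<longleftrightarrow> e \<in> edges G \<and> 0 \<le> l \<and> l < h \<and> h \<le> 1 \<and>
     (\<exists>j\<le>Suc (cnum e). l = pr e j \<or> l = pr e j + off e j) \<and>
     (\<forall>x j. l < x \<longrightarrow> x < h \<longrightarrow> j \<le> Suc (cnum e) \<longrightarrow> x \<noteq> pr e j \<and> x \<noteq> pr e j + off e j)"

lemma segment_overlap:
  assumes "segment e l h" "segment e l' h'" "l < l'" shows "\<not> l' < h"
proof
  assume "l' < h"
  obtain j where "j \<le> Suc (cnum e)" "l' = pr e j \<or> l' = pr e j + off e j" using assms(2) unfolding segment_def by blast
  then show False using assms(1,3) \<open>l' < h\<close> unfolding segment_def by blast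
qed

lemma pr_bounds:
  assumes e: "e \<in> edges G" and k: "k \<le> Suc (cnum e)" and a: "a = 0 \<or> a = off e k"
  shows "0 \<le> pr e k + a" "pr e k + a \<le> 1"
proof -
  show "0 \<le> pr e k + a" using shift_less[OF e, of 0 k 0 a] k a by (cases "k = 0") auto
  show "pr e k + a \<le> 1" using shift_less[OF e, of k "Suc (cnum e)" a 0] k a by (cases "k = Suc (cnum e)") auto
qed

lemma segment_piece:
  assumes e: "e \<in> edges G" and k: "k \<le> cnum e"
  shows "segment e (lo e k) (hi e k)"
  unfolding segment_def
proof (intro conjI allI impI)
  show "e \<in> edges G" by (rule e)
  show "0 \<le> lo e k" unfolding lo_def using k mm by (intro pr_bounds[OF e]) auto
  show "hi e k \<le> 1" unfolding hi_def using k mm by (intro pr_bounds[OF e]) auto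
  show "lo e k < hi e k" unfolding lo_def hi_def using k mm by (intro shift_less[OF e]) auto
  show "\<exists>j\<le>Suc (cnum e). lo e k = pr e j \<or> lo e k = pr e j + off e j"
    using k mm(1)[of e k] by (intro exI[of _ k]) (auto simp: lo_def)
  fix x j assume x: "lo e k < x" "x < hi e k" and j: "j \<le> Suc (cnum e)"
  have "x \<noteq> pr e j + a" if a: "a = 0 \<or> a = off e j" for a
  proof (cases "j \<le> k")
    case True
    have "pr e j + a \<le> lo e k"
    proof (cases "j = k")
      case True
      then show ?thesis using a by (auto simp: lo_def max_def)
    next
      case False
      then show ?thesis using shift_less[OF e, of j k a "max 0 (off e k)"] True k a mm(1)[of e k] by (simp add: lo_def)
    qed
    then show ?thesis using x by linarith
  next
    case False
    have "hi e k \<le> pr e j + a"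
    proof (cases "j = Suc k")
      case True
      then show ?thesis using a by (auto simp: hi_def min_def)
    next
      case False
      then show ?thesis using shift_less[OF e, of "Suc k" j "min 0 (off e (Suc k))" a] \<open>\<not> j \<le> k\<close> j a mm(2)[of e "Suc k"]
        by (simp add: hi_def)
    qed
    then show ?thesis using x by linarith
  qed
  from this[of 0] this[of "off e j"] show "x \<noteq> pr e j" "x \<noteq> pr e j + off e j" by auto
qed

lemma segment_stub:
  assumes e: "e \<in> edges G" and k: "1 \<le> k" "k \<le> cnum e"
  shows "segment e (stub_lo e k) (stub_hi e k)"
  unfolding segment_def
proof (intro conjI allI impI)
  show "e \<in> edges G" by (rule e)
  show "0 \<le> stub_lo e k" unfolding stub_lo_def using k mm by (intro pr_bounds[OF e]) auto
  show "stub_hi e k \<le> 1" unfolding stub_hi_def using k mm by (intro pr_bounds[OF e]) auto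
  show "stub_lo e k < stub_hi e k" using off_bounds(2)[OF e k] by (auto simp: stub_lo_def stub_hi_def)
  show "\<exists>j\<le>Suc (cnum e). stub_lo e k = pr e j \<or> stub_lo e k = pr e j + off e j"
    using k mm(2)[of e k] by (intro exI[of _ k]) (auto simp: stub_lo_def)
  fix x j assume x: "stub_lo e k < x" "x < stub_hi e k" and j: "j \<le> Suc (cnum e)"
  have "x \<noteq> pr e j + a" if a: "a = 0 \<or> a = off e j" for a
  proof (cases rule: linorder_cases[of j k])
    case less
    have "pr e j + a < stub_lo e k" unfolding stub_lo_def
      using less k a mm(2)[of e k] by (intro shift_less[OF e]) auto
    then show ?thesis using x by linarith
  next
    case greater
    have "stub_hi e k < pr e j + a" unfolding stub_hi_def
      using greater k a j mm(1)[of e k] by (intro shift_less[OF e]) auto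
    then show ?thesis using x by linarith
  next
    case equal
    then show ?thesis using a x by (auto simp: stub_lo_def stub_hi_def max_def min_def split: if_splits)
  qed
  from this[of 0] this[of "off e j"] show "x \<noteq> pr e j" "x \<noteq> pr e j + off e j" by auto
qed

lemma shift_eq:
  assumes e: "e \<in> edges G" "j \<le> Suc (cnum e)" "k \<le> Suc (cnum e)" and a: "a = 0 \<or> a = off e j" and b: "b = 0 \<or> b = off e k"
    and eq: "pr e j + a = pr e k + b"
  shows "j = k"
proof (cases rule: linorder_cases[of j k])
  case less
  then show ?thesis using shift_less[OF e(1) less e(3) a b] eq by simp
next
  case greater
  then show ?thesis using shift_less[OF e(1) greater e(2) b a] eq by simp
qed

lemma spt_props:
  assumes k: "e \<in> edges G" "1 \<le> k" "k \<le> cnum e"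
  shows "par e k + off e k \<in> {0<..<1}" "spt e k \<in> curve_interior D e" "spt e k \<notin> crs"
proof -
  show i: "par e k + off e k \<in> {0<..<1}"
    using shift_less[OF k(1), of 0 k 0 "off e k"] shift_less[OF k(1), of k "Suc (cnum e)" "off e k" 0] k by simp
  then show "spt e k \<in> curve_interior D e" by (auto simp: spt_def curve_interior_def)
  show "spt e k \<notin> crs"
  proof
    assume "spt e k \<in> crs"
    then have "par e k + off e k \<in> crossing_params G D e" using i by (simp add: params spt_def)
    then obtain j where j: "j \<in> {1..cnum e}" "par e k + off e k = par e j" using par_image[OF k(1)] by blast
    then have "k = j" using shift_eq[OF k(1), of k j "off e k" 0] k by simp
    then show False using j(2) off_bounds(2)[OF k] by simp
  qed
qed

lemma spt_eq:
  assumes k: "e \<in> edges G" "1 \<le> k" "k \<le> cnum e" and k': "e' \<in> edges G" "1 \<le> k'" "k' \<le> cnum e'"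
    and eq: "spt e k = spt e' k'"
  shows "e = e' \<and> k = k'"
proof -
  have ee: "e = e'"
  proof (rule ccontr)
    assume "e \<noteq> e'"
    then have "spt e k \<in> crs" using crs_iff spt_props(2)[OF k] spt_props(2)[OF k'] eq k(1) k'(1) by metis
    then show False using spt_props(3)[OF k] by simp
  qed
  have "par e k + off e k = par e' k' + off e' k'"
    using curve_inj[OF k(1)] spt_props(1)[OF k] spt_props(1)[OF k'] eq unfolding spt_def ee by auto
  then have "k = k'" using shift_eq[OF k(1), of k k' "off e k" "off e k'"] k k' ee by simp
  then show ?thesis using ee by simp
qed

primrec pt :: "'v star_vertex \<Rightarrow> complex" where
  "pt (Old v) = point D v"
| "pt (Block p i) = (if i \<in> {3, 5} then spt (eb p) (kb p) else if i \<in> {4, 7} then spt (ea p) (ka p) else p)"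

lemma pt_link:
  assumes k: "e \<in> edges G" "1 \<le> k" "k \<le> cnum e"
  shows "pt (link_vertex e k s) = (if shifted (att (curve D e (par e k)) e s) then spt e k else curve D e (par e k))"
proof -
  define p where "p = curve D e (par e k)"
  note ac = at_crossing[OF k p_def[symmetric]]
  have lv: "link_vertex e k s = Block p (carrier_vertex (att p e s))" by (simp add: link_vertex_def link_def p_def)
  have mem: "att p e s \<in> range (att p e)" by simp
  from ac(2) show ?thesis
  proof
    assume e: "e = ea p \<and> k = ka p"
    then have "att p e s = half_a \<or> att p e s = half_a'" using mem at_a[OF ac(1)] by auto
    then show ?thesis unfolding lv p_def[symmetric] using e by (auto simp: shifted_def)
  next
    assume e: "e = eb p \<and> k = kb p"
    then have "att p e s = half_b \<or> att p e s = half_b'" using mem at_b[OF ac(1)] by auto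
    then show ?thesis unfolding lv p_def[symmetric] using e by (auto simp: shifted_def)
  qed
qed

lemma shifted_out_in:
  assumes k: "e \<in> edges G" "1 \<le> k" "k \<le> cnum e"
  shows "shifted (att (curve D e (par e k)) e Incoming) \<longleftrightarrow> \<not> shifted (att (curve D e (par e k)) e Outgoing)"
proof -
  have "att (curve D e (par e k)) e Outgoing = mate (att (curve D e (par e k)) e Incoming)"
    using att_mate(1)[OF k(1) par_interior[OF k]] par_range[OF k] by blast
  then show ?thesis by (simp add: shifted_mate)
qed

lemma pt_source:
  assumes e: "e \<in> edges G" and k: "k \<le> cnum e"
  shows "pt (piece_source e k) = curve D e (lo e k)"
proof (cases "k = 0")
  case True
  then show ?thesis using ends_tl_hd(4)[OF e] by (simp add: piece_source_def lo_def pathstart_def)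
next
  case False
  then have k1: "1 \<le> k" by simp
  have "shifted (att (curve D e (par e k)) e Outgoing) \<longleftrightarrow> off e k > 0" using off_bounds(3)[OF e k1 k] by simp
  then show ?thesis using False k off_bounds(2)[OF e k1 k]
    by (simp add: piece_source_def lo_def pt_link[OF e k1 k] spt_def max_def)
qed

lemma pt_target:
  assumes e: "e \<in> edges G" and k: "k \<le> cnum e"
  shows "pt (piece_target e k) = curve D e (hi e k)"
proof (cases "k = cnum e")
  case True
  then show ?thesis using ends_tl_hd(5)[OF e] by (simp add: piece_target_def hi_def pathfinish_def)
next
  case False
  then have k1: "1 \<le> Suc k" "Suc k \<le> cnum e" using k by auto
  have "shifted (att (curve D e (par e (Suc k))) e Incoming) \<longleftrightarrow> \<not> off e (Suc k) > 0"
    using off_bounds(3)[OF e k1] shifted_out_in[OF e k1] by simp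
  then show ?thesis using False k1 off_bounds(2)[OF e k1]
    by (simp add: piece_target_def hi_def pt_link[OF e k1] spt_def min_def)
qed

text \<open>A piece stores the parameter at which it starts; this recovers its number.\<close>

definition kidx :: "'e \<Rightarrow> real \<Rightarrow> nat" where "kidx e t = inv_into {..cnum e} (par e) t"

lemma kidx_par: "e \<in> edges G \<Longrightarrow> k \<le> cnum e \<Longrightarrow> kidx e (par e k) = k"
  unfolding kidx_def using par_inj[of e] by (intro inv_into_f_f) (auto simp: inj_on_def)

definition on_curve :: "'e star_edge \<Rightarrow> bool" where
  "on_curve f \<longleftrightarrow> (\<exists>e\<in>edges G. \<exists>k\<le>cnum e. f = piece e k) \<or> (\<exists>p\<in>crs. f = Block_Edge p (0, 3) \<or> f = Block_Edge p (6, 7))"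

primrec carrier_edge :: "'e star_edge \<Rightarrow> 'e" where
  "carrier_edge (Piece e t) = e"
| "carrier_edge (Block_Edge p b) = (if b = (0, 3) then eb p else ea p)"

primrec seg_lo :: "'e star_edge \<Rightarrow> real" where
  "seg_lo (Piece e t) = lo e (kidx e t)"
| "seg_lo (Block_Edge p b) = (if b = (0, 3) then stub_lo (eb p) (kb p) else stub_lo (ea p) (ka p))"

primrec seg_hi :: "'e star_edge \<Rightarrow> real" where
  "seg_hi (Piece e t) = hi e (kidx e t)"
| "seg_hi (Block_Edge p b) = (if b = (0, 3) then stub_hi (eb p) (kb p) else stub_hi (ea p) (ka p))"

text \<open>In the quotient a block is a triangle on the crossing and its two displaced points. The
  sides at the crossing are doubled: 03 is a stub and 56 runs along \<alpha>, likewise 67 is a stub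
  and 24 runs along \<gamma>. The third side 34 runs along \<beta>.\<close>

primrec cv :: "'e star_edge \<Rightarrow> real \<Rightarrow> complex" where
  "cv (Piece e t) = subpath (lo e (kidx e t)) (hi e (kidx e t)) (curve D e)"
| "cv (Block_Edge p b) = (if b = (5, 6) then \<alpha> p else if b = (3, 4) then \<beta> p else if b = (2, 4) then \<gamma> p else
     if b = (0, 3) then subpath (stub_lo (eb p) (kb p)) (stub_hi (eb p) (kb p)) (curve D (eb p))
     else subpath (stub_lo (ea p) (ka p)) (stub_hi (ea p) (ka p)) (curve D (ea p)))"

lemma on_curve_segment: "on_curve f \<Longrightarrow> segment (carrier_edge f) (seg_lo f) (seg_hi f)"
  unfolding on_curve_def using segment_piece segment_stub at_a at_b kidx_par by (auto simp: piece_def)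

lemma on_curve_cv: "on_curve f \<Longrightarrow> cv f = subpath (seg_lo f) (seg_hi f) (curve D (carrier_edge f))"
  unfolding on_curve_def by (auto simp: piece_def)

lemma on_curve_kind:
  assumes "on_curve f"
  obtains (piece) e k where "e \<in> edges G" "k \<le> cnum e" "f = piece e k" "carrier_edge f = e" "seg_lo f = pr e k + max 0 (off e k)"
  | (stub) e k p b where "e \<in> edges G" "1 \<le> k" "k \<le> cnum e" "p \<in> crs" "curve D e (par e k) = p" "b = (0, 3) \<and> e = eb p \<or> b = (6, 7) \<and> e = ea p"
    "f = Block_Edge p b" "carrier_edge f = e" "seg_lo f = pr e k + min 0 (off e k)"
proof -
  from assms consider e k where "e \<in> edges G" "k \<le> cnum e" "f = piece e k"
    | p where "p \<in> crs" "f = Block_Edge p (0, 3)" | p where "p \<in> crs" "f = Block_Edge p (6, 7)"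
    unfolding on_curve_def by blast
  then show ?thesis
  proof cases
    case (1 e k)
    then show ?thesis using piece[of e k] kidx_par[of e k] by (simp add: piece_def lo_def)
  next
    case (2 p)
    then show ?thesis using stub[of "eb p" "kb p" p "(0, 3)"] at_b[of p] by (simp add: stub_lo_def)
  next
    case (3 p)
    then show ?thesis using stub[of "ea p" "ka p" p "(6, 7)"] at_a[of p] by (simp add: stub_lo_def)
  qed
qed

text \<open>Equal lower ends on one curve belong to the same crossing. A piece and a stub would then
  start together only if the displacement were zero.\<close>

lemma seg_lo_inj:
  assumes f: "on_curve f" "on_curve f'" "carrier_edge f = carrier_edge f'" "seg_lo f = seg_lo f'"
  shows "f = f'"
  using f(1)
proof (cases rule: on_curve_kind)
  case (piece e k)
  note 1 = piece
  show ?thesis using f(2)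
  proof (cases rule: on_curve_kind)
    case (piece e' k')
    then have "k = k'" using shift_eq[of e k k' "max 0 (off e k)" "max 0 (off e' k')"] 1 f(3,4) mm(1)[of e k] mm(1)[of e' k'] by simp
    then show ?thesis using 1 piece f(3) by simp
  next
    case (stub e' k' p b)
    then have ee: "e' = e" using 1 f(3) by simp
    have "k = k'" using shift_eq[of e k k' "max 0 (off e k)" "min 0 (off e k')"] 1 stub ee f(4) mm(1)[of e k] mm(2)[of e k'] by simp
    then have "max 0 (off e k) = min 0 (off e k)" using 1 stub ee f(4) by simp
    then have "off e k = 0" by (auto simp: max_def min_def split: if_splits)
    then show ?thesis using off_bounds(2)[of e k] 1 stub ee \<open>k = k'\<close> by simp
  qed
next
  case (stub e k p b)
  note 1 = stub
  show ?thesis using f(2)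
  proof (cases rule: on_curve_kind)
    case (piece e' k')
    then have ee: "e' = e" using 1 f(3) by simp
    have "k' = k" using shift_eq[of e k' k "max 0 (off e k')" "min 0 (off e k)"] 1 piece ee f(4) mm(1)[of e k'] mm(2)[of e k] by simp
    then have "max 0 (off e k) = min 0 (off e k)" using 1 piece ee f(4) by simp
    then have "off e k = 0" by (auto simp: max_def min_def split: if_splits)
    then show ?thesis using off_bounds(2)[of e k] 1 by simp
  next
    case (stub e' k' q b')
    then have ee: "e' = e" using 1 f(3) by simp
    have "k = k'" using shift_eq[of e k k' "min 0 (off e k)" "min 0 (off e k')"] 1 stub ee f(4) mm(2)[of e k] mm(2)[of e k'] by simp
    then have pq: "p = q" using 1(5) stub(5) ee by simp
    then have "b = b'" using 1(6) stub(6) ee at_crossing(3)[OF 1(1-3,5)] by auto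
    then show ?thesis using 1 stub pq by simp
  qed
qed

lemma subpath_interior:
  assumes "l < (h::real)"
  shows "subpath l h c ` {0<..<1} = c ` {l<..<h}"
proof -
  have "(\<lambda>x. (h - l) * x + l) ` {0<..<1} = {l<..<h}"
  proof (rule set_eqI, rule iffI)
    fix y assume "y \<in> (\<lambda>x. (h - l) * x + l) ` {0<..<1}"
    then obtain x where x: "0 < x" "x < 1" "y = (h - l) * x + l" by auto
    have "0 < (h - l) * x" "(h - l) * x < (h - l) * 1" using x assms by (auto intro: mult_strict_left_mono)
    then show "y \<in> {l<..<h}" using x(3) by simp
  next
    fix y assume "y \<in> {l<..<h}"
    then show "y \<in> (\<lambda>x. (h - l) * x + l) ` {0<..<1}"
      using assms by (intro image_eqI[of _ _ "(y - l) / (h - l)"]) (auto simp: field_simps)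
  qed
  then show ?thesis unfolding subpath_def by (metis (no_types, lifting) image_cong image_image)
qed

lemma on_curve_interior:
  assumes f: "on_curve f" and z: "z \<in> cv f ` {0<..<1}"
  obtains x where "seg_lo f < x" "x < seg_hi f" "x \<in> {0<..<1}" "z = curve D (carrier_edge f) x"
    "z \<in> curve_interior D (carrier_edge f)" "z \<notin> crs" "carrier_edge f \<in> edges G"
proof -
  let ?e = "carrier_edge f"
  have s: "segment ?e (seg_lo f) (seg_hi f)" by (rule on_curve_segment[OF f])
  then have s1: "?e \<in> edges G" "0 \<le> seg_lo f" "seg_lo f < seg_hi f" "seg_hi f \<le> 1" by (auto simp: segment_def)
  obtain x where x: "seg_lo f < x" "x < seg_hi f" "z = curve D ?e x"
    using z unfolding on_curve_cv[OF f] subpath_interior[OF s1(3)] by auto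
  have x01: "x \<in> {0<..<1}" using x s1 by auto
  have "z \<notin> crs"
  proof
    assume "z \<in> crs"
    then have "x \<in> crossing_params G D ?e" using x01 x(3) by (simp add: params)
    then obtain j where "j \<in> {1..cnum ?e}" "x = par ?e j" using par_image[OF s1(1)] by blast
    then have "j \<le> Suc (cnum ?e)" "x = pr ?e j" by auto
    then show False using s x(1,2) unfolding segment_def by blast
  qed
  then show ?thesis using that x x01 s1(1) by (auto simp: curve_interior_def)
qed

lemma on_curve_not_spt:
  assumes f: "on_curve f" and z: "z \<in> cv f ` {0<..<1}" and k: "e \<in> edges G" "1 \<le> k" "k \<le> cnum e"
  shows "z \<noteq> spt e k"
proof
  assume eq: "z = spt e k"
  obtain x where x: "seg_lo f < x" "x < seg_hi f" "x \<in> {0<..<1}" "z = curve D (carrier_edge f) x"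
    "z \<in> curve_interior D (carrier_edge f)" "z \<notin> crs" "carrier_edge f \<in> edges G"
    by (rule on_curve_interior[OF f z])
  have ee: "e = carrier_edge f" using crs_iff x(5-7) spt_props(2)[OF k] k(1) eq by blast
  have "x = par e k + off e k" using curve_inj[OF k(1)] x(3,4) spt_props(1)[OF k] eq unfolding spt_def ee by auto
  then have "x = pr e k + off e k" "k \<le> Suc (cnum e)" using k by auto
  then show False using on_curve_segment[OF f] x(1,2) unfolding segment_def ee by blast
qed

lemma pt_cases:
  assumes "x \<in> verts X"
  shows "pt x \<in> point D ` verts G \<or> pt x \<in> crs \<or> (\<exists>e k. e \<in> edges G \<and> 1 \<le> k \<and> k \<le> cnum e \<and> pt x = spt e k)"
proof (cases x)
  case (Old v)
  then show ?thesis using assms by simp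
next
  case (Block p i)
  then have p: "p \<in> crs" using assms by simp
  show ?thesis using at_a[OF p] at_b[OF p] p Block by auto
qed

lemma on_curve_avoids:
  assumes f: "on_curve f" shows "cv f ` {0<..<1} \<inter> pt ` verts X = {}"
proof -
  have False if z: "z \<in> cv f ` {0<..<1}" and x: "x \<in> verts X" "z = pt x" for z x
  proof -
    obtain y where y: "z \<in> curve_interior D (carrier_edge f)" "z \<notin> crs" "carrier_edge f \<in> edges G"
      by (rule on_curve_interior[OF f z])
    have "z \<notin> point D ` verts G" using drawing_facts(4)[OF y(3)] y(1) by blast
    then show False using pt_cases[OF x(1)] x(2) y(2) on_curve_not_spt[OF f z] by metis
  qed
  then show ?thesis by blast
qed

text \<open>Two different curves meet in their interiors only at crossings, which are marks and
  never inside a segment; on one curve, different segments do not overlap.\<close>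

lemma on_curve_disjoint:
  assumes f: "on_curve f" "on_curve f'" "f \<noteq> f'"
  shows "cv f ` {0<..<1} \<inter> cv f' ` {0<..<1} = {}"
proof -
  have False if z: "z \<in> cv f ` {0<..<1}" "z \<in> cv f' ` {0<..<1}" for z
  proof -
    obtain x where x: "seg_lo f < x" "x < seg_hi f" "x \<in> {0<..<1}" "z = curve D (carrier_edge f) x"
      "z \<in> curve_interior D (carrier_edge f)" "z \<notin> crs" "carrier_edge f \<in> edges G"
      by (rule on_curve_interior[OF f(1) z(1)])
    obtain y where y: "seg_lo f' < y" "y < seg_hi f'" "y \<in> {0<..<1}" "z = curve D (carrier_edge f') y"
      "z \<in> curve_interior D (carrier_edge f')" "z \<notin> crs" "carrier_edge f' \<in> edges G"
      by (rule on_curve_interior[OF f(2) z(2)])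
    have ee: "carrier_edge f = carrier_edge f'" using crs_iff x(5-7) y(5,7) by blast
    have xy: "x = y" using curve_inj[OF x(7)] x(3,4) y(3,4) unfolding ee by auto
    have s: "segment (carrier_edge f) (seg_lo f) (seg_hi f)" "segment (carrier_edge f) (seg_lo f') (seg_hi f')"
      using on_curve_segment[OF f(1)] on_curve_segment[OF f(2), folded ee] by simp_all
    have "seg_lo f \<noteq> seg_lo f'" using seg_lo_inj[OF f(1,2) ee] f(3) by blast
    then consider "seg_lo f < seg_lo f'" | "seg_lo f' < seg_lo f" by linarith
    then show False
    proof cases
      case 1
      then have "seg_lo f' < seg_hi f" using x y xy by linarith
      then show False using segment_overlap[OF s 1] by simp
    next
      case 2
      then have "seg_lo f < seg_hi f'" using x y xy by linarith
      then show False using segment_overlap[OF s(2,1) 2] by simp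
    qed
  qed
  then show ?thesis by blast
qed

lemma on_curve_in_path:
  assumes f: "on_curve f"
  shows "\<exists>e\<in>edges G. cv f ` {0<..<1} \<subseteq> path_image (curve D e)"
proof -
  have e: "carrier_edge f \<in> edges G" using on_curve_segment[OF f] by (simp add: segment_def)
  have "z \<in> path_image (curve D (carrier_edge f))" if z: "z \<in> cv f ` {0<..<1}" for z
  proof -
    obtain x where "x \<in> {0<..<1}" "z = curve D (carrier_edge f) x" by (rule on_curve_interior[OF f z])
    then show ?thesis by (auto simp: path_image_def)
  qed
  then show ?thesis using e by blast
qed

definition extra :: "complex \<Rightarrow> 'e star_edge \<Rightarrow> bool" where
  "extra p f \<longleftrightarrow> p \<in> crs \<and> f \<in> Block_Edge p ` {(5, 6), (3, 4), (2, 4)}"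

lemma extra_interior: "extra p f \<Longrightarrow> cv f ` {0<..<1} \<subseteq> Ar p"
  by (auto simp: extra_def Ar_def)

lemma extra_avoids:
  assumes f: "extra p f" shows "cv f ` {0<..<1} \<inter> pt ` verts X = {}"
proof -
  have p: "p \<in> crs" using f by (simp add: extra_def)
  have "pt x \<notin> Ar p" if x: "x \<in> verts X" for x
  proof -
    from pt_cases[OF x] consider "pt x \<in> point D ` verts G" | "pt x \<in> crs"
      | e k where "e \<in> edges G" "1 \<le> k" "k \<le> cnum e" "pt x = spt e k" by blast
    then show ?thesis
    proof cases
      case 1
      then show ?thesis using arcs_off_points[OF p] by blast
    next
      case 2
      then obtain e where "e \<in> edges G" "pt x \<in> curve_interior D e" using crs_iff by blast
      moreover from this have "pt x \<in> path_image (curve D e)" by (auto simp: curve_interior_def path_image_def)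
      ultimately show ?thesis using arcs_off_curves[OF p] by blast
    next
      case (3 e k)
      then have "pt x \<in> path_image (curve D e)" using spt_props(2)[OF 3(1-3)]
        by (auto simp: curve_interior_def path_image_def)
      then show ?thesis using arcs_off_curves[OF p 3(1)] by blast
    qed
  qed
  then have "Ar p \<inter> pt ` verts X = {}" unfolding disjoint_iff by (metis imageE)
  then show ?thesis using extra_interior[OF f] by (metis Int_mono subset_empty subset_refl)
qed

lemma extra_disjoint:
  assumes "extra p f" "extra q f'" "f \<noteq> f'"
  shows "cv f ` {0<..<1} \<inter> cv f' ` {0<..<1} = {}"
proof (cases "p = q")
  case False
  then show ?thesis using extra_interior[OF assms(1)] extra_interior[OF assms(2)] arcs_apart[of p q] assms
    unfolding extra_def by blast
next
  case True
  have "p \<in> crs" using assms(1) by (simp add: extra_def)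
  note d = arcs_disjoint[OF this]
  obtain b b' where b: "f = Block_Edge p b" "b \<in> {(5, 6), (3, 4), (2, 4)}" "f' = Block_Edge p b'" "b' \<in> {(5, 6), (3, 4), (2, 4)}"
    using assms(1,2) True unfolding extra_def by blast
  have "b \<noteq> b'" using b assms(3) by blast
  then show ?thesis using b(2,4) d unfolding b(1,3)
    by (elim insertE emptyE) (simp_all add: Int_commute)
qed

lemma extra_on_curve_disjoint:
  assumes "extra p f" "on_curve f'"
  shows "cv f ` {0<..<1} \<inter> cv f' ` {0<..<1} = {}"
proof -
  obtain e where "e \<in> edges G" "cv f' ` {0<..<1} \<subseteq> path_image (curve D e)" using on_curve_in_path[OF assms(2)] by blast
  moreover have "p \<in> crs" using assms(1) by (simp add: extra_def)
  ultimately show ?thesis using extra_interior[OF assms(1)] arcs_off_curves by blast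
qed

definition block_F :: "'e star_edge set" where
  "block_F = {Block_Edge p b | p b. p \<in> crs \<and> b \<in> block_matching}"

lemma not_F_cases:
  assumes "f \<in> edges X - block_F"
  shows "on_curve f \<or> (\<exists>p. extra p f)"
proof -
  have "f \<in> edges X" using assms by simp
  then show ?thesis
  proof (cases rule: edges_X_cases)
    case (1 e k)
    then show ?thesis by (auto simp: on_curve_def)
  next
    case (2 p i j)
    then have "(i, j) \<notin> block_matching" using assms by (auto simp: block_F_def)
    then have "(i, j) \<in> {(3, 4), (5, 6), (6, 7), (0, 3), (2, 4)}" using 2(2) unfolding block_edges_def block_matching_def by auto
    then show ?thesis using 2 by (auto simp: on_curve_def extra_def)
  qed
qed

lemma stub_ends:
  assumes k: "e \<in> edges G" "1 \<le> k" "k \<le> cnum e"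
  shows "Upair (curve D e (stub_lo e k)) (curve D e (stub_hi e k)) = Upair (curve D e (par e k)) (spt e k)"
  using off_bounds(2)[OF k] k by (auto simp: stub_lo_def stub_hi_def spt_def max_def min_def)

lemma cv_simple_ends:
  assumes f: "f \<in> edges X - block_F"
  shows "simple_path (cv f) \<and> map_uprod pt (ends X f) = Upair (pathstart (cv f)) (pathfinish (cv f))"
  using not_F_cases[OF f]
proof (elim disjE exE)
  assume c: "on_curve f"
  have s: "segment (carrier_edge f) (seg_lo f) (seg_hi f)" by (rule on_curve_segment[OF c])
  then have "simple_path (subpath (seg_lo f) (seg_hi f) (curve D (carrier_edge f)))"
    by (intro simple_path_subpath drawing_facts(2)) (auto simp: segment_def)
  moreover have "map_uprod pt (ends X f) = Upair (curve D (carrier_edge f) (seg_lo f)) (curve D (carrier_edge f) (seg_hi f))"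
    using c unfolding on_curve_def
  proof (elim disjE bexE exE conjE)
    fix e k assume e: "e \<in> edges G" "k \<le> cnum e" "f = piece e k"
    then show ?thesis using ends_piece'[OF e(1,2)] kidx_par[OF e(1,2)]
      by (simp add: pt_source pt_target piece_def del: Upair_inject)
  next
    fix p assume p: "p \<in> crs" "f = Block_Edge p (0, 3)"
    then show ?thesis using stub_ends[of "eb p" "kb p"] at_b[OF p(1)] ends_block_edge[OF p(1) block_edges_list(6)]
      by (simp del: Upair_inject)
  next
    fix p assume p: "p \<in> crs" "f = Block_Edge p (6, 7)"
    then show ?thesis using stub_ends[of "ea p" "ka p"] at_a[OF p(1)] ends_block_edge[OF p(1) block_edges_list(5)]
      by (simp del: Upair_inject)
  qed
  ultimately show ?thesis unfolding on_curve_cv[OF c] by (simp del: Upair_inject)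
next
  fix p assume e: "extra p f"
  then have p: "p \<in> crs" by (simp add: extra_def)
  note en = ends_block_edge[OF p block_edges_list(4)] ends_block_edge[OF p block_edges_list(3)] ends_block_edge[OF p block_edges_list(9)]
  show ?thesis using e arcs[OF p] arc_ends[OF p] en unfolding extra_def by (auto simp: arc_imp_simple_path)
qed

text \<open>The substantial direction is that points of vertices of \<open>G\<close>, crossings and
  displaced points are pairwise distinct, so that equal points force the same old vertex or the same
  matching member of one block.\<close>

lemma pt_eq_connected:
  assumes uv: "u \<in> verts X" "v \<in> verts X"
  shows "pt u = pt v \<longleftrightarrow> (u, v) \<in> (adj (X\<lparr>edges := block_F\<rparr>))\<^sup>*"
proof
  let ?R = "adj (X\<lparr>edges := block_F\<rparr>)"
  assume "(u, v) \<in> ?R\<^sup>*"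
  then show "pt u = pt v"
  proof (induction rule: rtrancl_induct)
    case (step y z)
    then obtain f where "f \<in> block_F" "ends X f = Upair y z" by (auto simp: adj_def)
    then obtain p i j where p: "p \<in> crs" "(i, j) \<in> block_matching" "ends X (Block_Edge p (i, j)) = Upair y z"
      by (auto simp: block_F_def)
    moreover have "(i, j) \<in> block_edges" using p(2) by (auto simp: block_matching_def block_edges_def)
    ultimately have "Upair (Block p i) (Block p j) = Upair y z" by (simp add: ends_block_edge del: Upair_inject)
    moreover have "pt (Block p i) = pt (Block p j)" using p(2) by (auto simp: block_matching_def)
    ultimately have "pt y = pt z" by auto
    then show ?case using step by simp
  qed simp
next
  let ?R = "adj (X\<lparr>edges := block_F\<rparr>)"
  assume eq: "pt u = pt v"
  have ed: "(Block p i, Block p j) \<in> ?R" if "p \<in> crs" "(i, j) \<in> block_matching" for p i j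
  proof -
    have "(i, j) \<in> block_edges" using that(2) by (auto simp: block_matching_def block_edges_def)
    then show ?thesis using that ends_block_edge[of p i j] unfolding adj_def block_F_def by auto
  qed
  have ed': "(Block p j, Block p i) \<in> ?R" if "p \<in> crs" "(i, j) \<in> block_matching" for p i j
    by (rule adj_sym[OF ed[OF that]])
  \<comment> \<open>A representative for each of the three members: 3 and 4 for the single edges,
    the centre 1 for the star.\<close>
  have centre: "(Block p i, Block p (if i \<in> {3, 5} then 3 else if i \<in> {4, 7} then 4 else 1)) \<in> ?R\<^sup>*"
    if p: "p \<in> crs" and i: "i \<in> {0..7}" for p i
  proof -
    have i': "i = 0 \<or> i = 1 \<or> i = 2 \<or> i = 3 \<or> i = 4 \<or> i = 5 \<or> i = 6 \<or> i = 7"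
      using i by (simp add: atLeastAtMost_iff) linarith
    have "(Block p 0, Block p 1) \<in> ?R" "(Block p 2, Block p 1) \<in> ?R" "(Block p 6, Block p 1) \<in> ?R"
      "(Block p 5, Block p 3) \<in> ?R" "(Block p 7, Block p 4) \<in> ?R"
      using ed[OF p, of 0 1] ed'[OF p, of 1 2] ed'[OF p, of 1 6] ed'[OF p, of 3 5] ed'[OF p, of 4 7]
      by (simp_all add: block_matching_def)
    then show ?thesis using i' by (elim disjE) auto
  qed
  have special: "pt (Block p i) \<in> crs \<or> (\<exists>e k. e \<in> edges G \<and> 1 \<le> k \<and> k \<le> cnum e \<and> pt (Block p i) = spt e k)"
    if p: "p \<in> crs" for p i
    using at_a[OF p] at_b[OF p] p by auto
  have old_block: "point D w \<noteq> pt (Block p i)" if w: "w \<in> verts G" and p: "p \<in> crs" for w p i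
  proof
    assume h: "point D w = pt (Block p i)"
    have "\<exists>e\<in>edges G. pt (Block p i) \<in> curve_interior D e"
      using special[OF p, of i] crs_iff spt_props(2) by metis
    then show False using drawing_facts(4) h w by (metis IntI empty_iff imageI)
  qed
  show "(u, v) \<in> ?R\<^sup>*"
  proof (cases u)
    case (Old w)
    note u = Old
    show ?thesis
    proof (cases v)
      case (Old w')
      then have "w = w'" using eq u uv inj_onD[OF drawing_facts(1), of w w'] by simp
      then show ?thesis using u Old by simp
    next
      case (Block p i)
      then show ?thesis using old_block[of w p i] eq u uv by (simp del: pt.simps(2))
    qed
  next
    case (Block p i)
    note u = Block
    show ?thesis
    proof (cases v)
      case (Old w)
      then show ?thesis using old_block[of w p i] eq u uv by (simp del: pt.simps(2))
    next
      case (Block q j)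
      have pq: "p \<in> crs" "q \<in> crs" "i \<in> {0..7}" "j \<in> {0..7}" using uv u Block by auto
      note a = at_a[OF pq(1)] at_a[OF pq(2)] and b = at_b[OF pq(1)] at_b[OF pq(2)]
      have nc: "spt (ea p) (ka p) \<notin> crs" "spt (eb p) (kb p) \<notin> crs" "spt (ea q) (ka q) \<notin> crs" "spt (eb q) (kb q) \<notin> crs"
        using a b by (simp_all add: spt_props(3))
      have sa: "p = q" if "spt (ea p) (ka p) = spt (ea q) (ka q)"
        using spt_eq[OF _ _ _ _ _ _ that] a by metis
      have sb: "p = q" if "spt (eb p) (kb p) = spt (eb q) (kb q)"
        using spt_eq[OF _ _ _ _ _ _ that] b by metis
      have sab: "spt (ea p) (ka p) \<noteq> spt (eb q) (kb q)" if pq': "p \<in> crs" "q \<in> crs" for p q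
      proof
        assume h: "spt (ea p) (ka p) = spt (eb q) (kb q)"
        note a = at_a[OF pq'(1)] and b = at_b[OF pq'(2)]
        have "ea p = eb q \<and> ka p = kb q" using spt_eq[OF _ _ _ _ _ _ h] a b by blast
        then have "p = q" using a b by metis
        then show False using \<open>ea p = eb q \<and> ka p = kb q\<close> a b by auto
      qed
      have "p = q \<and> (i \<in> {3, 5} \<longleftrightarrow> j \<in> {3, 5}) \<and> (i \<in> {4, 7} \<longleftrightarrow> j \<in> {4, 7})"
        using eq pq(1,2) nc sa sb sab[OF pq(1,2)] sab[OF pq(2,1)] unfolding u Block pt.simps
        by (cases "i \<in> {3, 5}"; cases "i \<in> {4, 7}"; cases "j \<in> {3, 5}"; cases "j \<in> {4, 7}") (simp_all, auto)
      then have same: "p = q" "(if i \<in> {3, 5} then 3 else if i \<in> {4, 7} then 4 else 1) =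
          (if j \<in> {3, 5} then 3 else if j \<in> {4, 7} then 4 else (1::nat))" by simp_all
      show ?thesis using centre[OF pq(1,3)] adj_rtrancl_sym[OF centre[OF pq(2,4)]]
        unfolding u Block same by (rule rtrancl_trans)
    qed
  qed
qed

lemma plane_quotient_blocks: "plane_quotient X block_F pt cv"
  unfolding plane_quotient_def
proof (intro conjI ballI impI)
  fix u v assume "u \<in> verts X" "v \<in> verts X"
  then show "pt u = pt v \<longleftrightarrow> (u, v) \<in> (adj (X\<lparr>edges := block_F\<rparr>))\<^sup>*" by (rule pt_eq_connected)
next
  fix f assume f: "f \<in> edges X - block_F"
  show "simple_path (cv f)" "map_uprod pt (ends X f) = Upair (pathstart (cv f)) (pathfinish (cv f))"
    using cv_simple_ends[OF f] by auto
  show "cv f ` {0<..<1} \<inter> pt ` verts X = {}"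
    using not_F_cases[OF f] on_curve_avoids extra_avoids by blast
next
  fix f f' assume f: "f \<in> edges X - block_F" "f' \<in> edges X - block_F" "f \<noteq> f'"
  show "cv f ` {0<..<1} \<inter> cv f' ` {0<..<1} = {}"
    using not_F_cases[OF f(1)]
  proof (elim disjE exE)
    assume 1: "on_curve f"
    show ?thesis using not_F_cases[OF f(2)]
    proof (elim disjE exE)
      assume "on_curve f'"
      then show ?thesis by (rule on_curve_disjoint[OF 1 _ f(3)])
    next
      fix q assume "extra q f'"
      then show ?thesis using extra_on_curve_disjoint[OF _ 1] by blast
    qed
  next
    fix p assume 1: "extra p f"
    show ?thesis using not_F_cases[OF f(2)]
    proof (elim disjE exE)
      assume "on_curve f'"
      then show ?thesis by (rule extra_on_curve_disjoint[OF 1])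
    next
      fix q assume "extra q f'"
      then show ?thesis by (rule extra_disjoint[OF 1 _ f(3)])
    qed
  qed
qed

end

section \<open>Choosing the displacements and the arcs\<close>

lemma finite_positive_bound:
  fixes A :: "real set"
  assumes "finite A" "\<And>x. x \<in> A \<Longrightarrow> 0 < x"
  obtains \<epsilon> where "0 < \<epsilon>" "\<And>x. x \<in> A \<Longrightarrow> 2 * \<epsilon> < x"
proof -
  define m where "m = Min (insert 1 A)"
  have m: "0 < m" "\<And>x. x \<in> A \<Longrightarrow> m \<le> x"
    using assms by (simp_all add: m_def Min_gr_iff)
  show ?thesis
  proof (rule that[of "m / 3"])
    show "0 < m / 3" using m(1) by simp
    show "2 * (m / 3) < x" if "x \<in> A" for x using m(1) m(2)[OF that] by simp
  qed
qed

context drawn_graph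
begin

lemma param_gap:
  obtains \<epsilon> where "0 < \<epsilon>" "\<And>e j k. e \<in> edges G \<Longrightarrow> j < k \<Longrightarrow> k \<le> Suc (cnum e) \<Longrightarrow>
    (if j = Suc (cnum e) then 1 else par e j) + 2 * \<epsilon> < (if k = Suc (cnum e) then 1 else par e k)"
proof -
  define pr where "pr e k = (if k = Suc (cnum e) then 1 else par e k)" for e k
  have less: "pr e j < pr e k" if e: "e \<in> edges G" and jk: "j < k" "k \<le> Suc (cnum e)" for e j k
  proof (cases "k = Suc (cnum e)")
    case True
    then show ?thesis using par_range[OF e, of j] jk by (cases "j = 0") (auto simp: pr_def)
  next
    case False
    then show ?thesis using par_less[OF e, of j k] jk by (simp add: pr_def)
  qed
  define A where "A = (\<lambda>(e, j, k). pr e k - pr e j) ` {(e, j, k). e \<in> edges G \<and> j < k \<and> k \<le> Suc (cnum e)}"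
  have "{(e, j, k). e \<in> edges G \<and> j < k \<and> k \<le> Suc (cnum e)} \<subseteq>
      (SIGMA e:edges G. {..Suc (cnum e)} \<times> {..Suc (cnum e)})" by auto
  moreover have "finite (SIGMA e:edges G. {..Suc (cnum e)} \<times> {..Suc (cnum e)})" using fin(2) by simp
  ultimately have "finite A" unfolding A_def by (intro finite_imageI) (rule finite_subset)
  moreover have "0 < x" if "x \<in> A" for x using that less by (auto simp: A_def)
  ultimately obtain \<epsilon> where \<epsilon>: "0 < \<epsilon>" "\<And>x. x \<in> A \<Longrightarrow> 2 * \<epsilon> < x" using finite_positive_bound[of A] by metis
  show ?thesis
  proof (rule that[OF \<epsilon>(1)])
    fix e j k assume e: "e \<in> edges G" "j < k" "k \<le> Suc (cnum e)"
    then have "pr e k - pr e j \<in> A" unfolding A_def by (intro image_eqI[of _ _ "(e, j, k)"]) auto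
    then have "pr e j + 2 * \<epsilon> < pr e k" using \<epsilon>(2) by fastforce
    then show "(if j = Suc (cnum e) then 1 else par e j) + 2 * \<epsilon> < (if k = Suc (cnum e) then 1 else par e k)"
      by (simp only: pr_def)
  qed
qed

text \<open>Arcs kept inside these balls cannot meet arcs of another crossing.\<close>

lemma crossing_separation:
  obtains \<rho> where "0 < \<rho>" "\<And>p q. p \<in> crs \<Longrightarrow> q \<in> crs \<Longrightarrow> p \<noteq> q \<Longrightarrow> ball p \<rho> \<inter> ball q \<rho> = {}"
proof -
  define A where "A = (\<lambda>(p, q). dist p q) ` {(p, q). p \<in> crs \<and> q \<in> crs \<and> p \<noteq> q}"
  have "{(p, q). p \<in> crs \<and> q \<in> crs \<and> p \<noteq> q} \<subseteq> crs \<times> crs" by auto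
  then have "finite A" unfolding A_def using finite_crs by (intro finite_imageI) (rule finite_subset, auto)
  moreover have "0 < x" if "x \<in> A" for x using that by (auto simp: A_def)
  ultimately obtain \<rho> where \<rho>: "0 < \<rho>" "\<And>x. x \<in> A \<Longrightarrow> 2 * \<rho> < x" using finite_positive_bound[of A] by metis
  show ?thesis
  proof (rule that[OF \<rho>(1)])
    fix p q assume pq: "p \<in> crs" "q \<in> crs" "p \<noteq> q"
    then have "dist p q \<in> A" unfolding A_def by (intro image_eqI[of _ _ "(p, q)"]) auto
    then have "\<rho> + \<rho> \<le> dist p q" using \<rho>(2)[of "dist p q"] by simp
    then show "ball p \<rho> \<inter> ball q \<rho> = {}" by (rule disjoint_ballI)
  qed
qed

lemma crossing_edges:
  assumes p: "p \<in> crs"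
  shows "\<exists>z. case z of (e, k, e', k') \<Rightarrow> e \<in> edges G \<and> 1 \<le> k \<and> k \<le> cnum e \<and> curve D e (par e k) = p \<and>
    range (att p e) = {half_a, half_a'} \<and> e' \<in> edges G \<and> 1 \<le> k' \<and> k' \<le> cnum e' \<and> curve D e' (par e' k') = p \<and>
    range (att p e') = {half_b, half_b'}"
proof -
  obtain e e' where e: "e \<in> edges G" "e' \<in> edges G" "e \<noteq> e'" "p \<in> curve_interior D e" "p \<in> curve_interior D e'"
    using p crs_iff by blast
  obtain k where k: "1 \<le> k" "k \<le> cnum e" "curve D e (par e k) = p" by (rule crossing_param_exists[OF e(1,4) p])
  obtain k' where k': "1 \<le> k'" "k' \<le> cnum e'" "curve D e' (par e' k') = p" by (rule crossing_param_exists[OF e(2,5) p])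
  from att_cases[OF e] show ?thesis
  proof
    assume "range (att p e) = {half_a, half_a'} \<and> range (att p e') = {half_b, half_b'}"
    then show ?thesis using e k k' by (intro exI[of _ "(e, k, e', k')"]) simp
  next
    assume "range (att p e) = {half_b, half_b'} \<and> range (att p e') = {half_a, half_a'}"
    then show ?thesis using e k k' by (intro exI[of _ "(e', k', e, k)"]) simp
  qed
qed

text \<open>Provides the parameters of \<open>plane_replacement\<close>: one gap \<epsilon> and one
  radius \<rho> for the whole drawing, and then a separate choice of edges, displacements and arcs
  at every crossing.\<close>

lemma exists_plane_quotient: "\<exists>pt cv. plane_quotient (star_graph G D att) {Block_Edge p b | p b. p \<in> crs \<and> b \<in> block_matching} pt cv"
proof -
  obtain \<epsilon> where \<epsilon>: "0 < \<epsilon>" "\<And>e j k. e \<in> edges G \<Longrightarrow> j < k \<Longrightarrow> k \<le> Suc (cnum e) \<Longrightarrow>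
    (if j = Suc (cnum e) then 1 else par e j) + 2 * \<epsilon> < (if k = Suc (cnum e) then 1 else par e k)"
    using param_gap by metis
  obtain \<rho> where \<rho>: "0 < \<rho>" "\<And>p q. p \<in> crs \<Longrightarrow> q \<in> crs \<Longrightarrow> p \<noteq> q \<Longrightarrow> ball p \<rho> \<inter> ball q \<rho> = {}"
    using crossing_separation by metis
  have "\<exists>z. \<forall>p\<in>crs. case z p of (e, k, e', k') \<Rightarrow> e \<in> edges G \<and> 1 \<le> k \<and> k \<le> cnum e \<and> curve D e (par e k) = p \<and>
    range (att p e) = {half_a, half_a'} \<and> e' \<in> edges G \<and> 1 \<le> k' \<and> k' \<le> cnum e' \<and> curve D e' (par e' k') = p \<and>
    range (att p e') = {half_b, half_b'}"
    by (rule bchoice, rule ballI, rule crossing_edges)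
  then obtain z where z: "\<forall>p\<in>crs. case z p of (e, k, e', k') \<Rightarrow> e \<in> edges G \<and> 1 \<le> k \<and> k \<le> cnum e \<and> curve D e (par e k) = p \<and>
    range (att p e) = {half_a, half_a'} \<and> e' \<in> edges G \<and> 1 \<le> k' \<and> k' \<le> cnum e' \<and> curve D e' (par e' k') = p \<and>
    range (att p e') = {half_b, half_b'}" ..
  define ea where "ea p = fst (z p)" for p
  define ka where "ka p = fst (snd (z p))" for p
  define eb where "eb p = fst (snd (snd (z p)))" for p
  define kb where "kb p = snd (snd (snd (z p)))" for p
  have at_a: "ea p \<in> edges G \<and> 1 \<le> ka p \<and> ka p \<le> cnum (ea p) \<and> curve D (ea p) (par (ea p) (ka p)) = p \<and>
      range (att p (ea p)) = {half_a, half_a'}"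
    and at_b: "eb p \<in> edges G \<and> 1 \<le> kb p \<and> kb p \<le> cnum (eb p) \<and> curve D (eb p) (par (eb p) (kb p)) = p \<and>
      range (att p (eb p)) = {half_b, half_b'}" if "p \<in> crs" for p
    using z that unfolding ea_def ka_def eb_def kb_def by (auto simp: case_prod_beta)
  have ab: "ea p \<noteq> eb p" if "p \<in> crs" for p using at_a[OF that] at_b[OF that] by auto
  have int: "p \<in> curve_interior D (ea p)" "p \<in> curve_interior D (eb p)" if "p \<in> crs" for p
    using par_interior[of "ea p" "ka p"] par_interior[of "eb p" "kb p"] at_a[OF that] at_b[OF that] by auto
  \<comment> \<open>A neighbourhood of \<open>p\<close> that misses all vertices, all curves except
    the two that cross, and the neighbourhoods of other crossings. The two curves themselves are
    avoided by the choice of quadrants.\<close>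
  define W where "W p = ball p \<rho> - (\<Union>e\<in>edges G - {ea p, eb p}. path_image (curve D e)) - point D ` verts G" for p
  have W: "open (W p)" "p \<in> W p" if p: "p \<in> crs" for p
  proof -
    have "closed (path_image (curve D e))" if "e \<in> edges G" for e
      using arc_curve[OF that] by (simp add: closed_arc_image)
    then have "closed (\<Union>e\<in>edges G - {ea p, eb p}. path_image (curve D e))" using fin(2) by (intro closed_UN) auto
    moreover have "closed (point D ` verts G)" using fin(1) by (intro finite_imp_closed) simp
    ultimately show "open (W p)" unfolding W_def by (intro open_Diff) auto
    have np: "p \<notin> point D ` verts G" using drawing_facts(4)[of "ea p"] int(1)[OF p] at_a[OF p] by blast
    have "p \<notin> path_image (curve D e)" if e: "e \<in> edges G" "e \<noteq> ea p" "e \<noteq> eb p" for e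
    proof
      assume "p \<in> path_image (curve D e)"
      then consider "p = pathstart (curve D e)" | "p = pathfinish (curve D e)" | "p \<in> curve_interior D e"
        unfolding path_image_interior curve_interior_def by blast
      then show False
      proof cases
        case 1
        then show ?thesis using np ends_tl_hd[OF e(1)] by (metis imageI)
      next
        case 2
        then show ?thesis using np ends_tl_hd[OF e(1)] by (metis imageI)
      next
        case 3
        then show ?thesis using drawing_facts(8)[OF e(1), of "ea p" "eb p"] e int[OF p] at_a[OF p] at_b[OF p] ab[OF p] by blast
      qed
    qed
    then show "p \<in> W p" using np \<rho>(1) by (auto simp: W_def)
  qed
  \<comment> \<open>The displaced point lies on the side of the shifted half-edge: forward along the
    curve if the edge leaves the block by it, backward otherwise.\<close>
  define sg where "sg e p = (if shifted (att p e Outgoing) then 1 else -1 :: real)" for e p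
  have ex: "\<exists>y. case y of (\<delta>, \<eta>, \<alpha>, \<beta>, \<gamma>) \<Rightarrow> 0 < \<delta> \<and> \<delta> < \<epsilon> \<and> 0 < \<eta> \<and> \<eta> < \<epsilon> \<and> arc \<alpha> \<and> arc \<beta> \<and> arc \<gamma> \<and>
     path_image \<alpha> \<subseteq> W p \<and> path_image \<beta> \<subseteq> W p \<and> path_image \<gamma> \<subseteq> W p \<and>
     pathstart \<alpha> = p \<and> pathfinish \<alpha> = curve D (eb p) (par (eb p) (kb p) + sg (eb p) p * \<eta>) \<and>
     pathstart \<beta> = curve D (eb p) (par (eb p) (kb p) + sg (eb p) p * \<eta>) \<and>
     pathfinish \<beta> = curve D (ea p) (par (ea p) (ka p) + sg (ea p) p * \<delta>) \<and>
     pathstart \<gamma> = curve D (ea p) (par (ea p) (ka p) + sg (ea p) p * \<delta>) \<and> pathfinish \<gamma> = p \<and>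
     (\<alpha> ` {0<..<1} \<union> \<beta> ` {0<..<1} \<union> \<gamma> ` {0<..<1}) \<inter> (path_image (curve D (ea p)) \<union> path_image (curve D (eb p))) = {} \<and>
     \<alpha> ` {0<..<1} \<inter> \<beta> ` {0<..<1} = {} \<and> \<beta> ` {0<..<1} \<inter> \<gamma> ` {0<..<1} = {} \<and> \<alpha> ` {0<..<1} \<inter> \<gamma> ` {0<..<1} = {}"
    if p: "p \<in> crs" for p
  proof -
    note a = at_a[OF p] and b = at_b[OF p]
    have cr: "cross_at (curve D (ea p)) (curve D (eb p)) p"
      by (rule drawing_facts(6)) (use a b ab[OF p] int[OF p] in auto)
    have t: "par (ea p) (ka p) \<in> {0<..<1}" "par (eb p) (kb p) \<in> {0<..<1}"
      using par_range[of "ea p" "ka p"] par_range[of "eb p" "kb p"] a b by blast+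
    have A: "arc (curve D (ea p))" "arc (curve D (eb p))" using arc_curve a b by blast+
    have e: "curve D (ea p) (par (ea p) (ka p)) = p" "curve D (eb p) (par (eb p) (kb p)) = p" using a b by blast+
    have s: "sg f p = 1 \<or> sg f p = -1" for f by (simp add: sg_def)
    show ?thesis using crossing_arcs[OF cr A(1) t(1) e(1) A(2) t(2) e(2) W[OF p] \<epsilon>(1) s[of "ea p"] s[of "eb p"]]
      by (simp only: split_paired_Ex prod.case)
  qed
  have "\<exists>y. \<forall>p\<in>crs. case y p of (\<delta>, \<eta>, \<alpha>, \<beta>, \<gamma>) \<Rightarrow> 0 < \<delta> \<and> \<delta> < \<epsilon> \<and> 0 < \<eta> \<and> \<eta> < \<epsilon> \<and> arc \<alpha> \<and> arc \<beta> \<and> arc \<gamma> \<and>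
     path_image \<alpha> \<subseteq> W p \<and> path_image \<beta> \<subseteq> W p \<and> path_image \<gamma> \<subseteq> W p \<and>
     pathstart \<alpha> = p \<and> pathfinish \<alpha> = curve D (eb p) (par (eb p) (kb p) + sg (eb p) p * \<eta>) \<and>
     pathstart \<beta> = curve D (eb p) (par (eb p) (kb p) + sg (eb p) p * \<eta>) \<and>
     pathfinish \<beta> = curve D (ea p) (par (ea p) (ka p) + sg (ea p) p * \<delta>) \<and>
     pathstart \<gamma> = curve D (ea p) (par (ea p) (ka p) + sg (ea p) p * \<delta>) \<and> pathfinish \<gamma> = p \<and>
     (\<alpha> ` {0<..<1} \<union> \<beta> ` {0<..<1} \<union> \<gamma> ` {0<..<1}) \<inter> (path_image (curve D (ea p)) \<union> path_image (curve D (eb p))) = {} \<and>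
     \<alpha> ` {0<..<1} \<inter> \<beta> ` {0<..<1} = {} \<and> \<beta> ` {0<..<1} \<inter> \<gamma> ` {0<..<1} = {} \<and> \<alpha> ` {0<..<1} \<inter> \<gamma> ` {0<..<1} = {}"
    by (rule bchoice, rule ballI, rule ex)
  then obtain y where y: "\<forall>p\<in>crs. case y p of (\<delta>, \<eta>, \<alpha>, \<beta>, \<gamma>) \<Rightarrow> 0 < \<delta> \<and> \<delta> < \<epsilon> \<and> 0 < \<eta> \<and> \<eta> < \<epsilon> \<and> arc \<alpha> \<and> arc \<beta> \<and> arc \<gamma> \<and>
     path_image \<alpha> \<subseteq> W p \<and> path_image \<beta> \<subseteq> W p \<and> path_image \<gamma> \<subseteq> W p \<and>
     pathstart \<alpha> = p \<and> pathfinish \<alpha> = curve D (eb p) (par (eb p) (kb p) + sg (eb p) p * \<eta>) \<and>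
     pathstart \<beta> = curve D (eb p) (par (eb p) (kb p) + sg (eb p) p * \<eta>) \<and>
     pathfinish \<beta> = curve D (ea p) (par (ea p) (ka p) + sg (ea p) p * \<delta>) \<and>
     pathstart \<gamma> = curve D (ea p) (par (ea p) (ka p) + sg (ea p) p * \<delta>) \<and> pathfinish \<gamma> = p \<and>
     (\<alpha> ` {0<..<1} \<union> \<beta> ` {0<..<1} \<union> \<gamma> ` {0<..<1}) \<inter> (path_image (curve D (ea p)) \<union> path_image (curve D (eb p))) = {} \<and>
     \<alpha> ` {0<..<1} \<inter> \<beta> ` {0<..<1} = {} \<and> \<beta> ` {0<..<1} \<inter> \<gamma> ` {0<..<1} = {} \<and> \<alpha> ` {0<..<1} \<inter> \<gamma> ` {0<..<1} = {}" ..
  define \<delta> where "\<delta> p = fst (y p)" for p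
  define \<eta> where "\<eta> p = fst (snd (y p))" for p
  define \<alpha> where "\<alpha> p = fst (snd (snd (y p)))" for p
  define \<beta> where "\<beta> p = fst (snd (snd (snd (y p))))" for p
  define \<gamma> where "\<gamma> p = snd (snd (snd (snd (y p))))" for p
  have Y: "0 < \<delta> p \<and> \<delta> p < \<epsilon> \<and> 0 < \<eta> p \<and> \<eta> p < \<epsilon> \<and> arc (\<alpha> p) \<and> arc (\<beta> p) \<and> arc (\<gamma> p) \<and>
     path_image (\<alpha> p) \<subseteq> W p \<and> path_image (\<beta> p) \<subseteq> W p \<and> path_image (\<gamma> p) \<subseteq> W p \<and>
     pathstart (\<alpha> p) = p \<and> pathfinish (\<alpha> p) = curve D (eb p) (par (eb p) (kb p) + sg (eb p) p * \<eta> p) \<and>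
     pathstart (\<beta> p) = curve D (eb p) (par (eb p) (kb p) + sg (eb p) p * \<eta> p) \<and>
     pathfinish (\<beta> p) = curve D (ea p) (par (ea p) (ka p) + sg (ea p) p * \<delta> p) \<and>
     pathstart (\<gamma> p) = curve D (ea p) (par (ea p) (ka p) + sg (ea p) p * \<delta> p) \<and> pathfinish (\<gamma> p) = p \<and>
     (\<alpha> p ` {0<..<1} \<union> \<beta> p ` {0<..<1} \<union> \<gamma> p ` {0<..<1}) \<inter> (path_image (curve D (ea p)) \<union> path_image (curve D (eb p))) = {} \<and>
     \<alpha> p ` {0<..<1} \<inter> \<beta> p ` {0<..<1} = {} \<and> \<beta> p ` {0<..<1} \<inter> \<gamma> p ` {0<..<1} = {} \<and> \<alpha> p ` {0<..<1} \<inter> \<gamma> p ` {0<..<1} = {}"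
    if "p \<in> crs" for p
    using y[rule_format, OF that] unfolding \<delta>_def \<eta>_def \<alpha>_def \<beta>_def \<gamma>_def case_prod_beta .
  define pr where "pr = (\<lambda>e k. if k = Suc (cnum e) then 1 else par e k)"
  define off where "off = (\<lambda>e k. if 1 \<le> k \<and> k \<le> cnum e then
      (if shifted (att (curve D e (par e k)) e Outgoing) then 1 else -1) *
      (if e = ea (curve D e (par e k)) then \<delta> (curve D e (par e k)) else \<eta> (curve D e (par e k))) else 0)"
  define spt where "spt = (\<lambda>e k. curve D e (par e k + off e k))"
  define Ar where "Ar = (\<lambda>p. \<alpha> p ` {0<..<1} \<union> \<beta> p ` {0<..<1} \<union> \<gamma> p ` {0<..<1})"
  have sa: "spt (ea p) (ka p) = curve D (ea p) (par (ea p) (ka p) + sg (ea p) p * \<delta> p)" if p: "p \<in> crs" for p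
    using at_a[OF p] by (simp add: spt_def off_def sg_def)
  have sb: "spt (eb p) (kb p) = curve D (eb p) (par (eb p) (kb p) + sg (eb p) p * \<eta> p)" if p: "p \<in> crs" for p
    using at_b[OF p] ab[OF p] by (simp add: spt_def off_def sg_def)
  have ArW: "Ar p \<subseteq> W p" if p: "p \<in> crs" for p
  proof -
    have "c ` {0<..<1} \<subseteq> path_image c" for c :: "real \<Rightarrow> complex" by (auto simp: path_image_def)
    then show ?thesis using Y[OF p] unfolding Ar_def by (meson Un_least order_trans)
  qed
  have gap: "pr e j + 2 * \<epsilon> < pr e k" if "e \<in> edges G" "j < k" "k \<le> Suc (cnum e)" for e j k
    unfolding pr_def by (rule \<epsilon>(2)[OF that])
  have arc_ends: "pathstart (\<alpha> p) = p \<and> pathfinish (\<alpha> p) = spt (eb p) (kb p) \<and>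
      pathstart (\<beta> p) = spt (eb p) (kb p) \<and> pathfinish (\<beta> p) = spt (ea p) (ka p) \<and>
      pathstart (\<gamma> p) = spt (ea p) (ka p) \<and> pathfinish (\<gamma> p) = p" if p: "p \<in> crs" for p
    unfolding sa[OF p] sb[OF p] by (insert Y[OF p], elim conjE, intro conjI)
  have off_curves: "Ar p \<inter> path_image (curve D e) = {}" if p: "p \<in> crs" and e: "e \<in> edges G" for p e
  proof (cases "e = ea p \<or> e = eb p")
    case True
    have "Ar p \<inter> (path_image (curve D (ea p)) \<union> path_image (curve D (eb p))) = {}" unfolding Ar_def by (insert Y[OF p], elim conjE)
    then show ?thesis using True by blast
  next
    case False
    then have "W p \<inter> path_image (curve D e) = {}" using e by (auto simp: W_def)
    then show ?thesis using ArW[OF p] by blast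
  qed
  have off_points: "Ar p \<inter> point D ` verts G = {}" if p: "p \<in> crs" for p
  proof -
    have "W p \<inter> point D ` verts G = {}" by (auto simp: W_def)
    then show ?thesis using ArW[OF p] by blast
  qed
  have apart: "Ar p \<inter> Ar q = {}" if p: "p \<in> crs" and q: "q \<in> crs" "p \<noteq> q" for p q
  proof -
    have "Ar p \<subseteq> ball p \<rho>" "Ar q \<subseteq> ball q \<rho>" using ArW[OF p] ArW[OF q(1)] by (auto simp: W_def)
    then show ?thesis using \<rho>(2)[OF p q] by blast
  qed
  have sm: "0 < \<delta> p \<and> \<delta> p < \<epsilon> \<and> 0 < \<eta> p \<and> \<eta> p < \<epsilon>" if "p \<in> crs" for p by (insert Y[OF that], elim conjE, intro conjI)
  have ar: "arc (\<alpha> p) \<and> arc (\<beta> p) \<and> arc (\<gamma> p)" if "p \<in> crs" for p by (insert Y[OF that], elim conjE, intro conjI)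
  have dj: "\<alpha> p ` {0<..<1} \<inter> \<beta> p ` {0<..<1} = {} \<and>
      \<beta> p ` {0<..<1} \<inter> \<gamma> p ` {0<..<1} = {} \<and> \<alpha> p ` {0<..<1} \<inter> \<gamma> p ` {0<..<1} = {}" if "p \<in> crs" for p
    by (insert Y[OF that], elim conjE, intro conjI)
  interpret R: plane_replacement G M D att ea eb ka kb \<delta> \<eta> \<alpha> \<beta> \<gamma> \<epsilon> pr off spt Ar
    by (rule plane_replacement.intro[OF drawn_graph_axioms plane_replacement_axioms.intro])
      ((rule gap[unfolded pr_def] at_a at_b sm ar arc_ends[unfolded spt_def off_def] off_curves[unfolded Ar_def]
        off_points[unfolded Ar_def] dj apart[unfolded Ar_def]; assumption)+,
        (rule pr_def[THEN eq_reflection] off_def[THEN eq_reflection] spt_def[THEN eq_reflection] Ar_def[THEN eq_reflection])+)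
  show ?thesis using R.plane_quotient_blocks unfolding R.block_F_def by blast
qed

end

section \<open>The pseudo-matching of the new graph\<close>

definition with_edges :: "('v, 'e) mgraph \<Rightarrow> 'v set \<Rightarrow> 'e set \<Rightarrow> ('v, 'e) mgraph" where
  "with_edges G V E = \<lparr>verts = V, edges = E, ends = ends G\<rparr>"

lemma with_edges_simps [simp]:
  "verts (with_edges G V E) = V" "edges (with_edges G V E) = E" "ends (with_edges G V E) = ends G"
  by (simp_all add: with_edges_def)

context graph_isomorphism
begin

lemma reachable_image:
  assumes "(u, v) \<in> (adj (G\<lparr>edges := F\<rparr>))\<^sup>*" "F \<subseteq> edges G"
  shows "(\<phi> u, \<phi> v) \<in> (adj (H\<lparr>edges := \<psi> ` F\<rparr>))\<^sup>*"
  using assms(1)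
proof (induction rule: rtrancl_induct)
  case (step y z)
  then obtain e where e: "e \<in> F" "ends G e = Upair y z" by (auto simp: adj_def)
  then have "ends H (\<psi> e) = Upair (\<phi> y) (\<phi> z)" using ends_map[of e] assms(2) by auto
  then have "(\<phi> y, \<phi> z) \<in> adj (H\<lparr>edges := \<psi> ` F\<rparr>)" using e(1) unfolding adj_def by simp blast
  then show ?case using step(3) by (rule rtrancl_into_rtrancl[rotated])
qed simp

text \<open>An isomorphism only renames vertices and edges, so points and curves are kept and
  reindexed by the inverse maps.\<close>

lemma plane_quotient_image:
  assumes D: "plane_quotient G F pt cv" and F: "F \<subseteq> edges G"
  shows "\<exists>pt cv. plane_quotient H (\<psi> ` F) pt cv"
proof -
  let ?i = "inv_into (verts G) \<phi>" and ?j = "inv_into (edges G) \<psi>"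
  interpret I: graph_isomorphism H G ?i ?j by (rule inverse)
  note D1 = D[unfolded plane_quotient_def, THEN conjunct1, rule_format]
    and D2 = D[unfolded plane_quotient_def, THEN conjunct2, THEN conjunct1, rule_format]
    and D3 = D[unfolded plane_quotient_def, THEN conjunct2, THEN conjunct2, rule_format]
  have i: "?i (\<phi> v) = v" if "v \<in> verts G" for v using inv_into_f_f[OF inj_verts that] .
  have j: "?j (\<psi> e) = e" if "e \<in> edges G" for e using inv_into_f_f[OF inj_edges that] .
  have jF: "?j ` \<psi> ` F = F" using inv_into_image_cancel[OF inj_edges F] .
  have FH: "\<psi> ` F \<subseteq> edges H" using F by (auto simp: edges_image)
  have rest: "edges H - \<psi> ` F = \<psi> ` (edges G - F)"
    unfolding edges_image using inj_on_image_set_diff[OF inj_edges, of "edges G" F] F by simp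
  have im: "(pt \<circ> ?i) ` verts H = pt ` verts G" unfolding verts_image using i by (auto simp: image_image)
  have "plane_quotient H (\<psi> ` F) (pt \<circ> ?i) (cv \<circ> ?j)"
    unfolding plane_quotient_def rest
  proof (intro conjI ballI impI)
    fix x y assume "x \<in> verts H" "y \<in> verts H"
    then obtain u v where uv: "u \<in> verts G" "x = \<phi> u" "v \<in> verts G" "y = \<phi> v" by (auto simp: verts_image)
    have "(u, v) \<in> (adj (G\<lparr>edges := F\<rparr>))\<^sup>* \<longleftrightarrow> (\<phi> u, \<phi> v) \<in> (adj (H\<lparr>edges := \<psi> ` F\<rparr>))\<^sup>*"
      using reachable_image[OF _ F, of u v] I.reachable_image[OF _ FH, of "\<phi> u" "\<phi> v"]
      unfolding jF i[OF uv(1)] i[OF uv(3)] by blast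
    moreover have "pt u = pt v \<longleftrightarrow> (u, v) \<in> (adj (G\<lparr>edges := F\<rparr>))\<^sup>*"
      by (rule D1[OF uv(1,3)])
    ultimately show "(pt \<circ> ?i) x = (pt \<circ> ?i) y \<longleftrightarrow> (x, y) \<in> (adj (H\<lparr>edges := \<psi> ` F\<rparr>))\<^sup>*"
      using i uv by simp
  next
    fix f assume "f \<in> \<psi> ` (edges G - F)"
    then obtain e where e: "e \<in> edges G - F" "f = \<psi> e" by blast
    have d: "simple_path (cv e) \<and> map_uprod pt (ends G e) = Upair (pathstart (cv e)) (pathfinish (cv e)) \<and>
        cv e ` {0<..<1} \<inter> pt ` verts G = {}" by (rule D2[OF e(1)])
    have cf: "(cv \<circ> ?j) f = cv e" using j e by simp
    have "map_uprod (pt \<circ> ?i) (ends H f) = map_uprod (pt \<circ> ?i \<circ> \<phi>) (ends G e)"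
      using e by (simp add: ends_map map_uprod_comp)
    also have "\<dots> = map_uprod pt (ends G e)"
      using wf_graphD(3)[OF wf, of e] e(1) i by (intro map_uprod_cong_on) auto
    finally show "map_uprod (pt \<circ> ?i) (ends H f) = Upair (pathstart ((cv \<circ> ?j) f)) (pathfinish ((cv \<circ> ?j) f))"
      using d unfolding cf by simp
    show "simple_path ((cv \<circ> ?j) f)" "(cv \<circ> ?j) f ` {0<..<1} \<inter> (pt \<circ> ?i) ` verts H = {}"
      using d unfolding cf im by blast+
  next
    fix f f' assume "f \<in> \<psi> ` (edges G - F)" "f' \<in> \<psi> ` (edges G - F)" "f \<noteq> f'"
    then obtain e e' where e: "e \<in> edges G - F" "f = \<psi> e" "e' \<in> edges G - F" "f' = \<psi> e'" "e \<noteq> e'" by blast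
    have "cv e ` {0<..<1} \<inter> cv e' ` {0<..<1} = {}" by (rule D3[OF e(1,3,5)])
    then show "(cv \<circ> ?j) f ` {0<..<1} \<inter> (cv \<circ> ?j) f' ` {0<..<1} = {}" using j e by simp
  qed
  then show ?thesis by blast
qed

lemma subgraph_iso_image:
  assumes K: "subgraph K G" and T: "graph_iso T K"
  shows "graph_iso T (with_edges H (\<phi> ` verts K) (\<psi> ` edges K))"
    "subgraph (with_edges H (\<phi> ` verts K) (\<psi> ` edges K)) H"
proof -
  let ?K = "with_edges H (\<phi> ` verts K) (\<psi> ` edges K)"
  have sub: "verts K \<subseteq> verts G" "edges K \<subseteq> edges G" "wf_graph K" and en: "\<And>e. e \<in> edges K \<Longrightarrow> ends K e = ends G e"
    using K by (auto simp: subgraph_def)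
  have "ends ?K (\<psi> e) = map_uprod \<phi> (ends K e)" if "e \<in> edges K" for e
    using that sub en ends_map[of e] by auto
  then have i: "graph_isomorphism K ?K \<phi> \<psi>"
    using sub inj_on_subset[OF inj_verts sub(1)] inj_on_subset[OF inj_edges sub(2)]
    by unfold_locales (auto simp: bij_betw_def)
  then have "graph_iso K ?K" using graph_iso_iff[OF sub(3)] by blast
  then show "graph_iso T ?K" using graph_iso_trans[OF T] by blast
  show "subgraph ?K H" using graph_isomorphism.wf_image[OF i] sub by (auto simp: subgraph_def verts_image edges_image)
qed

text \<open>The drawing is moved as a \<open>plane_quotient\<close> and contracted only afterwards,
  since the vertices of a contraction are sets that the isomorphism would have to be lifted
  to.\<close>

lemma planarizing_matching_image:
  assumes M: "perfect_pseudo_matching G M" and D: "plane_quotient G (matching_edges M) pt cv"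
  shows "\<exists>M'. perfect_pseudo_matching H M' \<and> planarizing H M'"
proof -
  have M1: "\<And>K. K \<in> M \<Longrightarrow> subgraph K G" "\<And>K. K \<in> M \<Longrightarrow> graph_iso (K1 1) K \<or> graph_iso (K1 3) K"
    and M2: "\<And>K K'. K \<in> M \<Longrightarrow> K' \<in> M \<Longrightarrow> K \<noteq> K' \<Longrightarrow> verts K \<inter> verts K' = {}"
    and M3: "\<Union> (verts ` M) = verts G"
    using M unfolding perfect_pseudo_matching_def by blast+
  define h where "h K = with_edges H (\<phi> ` verts K) (\<psi> ` edges K)" for K :: "('v, 'e) mgraph"
  have sub: "verts K \<subseteq> verts G" "edges K \<subseteq> edges G" if "K \<in> M" for K using M1(1)[OF that] by (auto simp: subgraph_def)
  have "perfect_pseudo_matching H (h ` M)"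
    unfolding perfect_pseudo_matching_def
  proof (intro conjI ballI impI)
    fix K' assume "K' \<in> h ` M"
    then obtain K where K: "K \<in> M" "K' = h K" by blast
    show "subgraph K' H" unfolding K(2) h_def
      using subgraph_iso_image(2)[OF M1(1)[OF K(1)]] M1(2)[OF K(1)] by blast
    show "graph_iso (K1 1) K' \<or> graph_iso (K1 3) K'" unfolding K(2) h_def
      using subgraph_iso_image(1)[OF M1(1)[OF K(1)]] M1(2)[OF K(1)] by blast
  next
    fix K L assume "K \<in> h ` M" "L \<in> h ` M" "K \<noteq> L"
    then obtain A B where AB: "A \<in> M" "K = h A" "B \<in> M" "L = h B" "A \<noteq> B" by blast
    have "\<phi> ` verts A \<inter> \<phi> ` verts B = {}"
      using inj_on_image_Int[OF inj_verts sub(1)[OF AB(1)] sub(1)[OF AB(3)]] M2[OF AB(1,3,5)] by simp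
    then show "verts K \<inter> verts L = {}" using AB by (simp add: h_def)
  next
    have "\<Union> (verts ` h ` M) = \<phi> ` \<Union> (verts ` M)" by (auto simp: h_def)
    then show "\<Union> (verts ` h ` M) = verts H" unfolding M3 verts_image .
  qed
  moreover have "matching_edges (h ` M) = \<psi> ` matching_edges M" by (auto simp: matching_edges_def h_def)
  moreover have "matching_edges M \<subseteq> edges G" using sub by (auto simp: matching_edges_def)
  ultimately show ?thesis
    using plane_quotient_image[OF D] plane_quotient_imp_planarizing[OF wf_image] by metis
qed

end

context drawn_graph
begin

text \<open>This is where the drawing being \<open>M\<close>-avoiding enters: a matching edge has no
  crossings, remains a single piece, and the members of \<open>M\<close> survive in the new
  graph.\<close>

lemma matching_uncrossed:
  assumes "H \<in> M" "e \<in> edges H"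
  shows "e \<in> edges G" "cnum e = 0" "ends (star_graph G D att) (piece e 0) = map_uprod Old (ends H e)"
proof -
  have sub: "subgraph H G" using matching assms(1) by (simp add: perfect_pseudo_matching_def)
  then show e: "e \<in> edges G" using assms(2) by (auto simp: subgraph_def)
  have "e \<in> matching_edges M" using assms by (auto simp: matching_edges_def)
  then have "curve D e t \<notin> crs" if "t \<in> {0<..<1}" for t
    using drawing_facts(9)[of e] that unfolding curve_interior_def by blast
  then have "crossing_params G D e = {}" unfolding crossing_params_def by blast
  then show n: "cnum e = 0" by (simp add: cnum_def)
  have "ends H e = Upair (tl_vert e) (hd_vert e)" using sub assms(2) ends_tl_hd(1)[OF e] by (simp add: subgraph_def)
  then show "ends (star_graph G D att) (piece e 0) = map_uprod Old (ends H e)"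
    using ends_piece'[OF e le0] n by (simp add: piece_source_def piece_target_def)
qed

abbreviation "SG \<equiv> star_graph G D att"

definition old_member :: "('v, 'e) mgraph \<Rightarrow> ('v star_vertex, 'e star_edge) mgraph" where
  "old_member H = with_edges SG (Old ` verts H) ((\<lambda>e. piece e 0) ` edges H)"

definition block_members :: "complex \<Rightarrow> ('v star_vertex, 'e star_edge) mgraph set" where
  "block_members p = {with_edges SG (Block p ` {0, 1, 2, 6}) (Block_Edge p ` {(0, 1), (1, 2), (1, 6)}),
     with_edges SG (Block p ` {3, 5}) (Block_Edge p ` {(3, 5)}),
     with_edges SG (Block p ` {4, 7}) (Block_Edge p ` {(4, 7)})}"

definition star_matching :: "('v star_vertex, 'e star_edge) mgraph set" where
  "star_matching = old_member ` M \<union> (\<Union>p\<in>crs. block_members p)"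

lemma old_member_props:
  assumes H: "H \<in> M"
  shows "subgraph (old_member H) SG" "graph_iso T H \<Longrightarrow> graph_iso T (old_member H)"
proof -
  have sub: "verts H \<subseteq> verts G" "edges H \<subseteq> edges G" "wf_graph H"
    using matching H by (auto simp: perfect_pseudo_matching_def subgraph_def)
  have "inj_on (\<lambda>e. piece e 0) (edges H)" by (auto simp: inj_on_def piece_def)
  then have i: "graph_isomorphism H (old_member H) Old (\<lambda>e. piece e 0)"
    using sub(3) matching_uncrossed(3)[OF H] by unfold_locales (auto simp: old_member_def bij_betw_def inj_on_def)
  then have "graph_iso H (old_member H)" using graph_iso_iff[OF sub(3)] by blast
  then show "graph_iso T H \<Longrightarrow> graph_iso T (old_member H)" using graph_iso_trans by blast
  show "subgraph (old_member H) SG"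
    using graph_isomorphism.wf_image[OF i] sub piece_in_edges[OF _ le0]
    by (auto simp: subgraph_def old_member_def verts_X)
qed

lemma K1_isoI:
  assumes "bij_betw \<phi> {0..m} V" "bij_betw \<psi> {1..m} E" "\<And>i. i \<in> {1..m} \<Longrightarrow> ends X' (\<psi> i) = Upair (\<phi> 0) (\<phi> i)"
  shows "graph_iso (K1 m) (with_edges X' V E)"
  unfolding graph_iso_def using assms by (intro exI[of _ \<phi>] exI[of _ \<psi>]) (simp add: K1_def)

lemma block_members_props:
  assumes p: "p \<in> crs" and H: "H \<in> block_members p"
  shows "subgraph H SG" "graph_iso (K1 1) H \<or> graph_iso (K1 3) H"
proof -
  have be: "(0, 1) \<in> block_edges" "(1, 2) \<in> block_edges" "(1, 6) \<in> block_edges" "(3, 5) \<in> block_edges" "(4, 7) \<in> block_edges"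
    using block_edges_list by blast+
  note en = be[THEN ends_block_edge[OF p]]
  have bX: "Block_Edge p b \<in> edges SG" if "b \<in> block_edges" for b
    using p that by (cases b) (auto simp: edges_X)
  show "subgraph H SG"
    using H p en be[THEN bX] unfolding block_members_def by (auto simp: subgraph_def wf_graph_def)
  have u: "Upair (Block p 0 :: 'v star_vertex) (Block p 1) = Upair (Block p 1) (Block p 0)" by simp
  \<comment> \<open>\<open>K1\<close> has its centre at 0 while the star of the block has centre 1,
    so \<open>f\<close> sends 0 to 1. The edges of \<open>K1\<close> are numbered from 1, and entry
    0 of the list for \<open>g\<close> is a filler.\<close>
  define f :: "nat \<Rightarrow> nat" where "f i = [1, 0, 2, 6] ! i" for i
  define g :: "nat \<Rightarrow> nat \<times> nat" where "g i = [(0, 0), (0, 1), (1, 2), (1, 6)] ! i" for i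
  have S: "{0..3} = {0, 1, 2, 3::nat}" "{1..3} = {1, 2, 3::nat}" "{0..1} = {0, 1::nat}" "{1..1} = {1::nat}" by auto
  have fv: "f 0 = 1" "f 1 = 0" "f 2 = 2" "f 3 = 6" and gv: "g 1 = (0, 1)" "g 2 = (1, 2)" "g 3 = (1, 6)"
    by (simp_all add: f_def g_def numeral_eq_Suc)
  have star: "graph_iso (K1 3) (with_edges SG (Block p ` {0, 1, 2, 6}) (Block_Edge p ` {(0, 1), (1, 2), (1, 6)}))"
  proof (rule K1_isoI[of "\<lambda>i. Block p (f i)" _ _ "\<lambda>i. Block_Edge p (g i)"])
    show "bij_betw (\<lambda>i. Block p (f i)) {0..3} (Block p ` {0, 1, 2, 6})"
      unfolding S bij_betw_def inj_on_def using fv by auto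
    show "bij_betw (\<lambda>i. Block_Edge p (g i)) {1..3} (Block_Edge p ` {(0, 1), (1, 2), (1, 6)})"
      unfolding S bij_betw_def inj_on_def using gv by auto
    show "ends SG (Block_Edge p (g i)) = Upair (Block p (f 0)) (Block p (f i))" if "i \<in> {1..3}" for i
      using that en unfolding S by (elim insertE emptyE) (simp_all only: fv gv u)
  qed
  have edge: "graph_iso (K1 1) (with_edges SG (Block p ` {i, j}) (Block_Edge p ` {(i, j)}))"
    if ij: "(i, j) \<in> block_edges" "i \<noteq> j" for i j
  proof (rule K1_isoI[of "\<lambda>k::nat. Block p (if k = 0 then i else j)" _ _ "\<lambda>_. Block_Edge p (i, j)"])
    show "bij_betw (\<lambda>k::nat. Block p (if k = 0 then i else j)) {0..1} (Block p ` {i, j})"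
      unfolding S bij_betw_def inj_on_def using ij(2) by auto
    show "bij_betw (\<lambda>_::nat. Block_Edge p (i, j)) {1..1} (Block_Edge p ` {(i, j)})" by (simp add: bij_betw_def)
  qed (use ends_block_edge[OF p ij(1)] in simp)
  show "graph_iso (K1 1) H \<or> graph_iso (K1 3) H"
    using H star edge[OF be(4)] edge[OF be(5)] unfolding block_members_def by auto
qed

lemma block_members_verts: "H \<in> block_members p \<Longrightarrow> verts H \<subseteq> block_verts p"
  by (auto simp: block_members_def)

lemma star_matching: "perfect_pseudo_matching SG star_matching"
  unfolding perfect_pseudo_matching_def
proof (intro conjI ballI impI)
  have Mp: "\<And>H. H \<in> M \<Longrightarrow> graph_iso (K1 1) H \<or> graph_iso (K1 3) H" using matching by (auto simp: perfect_pseudo_matching_def)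
  fix K assume K: "K \<in> star_matching"
  show "subgraph K SG" using K old_member_props(1) block_members_props(1) unfolding star_matching_def by blast
  show "graph_iso (K1 1) K \<or> graph_iso (K1 3) K"
    using K old_member_props(2) block_members_props(2) Mp unfolding star_matching_def by blast
next
  fix K L assume KL: "K \<in> star_matching" "L \<in> star_matching" "K \<noteq> L"
  have old: "verts (old_member H) = Old ` verts H" for H by (simp add: old_member_def)
  have mix: "verts (old_member H) \<inter> verts B = {}" if "B \<in> block_members p" for H B p
    using block_members_verts[OF that] unfolding old by auto
  consider (oo) A B where "A \<in> M" "B \<in> M" "K = old_member A" "L = old_member B"
    | (ob) A p where "K = old_member A" "L \<in> block_members p" | (bo) A p where "L = old_member A" "K \<in> block_members p"
    | (bb) p q where "K \<in> block_members p" "L \<in> block_members q"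
    using KL(1,2) unfolding star_matching_def by blast
  then show "verts K \<inter> verts L = {}"
  proof cases
    case oo
    then have "A \<noteq> B" using KL(3) by blast
    then have "verts A \<inter> verts B = {}" using matching oo(1,2) unfolding perfect_pseudo_matching_def by blast
    then show ?thesis unfolding oo old by auto
  next
    case ob
    then show ?thesis using mix by blast
  next
    case bo
    then show ?thesis using mix by blast
  next
    case bb
    show ?thesis
    proof (cases "p = q")
      case True
      then show ?thesis using bb KL(3) unfolding block_members_def by auto
    next
      case False
      then show ?thesis using block_members_verts[OF bb(1)] block_members_verts[OF bb(2)] block_disjoint[OF False] by blast
    qed
  qed
next
  have "\<Union> (verts ` block_members p) = block_verts p" for p
  proof -
    have "{0..7} = {0, 1, 2, 3, 4, 5, 6, 7::nat}" by auto
    then show ?thesis by (auto simp: block_members_def block_verts_def)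
  qed
  then have "(\<Union>p\<in>crs. \<Union> (verts ` block_members p)) = (\<Union>p\<in>crs. block_verts p)" by simp
  moreover have "\<Union> (verts ` old_member ` M) = Old ` \<Union> (verts ` M)" by (auto simp: old_member_def)
  moreover have "\<Union> (verts ` M) = verts G" using matching by (simp add: perfect_pseudo_matching_def)
  moreover have "\<Union> (verts ` star_matching) = \<Union> (verts ` old_member ` M) \<union> (\<Union>p\<in>crs. \<Union> (verts ` block_members p))"
    unfolding star_matching_def by blast
  ultimately show "\<Union> (verts ` star_matching) = verts SG"
    unfolding verts_X by simp
qed

text \<open>The local drawing has already contracted the matching edges inside blocks. What remains
  are the matching edges of \<open>G\<close>, which \<open>plane_quotient_extend\<close>
  collapses.\<close>

lemma star_plane_quotient: "\<exists>pt cv. plane_quotient SG (matching_edges star_matching) pt cv"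
proof -
  let ?F = "{Block_Edge p b | p b. p \<in> crs \<and> b \<in> block_matching}"
  obtain pt cv where D: "plane_quotient SG ?F pt cv" using exists_plane_quotient by blast
  have "?F \<subseteq> matching_edges star_matching"
    by (auto simp: matching_edges_def star_matching_def block_members_def block_matching_def)
  moreover have "matching_edges star_matching \<subseteq> edges SG"
  proof -
    have "edges K \<subseteq> edges SG" if "K \<in> star_matching" for K
    proof -
      have "subgraph K SG" using star_matching that by (simp add: perfect_pseudo_matching_def)
      then show ?thesis by (simp add: subgraph_def)
    qed
    then show ?thesis by (auto simp: matching_edges_def)
  qed
  ultimately show ?thesis by (rule plane_quotient_extend[OF wf_X D])
qed

text \<open>Membership in \<open>F4\<close> is witnessed by a graph on natural numbers, so all
  properties are moved to such a representative first.\<close>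

lemma star_in_F4:
  assumes "\<not> three_edge_colorable G"
  shows "iso_class SG \<in> F4"
proof -
  obtain H :: "(nat, nat) mgraph" where H: "graph_iso SG H" by (rule nat_representative[OF wf_X])
  then obtain \<phi> \<psi> where "graph_isomorphism SG H \<phi> \<psi>" using graph_iso_iff[OF wf_X] by blast
  then interpret I: graph_isomorphism SG H \<phi> \<psi> .
  have "verts H \<noteq> {}" using verts_X_ne by (simp add: I.verts_image)
  then have cyc: "cyclically_edge_connected 4 H"
    by (rule small_cuts_trivial_imp_cyclic[OF I.cubic_image[OF cubic_X] I.small_cuts_trivial_image[OF small_cuts_trivial_X]])
  have "\<not> three_edge_colorable H" using I.colorable_preimage not_colorable_X[OF assms] by blast
  then have "snark H" using cyc I.cubic_image[OF cubic_X] by (simp add: snark_def)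
  moreover obtain M' where "perfect_pseudo_matching H M'" "planarizing H M'"
    using star_plane_quotient I.planarizing_matching_image[OF star_matching] by blast
  ultimately show ?thesis using cyc iso_class_eq[OF wf_X H] unfolding F4_def by blast
qed

end

section \<open>The map between isomorphism classes\<close>

lemma F5_member:
  assumes "C \<in> F5" "g \<in> C"
  shows "cubic g" "small_cuts_trivial 4 g" "small_cuts_trivial 5 g" "verts g \<noteq> {}" "\<not> three_edge_colorable g"
    "C = iso_class g"
proof -
  obtain G0 :: "(nat, nat) mgraph" where G0: "C = iso_class G0" "snark G0" "cyclically_edge_connected 5 G0" 
    using assms(1) unfolding F5_def by blast
  have c: "cubic G0" "cyclically_edge_connected 4 G0" "\<not> three_edge_colorable G0" using G0(2) by (auto simp: snark_def)
  have iso: "graph_iso G0 g" using assms(2) G0(1) by (simp add: iso_class_def)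
  note wf0 = cubicD(1)[OF c(1)]
  obtain \<phi> \<psi> where "graph_isomorphism G0 g \<phi> \<psi>" using graph_iso_iff[OF wf0] iso by blast
  then interpret graph_isomorphism G0 g \<phi> \<psi> .
  show "cubic g" by (rule cubic_image[OF c(1)])
  show "small_cuts_trivial 4 g" "small_cuts_trivial 5 g"
    by (rule small_cuts_trivial_image[OF cyclic_imp_small_cuts_trivial[OF c(1)]], rule c(2) G0(3))+
  have "verts G0 \<noteq> {}" using c(2) by (simp add: cyclically_edge_connected_def connected_graph_def)
  then show "verts g \<noteq> {}" by (simp add: verts_image)
  show "\<not> three_edge_colorable g" using colorable_preimage c(3) by blast
  show "C = iso_class g" unfolding G0(1) by (rule iso_class_eq[OF wf0 iso])
qed

theorem theorem11:
  fixes f :: "(nat, nat) mgraph set \<Rightarrow> (nat, nat) mgraph set"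
    and G :: "(nat, nat) mgraph set \<Rightarrow> (nat, nat) mgraph"
    and M :: "(nat, nat) mgraph set \<Rightarrow> (nat, nat) mgraph set"
    and D :: "(nat, nat) mgraph set \<Rightarrow> (nat, nat) drawing"
    and att :: "(nat, nat) mgraph set \<Rightarrow> complex \<Rightarrow> nat \<Rightarrow> side \<Rightarrow> half_edge"
  assumes "\<And>C. C \<in> F5 \<Longrightarrow> G C \<in> C"
    and "\<And>C. C \<in> F5 \<Longrightarrow> perfect_pseudo_matching (G C) (M C)"
    and "\<And>C. C \<in> F5 \<Longrightarrow> avoiding_drawing (G C) (M C) (D C)"
    and "\<And>C. C \<in> F5 \<Longrightarrow> valid_attachment (G C) (D C) (att C)"
    and "\<And>C. C \<in> F5 \<Longrightarrow> f C = iso_class (star_graph (G C) (D C) (att C))"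
  shows "f \<in> F5 \<rightarrow> F4 \<and> inj_on f F5"
proof
  note mem = F5_member[OF _ assms(1)]
  have drawn: "drawn_graph (G C) (M C) (D C) (att C)" if C: "C \<in> F5" for C
    using mem(1,2,4)[OF C C] assms(2-4)[OF C] by (rule drawn_graph.intro)
  show "f \<in> F5 \<rightarrow> F4"
  proof
    fix C assume C: "C \<in> F5"
    show "f C \<in> F4" unfolding assms(5)[OF C]
      by (rule drawn_graph.star_in_F4[OF drawn[OF C] mem(5)[OF C C]])
  qed
  show "inj_on f F5"
  proof (rule inj_onI)
    fix C C' assume C: "C \<in> F5" and C': "C' \<in> F5" and eq: "f C = f C'"
    interpret A: drawn_graph "G C" "M C" "D C" "att C" by (rule drawn[OF C])
    interpret B: drawn_graph "G C'" "M C'" "D C'" "att C'" by (rule drawn[OF C'])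
    have "iso_class A.SG = iso_class B.SG" using eq unfolding assms(5)[OF C] assms(5)[OF C'] .
    then have "graph_iso A.SG B.SG" by (rule iso_class_eq_imp_iso[OF A.wf_X B.wf_X])
    then obtain \<phi> \<psi> where "graph_isomorphism A.SG B.SG \<phi> \<psi>" using graph_iso_iff[OF A.wf_X] by blast
    then interpret I: graph_isomorphism A.SG B.SG \<phi> \<psi> .
    interpret isomorphic_replacements "G C" A.SG A.tl_vert A.hd_vert A.cnum A.crs A.link A.par
      "G C'" B.SG B.tl_vert B.hd_vert B.cnum B.crs B.link B.par \<phi> \<psi>
      by unfold_locales (rule mem(3)[OF C C] mem(3)[OF C' C'] mem(5)[OF C C] mem(5)[OF C' C'])+
    \<comment> \<open>\<open>original_iso\<close> relates the chosen representatives, and a class is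
      determined by any of its members.\<close>
    have "iso_class (G C) = iso_class (G C')" by (rule iso_class_eq[OF A.wf original_iso])
    then show "C = C'" using mem(6)[OF C C] mem(6)[OF C' C'] by simp
  qed
qed


end
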